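(* Suppose the upper structure $(\Omega,\mathcal A,\mathbb P,\mathbb D,\Gamma)$ satisfies (EID). Let $f=(f_1,\dots,f_n)\in\mathbf d^n$ be such that $\nu\{f_i\ne f_j\}=+\infty$ for all $i\ne j$ and $\nu\{\det\gamma[f,f^t]>0\}=+\infty$, where $\gamma[f,f^t]=(\gamma[f_i,f_j])_{1\le i,j\le n}$. Then the random vector $$V=\Big(\sum_{j=1}^nN(f_j),\ \sum_{j=1}^n(N(f_j))^2,\ \dots,\ \sum_{j=1}^n(N(f_j))^n\Big)$$ has a density on $\mathbb R^n$ (its law is absolutely continuous with respect to Lebesgue measure).
   Context: Bottom structure. $(X,\mathcal X,\nu)$ is a measured space with $\nu$ $\sigma$-finite, $\{x\}\in\mathcal X$ and $\nu(\{x\})=0$ for all $x\in X$. $(X,\mathcal X,\nu,\mathbf d,\gamma)$ is a local symmetric Dirichlet structure with carré du champ: $e[f,g]=\frac12\int\gamma[f,g]\,d\nu$ is a local Dirichlet form with domain $\mathbf d\subset L^2(\nu)$, and $\gamma$ is its carré du champ operator ($\gamma[f]:=\gamma[f,f]$); $\mathbf d$ with the norm $(\|\cdot\|^2_{L^2(\nu)}+e[\cdot])^{1/2}$ is a separable Hilbert space. Its generator is $a$ with domain $\mathcal D(a)$. The constant $1$ is in $\mathbf d_{loc}$ (locally, in the measurable sense, equal to elements of $\mathbf d$). Poisson measure. $N$ is a Poisson random measure on $(X,\mathcal X)$ with intensity $\nu$, on the configuration space $(\Omega,\mathcal A,\mathbb P)$, with $\mathcal A$ generated by $N$; $N(f)=\int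 f\,dN$, $\tilde N=N-\nu$, and $\tilde N(f)$ is defined for $f\in L^2(\nu)$ by $L^2$-extension. Upper structure. Let $\mathcal D_0$ be the linear span of $\{e^{i\tilde N(f)}: f\in\mathcal D(a)\cap L^1(\nu),\ \gamma[f]\in L^2(\nu)\}$; it is a standing assumption that $\mathcal D_0$ is dense in $L^2(\mathbb P)$. For $U=\sum_p\lambda_pe^{i\tilde N(f_p)}\in\mathcal D_0$ put $A_0[U]=\sum_p\lambda_pe^{i\tilde N(f_p)}\big(i\tilde N(a[f_p])-\frac12N(\gamma[f_p])\big)$. This is a well-defined symmetric negative operator, whose Friedrichs extension generates a local Dirichlet form $\mathcal E$ on $L^2(\mathbb P)$ with domain $\mathbb D$ and carré du champ $\Gamma$ ($\mathcal E[F]=\frac12\mathbb E\Gamma[F]$). For $F\in\mathbb D$ one has $\Gamma[F]=\int\varepsilon^-\gamma[\varepsilon^+F]\,dN$, where $\varepsilon^+$ (resp. $\varepsilon^-$) adds (resp. removes) a particle at $x$: $(\varepsilon^\pm H)(\omega,x)=H(\varepsilon^\pm_x\omega,x)$, $\varepsilon^\pm_x\omega=\omega\pm\varepsilon_x$ ($\varepsilon^+_x\omega=\omega$ if $x\in\mathrm{supp}\,\omega$, $\varepsilon^-_x\omega=\omega$ if $x\notin\mathrm{supp}\,\omega$), $\varepsilon_x$ being the Dirac mass at $x$. The operator $\Gamma$ extends to the space $\mathbb D_{loc}$ of functions $F$ for which there are $\Omega_n\in\mathcal A$ with $\cup_n\Omega_n=\Omega$ and $F_n\in\mathbb D$ with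 $F=F_n$ on $\Omega_n$. (EID), energy image density property: a Dirichlet structure $(Y,\mathcal Y,\mu,\mathbb F,G)$ with carré du champ $G$ satisfies (EID) if for every $d\geq 1$ and every $\mathbb R^d$-valued $U$ with components in $\mathbb F$, the image by $U$ of the measure $\det(G[U_i,U_j])_{ij}\cdot\mu$ is absolutely continuous with respect to Lebesgue measure on $\mathbb R^d$.
   Formalization: The functions f_j are additionally assumed to be almost surely N-integrable (for f_j in L²(ν), equivalently f_j in L¹(ν)), since otherwise N(f_j)=∫f_j dN is infinite or undefined and V is not an R^n-valued random vector. *)

theory Defs
  imports "HOL-Probability.Probability" "Jordan_Normal_Form.Determinant"
begin

section \<open>Square integrable functions\<close>

text \<open>Elements of an \<open>L\<^sup>2\<close> space are represented by functions, not by classes of functions.\<close>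

definition l2_space :: "'a measure \<Rightarrow> ('a \<Rightarrow> 'b::{second_countable_topology, real_normed_vector}) set" where
  "l2_space M = {f \<in> borel_measurable M. integrable M (\<lambda>x. (norm (f x))\<^sup>2)}"

definition l2_norm :: "'a measure \<Rightarrow> ('a \<Rightarrow> 'b::{second_countable_topology, real_normed_vector}) \<Rightarrow> real" where
  "l2_norm M f = sqrt (\<integral>x. (norm (f x))\<^sup>2 \<partial>M)"

definition l2_dense :: "'a measure \<Rightarrow> ('a \<Rightarrow> 'b::{second_countable_topology, real_normed_vector}) set \<Rightarrow> bool" where
  "l2_dense M S \<longleftrightarrow> S \<subseteq> l2_space M \<and>
     (\<forall>f\<in>l2_space M. \<forall>\<epsilon>>0. \<exists>g\<in>S. l2_norm M (\<lambda>x. f x - g x) < \<epsilon>)"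

definition ess_bounded :: "'a measure \<Rightarrow> ('a \<Rightarrow> real) \<Rightarrow> bool" where
  "ess_bounded M f \<longleftrightarrow> (\<exists>C. AE x in M. \<bar>f x\<bar> \<le> C)"


section \<open>Local Dirichlet forms with carre du champ\<close>

definition form_norm :: "'a measure \<Rightarrow> (('a \<Rightarrow> real) \<Rightarrow> ('a \<Rightarrow> real) \<Rightarrow> real) \<Rightarrow> ('a \<Rightarrow> real) \<Rightarrow> real" where
  "form_norm M e f = sqrt ((l2_norm M f)\<^sup>2 + e f f)"

text \<open>A densely defined, closed, nonnegative symmetric bilinear form on which the unit contraction
  operates. The domain is stable under modification on null sets and the form does not see
  such modifications.\<close>

definition dirichlet_form ::
  "'a measure \<Rightarrow> ('a \<Rightarrow> real) set \<Rightarrow> (('a \<Rightarrow> real) \<Rightarrow> ('a \<Rightarrow> real) \<Rightarrow> real) \<Rightarrow> bool" where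
  "dirichlet_form M D e \<longleftrightarrow>
     (\<lambda>x. 0) \<in> D \<and>
     (\<forall>f\<in>D. \<forall>g\<in>D. \<forall>c. (\<lambda>x. c * f x + g x) \<in> D) \<and>
     (\<forall>f\<in>D. \<forall>g\<in>borel_measurable M. (AE x in M. f x = g x) \<longrightarrow> g \<in> D) \<and>
     l2_dense M D \<and>
     (\<forall>f\<in>D. \<forall>g\<in>D. e f g = e g f) \<and>
     (\<forall>f\<in>D. \<forall>g\<in>D. \<forall>h\<in>D. \<forall>c. e (\<lambda>x. c * f x + g x) h = c * e f h + e g h) \<and>
     (\<forall>f\<in>D. 0 \<le> e f f) \<and>
     (\<forall>f\<in>D. \<forall>g\<in>D. \<forall>h\<in>D. (AE x in M. f x = g x) \<longrightarrow> e f h = e g h) \<and>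
     (\<forall>S. (\<forall>k::nat. S k \<in> D) \<and>
          (\<forall>\<epsilon>>0. \<exists>K. \<forall>j\<ge>K. \<forall>k\<ge>K. form_norm M e (\<lambda>x. S j x - S k x) < \<epsilon>) \<longrightarrow>
          (\<exists>f\<in>D. (\<lambda>k. form_norm M e (\<lambda>x. S k x - f x)) \<longlonglongrightarrow> 0)) \<and>
     (\<forall>f\<in>D. (\<lambda>x. min 1 (max 0 (f x))) \<in> D \<and>
             e (\<lambda>x. min 1 (max 0 (f x))) (\<lambda>x. min 1 (max 0 (f x))) \<le> e f f)"

definition form_separable ::
  "'a measure \<Rightarrow> ('a \<Rightarrow> real) set \<Rightarrow> (('a \<Rightarrow> real) \<Rightarrow> ('a \<Rightarrow> real) \<Rightarrow> real) \<Rightarrow> bool" where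
  "form_separable M D e \<longleftrightarrow>
     (\<exists>C\<subseteq>D. countable C \<and> (\<forall>f\<in>D. \<forall>\<epsilon>>0. \<exists>g\<in>C. form_norm M e (\<lambda>x. f x - g x) < \<epsilon>))"

definition smooth_compactly_supported :: "(real \<Rightarrow> real) \<Rightarrow> bool" where
  "smooth_compactly_supported F \<longleftrightarrow>
     (\<forall>k. (deriv ^^ k) F differentiable_on UNIV) \<and> compact (closure {t. F t \<noteq> 0})"

text \<open>Locality in the sense of Bouleau and Hirsch. Subtracting the values at \<open>0\<close> is necessary when
  the constants are not in the domain; it also rules out a killing part.\<close>

definition local_form :: "('a \<Rightarrow> real) set \<Rightarrow> (('a \<Rightarrow> real) \<Rightarrow> ('a \<Rightarrow> real) \<Rightarrow> real) \<Rightarrow> bool" where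
  "local_form D e \<longleftrightarrow>
     (\<forall>f\<in>D. \<forall>F G. smooth_compactly_supported F \<and> smooth_compactly_supported G \<and>
        closure {t. F t \<noteq> 0} \<inter> closure {t. G t \<noteq> 0} = {} \<longrightarrow>
        e (\<lambda>x. F (f x) - F 0) (\<lambda>x. G (f x) - G 0) = 0)"

text \<open>The last clause is the identity which determines \<open>\<gamma>\<close> (up to null sets) on the bounded elements
  of the domain; the others make \<open>\<gamma>\<close> the \<open>L\<^sup>1\<close>-valued continuous bilinear extension, continuity
  being a consequence of positivity and of the formula for \<open>e\<close>.\<close>

definition carre_du_champ ::
  "'a measure \<Rightarrow> ('a \<Rightarrow> real) set \<Rightarrow> (('a \<Rightarrow> real) \<Rightarrow> ('a \<Rightarrow> real) \<Rightarrow> real) \<Rightarrow>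
    (('a \<Rightarrow> real) \<Rightarrow> ('a \<Rightarrow> real) \<Rightarrow> 'a \<Rightarrow> real) \<Rightarrow> bool" where
  "carre_du_champ M D e \<gamma> \<longleftrightarrow>
     (\<forall>f\<in>D. \<forall>g\<in>D. integrable M (\<gamma> f g)) \<and>
     (\<forall>f\<in>D. \<forall>g\<in>D. AE x in M. \<gamma> f g x = \<gamma> g f x) \<and>
     (\<forall>f\<in>D. \<forall>g\<in>D. \<forall>h\<in>D. \<forall>c. AE x in M. \<gamma> (\<lambda>y. c * f y + g y) h x = c * \<gamma> f h x + \<gamma> g h x) \<and>
     (\<forall>f\<in>D. \<forall>g\<in>D. \<forall>h\<in>D. (AE x in M. f x = g x) \<longrightarrow> (AE x in M. \<gamma> f h x = \<gamma> g h x)) \<and>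
     (\<forall>f\<in>D. AE x in M. 0 \<le> \<gamma> f f x) \<and>
     (\<forall>f\<in>D. \<forall>g\<in>D. e f g = (1/2) * (\<integral>x. \<gamma> f g x \<partial>M)) \<and>
     (\<forall>f\<in>D. \<forall>h\<in>D. ess_bounded M f \<and> ess_bounded M h \<longrightarrow>
        (\<integral>x. h x * \<gamma> f f x \<partial>M) = 2 * e (\<lambda>x. f x * h x) f - e h (\<lambda>x. (f x)\<^sup>2))"

definition loc_domain :: "'a measure \<Rightarrow> ('a \<Rightarrow> real) set \<Rightarrow> ('a \<Rightarrow> real) set" where
  "loc_domain M D = {f. \<exists>A g. (\<forall>k::nat. A k \<in> sets M \<and> g k \<in> D \<and> (\<forall>x\<in>A k. f x = g k x)) \<and>
                         (\<Union>k. A k) = space M}"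

definition is_generator_value ::
  "'a measure \<Rightarrow> ('a \<Rightarrow> real) set \<Rightarrow> (('a \<Rightarrow> real) \<Rightarrow> ('a \<Rightarrow> real) \<Rightarrow> real) \<Rightarrow>
    ('a \<Rightarrow> real) \<Rightarrow> ('a \<Rightarrow> real) \<Rightarrow> bool" where
  "is_generator_value M D e f g \<longleftrightarrow>
     f \<in> D \<and> g \<in> l2_space M \<and> (\<forall>h\<in>D. e f h = - (\<integral>x. g x * h x \<partial>M))"

definition generator_domain ::
  "'a measure \<Rightarrow> ('a \<Rightarrow> real) set \<Rightarrow> (('a \<Rightarrow> real) \<Rightarrow> ('a \<Rightarrow> real) \<Rightarrow> real) \<Rightarrow> ('a \<Rightarrow> real) set" where
  "generator_domain M D e = {f. \<exists>g. is_generator_value M D e f g}"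

text \<open>A version of the generator; it is unique up to null sets.\<close>

definition generator ::
  "'a measure \<Rightarrow> ('a \<Rightarrow> real) set \<Rightarrow> (('a \<Rightarrow> real) \<Rightarrow> ('a \<Rightarrow> real) \<Rightarrow> real) \<Rightarrow> ('a \<Rightarrow> real) \<Rightarrow> 'a \<Rightarrow> real" where
  "generator M D e f = (SOME g. is_generator_value M D e f g)"

definition gram_det :: "(('a \<Rightarrow> real) \<Rightarrow> ('a \<Rightarrow> real) \<Rightarrow> 'a \<Rightarrow> real) \<Rightarrow> nat \<Rightarrow> (nat \<Rightarrow> 'a \<Rightarrow> real) \<Rightarrow> 'a \<Rightarrow> real" where
  "gram_det G n u x = Determinant.det (Matrix.mat n n (\<lambda>(i, j). G (u i) (u j) x))"

text \<open>Since the dimension is quantified inside the property, \<open>\<real>\<^sup>d\<close> is rendered as the product of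
  \<open>d\<close> copies of the real line indexed by \<open>{..<d}\<close>.\<close>

abbreviation lebesgue_pow :: "nat \<Rightarrow> (nat \<Rightarrow> real) measure" where
  "lebesgue_pow d \<equiv> (\<Pi>\<^sub>M i\<in>{..<d}. lborel)"

definition energy_image_density ::
  "'a measure \<Rightarrow> ('a \<Rightarrow> real) set \<Rightarrow> (('a \<Rightarrow> real) \<Rightarrow> ('a \<Rightarrow> real) \<Rightarrow> 'a \<Rightarrow> real) \<Rightarrow> bool" where
  "energy_image_density M D G \<longleftrightarrow>
     (\<forall>d\<ge>1. \<forall>U. (\<forall>i<d. U i \<in> D) \<longrightarrow>
        absolutely_continuous (lebesgue_pow d)
          (distr (density M (\<lambda>x. ennreal (gram_det G d U x))) (lebesgue_pow d)
             (\<lambda>x. \<lambda>i\<in>{..<d}. U i x)))"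


section \<open>Poisson random measures on the configuration space\<close>

text \<open>Configurations are the countable sums of Dirac masses: the image of the counting measure of
  an index set \<open>J\<close> under \<open>x\<close> is the sum of the Dirac masses at the points \<open>x j\<close>.\<close>

definition configurations :: "'a measure \<Rightarrow> 'a measure set" where
  "configurations \<nu> = {distr (count_space J) \<nu> x | (J :: nat set) x. x \<in> J \<rightarrow> space \<nu>}"

text \<open>The random measure is the identity map \<open>\<omega> \<mapsto> \<omega>\<close>, and the \<open>\<sigma>\<close>-algebra is the one it generates.
  That sets of infinite intensity carry infinitely many points almost surely follows from the
  case of finite intensity when \<open>\<nu>\<close> is \<open>\<sigma>\<close>-finite.\<close>

definition poisson_random_measure :: "'a measure \<Rightarrow> 'a measure measure \<Rightarrow> bool" where
  "poisson_random_measure \<nu> P \<longleftrightarrow>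
     prob_space P \<and>
     space P = configurations \<nu> \<and>
     sets P = sigma_sets (configurations \<nu>)
       {{\<omega> \<in> configurations \<nu>. emeasure \<omega> A \<in> B} | A B. A \<in> sets \<nu> \<and> B \<in> sets (borel :: ennreal measure)} \<and>
     (\<forall>A\<in>sets \<nu>. emeasure \<nu> A < \<infinity> \<longrightarrow>
        (\<forall>k::nat. measure P {\<omega> \<in> space P. emeasure \<omega> A = of_nat k} =
           exp (- measure \<nu> A) * measure \<nu> A ^ k / fact k)) \<and>
     (\<forall>m. \<forall>A. (\<forall>i<m. A i \<in> sets \<nu>) \<and> disjoint_family_on A {..<m} \<longrightarrow>
        prob_space.indep_vars P (\<lambda>_. borel) (\<lambda>i \<omega>. emeasure \<omega> (A i)) {..<m::nat})"

text \<open>The \<open>L\<^sup>2\<close>-extension of \<open>f \<mapsto> N(f) - \<nu>(f)\<close> from the integrable functions to \<open>L\<^sup>2(\<nu>)\<close>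
  (a version; it is unique up to null sets).\<close>

definition compensated_integral :: "'a measure \<Rightarrow> 'a measure measure \<Rightarrow> ('a \<Rightarrow> real) \<Rightarrow> 'a measure \<Rightarrow> real" where
  "compensated_integral \<nu> P f = (SOME Z. Z \<in> l2_space P \<and>
     (\<exists>\<phi>. (\<forall>k::nat. \<phi> k \<in> l2_space \<nu> \<and> integrable \<nu> (\<phi> k)) \<and>
          (\<lambda>k. l2_norm \<nu> (\<lambda>x. \<phi> k x - f x)) \<longlonglongrightarrow> 0 \<and>
          (\<lambda>k. l2_norm P (\<lambda>\<omega>. ((\<integral>x. \<phi> k x \<partial>\<omega>) - (\<integral>x. \<phi> k x \<partial>\<nu>)) - Z \<omega>)) \<longlonglongrightarrow> 0))"


section \<open>The upper structure\<close>

definition test_functions ::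
  "'a measure \<Rightarrow> ('a \<Rightarrow> real) set \<Rightarrow> (('a \<Rightarrow> real) \<Rightarrow> ('a \<Rightarrow> real) \<Rightarrow> real) \<Rightarrow>
    (('a \<Rightarrow> real) \<Rightarrow> ('a \<Rightarrow> real) \<Rightarrow> 'a \<Rightarrow> real) \<Rightarrow> ('a \<Rightarrow> real) set" where
  "test_functions \<nu> D e \<gamma> =
     {f \<in> generator_domain \<nu> D e. integrable \<nu> f \<and> \<gamma> f f \<in> l2_space \<nu>}"

text \<open>The graph of the operator \<open>A\<^sub>0\<close>, whose domain is the linear span of the exponentials
  \<open>exp (i N~(f))\<close>.\<close>

definition upper_pregenerator ::
  "'a measure \<Rightarrow> 'a measure measure \<Rightarrow> ('a \<Rightarrow> real) set \<Rightarrow> (('a \<Rightarrow> real) \<Rightarrow> ('a \<Rightarrow> real) \<Rightarrow> real) \<Rightarrow>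
    (('a \<Rightarrow> real) \<Rightarrow> ('a \<Rightarrow> real) \<Rightarrow> 'a \<Rightarrow> real) \<Rightarrow>
    (('a measure \<Rightarrow> complex) \<times> ('a measure \<Rightarrow> complex)) set" where
  "upper_pregenerator \<nu> P D e \<gamma> =
     {((\<lambda>\<omega>. \<Sum>f\<in>T. c f * exp (\<i> * complex_of_real (compensated_integral \<nu> P f \<omega>))),
       (\<lambda>\<omega>. \<Sum>f\<in>T. c f * exp (\<i> * complex_of_real (compensated_integral \<nu> P f \<omega>)) *
               (\<i> * complex_of_real (compensated_integral \<nu> P (generator \<nu> D e f) \<omega>) -
                complex_of_real ((1/2) * (\<integral>x. \<gamma> f f x \<partial>\<omega>))))) |
      T c. finite T \<and> T \<subseteq> test_functions \<nu> D e \<gamma>}"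

text \<open>The form of the Friedrichs extension of a symmetric negative operator on the complex \<open>L\<^sup>2(M)\<close>,
  given by its graph \<open>A\<close>: the closure of \<open>(U, V) \<mapsto> - \<langle>A U, V\<rangle>\<close>, restricted to real functions.
  A function is in the domain if it is the \<open>L\<^sup>2\<close>-limit of a sequence in the domain of \<open>A\<close> which is
  Cauchy for the energy.\<close>

definition friedrichs_approx ::
  "'a measure \<Rightarrow> (('a \<Rightarrow> complex) \<times> ('a \<Rightarrow> complex)) set \<Rightarrow> ('a \<Rightarrow> real) \<Rightarrow>
    (nat \<Rightarrow> ('a \<Rightarrow> complex) \<times> ('a \<Rightarrow> complex)) \<Rightarrow> bool" where
  "friedrichs_approx M A F S \<longleftrightarrow>
     (\<forall>k. S k \<in> A) \<and>
     (\<lambda>k. l2_norm M (\<lambda>x. fst (S k) x - complex_of_real (F x))) \<longlonglongrightarrow> 0 \<and>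
     (\<forall>\<epsilon>>0. \<exists>K. \<forall>j\<ge>K. \<forall>k\<ge>K.
        Re (- (\<integral>x. (snd (S j) x - snd (S k) x) * cnj (fst (S j) x - fst (S k) x) \<partial>M)) < \<epsilon>)"

definition friedrichs_domain ::
  "'a measure \<Rightarrow> (('a \<Rightarrow> complex) \<times> ('a \<Rightarrow> complex)) set \<Rightarrow> ('a \<Rightarrow> real) set" where
  "friedrichs_domain M A = {F \<in> l2_space M. \<exists>S. friedrichs_approx M A F S}"

definition friedrichs_form ::
  "'a measure \<Rightarrow> (('a \<Rightarrow> complex) \<times> ('a \<Rightarrow> complex)) set \<Rightarrow> ('a \<Rightarrow> real) \<Rightarrow> ('a \<Rightarrow> real) \<Rightarrow> real" where
  "friedrichs_form M A F H = (THE r. \<forall>S T. friedrichs_approx M A F S \<and> friedrichs_approx M A H T \<longrightarrow>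
     (\<lambda>k. - (\<integral>x. snd (S k) x * cnj (fst (T k) x) \<partial>M)) \<longlonglongrightarrow> complex_of_real r)"

end

theory Submission
imports Defs "HOL-Real_Asymp.Real_Asymp"
begin

text \<open>Mecke's formula for \<open>N(W)\<close> turns the law of the power sums into that of \<open>T(v + f(x))\<close> for a particle \<open>x\<close>
added to a frozen configuration, so that it suffices to prove the energy image density property for the bottom
structure. This follows by testing the integration by parts against Riesz-type fields, whose size is controlled
as in Calderon-Zygmund theory.\<close>

text \<open>Let \<open>C\<close> be a null set. For \<open>W\<close> of finite measure inside the
  set of positive Gram determinant, Mecke's formula weighted by N(W) shows that almost surely N(W) =
  0 whenever the vector lies in \<open>C\<close>; this has probability at most exp(-\<nu>(W)), and
  \<nu>(W) can be made arbitrarily large. In the bottom structure, a constant matrix close to the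
  inverse Gram matrix turns integration by parts into a bound for the integral of div X over the
  image of W: a constant times sup |X|, plus the integral of |DX| against an error measure eta. The
  mass of eta is small, but eta may be as singular as the image of W. The field is therefore adapted
  to eta: X is the Riesz field of a small set A containing the null set and the surroundings of all
  cubes on which eta is too dense. Within such a cube DX oscillates by a bounded amount, so its
  values are comparable with averages over the cube, for which an L2 bound suffices. The chain rule
  for \<gamma> comes from locality by cutting functions into thin slices by level, whose mutual
  energies are nonnegative and vanish unless the slices are adjacent.\<close>

abbreviation "Leb \<equiv> lebesgue_pow"

abbreviation (input) tends (infix "--->" 60) where
"X ---> L \<equiv> X \<longlonglongrightarrow> L"

lemmas integrable_dom = Bochner_Integration.integrable_bound
and integrable_setsum = Bochner_Integration.integrable_sum
and integral_setsum = Bochner_Integration.integral_sum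
and lint_cong = Bochner_Integration.integral_cong
and lint_diff = Bochner_Integration.integral_diff

section \<open>Power integrals on the line and integrals of the regularised norm\<close>

lemma nn_integral_even_le:
fixes g :: "real => real"
assumes [measurable]: "g \<in> borel_measurable borel" and nonneg: "!!t. 0 <= g t"
shows "(nn_integral lborel (%t. ennreal (g \<bar>t\<bar>))) <= 2 * (nn_integral lborel (%t. ennreal (g t) * indicator {0..} t))"
proof -
let ?h = "%t. ennreal (g t) * indicator {0..} t"
have "(nn_integral lborel (%t. ennreal (g \<bar>t\<bar>))) <= (nn_integral lborel (%t. ?h t + ?h (- t)))" by (intro nn_integral_mono) (auto simp: indicator_def abs_if)
also have "... = (nn_integral lborel (%t. ?h t)) + (nn_integral lborel (%t. ?h (- t)))" by (intro nn_integral_add) measurable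
also have "(nn_integral lborel (%t. ?h (- t))) = (nn_integral lborel (%t. ?h t))" using nn_integral_real_affine[of ?h "-1" 0] by simp
finally show ?thesis by (simp add: mult_2)
qed

lemma powr_pow:
fixes x :: real
assumes "x > 0"
shows "(x powr a) ^ n = x powr (a * real n)" by (metis assms powr_gt_zero powr_powr powr_realpow)

lemma nn_integral_tail_powr:
fixes al eps :: real
assumes "al > 1" "eps > 0"
shows "(nn_integral lborel (%t. ennreal ((\<bar>t\<bar> + eps) powr - al))) <= ennreal (2 * eps powr (1 - al) / (al - 1))"
proof -
have "(nn_integral lborel (%t. ennreal ((t + eps) powr - al) * indicator {0..} t))
  = ennreal (0 - (- ((0 + eps) powr (1 - al)) / (al - 1)))"
proof (rule nn_integral_FTC_atLeast)
 show "((%t. - ((t + eps) powr (1 - al)) / (al - 1)) \<longlongrightarrow> 0) at_top"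
 proof -
  have "((%t. (t + eps) powr (1 - al)) \<longlongrightarrow> 0) at_top"
  proof (rule tendsto_neg_powr)
   show "filterlim (%t. t + eps) at_top at_top" using filterlim_tendsto_add_at_top[OF tendsto_const filterlim_ident, of eps] by (simp add: add.commute)
  qed (use assms in simp)
  from tendsto_divide[OF tendsto_minus[OF this] tendsto_const[of "al - 1"]] assms show ?thesis by simp
 qed
next
 fix t :: real assume "0 <= t"
 then have "t + eps > 0" using assms by simp
 have "((%t. - ((t + eps) powr (1 - al)) / (al - 1)) has_real_derivative
   - ((1 - al) * (t + eps) powr (1 - al - 1) * 1) / (al - 1)) (at t)" using \<open>t + eps > 0\<close> assms by (intro derivative_eq_intros refl) auto
 moreover have "- ((1 - al) * (t + eps) powr (1 - al - 1) * 1) / (al - 1) = (t + eps) powr - al" using assms by (simp add: field_simps)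
 ultimately show "((%t. - ((t + eps) powr (1 - al)) / (al - 1)) has_real_derivative (t + eps) powr - al) (at t)" by simp
qed auto
then have "(nn_integral lborel (%t. ennreal ((t + eps) powr - al) * indicator {0..} t)) = ennreal (eps powr (1 - al) / (al - 1))" by simp
with nn_integral_even_le[of "%t. (t + eps) powr - al"]
have "(nn_integral lborel (%t. ennreal ((\<bar>t\<bar> + eps) powr - al))) <= 2 * ennreal (eps powr (1 - al) / (al - 1))" by simp
also have "... = ennreal (2 * eps powr (1 - al) / (al - 1))" using assms by (subst ennreal_numeral[symmetric], subst ennreal_mult[symmetric]) auto
finally show ?thesis .
qed

lemma nn_integral_local_powr:
fixes be eps r :: real
assumes "0 < be" "be <= 1" "eps > 0" "r > 0"
shows "(nn_integral lborel (%t. ennreal ((\<bar>t\<bar> + eps) powr (be - 1)) * indicator {t. \<bar>t\<bar> < r} t)) <= ennreal (2 / be * (r + eps) powr be)"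
proof -
have "(nn_integral lborel (%t. ennreal ((t + eps) powr (be - 1)) * indicator {0..r} t))
  = ennreal ((r + eps) powr be / be - (0 + eps) powr be / be)"
proof (rule nn_integral_FTC_Icc)
 fix t :: real assume "t \<in> {0..r}"
 then have "t + eps > 0" using assms by simp
 have "((%t. (t + eps) powr be / be) has_real_derivative (be * (t + eps) powr (be - 1) * 1) / be) (at t)" using \<open>t + eps > 0\<close> assms by (intro derivative_eq_intros refl) auto
 then show "((%t. (t + eps) powr be / be) has_real_derivative (t + eps) powr (be - 1)) (at t)" using assms by simp
qed (use assms in auto)
also have "... <= ennreal ((r + eps) powr be / be)" using assms by (intro ennreal_leI) auto
finally have *: "(nn_integral lborel (%t. ennreal ((t + eps) powr (be - 1)) * indicator {0..r} t)) <= ennreal ((r + eps) powr be / be)" .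
let ?g = "%t. (t + eps) powr (be - 1) * indicator {..r} t"
have "(nn_integral lborel (%t. ennreal ((\<bar>t\<bar> + eps) powr (be - 1)) * indicator {t. \<bar>t\<bar> < r} t))
 <= (nn_integral lborel (%t. ennreal (?g \<bar>t\<bar>)))" by (intro nn_integral_mono) (auto simp: indicator_def)
also have "... <= 2 * (nn_integral lborel (%t. ennreal (?g t) * indicator {0..} t))" by (rule nn_integral_even_le) (auto simp: indicator_def)
also have "(nn_integral lborel (%t. ennreal (?g t) * indicator {0..} t)) = (nn_integral lborel (%t. ennreal ((t + eps) powr (be - 1)) * indicator {0..r} t))" by (intro nn_integral_cong) (auto simp: indicator_def)
also have "2 * ... <= 2 * ennreal ((r + eps) powr be / be)" using * by (intro mult_left_mono) auto
also have "... = ennreal (2 / be * (r + eps) powr be)" using assms by (subst ennreal_numeral[symmetric], subst ennreal_mult[symmetric]) auto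
finally show ?thesis .
qed

interpretation lebesgue_prod: product_sigma_finite "%_::nat. lborel :: real measure" by standard

lemma sigma_finite_Leb: "sigma_finite_measure (Leb n)" by (rule lebesgue_prod.sigma_finite) simp

text \<open>The Euclidean norm, smoothed at scale \<open>eps\<close> so that its negative powers are
  smooth and bounded.\<close>

definition wt :: "nat => real => (nat => real) => real" where
"wt n eps z = sqrt (eps\<^sup>2 + (\<Sum>i<n. (z i)^2))"

lemma wt_ge: "eps >= 0 ==> eps <= wt n eps z" unfolding wt_def by (rule real_le_rsqrt) (auto intro: sum_nonneg)

lemma wt_pos [simp]: "eps > 0 ==> wt n eps z > 0" using wt_ge[of eps n z] by linarith

lemma wt_coord: "i < n ==> \<bar>z i\<bar> <= wt n eps z"
proof -
assume "i < n"
then have "(z i)^2 <= (\<Sum>i<n. (z i)^2)" by (intro member_le_sum) auto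
then have "(z i)^2 <= eps\<^sup>2 + (\<Sum>i<n. (z i)^2)" using zero_le_power2[of eps] by linarith
then show ?thesis unfolding wt_def by (intro real_le_rsqrt) simp
qed

lemma wt_measurable [measurable]: "wt n eps \<in> borel_measurable (Leb n)" unfolding wt_def by measurable

text \<open>\<open>wt\<close> dominates both \<open>eps\<close> and every |z i|, hence their mean
  (|z i| + eps) / 2. Split into n equal factors, \<open>wt ^ m\<close> thus dominates a product of
  one-dimensional powers with exponent m / n; the factor \<open>2 ^ m\<close> collects the
  halves.\<close>

lemma nn_integral_wt_product:
fixes eps :: real
assumes n: "n >= 1" and eps: "eps > 0" and B [measurable]: "B \<in> sets borel"
shows "(nn_integral (Leb n) (%z. ennreal (1 / wt n eps z ^ m) * indicator {z. ALL i<n. z i \<in> B} z))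
 <= ennreal (2 ^ m) * (nn_integral lborel (%t. ennreal ((\<bar>t\<bar> + eps) powr - (real m / real n)) * indicator B t)) ^ n"
proof -
have "ennreal (1 / wt n eps z ^ m) * indicator {z. ALL i<n. z i \<in> B} z
  <= ennreal (2 ^ m) * (\<Prod>i<n. ennreal ((\<bar>z i\<bar> + eps) powr - (real m / real n)) * indicator B (z i))" for z
proof (cases "ALL i<n. z i \<in> B")
 case True
 have "wt n eps z powr (real m) = (\<Prod>i<n. wt n eps z powr (real m / real n))" using n eps by (simp add: powr_pow)
 also have "... >= (\<Prod>i<n. ((\<bar>z i\<bar> + eps) / 2) powr (real m / real n))"
 proof (intro prod_mono conjI powr_mono2)
  fix i assume "i \<in> {..<n}"
  then show "(\<bar>z i\<bar> + eps) / 2 <= wt n eps z" using wt_coord[of i n z eps] wt_ge[of eps n z] eps by simp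
 qed (use eps in auto)
 also have "(\<Prod>i<n. ((\<bar>z i\<bar> + eps) / 2) powr (real m / real n)) =
   (\<Prod>i<n. (\<bar>z i\<bar> + eps) powr (real m / real n)) / 2 ^ m"
 proof -
  have "(\<Prod>i<n. ((\<bar>z i\<bar> + eps) / 2) powr (real m / real n))
    = (\<Prod>i<n. (\<bar>z i\<bar> + eps) powr (real m / real n)) / (2 powr (real m / real n)) ^ n" using eps by (simp add: powr_divide prod_dividef)
  also have "(2 powr (real m / real n)) ^ n = 2 powr real m" using n by (subst powr_pow) auto
  finally show ?thesis by (simp add: powr_realpow)
 qed
 finally have *: "(\<Prod>i<n. (\<bar>z i\<bar> + eps) powr (real m / real n)) / 2 ^ m <= wt n eps z ^ m" using eps by (simp add: powr_realpow)
 have pos: "0 < (\<Prod>i<n. (\<bar>z i\<bar> + eps) powr (real m / real n))" using eps by (intro prod_pos) (auto simp: add_nonneg_pos)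
 have "1 / wt n eps z ^ m <= 2 ^ m * (1 / (\<Prod>i<n. (\<bar>z i\<bar> + eps) powr (real m / real n)))" using divide_left_mono[OF *, of 1] pos eps by (simp add: mult_pos_pos)
 also have "1 / (\<Prod>i<n. (\<bar>z i\<bar> + eps) powr (real m / real n)) = (\<Prod>i<n. (\<bar>z i\<bar> + eps) powr - (real m / real n))" by (simp add: powr_minus prod_inversef[symmetric] inverse_eq_divide[symmetric] comp_def)
 finally have "ennreal (1 / wt n eps z ^ m) <= ennreal (2 ^ m * (\<Prod>i<n. (\<bar>z i\<bar> + eps) powr - (real m / real n)))" by (rule ennreal_leI)
 also have "... = ennreal (2 ^ m) * (\<Prod>i<n. ennreal ((\<bar>z i\<bar> + eps) powr - (real m / real n)))" by (subst ennreal_mult) (auto intro: prod_nonneg simp: prod_ennreal)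
 finally show ?thesis using True by simp
qed simp
then have "(nn_integral (Leb n) (%z. ennreal (1 / wt n eps z ^ m) * indicator {z. ALL i<n. z i \<in> B} z))
 <= (nn_integral (Leb n) (%z. ennreal (2 ^ m) * (\<Prod>i<n. ennreal ((\<bar>z i\<bar> + eps) powr - (real m / real n)) * indicator B (z i))))" by (intro nn_integral_mono)
also have "... = ennreal (2 ^ m) * (nn_integral (Leb n) (%z. (\<Prod>i<n. ennreal ((\<bar>z i\<bar> + eps) powr - (real m / real n)) * indicator B (z i))))" by (intro nn_integral_cmult) measurable
also have "(nn_integral (Leb n) (%z. (\<Prod>i<n. ennreal ((\<bar>z i\<bar> + eps) powr - (real m / real n)) * indicator B (z i))))
  = (\<Prod>i<n. \<integral>\<^sup>+t. ennreal ((\<bar>t\<bar> + eps) powr - (real m / real n)) * indicator B t \<partial>lborel)" by (rule lebesgue_prod.product_nn_integral_prod) auto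
finally show ?thesis by simp
qed

text \<open>The n-th power of the one-dimensional constant 2 / (al - 1) at al = m / n, times the
  \<open>2 ^ m\<close> of the product estimate.\<close>

definition tail_const :: "nat => nat => real" where
"tail_const n m = 2 ^ m * (2 * real n / (real m - real n)) ^ n"

lemma nn_integral_wt_tail:
assumes n: "n >= 1" and m: "m > n" and eps: "eps > 0"
shows "(nn_integral (Leb n) (%z. ennreal (1 / wt n eps z ^ m))) <= ennreal (tail_const n m / eps ^ (m - n))"
proof -
have al: "real m / real n > 1" using n m by simp
have "(nn_integral (Leb n) (%z. ennreal (1 / wt n eps z ^ m)))
 <= ennreal (2 ^ m) * (nn_integral lborel (%t. ennreal ((\<bar>t\<bar> + eps) powr - (real m / real n)))) ^ n" using nn_integral_wt_product[OF n eps, of UNIV m] by simp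
also have "... <= ennreal (2 ^ m) * ennreal (2 * eps powr (1 - real m / real n) / (real m / real n - 1)) ^ n" by (intro mult_left_mono power_mono nn_integral_tail_powr al eps) auto
also have "... = ennreal (2 ^ m * (2 * eps powr (1 - real m / real n) / (real m / real n - 1)) ^ n)" using al by (subst ennreal_power, simp, subst ennreal_mult) auto
also have "2 ^ m * (2 * eps powr (1 - real m / real n) / (real m / real n - 1)) ^ n = tail_const n m / eps ^ (m - n)"
proof -
 have "(eps powr (1 - real m / real n)) ^ n = eps powr (real n - real m)" using n eps by (simp add: powr_pow left_diff_distrib)
 also have "... = 1 / eps ^ (m - n)"
 proof -
  have "real n - real m = - real (m - n)" using m by simp
  then show ?thesis using eps by (simp only: powr_minus_divide powr_realpow)
 qed
 finally have e: "(eps powr (1 - real m / real n)) ^ n = 1 / eps ^ (m - n)" .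
 have "2 * eps powr (1 - real m / real n) / (real m / real n - 1) = (2 * real n / (real m - real n)) * eps powr (1 - real m / real n)" using n m by (simp add: field_simps)
 then show ?thesis unfolding tail_const_def by (simp only: power_mult_distrib e) simp
qed
finally show ?thesis .
qed

text \<open>The power n - 1 is that of the Riesz kernel. Each one-dimensional factor then has
  exponent 1/n - 1 > -1 and contributes (r + eps) powr (1/n), so the product is of order r + eps,
  with a constant independent of \<open>eps\<close>.\<close>

lemma nn_integral_wt_local:
assumes n: "n >= 1" and eps: "eps > 0" and r: "r > 0"
shows "(nn_integral (Leb n) (%z. ennreal (1 / wt n eps z ^ (n - 1)) * indicator {z. ALL i<n. \<bar>z i\<bar> < r} z))
 <= ennreal (2 ^ (n - 1) * (2 * real n) ^ n * (r + eps))"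
proof -
have eq: "- (real (n - 1) / real n) = 1 / real n - 1" using n by (simp add: of_nat_diff field_simps)
have "(nn_integral (Leb n) (%z. ennreal (1 / wt n eps z ^ (n - 1)) * indicator {z. ALL i<n. \<bar>z i\<bar> < r} z))
 <= ennreal (2 ^ (n - 1)) * (nn_integral lborel (%t. ennreal ((\<bar>t\<bar> + eps) powr (1 / real n - 1)) * indicator {t. \<bar>t\<bar> < r} t)) ^ n" using nn_integral_wt_product[OF n eps, of "{t. \<bar>t\<bar> < r}" "n - 1"] unfolding eq by simp
also have "... <= ennreal (2 ^ (n - 1)) * ennreal (2 / (1 / real n) * (r + eps) powr (1 / real n)) ^ n" using n by (intro mult_left_mono power_mono nn_integral_local_powr eps r) auto
also have "... = ennreal (2 ^ (n - 1) * (2 / (1 / real n) * (r + eps) powr (1 / real n)) ^ n)" by (subst ennreal_power, simp, subst ennreal_mult) auto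
also have "(2 / (1 / real n) * (r + eps) powr (1 / real n)) ^ n = (2 * real n) ^ n * (r + eps)" using n eps r by (simp add: power_mult_distrib powr_pow)
finally show ?thesis by (simp add: mult.assoc)
qed

section \<open>Reflections, translations and integration by parts for the product Lebesgue
  measure\<close>

text \<open>The restriction keeps the difference extensional, hence a point of
  \<open>space (Leb n)\<close>.\<close>

definition dif :: "nat => (nat => real) => (nat => real) => nat => real" where
"dif n x y = (\<lambda>i\<in>{..<n}. x i - y i)"

lemma dif_apply [simp]: "i < n ==> dif n x y i = x i - y i" by (simp add: dif_def)

lemma dif_measurable [measurable (raw)]:
assumes "f \<in> measurable M (Leb n)" "g \<in> measurable M (Leb n)"
shows "(%x. dif n (f x) (g x)) \<in> measurable M (Leb n)"
proof -
have [measurable]: "i < n ==> (%x. f x i) \<in> borel_measurable M" "i < n ==> (%x. g x i) \<in> borel_measurable M" for i using measurable_compose[OF assms(1) measurable_component_singleton[of i "{..<n}" "%_. lborel"]]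
  measurable_compose[OF assms(2) measurable_component_singleton[of i "{..<n}" "%_. lborel"]] by auto
show ?thesis unfolding dif_def by (rule measurable_restrict) auto
qed

lemma space_Leb: "space (Leb n) = PiE {..<n} (%_. UNIV)" by (simp add: space_PiM)

lemma distr_dif_left:
assumes x: "x \<in> space (Leb n)"
shows "distr (Leb n) (Leb n) (dif n x) = Leb n"
proof (rule lebesgue_prod.PiM_eqI)
fix A :: "nat => real set" assume A: "!!i. i \<in> {..<n} ==> A i \<in> sets lborel"
have m [measurable]: "dif n x \<in> measurable (Leb n) (Leb n)" using x by measurable
have A': "Pi\<^sub>E {..<n} A \<in> sets (Leb n)" using A by (intro sets_PiM_I_finite) auto
have rv: "(%t. x i - t) -` A i \<in> sets borel" if "i < n" for i using measurable_sets[of "%t. x i - t" borel borel "A i"] A[of i] that by simp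
have "emeasure (distr (Leb n) (Leb n) (dif n x)) (Pi\<^sub>E {..<n} A)
  = emeasure (Leb n) (dif n x -` Pi\<^sub>E {..<n} A \<inter> space (Leb n))" by (rule emeasure_distr[OF m A'])
also have "dif n x -` Pi\<^sub>E {..<n} A \<inter> space (Leb n) = Pi\<^sub>E {..<n} (%i. (%t. x i - t) -` A i)" by (auto simp: space_Leb dif_def PiE_iff extensional_def)
also have "emeasure (Leb n) ... = (\<Prod>i<n. emeasure lborel ((%t. x i - t) -` A i))" using rv by (intro lebesgue_prod.emeasure_PiM) auto
also have "... = (\<Prod>i<n. emeasure lborel (A i))"
proof (intro prod.cong refl)
 fix i assume "i \<in> {..<n}"
 then have [measurable]: "A i \<in> sets borel" using A by simp
 have "emeasure lborel (A i) = (nn_integral lborel (%t. indicator (A i) t))" by simp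
 also have "... = (nn_integral lborel (%t. indicator (A i) (x i - t)))" using nn_integral_real_affine[of "indicator (A i)" "-1" "x i"] by simp
 also have "... = (nn_integral lborel (%t. indicator ((%t. x i - t) -` A i) t))" by (simp add: indicator_def vimage_def)
 also have "... = emeasure lborel ((%t. x i - t) -` A i)" using rv \<open>i \<in> {..<n}\<close> by simp
 finally show "emeasure lborel ((%t. x i - t) -` A i) = emeasure lborel (A i)" ..
qed
finally show "emeasure (distr (Leb n) (Leb n) (dif n x)) (Pi\<^sub>E {..<n} A) = (\<Prod>i<n. emeasure lborel (A i))" .
qed auto

lemma nn_integral_dif_left:
assumes x: "x \<in> space (Leb n)" and [measurable]: "h \<in> borel_measurable (Leb n)"
shows "(nn_integral (Leb n) (%y. h (dif n x y))) = (nn_integral (Leb n) (%y. h y))"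
proof -
have "(nn_integral (Leb n) (%y. h y)) = (nn_integral (distr (Leb n) (Leb n) (dif n x)) (%y. h y))" by (simp add: distr_dif_left[OF x])
also have "... = (nn_integral (Leb n) (%y. h (dif n x y)))" using x by (intro nn_integral_distr) measurable
finally show ?thesis ..
qed

text \<open>A translation is the product of two reflections, the second one at the origin, and
  reflections preserve the measure by \<open>distr_dif_left\<close>.\<close>

lemma nn_integral_dif_right:
assumes x: "x \<in> space (Leb n)" and [measurable]: "h \<in> borel_measurable (Leb n)"
shows "(nn_integral (Leb n) (%y. h (dif n y x))) = (nn_integral (Leb n) (%y. h y))"
proof -
let ?z = "\<lambda>i\<in>{..<n}. 0 :: real"
have z: "?z \<in> space (Leb n)" by (simp add: space_Leb)
have "(nn_integral (Leb n) (%y. h (dif n y x))) = (nn_integral (Leb n) (%y. h (dif n ?z (dif n x y))))" by (intro nn_integral_cong arg_cong[of _ _ h]) (auto simp: dif_def)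
also have "... = (nn_integral (Leb n) (%y. h (dif n ?z y)))" using z by (intro nn_integral_dif_left[OF x, of "%y. h (dif n ?z y)"]) measurable
also have "... = (nn_integral (Leb n) (%y. h y))" by (rule nn_integral_dif_left[OF z]) measurable
finally show ?thesis .
qed

text \<open>Fubini along coordinate j, then the fundamental theorem on the whole line. Decay is
  asked only along the lines parallel to axis j.\<close>

lemma integral_derivative_zero:
assumes j: "j < n"
 and int: "integrable (Leb n) F'"
 and der: "!!x t. x \<in> space (Leb n) ==> ((%t. F (x(j := t))) has_real_derivative F' (x(j := t))) (at t)"
 and cont: "!!x. x \<in> space (Leb n) ==> continuous_on UNIV (%t. F' (x(j := t)))"
 and top: "!!x. x \<in> space (Leb n) ==> ((%t. F (x(j := t))) \<longlongrightarrow> 0) at_top"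
 and bot: "!!x. x \<in> space (Leb n) ==> ((%t. F (x(j := t))) \<longlongrightarrow> 0) at_bot"
shows "(LINT x|Leb n. F' x) = (0::real)"
proof -
let ?I = "{..<n} - {j}"
have ins: "insert j ?I = {..<n}" using j by auto
interpret I: sigma_finite_measure "Pi\<^sub>M ?I (%_. lborel :: real measure)" by (rule lebesgue_prod.sigma_finite) simp
have m [measurable]: "F' \<in> borel_measurable (Leb n)" using int by auto
have int': "integrable (Pi\<^sub>M (insert j ?I) (%_. lborel)) F'" using int ins by simp
have "(LINT x|Leb n. F' x) = (LINT x|Pi\<^sub>M ?I (%_. lborel). (LINT t|lborel. F' (x(j := t))))" using lebesgue_prod.product_integral_insert[OF _ _ int'] ins by simp
also have "... = (\<integral>x. 0 \<partial>Pi\<^sub>M ?I (%_. lborel :: real measure))"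
proof (rule lint_cong[OF refl])
 fix x :: "nat => real" assume x: "x \<in> space (Pi\<^sub>M ?I (%_. lborel :: real measure))"
 \<comment> \<open>The remaining coordinates, extended by 0 at j to a point of
   \<open>space (Leb n)\<close>, where the hypotheses apply.\<close>
 define x' where "x' = x(j := 0)"
 have x': "x' \<in> space (Leb n)" using x j unfolding x'_def space_PiM by (auto simp: PiE_iff extensional_def)
 have upd: "x(j := t) = x'(j := t)" for t by (simp add: x'_def)
 show "(LINT t|lborel. F' (x(j := t))) = 0"
 proof (cases "integrable lborel (%t. F' (x'(j := t)))")
  case True
  have "(LBINT t=-\<infinity>..\<infinity>. F' (x'(j := t))) = 0 - 0"
  proof (rule interval_integral_FTC_integrable)
   show "((%t. F (x'(j := t))) has_vector_derivative F' (x'(j := t))) (at t)" for t using der[OF x'] by (simp add: has_real_derivative_iff_has_vector_derivative)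
   show "isCont (%t. F' (x'(j := t))) t" for t using cont[OF x'] by (simp add: continuous_on_eq_continuous_at)
   show "set_integrable lborel (einterval (-\<infinity>) \<infinity>) (%t. F' (x'(j := t)))" using True by (simp add: set_integrable_def einterval_def)
   show "(((%t. F (x'(j := t))) \<circ> real_of_ereal) \<longlongrightarrow> 0) (at_right (-\<infinity>))" using bot[OF x'] by (simp add: at_right_MInf filterlim_filtermap comp_def ereal_tendsto_simps)
   show "(((%t. F (x'(j := t))) \<circ> real_of_ereal) \<longlongrightarrow> 0) (at_left \<infinity>)" using top[OF x'] by (simp add: ereal_tendsto_simps)
  qed auto
  then show ?thesis by (simp add: upd interval_lebesgue_integral_def set_lebesgue_integral_def einterval_def)
 \<comment> \<open>A slice that is not integrable has Bochner integral 0 by convention.\<close>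
 qed (simp add: upd not_integrable_integral_eq)
qed
finally show ?thesis by simp
qed

section \<open>The regularised Riesz kernel and its derivatives\<close>

text \<open>Up to a constant, component i of the gradient of the fundamental solution of the
  Laplacian, smoothed at scale \<open>eps\<close>; \<open>drk\<close> and \<open>ddrk\<close> below
  are its first and second partial derivatives.\<close>

definition rk :: "nat => real => nat => (nat => real) => real" where
"rk n eps i z = z i / wt n eps z ^ n"

definition kd :: "nat => nat => real" where
"kd i j = (if i = j then 1 else 0)"

lemma kd_sum: "i < n ==> (\<Sum>k<n. kd i k * f k) = f i" "i < n ==> (\<Sum>k<n. f k * kd i k) = f i" by (simp_all add: kd_def if_distrib[of "%x. x * _"] if_distrib[of "%x. _ * x"] cong: if_cong)

lemma kd_bounds: "0 <= kd i j" "kd i j <= 1" "kd i i = 1" by (simp_all add: kd_def)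

lemma kd_commute: "kd i j = kd j i" by (simp add: kd_def)

definition drk :: "nat => real => nat => nat => (nat => real) => real" where
"drk n eps i j z = kd i j / wt n eps z ^ n - real n * z i * z j / wt n eps z ^ (n + 2)"

definition ddrk :: "nat => real => nat => nat => nat => (nat => real) => real" where
"ddrk n eps i j k z = real n * (real n + 2) * z i * z j * z k / wt n eps z ^ (n + 4)
 - real n * (kd i j * z k + kd i k * z j + kd j k * z i) / wt n eps z ^ (n + 2)"

lemma wt_sq: "(wt n eps z)^2 = eps\<^sup>2 + (\<Sum>i<n. (z i)^2)" unfolding wt_def by (simp add: sum_nonneg)

lemma wt_neq0 [simp]: "eps > 0 ==> wt n eps z ~= 0" using wt_pos[of eps n z] by linarith

text \<open>Away from the origin the unsmoothed field is divergence free; smoothing spreads the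
  point mass of its divergence over the scale \<open>eps\<close>. What remains is a positive kernel
  whose integral, by scaling, does not depend on \<open>eps\<close>.\<close>

lemma drk_trace: "eps > 0 ==> (\<Sum>i<n. drk n eps i i z) = real n * eps\<^sup>2 / wt n eps z ^ (n + 2)"
proof -
assume eps: "eps > 0"
have "(\<Sum>i<n. drk n eps i i z) = real n / wt n eps z ^ n - real n * (\<Sum>i<n. (z i)^2) / wt n eps z ^ (n + 2)" by (simp add: drk_def sum_subtractf sum_divide_distrib sum_distrib_left power2_eq_square mult.assoc kd_bounds)
also have "... = real n * ((wt n eps z)^2 - (\<Sum>i<n. (z i)^2)) / wt n eps z ^ (n + 2)" using eps by (simp add: field_simps power_add power2_eq_square)
finally show ?thesis by (simp add: wt_sq)
qed

lemma abs_coord_div_wt: "eps > 0 ==> i < n ==> \<bar>z i / wt n eps z\<bar> <= 1" using wt_coord[of i n z eps] wt_pos[of eps n z] by (simp add: abs_div)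

lemma rk_bound:
assumes "eps > 0" "i < n"
shows "\<bar>rk n eps i z\<bar> <= 1 / wt n eps z ^ (n - 1)"
proof -
have "rk n eps i z = (z i / wt n eps z) * (1 / wt n eps z ^ (n - 1))" using assms by (cases n) (auto simp: rk_def)
then show ?thesis using mult_right_mono[OF abs_coord_div_wt[OF assms, of z], of "1 / wt n eps z ^ (n - 1)"] assms by (simp add: abs_mult less_imp_le)
qed

lemma drk_bound:
assumes eps: "eps > 0" and i: "i < n" and j: "j < n"
shows "\<bar>drk n eps i j z\<bar> <= (1 + real n) / wt n eps z ^ n"
proof -
let ?s = "wt n eps z"
have "drk n eps i j z = (kd i j - real n * ((z i / ?s) * (z j / ?s))) * (1 / ?s ^ n)" using eps by (simp add: drk_def field_simps power2_eq_square)
moreover have "\<bar>kd i j - real n * ((z i / ?s) * (z j / ?s))\<bar> <= 1 + real n"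
proof -
 have "\<bar>(z i / ?s) * (z j / ?s)\<bar> <= 1 * 1" unfolding abs_mult by (intro mult_mono abs_coord_div_wt assms) auto
 then have "\<bar>real n * ((z i / ?s) * (z j / ?s))\<bar> <= real n * 1" unfolding abs_mult[of "real n"] by (intro mult_mono) auto
 then show ?thesis using kd_bounds(1,2)[of i j] unfolding abs_le_iff by linarith
qed
ultimately show ?thesis using mult_right_mono[of _ "1 + real n" "1 / ?s ^ n"] eps by (simp add: abs_mult less_imp_le)
qed

lemma ddrk_bound:
assumes eps: "eps > 0" and i: "i < n" and j: "j < n" and k: "k < n"
shows "\<bar>ddrk n eps i j k z\<bar> <= (real n * (real n + 5)) / wt n eps z ^ (n + 1)"
proof -
let ?s = "wt n eps z"
define a b c where "a = z i / ?s" and "b = z j / ?s" and "c = z k / ?s"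
have abc: "\<bar>a\<bar> <= 1" "\<bar>b\<bar> <= 1" "\<bar>c\<bar> <= 1" unfolding a_def b_def c_def using assms by (simp_all only: abs_coord_div_wt)
let ?L = "real n * (real n + 2) * (a * b * c)
 - real n * (kd i j * c + kd i k * b + kd j k * a)"
have "ddrk n eps i j k z = ?L * (1 / ?s ^ (n + 1))" unfolding ddrk_def a_def b_def c_def using eps by (simp add: field_simps power_add eval_nat_numeral)
moreover have "\<bar>?L\<bar> <= real n * (real n + 5)"
proof -
 have "\<bar>a * b * c\<bar> <= 1 * 1 * 1" unfolding abs_mult by (intro mult_mono abc) auto
 then have 1: "\<bar>real n * (real n + 2) * (a * b * c)\<bar> <= real n * (real n + 2) * 1" unfolding abs_mult[of "real n * (real n + 2)"] by (intro mult_mono) auto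
 have "\<bar>kd i j * c + kd i k * b + kd j k * a\<bar> <= 3" using abc by (auto simp: kd_def)
 then have 2: "\<bar>real n * (kd i j * c + kd i k * b + kd j k * a)\<bar> <= real n * 3" unfolding abs_mult[of "real n"] by (intro mult_mono) auto
 have "real n * (real n + 5) = real n * (real n + 2) * 1 + real n * 3" by (simp add: algebra_simps)
 then show ?thesis using 1 2 by linarith
qed
ultimately show ?thesis using mult_right_mono[of "\<bar>?L\<bar>" "real n * (real n + 5)" "1 / ?s ^ (n + 1)"] eps by (simp add: abs_mult less_imp_le)
qed

context
fixes n :: nat and eps :: real and w :: "real => nat => real" and h :: "nat => real" and t :: real
assumes eps: "eps > 0"
 and w: "!!i. i < n ==> ((%t. w t i) has_real_derivative h i) (at t)"
begin

text \<open>Derivatives are taken along an arbitrary path \<open>w\<close>, so that one computation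
  serves both the coordinate lines of the integrations by parts and the segments of the mean value
  estimates.\<close>

lemma wt_path_deriv:
"((%t. wt n eps (w t)) has_real_derivative (\<Sum>k<n. w t k * h k) / wt n eps (w t)) (at t)"
proof -
have pos: "eps\<^sup>2 + (\<Sum>i<n. (w t i)^2) > 0" using eps by (intro add_pos_nonneg sum_nonneg) auto
have "((%t. eps\<^sup>2 + (\<Sum>i<n. (w t i)^2)) has_real_derivative 0 + (\<Sum>k<n. 2 * (h k * w t k))) (at t)" by (intro DERIV_add DERIV_const DERIV_sum) (auto intro!: derivative_eq_intros w)
then have "((%t. sqrt (eps\<^sup>2 + (\<Sum>i<n. (w t i)^2))) has_real_derivative
 (inverse (sqrt (eps\<^sup>2 + (\<Sum>i<n. (w t i)^2))) / 2) * (0 + (\<Sum>k<n. 2 * (h k * w t k)))) (at t)" using pos by (intro DERIV_chain2[where f = sqrt] DERIV_real_sqrt)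
then show ?thesis unfolding wt_def
proof (rule DERIV_cong)
 have "(\<Sum>k<n. 2 * (h k * w t k)) = 2 * (\<Sum>k<n. w t k * h k)" by (simp add: sum_distrib_left mult_ac)
 then show "inverse (sqrt (eps\<^sup>2 + (\<Sum>i<n. (w t i)^2))) / 2 * (0 + (\<Sum>k<n. 2 * (h k * w t k))) =
  (\<Sum>k<n. w t k * h k) / sqrt (eps\<^sup>2 + (\<Sum>i<n. (w t i)^2))" by (simp add: inverse_eq_divide)
qed
qed

lemma inverse_wt_path_deriv:
"((%t. 1 / wt n eps (w t) ^ m) has_real_derivative - real m * (\<Sum>k<n. w t k * h k) / wt n eps (w t) ^ (m + 2)) (at t)"
proof (cases m)
case (Suc m')
have "((%t. 1 / wt n eps (w t) ^ m) has_real_derivative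
 (0 * wt n eps (w t) ^ m - 1 * (real m * wt n eps (w t) ^ (m - 1) * ((\<Sum>k<n. w t k * h k) / wt n eps (w t))))
  / (wt n eps (w t) ^ m * wt n eps (w t) ^ m)) (at t)" using eps by (intro DERIV_divide DERIV_const) (auto intro!: derivative_eq_intros wt_path_deriv)
then show ?thesis by (rule DERIV_cong) (use eps Suc in \<open>simp add: field_simps power_add power2_eq_square\<close>)
qed simp

lemma rk_path_deriv:
assumes i: "i < n"
shows "((%t. rk n eps i (w t)) has_real_derivative (\<Sum>k<n. drk n eps i k (w t) * h k)) (at t)"
proof -
have "((%t. w t i * (1 / wt n eps (w t) ^ n)) has_real_derivative
  h i * (1 / wt n eps (w t) ^ n) + - real n * (\<Sum>k<n. w t k * h k) / wt n eps (w t) ^ (n + 2) * w t i) (at t)" by (intro DERIV_mult w i inverse_wt_path_deriv)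
moreover have "h i * (1 / wt n eps (w t) ^ n) + - real n * (\<Sum>k<n. w t k * h k) / wt n eps (w t) ^ (n + 2) * w t i
 = (\<Sum>k<n. drk n eps i k (w t) * h k)"
proof -
 have "(\<Sum>k<n. kd i k / wt n eps (w t) ^ n * h k) = h i * (1 / wt n eps (w t) ^ n)" using kd_sum(1)[OF i, of "%k. h k / wt n eps (w t) ^ n"] by simp
 moreover have "(\<Sum>k<n. real n * w t i * w t k / wt n eps (w t) ^ (n + 2) * h k)
   = real n * (\<Sum>k<n. w t k * h k) / wt n eps (w t) ^ (n + 2) * w t i" by (simp add: sum_distrib_left sum_divide_distrib sum_distrib_right mult_ac)
 ultimately show ?thesis unfolding drk_def left_diff_distrib sum_subtractf by simp
qed
ultimately show ?thesis by (simp add: rk_def)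
qed

lemma drk_path_deriv:
assumes i: "i < n" and j: "j < n"
shows "((%t. drk n eps i j (w t)) has_real_derivative (\<Sum>k<n. ddrk n eps i j k (w t) * h k)) (at t)"
proof -
let ?s = "wt n eps (w t)" and ?S = "\<Sum>k<n. w t k * h k"
have "((%t. kd i j * (1 / wt n eps (w t) ^ n) - real n * ((w t i * w t j) * (1 / wt n eps (w t) ^ (n + 2)))) has_real_derivative
  kd i j * (- real n * ?S / ?s ^ (n + 2)) - real n * ((h i * w t j + h j * w t i) * (1 / ?s ^ (n + 2)) +
   (- real (n + 2) * ?S / ?s ^ (n + 2 + 2)) * (w t i * w t j))) (at t)" by (intro DERIV_diff DERIV_cmult DERIV_mult w i j inverse_wt_path_deriv)
moreover have "kd i j * (- real n * ?S / ?s ^ (n + 2)) - real n * ((h i * w t j + h j * w t i) * (1 / ?s ^ (n + 2)) +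
   (- real (n + 2) * ?S / ?s ^ (n + 2 + 2)) * (w t i * w t j)) = (\<Sum>k<n. ddrk n eps i j k (w t) * h k)"
proof -
 have 1: "(\<Sum>k<n. real n * (real n + 2) * w t i * w t j * w t k / ?s ^ (n + 4) * h k)
   = real n * (real n + 2) * w t i * w t j * ?S / ?s ^ (n + 4)" by (simp add: sum_distrib_left sum_divide_distrib mult_ac)
 have "(\<Sum>k<n. (kd i j * w t k + kd i k * w t j + kd j k * w t i) * h k)
   = kd i j * ?S + (\<Sum>k<n. kd i k * (w t j * h k)) + (\<Sum>k<n. kd j k * (w t i * h k))" by (simp add: sum.distrib distrib_right sum_distrib_left mult.assoc)
 also have "... = kd i j * ?S + w t j * h i + w t i * h j" using i j by (simp add: kd_sum)
 finally have "real n * (\<Sum>k<n. (kd i j * w t k + kd i k * w t j + kd j k * w t i) * h k) / ?s ^ (n + 2)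
   = real n * (kd i j * ?S + w t j * h i + w t i * h j) / ?s ^ (n + 2)" by simp
 then have 2: "(\<Sum>k<n. real n * (kd i j * w t k + kd i k * w t j + kd j k * w t i) / ?s ^ (n + 2) * h k)
   = real n * (kd i j * ?S + w t j * h i + w t i * h j) / ?s ^ (n + 2)" by (simp add: sum_distrib_left sum_divide_distrib mult.assoc)
 have "n + 2 + 2 = n + 4" by simp
 then show ?thesis unfolding ddrk_def left_diff_distrib sum_subtractf 1 2 by (simp only:) (simp add: algebra_simps add_divide_distrib diff_divide_distrib)
qed
ultimately show ?thesis by (simp add: drk_def mult.assoc)
qed

end

lemma rk_measurable [measurable]: "i < n ==> rk n eps i \<in> borel_measurable (Leb n)" unfolding rk_def[abs_def] by measurable

lemma drk_measurable [measurable]: "i < n ==> j < n ==> drk n eps i j \<in> borel_measurable (Leb n)" unfolding drk_def[abs_def] by measurable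

lemma ddrk_measurable [measurable]:
"i < n ==> j < n ==> k < n ==> ddrk n eps i j k \<in> borel_measurable (Leb n)" unfolding ddrk_def[abs_def] by measurable

text \<open>From |u|^2 \<le> 2 |u - v|^2 + 2 |v|^2 and \<open>eps \<le> wt n eps v\<close>. It makes
  kernels with different centres comparable, but the constant blows up as \<open>eps\<close> tends
  to 0; so it serves to show integrability and decay for fixed \<open>eps\<close>, not to obtain
  uniform bounds.\<close>

lemma wt_compare:
assumes "eps > 0"
shows "wt n eps u <= sqrt (2 + 2 * (\<Sum>i<n. (u i - v i)^2) / eps\<^sup>2) * wt n eps v"
proof (rule power2_le_imp_le)
let ?S = "\<Sum>i<n. (u i - v i)^2" and ?V = "\<Sum>i<n. (v i)^2"
have S0: "?S >= 0" and V0: "?V >= 0" by (auto intro: sum_nonneg)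
have "(\<Sum>i<n. (u i)^2) <= (\<Sum>i<n. 2 * (u i - v i)^2 + 2 * (v i)^2)"
proof (intro sum_mono)
 fix i
 have "2 * (u i - v i)^2 + 2 * (v i)^2 - (u i)\<^sup>2 = (u i - 2 * v i)^2" by (simp add: power2_eq_square algebra_simps)
 then show "(u i)^2 <= 2 * (u i - v i)^2 + 2 * (v i)^2" using zero_le_power2[of "u i - 2 * v i"] by linarith
qed
then have 1: "(wt n eps u)^2 <= eps\<^sup>2 + 2 * ?S + 2 * ?V" by (simp add: wt_sq sum.distrib sum_distrib_left)
have "(2 + 2 * ?S / eps\<^sup>2) * (eps\<^sup>2 + ?V) = 2 * eps\<^sup>2 + 2 * ?V + 2 * ?S + 2 * ?S / eps\<^sup>2 * ?V" using assms by (simp add: field_simps)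
moreover have "2 * ?S / eps\<^sup>2 * ?V >= 0" using S0 V0 by (intro mult_nonneg_nonneg divide_nonneg_nonneg) auto
ultimately have 2: "eps\<^sup>2 + 2 * ?S + 2 * ?V <= (2 + 2 * ?S / eps\<^sup>2) * (eps\<^sup>2 + ?V)" using zero_le_power2[of eps] by linarith
have "2 + 2 * ?S / eps\<^sup>2 >= 0" using S0 by (intro add_nonneg_nonneg divide_nonneg_nonneg) auto
then show "(wt n eps u)^2 <= (sqrt (2 + 2 * ?S / eps\<^sup>2) * wt n eps v)^2" using 1 2 by (simp add: power_mult_distrib wt_sq)
show "0 <= sqrt (2 + 2 * ?S / eps\<^sup>2) * wt n eps v" using \<open>2 + 2 * ?S / eps\<^sup>2 >= 0\<close> assms by (simp add: less_imp_le)
qed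

lemma integrable_wt_bound:
assumes n: "n >= 1" and eps: "eps > 0" and m: "m > n" and y: "y \<in> space (Leb n)"
 and [measurable]: "f \<in> borel_measurable (Leb n)"
 and bd: "!!x. \<bar>f x\<bar> <= C / wt n eps (dif n x y) ^ m"
shows "integrable (Leb n) (f :: _ => real)"
proof (rule integrable_dom)
have "(nn_integral (Leb n) (%x. ennreal (1 / wt n eps (dif n x y) ^ m))) = (nn_integral (Leb n) (%x. ennreal (1 / wt n eps x ^ m)))" by (rule nn_integral_dif_right[OF y]) measurable
also have "... < \<infinity>" using nn_integral_wt_tail[OF n m eps] by (rule order_le_less_trans) simp
finally have "integrable (Leb n) (%x. 1 / wt n eps (dif n x y) ^ m)" using eps y by (intro integrableI_bounded) (auto simp: less_imp_le)
then show "integrable (Leb n) (%x. C * (1 / wt n eps (dif n x y) ^ m))" by (rule integrable_mult_right)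
show "AE x in Leb n. norm (f x) <= norm (C * (1 / wt n eps (dif n x y) ^ m))" using order_trans[OF bd abs_ge_self] by simp
qed simp

lemma wt_coord_line_tendsto:
assumes eps: "eps > 0" and j: "j < n" and C: "!!t. \<bar>F t\<bar> <= C / wt n eps (dif n (x(j := t)) y)"
shows "(F \<longlongrightarrow> (0::real)) at_top" "(F \<longlongrightarrow> 0) at_bot"
proof -
have C0: "C >= 0"
proof -
 have "0 <= C / wt n eps (dif n (x(j := 0)) y)" using C[of 0] by linarith
 then show ?thesis using wt_pos[OF eps, of n "dif n (x(j := 0)) y"] by (simp add: zero_le_divide_iff)
qed
have bd: "norm (F t) <= C / \<bar>t - y j\<bar>" if "t ~= y j" for t
proof -
 have "\<bar>t - y j\<bar> <= wt n eps (dif n (x(j := t)) y)" using wt_coord[OF j, of "dif n (x(j := t)) y" eps] j by simp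
 then have "C / wt n eps (dif n (x(j := t)) y) <= C / \<bar>t - y j\<bar>" using C0 that by (intro divide_left_mono) (auto intro!: mult_pos_pos wt_pos eps)
 then show ?thesis using C[of t] by simp
qed
have top: "filterlim (%t. \<bar>t - y j\<bar>) at_top at_top" by (rule filterlim_compose[OF filterlim_abs_real])
  (use filterlim_tendsto_add_at_top[OF tendsto_const filterlim_ident, of "- y j"] in simp)
have bot: "filterlim (%t. \<bar>t - y j\<bar>) at_top at_bot"
proof -
 have "filterlim (%t. \<bar>- t - y j\<bar>) at_top at_top"
 proof -
  have "(%t. \<bar>- t - y j\<bar>) = (%t. \<bar>t + y j\<bar>)" by (auto simp: abs_if)
  then show ?thesis using filterlim_compose[OF filterlim_abs_real filterlim_tendsto_add_at_top[OF tendsto_const filterlim_ident, of "y j"]] by (simp add: add.commute)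
 qed
 then show ?thesis by (simp add: filterlim_at_bot_mirror)
qed
show "(F \<longlongrightarrow> 0) at_top" by (rule Lim_null_comparison[OF _ tendsto_divide_0[OF tendsto_const filterlim_at_top_imp_at_infinity[OF top]], of _ C])
  (rule eventually_mono[OF eventually_gt_at_top[of "y j"]], rule bd, simp)
show "(F \<longlongrightarrow> 0) at_bot" by (rule Lim_null_comparison[OF _ tendsto_divide_0[OF tendsto_const filterlim_at_top_imp_at_infinity[OF bot]], of _ C])
  (rule eventually_mono[OF eventually_gt_at_bot[of "y j"]], rule bd, simp)
qed

lemma coord_line_deriv:
assumes "j < n" "i < n"
shows "((%t. dif n (x(j := t)) y i) has_real_derivative kd j i) (at t)" using assms by (auto simp: kd_def intro!: derivative_eq_intros)

lemma rk_coord_deriv: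
assumes "eps > 0" "i < n" "j < n"
shows "((%t. rk n eps i (dif n (x(j := t)) y)) has_real_derivative drk n eps i j (dif n (x(j := t)) y)) (at t)"
proof -
have "((%t. rk n eps i (dif n (x(j := t)) y)) has_real_derivative
  (\<Sum>k<n. drk n eps i k (dif n (x(j := t)) y) * kd j k)) (at t)" using assms by (intro rk_path_deriv coord_line_deriv)
then show ?thesis by (simp only: kd_sum(2)[OF assms(3)])
qed

lemma drk_coord_deriv:
assumes "eps > 0" "i < n" "j < n" "k < n"
shows "((%t. drk n eps i j (dif n (x(k := t)) y)) has_real_derivative ddrk n eps i j k (dif n (x(k := t)) y)) (at t)"
proof -
have "((%t. drk n eps i j (dif n (x(k := t)) y)) has_real_derivative
  (\<Sum>l<n. ddrk n eps i j l (dif n (x(k := t)) y) * kd k l)) (at t)" using assms by (intro drk_path_deriv coord_line_deriv)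
then show ?thesis by (simp only: kd_sum(2)[OF assms(4)])
qed

lemma ddrk_coord_cont:
assumes "eps > 0" "i < n" "j < n" "k < n" "l < n"
shows "continuous_on UNIV (%t. ddrk n eps i j k (dif n (x(l := t)) y))"
proof -
have *: "continuous_on UNIV (%t. dif n (x(l := t)) y m)" if "m < n" for m using coord_line_deriv[OF assms(5) that] by (intro DERIV_continuous_on) (auto intro: has_field_derivative_at_within)
have "continuous_on UNIV (%t. wt n eps (dif n (x(l := t)) y))" unfolding wt_def by (intro continuous_intros *) auto
then show ?thesis unfolding ddrk_def using assms by (intro continuous_intros *) (auto intro!: continuous_intros *)
qed

section \<open>The L2 bound for the derivatives of the convolution with an indicator\<close>

interpretation Leb: sigma_finite_measure "Leb n" for n by (rule sigma_finite_Leb)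

interpretation Leb_pair: pair_sigma_finite "Leb n" "Leb n" for n by standard

lemma inverse_wt_mono: "eps > 0 ==> 1 / wt n eps z ^ m <= 1 / eps ^ m" by (intro divide_left_mono power_mono wt_ge mult_pos_pos) auto

lemma inverse_wt_compare:
assumes "eps > 0"
shows "1 / wt n eps v ^ m <= sqrt (2 + 2 * (\<Sum>i<n. (u i - v i)^2) / eps\<^sup>2) ^ m / wt n eps u ^ m"
proof -
let ?c = "sqrt (2 + 2 * (\<Sum>i<n. (u i - v i)^2) / eps\<^sup>2)"
have "wt n eps u ^ m <= (?c * wt n eps v) ^ m" using assms by (intro power_mono wt_compare) (auto simp: less_imp_le)
then show ?thesis using assms by (simp add: power_mult_distrib field_simps)
qed

lemma wt_dif_commute: "wt n eps (dif n x y) = wt n eps (dif n y x)"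
proof -
have "(\<Sum>i<n. (dif n x y i)^2) = (\<Sum>i<n. (dif n y x i)^2)" by (intro sum.cong refl) (simp add: power2_commute)
then show ?thesis by (simp add: wt_def)
qed

lemma drk_dif_commute: "i < n ==> j < n ==> drk n eps i j (dif n x y) = drk n eps i j (dif n y x)"
proof -
assume "i < n" "j < n"
then have "dif n x y i * dif n x y j = dif n y x i * dif n y x j" by (simp add: algebra_simps)
then show ?thesis by (simp add: drk_def wt_dif_commute[of n eps x y] mult.assoc)
qed

text \<open>The product \<open>rk i * drk j k\<close> is differentiated in coordinate l. Both
  resulting terms are of order |x|^(-2n), hence separately integrable;
  \<open>inverse_wt_compare\<close> moves the two centres into one weight.\<close>

lemma kernel_ibp:
assumes n: "n >= 1" and eps: "eps > 0" and yz: "y \<in> space (Leb n)" "z \<in> space (Leb n)"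
 and i: "i < n" and j: "j < n" and k: "k < n" and l: "l < n"
shows "integrable (Leb n) (%x. drk n eps i l (dif n x y) * drk n eps j k (dif n x z))" (is "integrable _ ?G")
 and "(LINT x|Leb n. drk n eps i l (dif n x y) * drk n eps j k (dif n x z))
  = - (LINT x|Leb n. rk n eps i (dif n x y) * ddrk n eps j k l (dif n x z))"
proof -
let ?c = "sqrt (2 + 2 * (\<Sum>i<n. (y i - z i)^2) / eps\<^sup>2)"
have c: "1 / wt n eps (dif n x y) ^ m <= ?c ^ m / wt n eps (dif n x z) ^ m" for x m
proof -
 have "(\<Sum>i<n. (dif n x z i - dif n x y i)^2) = (\<Sum>i<n. (y i - z i)^2)" by (intro sum.cong) auto
 then show ?thesis using inverse_wt_compare[OF eps, of n "dif n x y" m "dif n x z"] by simp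
qed
have [measurable]: "y \<in> space (Leb n)" "z \<in> space (Leb n)" by (fact yz)+
have [measurable]: "rk n eps i \<in> borel_measurable (Leb n)" "drk n eps i l \<in> borel_measurable (Leb n)"
 "drk n eps j k \<in> borel_measurable (Leb n)" "ddrk n eps j k l \<in> borel_measurable (Leb n)" using i j k l by measurable
let ?H = "%x. rk n eps i (dif n x y) * ddrk n eps j k l (dif n x z)"
show iG: "integrable (Leb n) ?G"
proof (rule integrable_wt_bound[OF n eps _ yz(2), of "2 * n"])
 fix x
 have "\<bar>?G x\<bar> <= ((1 + real n) * (?c ^ n / wt n eps (dif n x z) ^ n)) * ((1 + real n) / wt n eps (dif n x z) ^ n)" unfolding abs_mult
 proof (rule mult_mono)
  have "\<bar>drk n eps i l (dif n x y)\<bar> <= (1 + real n) * (1 / wt n eps (dif n x y) ^ n)" using drk_bound[OF eps i l] by simp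
  also have "... <= (1 + real n) * (?c ^ n / wt n eps (dif n x z) ^ n)" by (rule mult_left_mono[OF c]) simp
  finally show "\<bar>drk n eps i l (dif n x y)\<bar> <= (1 + real n) * (?c ^ n / wt n eps (dif n x z) ^ n)" .
  then show "0 <= (1 + real n) * (?c ^ n / wt n eps (dif n x z) ^ n)" by (rule order_trans[OF abs_ge_zero])
 qed (use drk_bound[OF eps j k] in auto)
 also have "... = ((1 + real n) * (1 + real n) * ?c ^ n) / wt n eps (dif n x z) ^ (2 * n)"
 proof -
  have alg: "(a * (b / c)) * (a / c) = (a * a * b) / (c * c)" for a b c :: real by simp
  show ?thesis by (simp only: alg power_add mult_2[of n])
 qed
 finally show "\<bar>?G x\<bar> <= ..." .
 show "?G \<in> borel_measurable (Leb n)" by measurable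
 show "n < 2 * n" using n by simp
qed
have iH: "integrable (Leb n) ?H"
proof (rule integrable_wt_bound[OF n eps _ yz(2), of "2 * n"])
 fix x
 have "\<bar>?H x\<bar> <= (?c ^ (n - 1) / wt n eps (dif n x z) ^ (n - 1)) * (real n * (real n + 5) / wt n eps (dif n x z) ^ (n + 1))" unfolding abs_mult
 proof (rule mult_mono)
  show *: "\<bar>rk n eps i (dif n x y)\<bar> <= ?c ^ (n - 1) / wt n eps (dif n x z) ^ (n - 1)" using rk_bound[OF eps i] c by (rule order_trans)
  show "0 <= ?c ^ (n - 1) / wt n eps (dif n x z) ^ (n - 1)" by (rule order_trans[OF abs_ge_zero *])
 qed (use ddrk_bound[OF eps j k l] in auto)
 also have "... = (?c ^ (n - 1) * (real n * (real n + 5))) / wt n eps (dif n x z) ^ (2 * n)"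
 proof -
  have "2 * n = (n - 1) + (n + 1)" using n by simp
  then show ?thesis by (simp only: power_add times_divide_times_eq)
 qed
 finally show "\<bar>?H x\<bar> <= ..." .
 show "?H \<in> borel_measurable (Leb n)" by measurable
 show "n < 2 * n" using n by simp
qed
have "(LINT x|Leb n. ?G x + ?H x) = 0"
proof (rule integral_derivative_zero[OF l, of _ "%x. rk n eps i (dif n x y) * drk n eps j k (dif n x z)"])
 show "integrable (Leb n) (%x. ?G x + ?H x)" using iG iH by simp
next
 fix x t
 have "((%t. rk n eps i (dif n (x(l := t)) y) * drk n eps j k (dif n (x(l := t)) z)) has_real_derivative
  drk n eps i l (dif n (x(l := t)) y) * drk n eps j k (dif n (x(l := t)) z)
  + ddrk n eps j k l (dif n (x(l := t)) z) * rk n eps i (dif n (x(l := t)) y)) (at t)" by (intro DERIV_mult rk_coord_deriv drk_coord_deriv eps i j k l)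
 then show "((%t. rk n eps i (dif n (x(l := t)) y) * drk n eps j k (dif n (x(l := t)) z)) has_real_derivative
  ?G (x(l := t)) + ?H (x(l := t))) (at t)" by (simp add: mult.commute)
next
 fix x
 have c: "continuous_on UNIV (%t. rk n eps i (dif n (x(l := t)) y))" "continuous_on UNIV (%t. drk n eps i l (dif n (x(l := t)) y))"
  "continuous_on UNIV (%t. drk n eps j k (dif n (x(l := t)) z))" by (rule DERIV_continuous_on[OF rk_coord_deriv[OF eps i l]],
    rule DERIV_continuous_on[OF drk_coord_deriv[OF eps i l l]],
    rule DERIV_continuous_on[OF drk_coord_deriv[OF eps j k l]])
 show "continuous_on UNIV (%t. ?G (x(l := t)) + ?H (x(l := t)))" by (intro continuous_on_add continuous_on_mult c ddrk_coord_cont eps i j k l)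
next
 fix x
 have bd: "\<bar>rk n eps i (dif n (x(l := t)) y) * drk n eps j k (dif n (x(l := t)) z)\<bar>
  <= (1 / eps ^ (n - 1) * ((1 + real n) / eps ^ (n - 1))) / wt n eps (dif n (x(l := t)) z)" for t
 proof -
  let ?z = "dif n (x(l := t)) z"
  have "\<bar>drk n eps j k ?z\<bar> <= (1 + real n) / wt n eps ?z ^ n" by (rule drk_bound[OF eps j k])
  also have "... = (1 + real n) * (1 / wt n eps ?z ^ (n - 1)) / wt n eps ?z" using n by (cases n) auto
  also have "... <= (1 + real n) * (1 / eps ^ (n - 1)) / wt n eps ?z" using eps by (intro divide_right_mono mult_left_mono inverse_wt_mono) (auto simp: less_imp_le)
  finally have "\<bar>drk n eps j k ?z\<bar> <= (1 + real n) / eps ^ (n - 1) / wt n eps ?z" by simp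
  moreover have "\<bar>rk n eps i (dif n (x(l := t)) y)\<bar> <= 1 / eps ^ (n - 1)" using rk_bound[OF eps i] inverse_wt_mono[OF eps] by (rule order_trans)
  ultimately have "\<bar>rk n eps i (dif n (x(l := t)) y)\<bar> * \<bar>drk n eps j k ?z\<bar> <= 1 / eps ^ (n - 1) * ((1 + real n) / eps ^ (n - 1) / wt n eps ?z)" using eps by (intro mult_mono) auto
  then show ?thesis by (simp add: abs_mult)
 qed
 show "((%t. rk n eps i (dif n (x(l := t)) y) * drk n eps j k (dif n (x(l := t)) z)) \<longlongrightarrow> 0) at_top"
  "((%t. rk n eps i (dif n (x(l := t)) y) * drk n eps j k (dif n (x(l := t)) z)) \<longlongrightarrow> 0) at_bot" using wt_coord_line_tendsto[OF eps l bd] by auto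
qed
then show "(LINT x|Leb n. ?G x) = - (LINT x|Leb n. ?H x)" using iG iH by simp
qed

text \<open>Moving one derivative turns both sides into the same integral, because the second
  derivatives of a gradient field are symmetric in all indices. The same identity makes the L2 norms
  of the Hessian and of the Laplacian of a function agree.\<close>

lemma kernel_ibp_swap:
assumes n: "n >= 1" and eps: "eps > 0" and yz: "y \<in> space (Leb n)" "z \<in> space (Leb n)"
 and i: "i < n" and j: "j < n"
shows "(LINT x|Leb n. drk n eps i j (dif n x y) * drk n eps i j (dif n x z))
  = (LINT x|Leb n. drk n eps i i (dif n x y) * drk n eps j j (dif n x z))"
proof -
have "ddrk n eps i j j = ddrk n eps j j i" by (rule ext) (simp add: ddrk_def kd_commute[of i j] mult_ac add_ac)
then show ?thesis using kernel_ibp(2)[OF n eps yz i i j j] kernel_ibp(2)[OF n eps yz i j j i] by simp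
qed

text \<open>Derivative j of component i of the convolution \<open>rki\<close> below. As
  \<open>drk\<close> is bounded for fixed \<open>eps\<close>, differentiation under the integral is
  built into the definition.\<close>

definition drki :: "nat => real => (nat => real) set => nat => nat => (nat => real) => real" where
"drki n eps A i j x = (LINT y|Leb n. indicator A y * drk n eps i j (dif n x y))"

definition rki :: "nat => real => (nat => real) set => nat => (nat => real) => real" where
"rki n eps A i x = (LINT y|Leb n. indicator A y * rk n eps i (dif n x y))"

lemma drki_measurable [measurable]:
assumes "i < n" "j < n" and [measurable]: "A \<in> sets (Leb n)"
shows "drki n eps A i j \<in> borel_measurable (Leb n)"
proof -
have [measurable]: "drk n eps i j \<in> borel_measurable (Leb n)" using assms by simp
show ?thesis unfolding drki_def[abs_def] by measurable
qed

lemma rki_measurable [measurable]: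
assumes "i < n" and [measurable]: "A \<in> sets (Leb n)"
shows "rki n eps A i \<in> borel_measurable (Leb n)"
proof -
have [measurable]: "rk n eps i \<in> borel_measurable (Leb n)" using assms by simp
show ?thesis unfolding rki_def[abs_def] by measurable
qed

lemma integrable_indicator_bounded:
assumes A: "A \<in> sets M" "emeasure M A < \<infinity>" and [measurable]: "g \<in> borel_measurable M" and bd: "!!x. x \<in> space M ==> \<bar>g x\<bar> <= C"
shows "integrable M (%x. indicator A x * g x :: real)"
proof (rule integrable_dom)
show "integrable M (%x. C * indicator A x)" using A by (intro integrable_mult_right) simp
show "AE x in M. norm (indicator A x * g x) <= norm (C * indicator A x)" using bd by (auto simp: indicator_def intro!: AE_I2 intro: order_trans[OF _ abs_ge_self])
qed (use A in measurable)

lemma drk_sup_bound: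
assumes "eps > 0" "i < n" "j < n"
shows "\<bar>drk n eps i j z\<bar> <= (1 + real n) / eps ^ n"
proof -
have "\<bar>drk n eps i j z\<bar> <= (1 + real n) * (1 / wt n eps z ^ n)" using drk_bound[OF assms] by simp
also have "... <= (1 + real n) * (1 / eps ^ n)" by (intro mult_left_mono inverse_wt_mono assms) auto
finally show ?thesis by simp
qed

lemma rk_sup_bound:
assumes "eps > 0" "i < n"
shows "\<bar>rk n eps i z\<bar> <= 1 / eps ^ (n - 1)" using rk_bound[OF assms, of z] inverse_wt_mono[OF assms(1), of n z "n - 1"] by linarith

lemma drki_integrable:
assumes "eps > 0" "i < n" "j < n" "A \<in> sets (Leb n)" "emeasure (Leb n) A < \<infinity>" "x \<in> space (Leb n)"
shows "integrable (Leb n) (%y. indicator A y * drk n eps i j (dif n x y))"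
proof -
have [measurable]: "drk n eps i j \<in> borel_measurable (Leb n)" using assms by simp
show ?thesis using assms by (intro integrable_indicator_bounded[where C = "(1 + real n) / eps ^ n"] drk_sup_bound) simp_all
qed

lemma abs_indicator_integral_le:
assumes A: "A \<in> sets M" "emeasure M A < \<infinity>" and m: "g \<in> borel_measurable M" and bd: "!!x. x \<in> space M ==> \<bar>g x\<bar> <= C"
shows "\<bar>\<integral>x. indicator A x * g x \<partial>M\<bar> <= C * measure M A"
proof -
have int: "integrable M (%x. indicator A x * g x)" by (rule integrable_indicator_bounded[OF A m bd])
have "\<bar>\<integral>x. indicator A x * g x \<partial>M\<bar> <= (LINT x|M. \<bar>indicator A x * g x\<bar>)" by (rule integral_abs_bound)
also have "... <= (LINT x|M. C * indicator A x)"
proof (rule integral_mono)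
 show "integrable M (%x. \<bar>indicator A x * g x\<bar>)" using int by simp
 show "integrable M (%x. C * indicator A x)" using A by (intro integrable_mult_right) simp
 show "\<bar>indicator A x * g x\<bar> <= C * indicator A x" if "x \<in> space M" for x using bd[OF that] by (auto simp: indicator_def)
qed
also have "... = C * measure M A" using A by simp
finally show ?thesis .
qed

lemma drki_sup_bound:
assumes "eps > 0" "i < n" "j < n" "A \<in> sets (Leb n)" "emeasure (Leb n) A < \<infinity>" "x \<in> space (Leb n)"
shows "\<bar>drki n eps A i j x\<bar> <= (1 + real n) / eps ^ n * measure (Leb n) A"
proof -
have [measurable]: "drk n eps i j \<in> borel_measurable (Leb n)" using assms by simp
show ?thesis unfolding drki_def using assms by (intro abs_indicator_integral_le drk_sup_bound) simp_all
qed

lemma (in pair_sigma_finite) integral_prod_mult: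
assumes f: "integrable M1 f" and g: "integrable M2 g"
shows "integrable (M1 \<Otimes>\<^sub>M M2) (%(x, y). f x * g y :: real)"
 and "(LINT z|(M1 \<Otimes>\<^sub>M M2). (case z of (x, y) => f x * g y)) = (LINT x|M1. f x) * (LINT y|M2. g y)"
proof -
have [measurable]: "f \<in> borel_measurable M1" "g \<in> borel_measurable M2" using f g by auto
show int: "integrable (M1 \<Otimes>\<^sub>M M2) (%(x, y). f x * g y :: real)"
proof (rule Fubini_integrable)
 show "integrable M1 (%x. \<integral>y. norm (case (x, y) of (x, y) => f x * g y) \<partial>M2)" using f g by (simp add: abs_mult)
 show "AE x in M1. integrable M2 (%y. case (x, y) of (x, y) => f x * g y)" using g by simp
qed measurable
show "(LINT z|(M1 \<Otimes>\<^sub>M M2). (case z of (x, y) => f x * g y)) = (LINT x|M1. f x) * (LINT y|M2. g y)" using integral_fst'[OF int] by simp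
qed

text \<open>Fubini for x and the pair (y, z). For absolute integrability, the product of two kernels
  of order wt^(-n) is split by ab \<le> a^2 + b^2 into terms with a single centre each; their
  integral in x is bounded independently of the centre, and \<open>A\<close> has finite
  measure.\<close>

lemma drki_product:
assumes n: "n >= 1" and eps: "eps > 0" and A [measurable]: "A \<in> sets (Leb n)" and fin: "emeasure (Leb n) A < \<infinity>"
 and ij: "i < n" "j < n" and kl: "k < n" "l < n"
shows "integrable (Leb n) (%x. drki n eps A i j x * drki n eps A k l x)"
 and "(LINT x|Leb n. drki n eps A i j x * drki n eps A k l x)
  = (LINT yz|(Leb n \<Otimes>\<^sub>M Leb n). indicator (A \<times> A) yz * (LINT x|Leb n. drk n eps i j (dif n x (fst yz)) * drk n eps k l (dif n x (snd yz))))"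
proof -
let ?L = "Leb n" and ?M = "Leb n \<Otimes>\<^sub>M Leb n"
interpret M: sigma_finite_measure ?M by (rule Leb_pair.P.sigma_finite_measure_axioms)
interpret LM: pair_sigma_finite ?L ?M by standard
have [measurable]: "drk n eps i j \<in> borel_measurable ?L" "drk n eps k l \<in> borel_measurable ?L" using ij kl by simp_all
let ?G = "%(x, yz). (indicator A (fst yz) * drk n eps i j (dif n x (fst yz))) * (indicator A (snd yz) * drk n eps k l (dif n x (snd yz)))"
let ?c = "(1 + real n)^2" and ?T = "ennreal (tail_const n (2 * n) / eps ^ (2 * n - n))"
have G [measurable]: "?G \<in> borel_measurable (?L \<Otimes>\<^sub>M ?M)" by measurable
have inner: "(nn_integral ?L (%x. ennreal (norm (?G (x, yz))))) <= ennreal ?c * 2 * ?T * indicator (A \<times> A) yz" if yz: "yz \<in> space ?M" for yz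
proof (cases "yz \<in> A \<times> A")
 case True
 have y: "fst yz \<in> space ?L" and z: "snd yz \<in> space ?L" using yz by (auto simp: space_pair_measure)
 have "(nn_integral ?L (%x. ennreal (norm (?G (x, yz))))) <=
  (nn_integral ?L (%x. ennreal ?c * (ennreal (1 / wt n eps (dif n x (fst yz)) ^ (2 * n)) + ennreal (1 / wt n eps (dif n x (snd yz)) ^ (2 * n)))))"
 proof (intro nn_integral_mono)
  fix x
  define a b where "a = 1 / wt n eps (dif n x (fst yz)) ^ n" and "b = 1 / wt n eps (dif n x (snd yz)) ^ n"
  have ab: "a >= 0" "b >= 0" using eps by (auto simp: a_def b_def less_imp_le)
  have "norm (?G (x, yz)) = \<bar>drk n eps i j (dif n x (fst yz))\<bar> * \<bar>drk n eps k l (dif n x (snd yz))\<bar>" using True by (auto simp: abs_mult)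
  also have "... <= ((1 + real n) * a) * ((1 + real n) * b)" using drk_bound[OF eps ij] drk_bound[OF eps kl] ab by (intro mult_mono) (auto simp: a_def b_def)
  also have "... = ?c * (a * b)" by (simp add: power2_eq_square)
  also have "... <= ?c * (a^2 + b^2)"
  proof (rule mult_left_mono)
   have "2 * (a * b) <= a^2 + b^2" using sum_squares_bound[of a b] by (simp add: mult_ac)
   moreover have "0 <= a * b" using ab by simp
   ultimately show "a * b <= a^2 + b^2" by linarith
  qed simp
  also have "a^2 + b^2 = 1 / wt n eps (dif n x (fst yz)) ^ (2 * n) + 1 / wt n eps (dif n x (snd yz)) ^ (2 * n)" by (simp add: a_def b_def power_divide power_mult[symmetric] mult.commute)
  finally have "ennreal (norm (?G (x, yz))) <= ennreal (?c * (1 / wt n eps (dif n x (fst yz)) ^ (2 * n) + 1 / wt n eps (dif n x (snd yz)) ^ (2 * n)))" by (rule ennreal_leI)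
  also have "... = ennreal ?c * (ennreal (1 / wt n eps (dif n x (fst yz)) ^ (2 * n)) + ennreal (1 / wt n eps (dif n x (snd yz)) ^ (2 * n)))"
  proof -
   have "ennreal (c * (a + b)) = ennreal c * (ennreal a + ennreal b)" if "c >= 0" "a >= 0" "b >= 0" for a b c using that by (simp add: ennreal_mult)
   then show ?thesis using eps by (simp add: less_imp_le)
  qed
  finally show "ennreal (norm (?G (x, yz))) <= ..." .
 qed
 also have "... = ennreal ?c * ((nn_integral ?L (%x. ennreal (1 / wt n eps (dif n x (fst yz)) ^ (2 * n)))) + (nn_integral ?L (%x. ennreal (1 / wt n eps (dif n x (snd yz)) ^ (2 * n)))))" using y z by (subst nn_integral_cmult, measurable, subst nn_integral_add, measurable)
 also have "(nn_integral ?L (%x. ennreal (1 / wt n eps (dif n x (fst yz)) ^ (2 * n)))) = (nn_integral ?L (%x. ennreal (1 / wt n eps x ^ (2 * n))))" by (rule nn_integral_dif_right[OF y]) measurable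
 also have "(nn_integral ?L (%x. ennreal (1 / wt n eps (dif n x (snd yz)) ^ (2 * n)))) = (nn_integral ?L (%x. ennreal (1 / wt n eps x ^ (2 * n))))" by (rule nn_integral_dif_right[OF z]) measurable
 also have "ennreal ?c * ((nn_integral ?L (%x. ennreal (1 / wt n eps x ^ (2 * n)))) + (nn_integral ?L (%x. ennreal (1 / wt n eps x ^ (2 * n))))) <= ennreal ?c * (?T + ?T)" using n by (intro mult_left_mono add_mono nn_integral_wt_tail eps) auto
 finally show ?thesis using True by (simp add: mult_2 mult.assoc)
next
 case False
 then have "indicator A (fst yz) * indicator A (snd yz) = (0 :: real)" by (cases yz) (auto simp: indicator_def)
 then have "?G (x, yz) = 0" for x by auto
 then show ?thesis by (simp only:) simp
qed
have AA: "A \<times> A \<in> sets ?M" by measurable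
have "(nn_integral (?L \<Otimes>\<^sub>M ?M) (%w. ennreal (norm (?G w)))) = (nn_integral ?M (%yz. (nn_integral ?L (%x. ennreal (norm (?G (x, yz)))))))" by (rule LM.nn_integral_snd[symmetric]) measurable
also have "... <= (nn_integral ?M (%yz. ennreal ?c * 2 * ?T * indicator (A \<times> A) yz))" by (intro nn_integral_mono inner)
also have "... = ennreal ?c * 2 * ?T * emeasure ?M (A \<times> A)" by (rule nn_integral_cmult_indicator[OF AA])
also have "... < \<infinity>" using fin by (simp add: Leb.emeasure_pair_measure_Times ennreal_mult_less_top)
finally have int: "integrable (?L \<Otimes>\<^sub>M ?M) ?G" by (intro integrableI_bounded) measurable
have eq: "(LINT yz|?M. ?G (x, yz)) = drki n eps A i j x * drki n eps A k l x" if x: "x \<in> space ?L" for x using Leb_pair.integral_prod_mult(2)[OF drki_integrable[OF eps ij A fin x] drki_integrable[OF eps kl A fin x]] by (simp add: drki_def case_prod_beta)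
have "integrable ?L (%x. \<integral>yz. ?G (x, yz) \<partial>?M)" by (rule LM.integrable_fst'[OF int])
then show "integrable ?L (%x. drki n eps A i j x * drki n eps A k l x)" by (subst (asm) Bochner_Integration.integrable_cong[OF refl eq])
have "(LINT x|?L. drki n eps A i j x * drki n eps A k l x) = (LINT x|?L. (LINT yz|?M. ?G (x, yz)))" by (rule lint_cong[OF refl eq[symmetric]])
also have "... = (LINT yz|?M. (LINT x|?L. ?G (x, yz)))" using LM.Fubini_integral[of "%x yz. ?G (x, yz)"] int by simp
also have "... = (LINT yz|?M. indicator (A \<times> A) yz * (LINT x|?L. drk n eps i j (dif n x (fst yz)) * drk n eps k l (dif n x (snd yz))))"
proof (rule lint_cong[OF refl])
 fix yz :: "(nat => real) \<times> (nat => real)"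
 have "?G (x, yz) = indicator (A \<times> A) yz * (drk n eps i j (dif n x (fst yz)) * drk n eps k l (dif n x (snd yz)))" for x by (cases yz) (simp add: indicator_times)
 from this show "(LINT x|?L. ?G (x, yz)) = indicator (A \<times> A) yz * (LINT x|?L. drk n eps i j (dif n x (fst yz)) * drk n eps k l (dif n x (snd yz)))" by (simp only: integral_mult_right_zero)
qed
finally show "(LINT x|?L. drki n eps A i j x * drki n eps A k l x) = ..." .
qed

text \<open>The eps^2 of the trace kernel cancels against the eps^(-2) of its tail integral, so one
  constant serves all scales.\<close>

definition trace_const :: "nat => real" where
"trace_const n = real n * tail_const n (n + 2)"

lemma tail_const_nonneg: "m >= n ==> tail_const n m >= 0" by (simp add: tail_const_def)

lemma trace_const_nonneg: "trace_const n >= 0" by (simp add: trace_const_def tail_const_nonneg)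

lemma trace_kernel_nn_integral:
assumes n: "n >= 1" and eps: "eps > 0"
shows "(nn_integral (Leb n) (%z. ennreal (real n * eps\<^sup>2 / wt n eps z ^ (n + 2)))) <= ennreal (trace_const n)"
proof -
have "(nn_integral (Leb n) (%z. ennreal (real n * eps\<^sup>2 / wt n eps z ^ (n + 2))))
 = (nn_integral (Leb n) (%z. ennreal (real n * eps\<^sup>2) * ennreal (1 / wt n eps z ^ (n + 2))))" using eps by (intro nn_integral_cong) (simp add: ennreal_mult[symmetric] less_imp_le)
also have "... = ennreal (real n * eps\<^sup>2) * (nn_integral (Leb n) (%z. ennreal (1 / wt n eps z ^ (n + 2))))" by (rule nn_integral_cmult) measurable
also have "... <= ennreal (real n * eps\<^sup>2) * ennreal (tail_const n (n + 2) / eps ^ (n + 2 - n))" by (intro mult_left_mono nn_integral_wt_tail n eps) auto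
also have "... = ennreal (real n * eps\<^sup>2 * (tail_const n (n + 2) / eps ^ (n + 2 - n)))" using eps by (subst ennreal_mult) (auto simp: tail_const_nonneg)
also have "real n * eps\<^sup>2 * (tail_const n (n + 2) / eps ^ (n + 2 - n)) = trace_const n" using eps by (simp add: trace_const_def)
finally show ?thesis .
qed

lemma drki_trace_eq:
assumes "eps > 0" "A \<in> sets (Leb n)" "emeasure (Leb n) A < \<infinity>" "x \<in> space (Leb n)"
shows "(\<Sum>i<n. drki n eps A i i x) = (LINT y|Leb n. indicator A y * (real n * eps\<^sup>2 / wt n eps (dif n x y) ^ (n + 2)))"
proof -
have "(\<Sum>i<n. drki n eps A i i x) = (LINT y|Leb n. (\<Sum>i<n. indicator A y * drk n eps i i (dif n x y)))" unfolding drki_def using assms by (intro integral_setsum[symmetric] drki_integrable) auto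
then show ?thesis using assms(1) by (simp add: sum_distrib_left[symmetric] drk_trace)
qed

lemma drki_trace_ennreal:
assumes "eps > 0" and A: "A \<in> sets (Leb n)" "emeasure (Leb n) A < \<infinity>" and x: "x \<in> space (Leb n)"
shows "ennreal (\<Sum>i<n. drki n eps A i i x) = (nn_integral (Leb n) (%y. indicator A y * ennreal (real n * eps\<^sup>2 / wt n eps (dif n x y) ^ (n + 2))))"
proof -
have [measurable]: "A \<in> sets (Leb n)" "x \<in> space (Leb n)" by fact+
have "integrable (Leb n) (%y. \<Sum>i<n. indicator A y * drk n eps i i (dif n x y))" using assms by (intro integrable_setsum drki_integrable) auto
then have int: "integrable (Leb n) (%y. indicator A y * (real n * eps\<^sup>2 / wt n eps (dif n x y) ^ (n + 2)))" using assms(1) by (simp add: sum_distrib_left[symmetric] drk_trace)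
have "ennreal (\<Sum>i<n. drki n eps A i i x) = (nn_integral (Leb n) (%y. ennreal (indicator A y * (real n * eps\<^sup>2 / wt n eps (dif n x y) ^ (n + 2)))))" unfolding drki_trace_eq[OF assms] using assms(1) by (intro nn_integral_eq_integral[symmetric] int) (auto simp: less_imp_le)
also have "... = (nn_integral (Leb n) (%y. indicator A y * ennreal (real n * eps\<^sup>2 / wt n eps (dif n x y) ^ (n + 2))))" by (intro nn_integral_cong) (simp add: indicator_def)
finally show ?thesis .
qed

lemma drki_trace_nonneg:
assumes "eps > 0" "A \<in> sets (Leb n)" "emeasure (Leb n) A < \<infinity>" "x \<in> space (Leb n)"
shows "0 <= (\<Sum>i<n. drki n eps A i i x)" unfolding drki_trace_eq[OF assms] using assms(1) by (intro Bochner_Integration.integral_nonneg) (auto simp: less_imp_le)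

lemma drki_trace_le:
assumes n: "n >= 1" and "eps > 0" and A: "A \<in> sets (Leb n)" "emeasure (Leb n) A < \<infinity>" and x: "x \<in> space (Leb n)"
shows "(\<Sum>i<n. drki n eps A i i x) <= trace_const n"
proof -
have "ennreal (\<Sum>i<n. drki n eps A i i x) <= (nn_integral (Leb n) (%y. ennreal (real n * eps\<^sup>2 / wt n eps (dif n x y) ^ (n + 2))))" unfolding drki_trace_ennreal[OF assms(2-)] by (intro nn_integral_mono) (auto simp: indicator_def)
also have "... = (nn_integral (Leb n) (%y. ennreal (real n * eps\<^sup>2 / wt n eps y ^ (n + 2))))" by (rule nn_integral_dif_left[OF x]) measurable
also have "... <= ennreal (trace_const n)" by (rule trace_kernel_nn_integral[OF n assms(2)])
finally show ?thesis using trace_const_nonneg by (simp add: ennreal_le_iff)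
qed

lemma drki_trace_nn_integral:
assumes n: "n >= 1" and eps: "eps > 0" and A: "A \<in> sets (Leb n)" "emeasure (Leb n) A < \<infinity>"
shows "(nn_integral (Leb n) (%x. ennreal (\<Sum>i<n. drki n eps A i i x))) <= ennreal (trace_const n) * emeasure (Leb n) A"
proof -
have [measurable]: "A \<in> sets (Leb n)" by fact
have "(nn_integral (Leb n) (%x. ennreal (\<Sum>i<n. drki n eps A i i x)))
 = (nn_integral (Leb n) (%x. (nn_integral (Leb n) (%y. indicator A y * ennreal (real n * eps\<^sup>2 / wt n eps (dif n x y) ^ (n + 2))))))" by (intro nn_integral_cong drki_trace_ennreal[OF eps A])
also have "... = (nn_integral (Leb n) (%y. (nn_integral (Leb n) (%x. indicator A y * ennreal (real n * eps\<^sup>2 / wt n eps (dif n x y) ^ (n + 2))))))" by (rule Leb_pair.Fubini'[symmetric]) measurable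
also have "... <= (nn_integral (Leb n) (%y. ennreal (trace_const n) * indicator A y))"
proof (rule nn_integral_mono)
 fix y assume y: "y \<in> space (Leb n)"
 then have [measurable]: "y \<in> space (Leb n)" .
 have "(nn_integral (Leb n) (%x. indicator A y * ennreal (real n * eps\<^sup>2 / wt n eps (dif n x y) ^ (n + 2))))
  = indicator A y * (nn_integral (Leb n) (%x. ennreal (real n * eps\<^sup>2 / wt n eps (dif n x y) ^ (n + 2))))" by (rule nn_integral_cmult) measurable
 also have "(nn_integral (Leb n) (%x. ennreal (real n * eps\<^sup>2 / wt n eps (dif n x y) ^ (n + 2)))) = (nn_integral (Leb n) (%x. ennreal (real n * eps\<^sup>2 / wt n eps x ^ (n + 2))))" by (rule nn_integral_dif_right[OF y]) measurable
 also have "indicator A y * ... <= indicator A y * ennreal (trace_const n)" by (intro mult_left_mono trace_kernel_nn_integral n eps) auto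
 finally show "(nn_integral (Leb n) (%x. indicator A y * ennreal (real n * eps\<^sup>2 / wt n eps (dif n x y) ^ (n + 2)))) <= ennreal (trace_const n) * indicator A y" by (simp add: mult.commute)
qed
also have "... = ennreal (trace_const n) * emeasure (Leb n) A" by (rule nn_integral_cmult_indicator) fact
finally show ?thesis .
qed

text \<open>By \<open>kernel_ibp_swap\<close> the square norm of the whole matrix has the same
  integral as the square of its trace. The trace is a convolution with a positive kernel of bounded
  mass: it lies between 0 and \<open>trace_const n\<close>, and its integral is at most
  \<open>trace_const n\<close> times the measure of \<open>A\<close>.\<close>

lemma drki_L2_bound:
assumes n: "n >= 1" and eps: "eps > 0" and A: "A \<in> sets (Leb n)" "emeasure (Leb n) A < \<infinity>"
shows "integrable (Leb n) (%x. \<Sum>i<n. \<Sum>j<n. (drki n eps A i j x)^2)"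
 and "(LINT x|Leb n. (\<Sum>i<n. \<Sum>j<n. (drki n eps A i j x)^2)) <= (trace_const n)^2 * measure (Leb n) A"
proof -
have [measurable]: "A \<in> sets (Leb n)" by fact
let ?L = "Leb n" and ?T = "%x. \<Sum>i<n. drki n eps A i i x"
have int: "integrable ?L (%x. (drki n eps A i j x)^2)" if "i < n" "j < n" for i j using drki_product(1)[OF n eps A that that] by (simp add: power2_eq_square)
then show "integrable ?L (%x. \<Sum>i<n. \<Sum>j<n. (drki n eps A i j x)^2)" by (intro integrable_setsum) auto
have eq: "(LINT x|?L. (drki n eps A i j x)^2) = (LINT x|?L. drki n eps A i i x * drki n eps A j j x)" if ij: "i < n" "j < n" for i j unfolding power2_eq_square drki_product(2)[OF n eps A ij ij] drki_product(2)[OF n eps A ij(1) ij(1) ij(2) ij(2)]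
proof (rule lint_cong[OF refl])
 fix yz assume "yz \<in> space (?L \<Otimes>\<^sub>M ?L)"
 then have yz: "fst yz \<in> space ?L" "snd yz \<in> space ?L" by (auto simp: space_pair_measure)
 show "indicator (A \<times> A) yz * (LINT x|?L. drk n eps i j (dif n x (fst yz)) * drk n eps i j (dif n x (snd yz)))
  = indicator (A \<times> A) yz * (LINT x|?L. drk n eps i i (dif n x (fst yz)) * drk n eps j j (dif n x (snd yz)))" by (simp only: kernel_ibp_swap[OF n eps yz ij])
qed
have "(LINT x|?L. (\<Sum>i<n. \<Sum>j<n. (drki n eps A i j x)^2)) = (\<Sum>i<n. \<Sum>j<n. \<integral>x. (drki n eps A i j x)^2 \<partial>?L)" using int by (subst integral_setsum; (intro integrable_setsum)?; simp)
also have "... = (\<Sum>i<n. \<Sum>j<n. \<integral>x. drki n eps A i i x * drki n eps A j j x \<partial>?L)" by (intro sum.cong refl eq) auto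
also have "... = (LINT x|?L. (\<Sum>i<n. \<Sum>j<n. drki n eps A i i x * drki n eps A j j x))" using drki_product(1)[OF n eps A] by (subst integral_setsum; (intro integrable_setsum)?; simp)
also have "... = (LINT x|?L. (?T x)^2)" by (simp add: power2_eq_square sum_product)
finally have 1: "(LINT x|?L. (\<Sum>i<n. \<Sum>j<n. (drki n eps A i j x)^2)) = (LINT x|?L. (?T x)^2)" .
have m [measurable]: "?T \<in> borel_measurable ?L" by measurable
have "(nn_integral ?L (%x. ennreal ((?T x)^2))) <= (nn_integral ?L (%x. ennreal (trace_const n) * ennreal (?T x)))"
proof (rule nn_integral_mono)
 fix x assume x: "x \<in> space ?L"
 have "(?T x)^2 <= trace_const n * ?T x" unfolding power2_eq_square using drki_trace_le[OF n eps A x] drki_trace_nonneg[OF eps A x] by (rule mult_right_mono)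
 then show "ennreal ((?T x)^2) <= ennreal (trace_const n) * ennreal (?T x)" using drki_trace_nonneg[OF eps A x] trace_const_nonneg by (subst ennreal_mult[symmetric]) (auto intro: ennreal_leI)
qed
also have "... = ennreal (trace_const n) * (nn_integral ?L (%x. ennreal (?T x)))" by (rule nn_integral_cmult) measurable
also have "... <= ennreal (trace_const n) * (ennreal (trace_const n) * emeasure ?L A)" by (intro mult_left_mono drki_trace_nn_integral n eps A) auto
also have "emeasure ?L A = ennreal (measure ?L A)" using A by (simp add: emeasure_eq_ennreal_measure)
also have "ennreal (trace_const n) * (ennreal (trace_const n) * ennreal (measure ?L A)) = ennreal ((trace_const n)^2 * measure ?L A)" using trace_const_nonneg by (simp add: ennreal_mult[symmetric] power2_eq_square mult.assoc)
finally have 2: "(nn_integral ?L (%x. ennreal ((?T x)^2))) <= ennreal ((trace_const n)^2 * measure ?L A)" .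
have "(LINT x|?L. (?T x)^2) = enn2real (nn_integral ?L (%x. ennreal ((?T x)^2)))" by (rule integral_eq_nn_integral) auto
also have "... <= (trace_const n)^2 * measure ?L A" using enn2real_mono[OF 2] by simp
finally show "(LINT x|?L. (\<Sum>i<n. \<Sum>j<n. (drki n eps A i j x)^2)) <= (trace_const n)^2 * measure ?L A" unfolding 1 .
qed

section \<open>Oscillation, size and divergence of the field\<close>

lemma drk_mean_value:
assumes eps: "eps > 0" and ij: "i < n" "j < n"
obtains th where "0 < th" "th < 1" "drk n eps i j v - drk n eps i j u = (\<Sum>k<n. ddrk n eps i j k (%m. u m + th * (v m - u m)) * (v k - u k))"
proof -
have d: "((%t. drk n eps i j (%m. u m + t * (v m - u m))) has_real_derivative
  (\<Sum>k<n. ddrk n eps i j k (%m. u m + t * (v m - u m)) * (v k - u k))) (at t)" for t by (rule drk_path_deriv[OF eps _ ij]) (auto intro!: derivative_eq_intros)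
from MVT2[of 0 1, OF _ d] that show ?thesis by auto
qed

lemma rk_mean_value:
assumes eps: "eps > 0" and i: "i < n"
obtains th where "0 < th" "th < 1" "rk n eps i v - rk n eps i u = (\<Sum>k<n. drk n eps i k (%m. u m + th * (v m - u m)) * (v k - u k))"
proof -
have d: "((%t. rk n eps i (%m. u m + t * (v m - u m))) has_real_derivative
  (\<Sum>k<n. drk n eps i k (%m. u m + t * (v m - u m)) * (v k - u k))) (at t)" for t by (rule rk_path_deriv[OF eps _ i]) (auto intro!: derivative_eq_intros)
from MVT2[of 0 1, OF _ d] that show ?thesis by auto
qed

lemma abs_sum_mult_le:
assumes "!!k. k < n ==> \<bar>a k\<bar> <= (C::real)" "!!k. k < n ==> \<bar>b k\<bar> <= l"
shows "\<bar>\<Sum>k<n. a k * b k\<bar> <= real n * (C * l)"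
proof -
have "\<bar>\<Sum>k<n. a k * b k\<bar> <= (\<Sum>k<n. \<bar>a k * b k\<bar>)" by (rule sum_abs)
also have "... <= (\<Sum>k<n. C * l)"
proof (rule sum_mono)
 fix k assume "k \<in> {..<n}"
 then have "k < n" by simp
 with assms[of k] show "\<bar>a k * b k\<bar> <= C * l" unfolding abs_mult by (intro mult_mono) (auto intro: order_trans[OF abs_ge_zero])
qed
finally show ?thesis by simp
qed

lemma segment_wt_compare:
assumes eps: "eps > 0" and h: "!!k. k < n ==> \<bar>v k - u k\<bar> <= l" and th: "0 < th" "th < 1"
shows "1 / wt n eps (%m. u m + th * (v m - u m)) ^ m <= sqrt (2 + 2 * (real n * l^2) / eps\<^sup>2) ^ m / wt n eps u ^ m"
proof -
let ?w = "%m. u m + th * (v m - u m)"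
have "(\<Sum>i<n. (u i - ?w i)^2) <= (\<Sum>i<n. l^2)"
proof (rule sum_mono)
 fix i assume "i \<in> {..<n}"
 then have "\<bar>v i - u i\<bar> <= l" using h by simp
 moreover have "th * \<bar>v i - u i\<bar> <= 1 * \<bar>v i - u i\<bar>" using th by (intro mult_right_mono) auto
 ultimately have "\<bar>u i - ?w i\<bar> <= l" using th by (simp add: abs_mult)
 then show "(u i - ?w i)^2 <= l^2" using power_mono[of "\<bar>u i - ?w i\<bar>" l 2] by simp
qed
then have "(\<Sum>i<n. (u i - ?w i)^2) <= real n * l^2" by simp
then have le: "2 + 2 * (\<Sum>i<n. (u i - ?w i)^2) / eps\<^sup>2 <= 2 + 2 * (real n * l^2) / eps\<^sup>2" by (intro add_left_mono divide_right_mono mult_left_mono) auto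
have "1 / wt n eps ?w ^ m <= sqrt (2 + 2 * (\<Sum>i<n. (u i - ?w i)^2) / eps\<^sup>2) ^ m / wt n eps u ^ m" by (rule inverse_wt_compare[OF eps])
also have "... <= sqrt (2 + 2 * (real n * l^2) / eps\<^sup>2) ^ m / wt n eps u ^ m" using le eps by (intro divide_right_mono power_mono real_sqrt_le_mono)
  (auto simp: less_imp_le intro!: sum_nonneg divide_nonneg_nonneg add_nonneg_nonneg)
finally show ?thesis .
qed

lemma drk_difference_bound:
assumes eps: "eps > 0" and ij: "i < n" "j < n" and h: "!!k. k < n ==> \<bar>v k - u k\<bar> <= l"
 and c: "!!th. 0 < th ==> th < 1 ==> 1 / wt n eps (%m. u m + th * (v m - u m)) ^ (n + 1) <= c"
shows "\<bar>drk n eps i j v - drk n eps i j u\<bar> <= real n * (real n * (real n + 5) * c * l)"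
proof -
obtain th where th: "0 < th" "th < 1"
 and eq: "drk n eps i j v - drk n eps i j u = (\<Sum>k<n. ddrk n eps i j k (%m. u m + th * (v m - u m)) * (v k - u k))" using drk_mean_value[OF eps ij] by blast
have "\<bar>ddrk n eps i j k (%m. u m + th * (v m - u m))\<bar> <= real n * (real n + 5) * c" if "k < n" for k
proof -
 have "\<bar>ddrk n eps i j k (%m. u m + th * (v m - u m))\<bar>
  <= real n * (real n + 5) * (1 / wt n eps (%m. u m + th * (v m - u m)) ^ (n + 1))" using ddrk_bound[OF eps ij that, of "%m. u m + th * (v m - u m)"] by simp
 also have "... <= real n * (real n + 5) * c" by (rule mult_left_mono[OF c[OF th]]) simp
 finally show ?thesis .
qed
then show ?thesis unfolding eq using h by (intro abs_sum_mult_le) auto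
qed

lemma rk_difference_bound:
assumes eps: "eps > 0" and i: "i < n" and h: "!!k. k < n ==> \<bar>v k - u k\<bar> <= l"
 and c: "!!th. 0 < th ==> th < 1 ==> 1 / wt n eps (%m. u m + th * (v m - u m)) ^ n <= c"
shows "\<bar>rk n eps i v - rk n eps i u\<bar> <= real n * ((1 + real n) * c * l)"
proof -
obtain th where th: "0 < th" "th < 1"
 and eq: "rk n eps i v - rk n eps i u = (\<Sum>k<n. drk n eps i k (%m. u m + th * (v m - u m)) * (v k - u k))" using rk_mean_value[OF eps i] by blast
have "\<bar>drk n eps i k (%m. u m + th * (v m - u m))\<bar> <= (1 + real n) * c" if "k < n" for k
proof -
 have "\<bar>drk n eps i k (%m. u m + th * (v m - u m))\<bar>
  <= (1 + real n) * (1 / wt n eps (%m. u m + th * (v m - u m)) ^ n)" using drk_bound[OF eps i that, of "%m. u m + th * (v m - u m)"] by simp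
 also have "... <= (1 + real n) * c" by (rule mult_left_mono[OF c[OF th]]) simp
 finally show ?thesis .
qed
then show ?thesis unfolding eq using h by (intro abs_sum_mult_le) auto
qed

text \<open>The order |y|^(-n) of \<open>drk\<close> falls short of integrability at infinity, but
  the difference of two translates gains one power of decay. It is the derivative of a difference of
  two \<open>rk\<close>, which vanishes at infinity.\<close>

lemma drk_difference_integral:
assumes n: "n >= 1" and eps: "eps > 0" and x: "x \<in> space (Leb n)" and x': "x' \<in> space (Leb n)"
 and i: "i < n" and j: "j < n"
shows "integrable (Leb n) (%y. drk n eps i j (dif n y x') - drk n eps i j (dif n y x))"
 and "(LINT y|Leb n. drk n eps i j (dif n y x') - drk n eps i j (dif n y x)) = 0"
proof -
have [measurable]: "x \<in> space (Leb n)" "x' \<in> space (Leb n)"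
 "drk n eps i j \<in> borel_measurable (Leb n)" using x x' i j by auto
define l where "l = (\<Sum>k<n. \<bar>x k - x' k\<bar>)"
have h: "\<bar>dif n y x' k - dif n y x k\<bar> <= l" if "k < n" for k y
proof -
 have "\<bar>x k - x' k\<bar> <= l" unfolding l_def using that by (intro member_le_sum) auto
 then show ?thesis using that by simp
qed
define c where "c = sqrt (2 + 2 * (real n * l^2) / eps\<^sup>2)"
have cmp: "1 / wt n eps (%m. dif n y x m + th * (dif n y x' m - dif n y x m)) ^ m <= c ^ m / wt n eps (dif n y x) ^ m"
 if "0 < th" "th < 1" for y th m unfolding c_def by (rule segment_wt_compare[OF eps h that])
show int: "integrable (Leb n) (%y. drk n eps i j (dif n y x') - drk n eps i j (dif n y x))"
proof (rule integrable_wt_bound[OF n eps _ x, of "n + 1"])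
 fix y
 have "\<bar>drk n eps i j (dif n y x') - drk n eps i j (dif n y x)\<bar>
  <= real n * (real n * (real n + 5) * (c ^ (n + 1) / wt n eps (dif n y x) ^ (n + 1)) * l)" by (rule drk_difference_bound[where u = "dif n y x" and v = "dif n y x'", OF eps i j h cmp])
 then show "\<bar>drk n eps i j (dif n y x') - drk n eps i j (dif n y x)\<bar>
  <= (real n * (real n * (real n + 5) * c ^ (n + 1) * l)) / wt n eps (dif n y x) ^ (n + 1)" by simp
qed auto
show "(LINT y|Leb n. drk n eps i j (dif n y x') - drk n eps i j (dif n y x)) = 0"
proof (rule integral_derivative_zero[OF j int, of "%y. rk n eps i (dif n y x') - rk n eps i (dif n y x)"])
 fix y t
 show "((%t. rk n eps i (dif n (y(j := t)) x') - rk n eps i (dif n (y(j := t)) x)) has_real_derivative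
  drk n eps i j (dif n (y(j := t)) x') - drk n eps i j (dif n (y(j := t)) x)) (at t)" by (intro DERIV_diff rk_coord_deriv eps i j)
 show "continuous_on UNIV (%t. drk n eps i j (dif n (y(j := t)) x') - drk n eps i j (dif n (y(j := t)) x))" by (intro continuous_on_diff DERIV_continuous_on[OF drk_coord_deriv[OF eps i j j]])
next
 fix y
 have bd: "\<bar>rk n eps i (dif n (y(j := t)) x') - rk n eps i (dif n (y(j := t)) x)\<bar>
  <= (real n * ((1 + real n) * c ^ n * l) / eps ^ (n - 1)) / wt n eps (dif n (y(j := t)) x)" for t
 proof -
  let ?u = "dif n (y(j := t)) x"
  have c0: "c >= 0" "l >= 0" unfolding c_def l_def by (auto intro!: real_sqrt_ge_zero add_nonneg_nonneg divide_nonneg_nonneg sum_nonneg)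
  have "\<bar>rk n eps i (dif n (y(j := t)) x') - rk n eps i ?u\<bar> <= real n * ((1 + real n) * (c ^ n / wt n eps ?u ^ n) * l)" by (rule rk_difference_bound[where u = ?u and v = "dif n (y(j := t)) x'", OF eps i h cmp])
  also have "... = (real n * ((1 + real n) * c ^ n * l) * (1 / wt n eps ?u ^ (n - 1))) / wt n eps ?u" using n by (cases n) auto
  also have "... <= (real n * ((1 + real n) * c ^ n * l) * (1 / eps ^ (n - 1))) / wt n eps ?u" using eps c0 by (intro divide_right_mono mult_left_mono inverse_wt_mono) (auto simp: less_imp_le)
  finally show ?thesis by simp
 qed
 show "((%t. rk n eps i (dif n (y(j := t)) x') - rk n eps i (dif n (y(j := t)) x)) \<longlongrightarrow> 0) at_top"
  "((%t. rk n eps i (dif n (y(j := t)) x') - rk n eps i (dif n (y(j := t)) x)) \<longlongrightarrow> 0) at_bot" using wt_coord_line_tendsto[OF eps j bd] by auto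
qed
qed

definition osc_const :: "nat => real" where
"osc_const n = real n * (real n * (real n + 5) * (2 * real n + 2) ^ (n + 1)) * tail_const n (n + 1)"

text \<open>As the difference kernel has total integral 0, the oscillation is minus its integral
  over the complement of \<open>A\<close>. There y is more than 2 l away from x in some coordinate,
  the mean value theorem bounds the kernel by a constant times l / wt n l ^ (n + 1), and the tail
  integral contributes 1 / l. Hence the bound depends neither on l nor on
  \<open>eps\<close>.\<close>

lemma drki_oscillation:
assumes n: "n >= 1" and eps: "eps > 0" and l: "l > 0"
 and x: "x \<in> space (Leb n)" and x': "x' \<in> space (Leb n)"
 and near: "!!k. k < n ==> \<bar>x k - x' k\<bar> <= l"
 and A: "A \<in> sets (Leb n)" "emeasure (Leb n) A < \<infinity>"
 and nbhd: "!!y. y \<in> space (Leb n) ==> (!!k. k < n ==> \<bar>y k - x k\<bar> <= 2 * l) ==> y \<in> A"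
 and i: "i < n" and j: "j < n"
shows "\<bar>drki n eps A i j x' - drki n eps A i j x\<bar> <= osc_const n"
proof -
let ?L = "Leb n"
have [measurable]: "x \<in> space ?L" "x' \<in> space ?L" "A \<in> sets ?L" "drk n eps i j \<in> borel_measurable ?L" using x x' A i j by auto
let ?q = "2 * real n + 2"
let ?d = "%y. drk n eps i j (dif n y x') - drk n eps i j (dif n y x)"
let ?C = "real n * (real n * (real n + 5) * ?q ^ (n + 1)) * l"
have bound: "\<bar>?d y\<bar> <= ?C * (1 / wt n l (dif n y x) ^ (n + 1))" if y: "y \<in> space ?L" "y \<notin> A" for y
proof -
 from nbhd[OF y(1)] y(2) obtain m where m: "m < n" "\<bar>y m - x m\<bar> > 2 * l" by force
 let ?u = "dif n y x" and ?v = "dif n y x'"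
 have h: "\<bar>?v k - ?u k\<bar> <= l" if "k < n" for k using near[OF that] that by simp
 \<comment> \<open>The weight at scale \<open>eps\<close> on the segment is compared with the weight
   at scale l at its endpoint. Coordinate m of the intermediate point stays above l, so its norm
   dominates l and therefore, up to the factor \<open>?q\<close>, the endpoint.\<close>
 have "1 / wt n eps (%m. ?u m + th * (?v m - ?u m)) ^ (n + 1) <= ?q ^ (n + 1) / wt n l ?u ^ (n + 1)"
  if th: "0 < th" "th < 1" for th
 proof -
  let ?w = "%m. ?u m + th * (?v m - ?u m)"
  have hw: "\<bar>?u k - ?w k\<bar> <= l" if "k < n" for k
  proof -
   have "th * \<bar>?v k - ?u k\<bar> <= 1 * \<bar>?v k - ?u k\<bar>" using th by (intro mult_right_mono) auto
   then show ?thesis using h[OF that] th by (simp add: abs_mult)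
  qed
  have "l <= \<bar>?w m\<bar>" using hw[OF m(1)] m by simp
  then have "l^2 <= (?w m)^2" using l power_mono[of l "\<bar>?w m\<bar>" 2] by simp
  also have "... <= (\<Sum>k<n. (?w k)^2)" using m(1) by (intro member_le_sum) auto
  finally have lw: "l^2 <= (\<Sum>k<n. (?w k)^2)" .
  have "(\<Sum>k<n. (?u k)^2) <= (\<Sum>k<n. 2 * (?w k)^2 + 2 * l^2)"
  proof (rule sum_mono)
   fix k assume "k \<in> {..<n}"
   then have "(?u k - ?w k)^2 <= l^2" using hw[of k] power_mono[of "\<bar>?u k - ?w k\<bar>" l 2] by simp
   moreover have "2 * (?w k)^2 + 2 * (?u k - ?w k)^2 - (?u k)\<^sup>2 = (2 * ?w k - ?u k)^2" by (simp add: power2_eq_square algebra_simps)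
   ultimately show "(?u k)^2 <= 2 * (?w k)^2 + 2 * l^2" using zero_le_power2[of "2 * ?w k - ?u k"] by linarith
  qed
  also have "... = 2 * (\<Sum>k<n. (?w k)^2) + 2 * real n * l^2" by (simp add: sum.distrib sum_distrib_left)
  finally have "(wt n l ?u)^2 <= 2 * (\<Sum>k<n. (?w k)^2) + (2 * real n + 1) * l^2" by (simp add: wt_sq algebra_simps)
  also have "... <= 2 * (\<Sum>k<n. (?w k)^2) + (2 * real n + 1) * (\<Sum>k<n. (?w k)^2)" by (intro add_left_mono mult_left_mono lw) auto
  also have "... = (2 * real n + 3) * (\<Sum>k<n. (?w k)^2)" by (simp add: algebra_simps)
  also have "... <= ?q^2 * (wt n eps ?w)^2"
  proof (rule mult_mono)
   show "2 * real n + 3 <= ?q^2" by (simp add: power2_eq_square algebra_simps)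
   show "(\<Sum>k<n. (?w k)^2) <= (wt n eps ?w)^2" by (simp add: wt_sq)
  qed (auto intro: sum_nonneg)
  finally have "(wt n l ?u)^2 <= (?q * wt n eps ?w)^2" by (simp add: power_mult_distrib)
  then have "wt n l ?u <= ?q * wt n eps ?w" by (rule power2_le_imp_le) (use eps in \<open>simp add: less_imp_le\<close>)
  then have "wt n l ?u ^ (n + 1) <= (?q * wt n eps ?w) ^ (n + 1)" by (rule power_mono) (use l in \<open>simp add: less_imp_le\<close>)
  then have *: "wt n l ?u ^ (n + 1) <= ?q ^ (n + 1) * wt n eps ?w ^ (n + 1)" by (simp only: power_mult_distrib)
  have pos: "wt n l ?u ^ (n + 1) > 0" "wt n eps ?w ^ (n + 1) > 0" using l eps by (auto intro!: zero_less_power)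
  have alg: "1 / b <= q / a" if "a <= q * b" "a > 0" "b > 0" for a b q :: real using that by (simp add: field_simps)
  show ?thesis by (rule alg[OF * pos])
 qed
 from drk_difference_bound[where u = ?u and v = ?v, OF eps i j h this]
 have "\<bar>?d y\<bar> <= real n * (real n * (real n + 5) * (?q ^ (n + 1) / wt n l ?u ^ (n + 1)) * l)" .
 then show ?thesis by simp
qed
have int: "integrable ?L ?d" and zero: "(LINT y|?L. ?d y) = 0" by (rule drk_difference_integral[OF n eps x x' i j])+
have drki_eq: "drki n eps A i j z = (LINT y|?L. indicator A y * drk n eps i j (dif n y z))" for z unfolding drki_def by (simp only: drk_dif_commute[OF i j, of eps z])
have int1: "integrable ?L (%y. indicator A y * drk n eps i j (dif n y z))" if "z \<in> space ?L" for z using drki_integrable[OF eps i j A that] by (simp only: drk_dif_commute[OF i j, of eps z])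
have "drki n eps A i j x' - drki n eps A i j x
  = (LINT y|?L. indicator A y * drk n eps i j (dif n y x') - indicator A y * drk n eps i j (dif n y x))" unfolding drki_eq by (rule lint_diff[symmetric]) (intro int1 x x')+
\<comment> \<open>Only the complement of \<open>A\<close> remains after cancellation; the region
  near x, where the kernel can be as large as eps^(-n), lies inside \<open>A\<close>.\<close>
also have "... = (LINT y|?L. ?d y - indicator (- A) y * ?d y)" by (intro lint_cong refl) (auto simp: indicator_def)
also have "... = (LINT y|?L. ?d y) - (LINT y|?L. indicator (- A) y * ?d y)"
proof (rule lint_diff[OF int])
 have "integrable ?L (%y. indicator (space ?L - A) y *\<^sub>R ?d y)" by (rule integrable_mult_indicator[OF _ int]) measurable
 then show "integrable ?L (%y. indicator (- A) y * ?d y)" by (rule Bochner_Integration.integrable_cong[THEN iffD1, rotated 2]) (auto simp: indicator_def)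
qed
finally have eq: "drki n eps A i j x' - drki n eps A i j x = - (LINT y|?L. indicator (- A) y * ?d y)" using zero by simp
have C0: "?C >= 0" using l by simp
have "(nn_integral ?L (%y. ennreal \<bar>indicator (- A) y * ?d y\<bar>)) <= (nn_integral ?L (%y. ennreal ?C * ennreal (1 / wt n l (dif n y x) ^ (n + 1))))"
proof (rule nn_integral_mono)
 fix y assume y: "y \<in> space ?L"
 have "\<bar>indicator (- A) y * ?d y\<bar> <= ?C * (1 / wt n l (dif n y x) ^ (n + 1))"
 proof (cases "y \<in> A")
  case True
  have "0 <= ?C * (1 / wt n l (dif n y x) ^ (n + 1))" using l wt_pos[OF l, of n "dif n y x"] by (intro mult_nonneg_nonneg C0) (simp add: less_imp_le)
  then show ?thesis using True by simp
 qed (use bound[OF y] in simp)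
 then have "ennreal \<bar>indicator (- A) y * ?d y\<bar> <= ennreal (?C * (1 / wt n l (dif n y x) ^ (n + 1)))" by (rule ennreal_leI)
 also have "... = ennreal ?C * ennreal (1 / wt n l (dif n y x) ^ (n + 1))" by (rule ennreal_mult) (use C0 l wt_pos[OF l, of n "dif n y x"] in \<open>simp_all add: less_imp_le\<close>)
 finally show "ennreal \<bar>indicator (- A) y * ?d y\<bar> <= ..." .
qed
also have "... = ennreal ?C * (nn_integral ?L (%y. ennreal (1 / wt n l (dif n y x) ^ (n + 1))))" by (rule nn_integral_cmult) measurable
also have "(nn_integral ?L (%y. ennreal (1 / wt n l (dif n y x) ^ (n + 1)))) = (nn_integral ?L (%y. ennreal (1 / wt n l y ^ (n + 1))))" by (rule nn_integral_dif_right[OF x]) measurable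
also have "ennreal ?C * ... <= ennreal ?C * ennreal (tail_const n (n + 1) / l ^ (n + 1 - n))" by (intro mult_left_mono nn_integral_wt_tail n l) auto
also have "... = ennreal (?C * (tail_const n (n + 1) / l))" using C0 l by (subst ennreal_mult) (auto simp: tail_const_nonneg)
also have "?C * (tail_const n (n + 1) / l) = osc_const n" using l by (simp add: osc_const_def)
finally have le: "(nn_integral ?L (%y. ennreal \<bar>indicator (- A) y * ?d y\<bar>)) <= ennreal (osc_const n)" .
have "\<bar>\<integral>y. indicator (- A) y * ?d y \<partial>?L\<bar> <= (LINT y|?L. \<bar>indicator (- A) y * ?d y\<bar>)" by (rule integral_abs_bound)
also have "... = enn2real (nn_integral ?L (%y. ennreal \<bar>indicator (- A) y * ?d y\<bar>))" by (rule integral_eq_nn_integral) (auto intro!: borel_measurable_times borel_measurable_indicator')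
also have "... <= osc_const n" using enn2real_mono[OF le] by (simp add: osc_const_def tail_const_nonneg)
finally show ?thesis unfolding eq by simp
qed

text \<open>A crude bound that depends on \<open>eps\<close>, meant for the cells of the last
  generation, whose side is chosen after \<open>eps\<close>.\<close>

lemma drki_lipschitz:
assumes n: "n >= 1" and eps: "eps > 0" and x: "x \<in> space (Leb n)" and x': "x' \<in> space (Leb n)"
 and near: "!!k. k < n ==> \<bar>x k - x' k\<bar> <= l"
 and A: "A \<in> sets (Leb n)" "emeasure (Leb n) A < \<infinity>"
 and i: "i < n" and j: "j < n"
shows "\<bar>drki n eps A i j x' - drki n eps A i j x\<bar> <= real n * (real n * (real n + 5) / eps ^ (n + 1) * l) * measure (Leb n) A"
proof -
let ?L = "Leb n"
have [measurable]: "x \<in> space ?L" "x' \<in> space ?L" "A \<in> sets ?L" "drk n eps i j \<in> borel_measurable ?L" using x x' A i j by auto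
have "drki n eps A i j x' - drki n eps A i j x
  = (LINT y|?L. indicator A y * drk n eps i j (dif n x' y) - indicator A y * drk n eps i j (dif n x y))" unfolding drki_def by (rule lint_diff[symmetric]) (intro drki_integrable eps i j A x x')+
also have "... = (LINT y|?L. indicator A y * (drk n eps i j (dif n x' y) - drk n eps i j (dif n x y)))" by (simp only: right_diff_distrib)
also have "\<bar>...\<bar> <= real n * (real n * (real n + 5) / eps ^ (n + 1) * l) * measure ?L A"
proof (rule abs_indicator_integral_le[OF A])
 fix y
 have "\<bar>drk n eps i j (dif n x' y) - drk n eps i j (dif n x y)\<bar> <= real n * (real n * (real n + 5) * (1 / eps ^ (n + 1)) * l)"
 proof (rule drk_difference_bound[OF eps i j])
  show "\<bar>dif n x' y k - dif n x y k\<bar> <= l" if "k < n" for k using near[OF that] that by simp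
 qed (rule inverse_wt_mono[OF eps])
 then show "\<bar>drk n eps i j (dif n x' y) - drk n eps i j (dif n x y)\<bar> <= real n * (real n * (real n + 5) / eps ^ (n + 1) * l)" by simp
qed measurable
finally show ?thesis .
qed

text \<open>The convolution is split at distance r: the near part is of order r + eps by local
  integrability, the far part is at most the measure of \<open>A\<close> over r ^ (n - 1). So the
  field is uniformly small once r and \<open>eps\<close> are small and \<open>A\<close> is small
  compared with r ^ (n - 1).\<close>

lemma rki_bound:
assumes n: "n >= 1" and eps: "eps > 0" and r: "r > 0" and x: "x \<in> space (Leb n)"
 and A: "A \<in> sets (Leb n)" "emeasure (Leb n) A < \<infinity>" and i: "i < n"
shows "\<bar>rki n eps A i x\<bar> <= 2 ^ (n - 1) * (2 * real n) ^ n * (r + eps) + measure (Leb n) A / r ^ (n - 1)"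
proof -
let ?L = "Leb n" and ?B = "{z \<in> space (Leb n). ALL i<n. \<bar>z i\<bar> < r}"
have [measurable]: "x \<in> space ?L" "A \<in> sets ?L" "rk n eps i \<in> borel_measurable ?L" using x A i by auto
define g where "g = (%z. ennreal (1 / wt n eps z ^ (n - 1)) * indicator ?B z)"
have Bm: "?B \<in> sets ?L" by measurable
have [measurable]: "g \<in> borel_measurable ?L" unfolding g_def by (intro borel_measurable_times_ennreal borel_measurable_indicator Bm) measurable
have "(nn_integral ?L (%y. ennreal \<bar>indicator A y * rk n eps i (dif n x y)\<bar>))
 <= (nn_integral ?L (%y. g (dif n x y) + ennreal (1 / r ^ (n - 1)) * indicator A y))"
proof (rule nn_integral_mono)
 fix y assume y: "y \<in> space ?L"
 let ?z = "dif n x y"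
 have le: "\<bar>indicator A y * rk n eps i ?z\<bar> <= 1 / wt n eps ?z ^ (n - 1) * indicator A y" using rk_bound[OF eps i, of ?z] by (auto simp: indicator_def)
 show "ennreal \<bar>indicator A y * rk n eps i ?z\<bar>
  <= g ?z + ennreal (1 / r ^ (n - 1)) * indicator A y"
 proof (cases "?z \<in> ?B \<or> y \<notin> A")
  case True
  then show ?thesis
  proof
   assume "?z \<in> ?B"
   have "ennreal \<bar>indicator A y * rk n eps i ?z\<bar> <= ennreal (1 / wt n eps ?z ^ (n - 1))" using rk_bound[OF eps i, of ?z] eps by (intro ennreal_leI) (auto simp: indicator_def less_imp_le)
   also have "... = g ?z" using \<open>?z \<in> ?B\<close> by (simp add: g_def)
   finally show ?thesis by (rule order_trans) simp
  qed simp
 next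
  case False
  moreover have "?z \<in> space ?L" by (simp add: dif_def space_Leb)
  ultimately obtain k where k: "k < n" "r <= \<bar>?z k\<bar>" unfolding mem_Collect_eq not_less[symmetric] by blast
  then have "r <= wt n eps ?z" using wt_coord[OF k(1), of ?z eps] by linarith
  then have "1 / wt n eps ?z ^ (n - 1) <= 1 / r ^ (n - 1)" using r by (intro divide_left_mono power_mono mult_pos_pos zero_less_power wt_pos eps) auto
  then have "ennreal \<bar>indicator A y * rk n eps i ?z\<bar> <= ennreal (1 / r ^ (n - 1))" using le False by (intro ennreal_leI) auto
  also have "... <= g ?z + ennreal (1 / r ^ (n - 1)) * indicator A y" using False by simp
  finally show ?thesis .
 qed
qed
also have "... = (nn_integral ?L (%y. g (dif n x y))) + (nn_integral ?L (%y. ennreal (1 / r ^ (n - 1)) * indicator A y))" by (rule nn_integral_add) measurable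
also have "... <= ennreal (2 ^ (n - 1) * (2 * real n) ^ n * (r + eps)) + ennreal (1 / r ^ (n - 1) * measure ?L A)"
proof (rule add_mono)
 have "(nn_integral ?L (%y. g (dif n x y)))
   = (nn_integral ?L (%y. g y))" by (rule nn_integral_dif_left[OF x]) measurable
 also have "... = (nn_integral ?L (%y. ennreal (1 / wt n eps y ^ (n - 1)) * indicator {z. ALL i<n. \<bar>z i\<bar> < r} y))" unfolding g_def by (intro nn_integral_cong) (simp add: indicator_def)
 also have "... <= ennreal (2 ^ (n - 1) * (2 * real n) ^ n * (r + eps))" by (rule nn_integral_wt_local[OF n eps r])
 finally show "(nn_integral ?L (%y. g (dif n x y))) <= ..." .
 have "(nn_integral ?L (%y. ennreal (1 / r ^ (n - 1)) * indicator A y)) = ennreal (1 / r ^ (n - 1)) * emeasure ?L A" by (rule nn_integral_cmult_indicator) fact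
 also have "... = ennreal (1 / r ^ (n - 1)) * ennreal (measure ?L A)" using A by (simp add: emeasure_eq_ennreal_measure)
 also have "... = ennreal (1 / r ^ (n - 1) * measure ?L A)" using r by (intro ennreal_mult[symmetric]) auto
 finally show "(nn_integral ?L (%y. ennreal (1 / r ^ (n - 1)) * indicator A y)) <= ennreal (1 / r ^ (n - 1) * measure ?L A)" by simp
qed
also have "... = ennreal (2 ^ (n - 1) * (2 * real n) ^ n * (r + eps) + measure ?L A / r ^ (n - 1))" using r eps by (subst ennreal_plus[symmetric]) auto
finally have le: "(nn_integral ?L (%y. ennreal \<bar>indicator A y * rk n eps i (dif n x y)\<bar>))
  <= ennreal (2 ^ (n - 1) * (2 * real n) ^ n * (r + eps) + measure ?L A / r ^ (n - 1))" .
have "\<bar>rki n eps A i x\<bar> <= (LINT y|?L. \<bar>indicator A y * rk n eps i (dif n x y)\<bar>)" unfolding rki_def by (rule integral_abs_bound)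
also have "... = enn2real (nn_integral ?L (%y. ennreal \<bar>indicator A y * rk n eps i (dif n x y)\<bar>))" by (rule integral_eq_nn_integral) auto
also have "... <= 2 ^ (n - 1) * (2 * real n) ^ n * (r + eps) + measure ?L A / r ^ (n - 1)"
proof -
 have "0 <= 2 ^ (n - 1) * (2 * real n) ^ n * (r + eps) + measure ?L A / r ^ (n - 1)" using r eps by (intro add_nonneg_nonneg mult_nonneg_nonneg divide_nonneg_nonneg) auto
 then show ?thesis using enn2real_mono[OF le ennreal_less_top] by (simp only: enn2real_ennreal)
qed
finally show ?thesis .
qed

text \<open>The lower bound n eps^2 / ((n + 1) eps)^(n + 2) for the trace kernel on the cube of half
  side \<open>eps\<close>, times the volume (2 eps)^n; all powers of \<open>eps\<close>
  cancel.\<close>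

definition cube_const :: "nat => real" where
"cube_const n = real n * 2 ^ n / (real n + 1) ^ (n + 2)"

lemma drki_trace_lower:
assumes n: "n >= 1" and eps: "eps > 0" and x: "x \<in> space (Leb n)"
 and A: "A \<in> sets (Leb n)" "emeasure (Leb n) A < \<infinity>"
 and cube: "!!y. y \<in> space (Leb n) ==> (!!k. k < n ==> \<bar>y k - x k\<bar> < eps) ==> y \<in> A"
shows "cube_const n <= (\<Sum>i<n. drki n eps A i i x)"
proof -
let ?L = "Leb n" and ?Q = "PiE {..<n} (%k. {x k - eps <..< x k + eps})"
have Q: "?Q \<in> sets ?L" by (rule sets_PiM_I_finite) auto
have eQ: "emeasure ?L ?Q = ennreal ((2 * eps) ^ n)" using eps by (subst lebesgue_prod.emeasure_PiM) (auto simp: prod_ennreal ennreal_power)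
have "ennreal (cube_const n) = ennreal (real n * eps\<^sup>2 / ((real n + 1) * eps) ^ (n + 2) * (2 * eps) ^ n)" using eps by (simp add: cube_const_def power_mult_distrib power_add power2_eq_square)
also have "... = ennreal (real n * eps\<^sup>2 / ((real n + 1) * eps) ^ (n + 2)) * emeasure ?L ?Q" unfolding eQ using eps by (intro ennreal_mult) auto
also have "... = (nn_integral ?L (%y. ennreal (real n * eps\<^sup>2 / ((real n + 1) * eps) ^ (n + 2)) * indicator ?Q y))" by (rule nn_integral_cmult_indicator[OF Q, symmetric])
also have "... <= (nn_integral ?L (%y. indicator A y * ennreal (real n * eps\<^sup>2 / wt n eps (dif n x y) ^ (n + 2))))"
proof (rule nn_integral_mono)
 fix y assume y: "y \<in> space ?L"
 show "ennreal (real n * eps\<^sup>2 / ((real n + 1) * eps) ^ (n + 2)) * indicator ?Q y <= indicator A y * ennreal (real n * eps\<^sup>2 / wt n eps (dif n x y) ^ (n + 2))"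
 proof (cases "y \<in> ?Q")
  case True
  then have near: "\<bar>y k - x k\<bar> < eps" if "k < n" for k using that by (force simp: PiE_iff abs_less_iff)
  then have "y \<in> A" using cube[OF y] by simp
  have "(wt n eps (dif n x y))^2 <= eps\<^sup>2 + (\<Sum>k<n. eps\<^sup>2)" unfolding wt_sq
  proof (intro add_left_mono sum_mono)
   fix k assume "k \<in> {..<n}"
   then show "(dif n x y k)^2 <= eps\<^sup>2" using near[of k] power_mono[of "\<bar>dif n x y k\<bar>" eps 2] by (simp add: abs_minus_commute)
  qed
  also have "... = (real n + 1) * eps\<^sup>2" by (simp add: algebra_simps)
  also have "... <= ((real n + 1) * eps)^2" by (simp add: power_mult_distrib power2_eq_square[of "real n + 1"] mult_right_mono)
  finally have "wt n eps (dif n x y) <= (real n + 1) * eps" by (rule power2_le_imp_le) (use eps in simp)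
  then have "real n * eps\<^sup>2 / ((real n + 1) * eps) ^ (n + 2) <= real n * eps\<^sup>2 / wt n eps (dif n x y) ^ (n + 2)" using eps by (intro divide_left_mono power_mono mult_pos_pos zero_less_power wt_pos) (auto simp: less_imp_le)
  then show ?thesis using True \<open>y \<in> A\<close> by (simp add: ennreal_leI)
 qed simp
qed
also have "... = ennreal (\<Sum>i<n. drki n eps A i i x)" by (rule drki_trace_ennreal[OF eps A x, symmetric])
finally show ?thesis using drki_trace_nonneg[OF eps A x] by (simp add: ennreal_le_iff)
qed

section \<open>Dyadic cells and Calderon-Zygmund stopping\<close>

definition same_cell :: "nat => nat => (nat => real) => (nat => real) => bool" where
"same_cell n j x y \<longleftrightarrow> (ALL i<n. \<lfloor>2 ^ j * x i\<rfloor> = \<lfloor>2 ^ j * y i\<rfloor>)"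

definition dcell :: "nat => nat => (nat => real) => (nat => real) set" where
"dcell n j x = {y \<in> space (Leb n). same_cell n j x y}"

lemma same_cell_refl [simp]: "same_cell n j x x"
and same_cell_sym: "same_cell n j x y \<longleftrightarrow> same_cell n j y x"
and same_cell_trans: "same_cell n j x y ==> same_cell n j y z ==> same_cell n j x z" by (auto simp: same_cell_def)

lemma floor_double: "\<lfloor>a :: real\<rfloor> = \<lfloor>2 * a\<rfloor> div 2"
proof -
have "of_int \<lfloor>a\<rfloor> <= a" "a < of_int \<lfloor>a\<rfloor> + 1" by linarith+
then have "\<lfloor>2 * a\<rfloor> = 2 * \<lfloor>a\<rfloor> \<or> \<lfloor>2 * a\<rfloor> = 2 * \<lfloor>a\<rfloor> + 1" by linarith
then show ?thesis by auto
qed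

lemma same_cell_mono:
assumes "same_cell n j x y" "j' <= j"
shows "same_cell n j' x y" using assms(2,1)
proof (induction rule: dec_induct)
case (step k)
have "same_cell n k x y" if "same_cell n (Suc k) x y" unfolding same_cell_def
proof (intro allI impI)
 fix i assume "i < n"
 then have "\<lfloor>2 * (2 ^ k * x i)\<rfloor> = \<lfloor>2 * (2 ^ k * y i)\<rfloor>" using that by (simp add: same_cell_def mult.assoc)
 then show "\<lfloor>2 ^ k * x i\<rfloor> = \<lfloor>2 ^ k * y i\<rfloor>" using floor_double[of "2 ^ k * x i"] floor_double[of "2 ^ k * y i"] by simp
qed
then show ?case using step by blast
qed

lemma same_cell_near:
assumes "same_cell n j x y" "i < n"
shows "\<bar>x i - y i\<bar> <= 1 / 2 ^ j"
proof -
have "\<lfloor>2 ^ j * x i\<rfloor> = \<lfloor>2 ^ j * y i\<rfloor>" using assms by (simp add: same_cell_def)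
then have "\<bar>2 ^ j * x i - 2 ^ j * y i\<bar> <= 1" by linarith
then have "2 ^ j * \<bar>x i - y i\<bar> <= 1" by (simp add: abs_mult flip: right_diff_distrib)
then show ?thesis by (simp add: field_simps)
qed

lemma dcell_eq: "same_cell n j x y ==> dcell n j x = dcell n j y" unfolding dcell_def using same_cell_trans same_cell_sym by blast

lemma dcell_sets: "dcell n j x \<in> sets (Leb n)" unfolding dcell_def same_cell_def by measurable

lemma emeasure_dcell: "emeasure (Leb n) (dcell n j x) = ennreal ((1 / 2 ^ j) ^ n)"
proof -
have "dcell n j x = PiE {..<n} (%i. {real_of_int \<lfloor>2 ^ j * x i\<rfloor> / 2 ^ j ..< (real_of_int \<lfloor>2 ^ j * x i\<rfloor> + 1) / 2 ^ j})"
proof -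
 have "\<lfloor>2 ^ j * a\<rfloor> = \<lfloor>2 ^ j * b\<rfloor> \<longleftrightarrow> b \<in> {real_of_int \<lfloor>2 ^ j * a\<rfloor> / 2 ^ j ..< (real_of_int \<lfloor>2 ^ j * a\<rfloor> + 1) / 2 ^ j}" for a b :: real
 proof -
  have "\<lfloor>2 ^ j * a\<rfloor> = \<lfloor>2 ^ j * b\<rfloor> \<longleftrightarrow> real_of_int \<lfloor>2 ^ j * a\<rfloor> <= 2 ^ j * b \<and> 2 ^ j * b < real_of_int \<lfloor>2 ^ j * a\<rfloor> + 1" by linarith
  then show ?thesis by (simp add: pos_divide_le_eq pos_less_divide_eq mult.commute)
 qed
 then show ?thesis unfolding dcell_def same_cell_def space_Leb by (auto simp: PiE_iff extensional_def)
qed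
then have "emeasure (Leb n) (dcell n j x) = (\<Prod>i<n. emeasure lborel {real_of_int \<lfloor>2 ^ j * x i\<rfloor> / 2 ^ j ..< (real_of_int \<lfloor>2 ^ j * x i\<rfloor> + 1) / 2 ^ j})" by (simp add: lebesgue_prod.emeasure_PiM)
also have "... = (\<Prod>i<n. ennreal (1 / 2 ^ j))" by (intro prod.cong refl) (simp add: divide_right_mono diff_divide_distrib[symmetric])
finally show ?thesis by (simp add: ennreal_power)
qed

lemma same_cell_kernel:
"(%p. if same_cell n j (fst p) (snd p) then 1 else 0 :: ennreal) \<in> borel_measurable (Leb n \<Otimes>\<^sub>M Leb n)" unfolding same_cell_def by measurable

text \<open>Stopping cubes at height \<open>lam\<close> for a finite measure that may be singular to
  Lebesgue measure. Only generations up to \<open>m\<close> are inspected, so every point has a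
  stopping cell; \<open>lam_ge\<close> keeps the unit cells from being heavy.\<close>

locale stopping =
fixes n :: nat and eta :: "(nat => real) measure" and lam :: real and m :: nat
assumes n1: "n >= 1" and sets_eta: "sets eta = sets (Leb n)" and fin_eta: "finite_measure eta"
 and lam_pos: "lam > 0" and lam_ge: "emeasure eta (space eta) <= ennreal lam"
begin

abbreviation "L \<equiv> Leb n"

lemma space_eta: "space eta = space L" by (rule sets_eq_imp_space_eq[OF sets_eta])

lemma sigma_finite_eta: "sigma_finite_measure eta" using fin_eta by (simp add: finite_measure_def)

lemma pair_eta: "pair_sigma_finite eta L" "pair_sigma_finite L eta" by (intro pair_sigma_finite.intro sigma_finite_eta sigma_finite_Leb)+

lemma measurable_eta: "measurable eta N = measurable L N" by (rule measurable_cong_sets[OF sets_eta refl])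

definition heavy :: "nat => (nat => real) => bool" where
"heavy j x \<longleftrightarrow> emeasure eta (dcell n j x) > ennreal (lam * (1 / 2 ^ j) ^ n)"

definition selected :: "(nat => real) => bool" where
"selected x \<longleftrightarrow> (EX j<=m. heavy j x)"

definition gen :: "(nat => real) => nat" where
"gen x = (if selected x then LEAST j. heavy j x else m)"

abbreviation "stop_cell x \<equiv> dcell n (gen x) x"

lemma measurable_pair_eta:
"measurable (eta \<Otimes>\<^sub>M L) N = measurable (L \<Otimes>\<^sub>M L) N"
"measurable (L \<Otimes>\<^sub>M eta) N = measurable (L \<Otimes>\<^sub>M L) N" by (rule measurable_cong_sets[OF sets_pair_measure_cong[OF sets_eta refl] refl],
  rule measurable_cong_sets[OF sets_pair_measure_cong[OF refl sets_eta] refl])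

lemma emeasure_dcell_measurable: "(%x. emeasure eta (dcell n j x)) \<in> borel_measurable L"
proof -
have "(%x. \<integral>\<^sup>+y. (if same_cell n j x y then 1 else 0 :: ennreal) \<partial>eta) \<in> borel_measurable L"
proof (rule sigma_finite_measure.borel_measurable_nn_integral[OF sigma_finite_eta])
 show "(%(x, y). if same_cell n j x y then 1 else 0 :: ennreal) \<in> borel_measurable (L \<Otimes>\<^sub>M eta)" unfolding case_prod_beta using same_cell_kernel by (simp only: measurable_pair_eta)
qed
moreover have "(nn_integral eta (%y. (if same_cell n j x y then 1 else 0 :: ennreal))) = emeasure eta (dcell n j x)" for x
proof -
 have "(nn_integral eta (%y. (if same_cell n j x y then 1 else 0))) = (nn_integral eta (%y. indicator (dcell n j x) y))" by (intro nn_integral_cong) (auto simp: dcell_def indicator_def space_eta)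
 also have "... = emeasure eta (dcell n j x)" by (rule nn_integral_indicator) (simp add: sets_eta dcell_sets)
 finally show ?thesis .
qed
ultimately show ?thesis by simp
qed

lemma heavy_measurable [measurable]: "Measurable.pred L (heavy j)"
proof -
note [measurable] = emeasure_dcell_measurable
show ?thesis unfolding heavy_def[abs_def] by measurable
qed

lemma selected_measurable [measurable]: "Measurable.pred L selected" unfolding selected_def[abs_def] by measurable

lemma gen_measurable [measurable]: "gen \<in> measurable L (count_space UNIV)" unfolding gen_def[abs_def] by measurable

lemma heavy_cong: "same_cell n j x y ==> heavy j x = heavy j y" by (simp add: heavy_def dcell_eq)

lemma selectedD:
assumes "selected x"
shows "heavy (gen x) x" "gen x <= m" "!!j. j < gen x ==> \<not> heavy j x"
proof -
obtain j where j: "j <= m" "heavy j x" using assms by (auto simp: selected_def)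
show "heavy (gen x) x" using LeastI[of "%j. heavy j x", OF j(2)] assms by (simp add: gen_def)
show "gen x <= m" using Least_le[of "%j. heavy j x", OF j(2)] j(1) assms by (simp add: gen_def)
show "\<not> heavy j x" if "j < gen x" for j using not_less_Least[of j "%j. heavy j x"] that assms by (simp add: gen_def)
qed

lemma stop_cell_cong:
assumes "same_cell n (gen x) x y"
shows "gen y = gen x" "selected y = selected x" "stop_cell y = stop_cell x"
proof -
have eq: "heavy j x = heavy j y" if "j <= gen x" for j using same_cell_mono[OF assms that] by (rule heavy_cong)
show sel: "selected y = selected x"
proof (cases "selected x")
 case True
 then show ?thesis using selectedD(1,2)[OF True] eq by (auto simp: selected_def)
next
 case False
 then have "gen x = m" by (simp add: gen_def)
 then show ?thesis using eq by (auto simp: selected_def)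
qed
show gen: "gen y = gen x"
proof (cases "selected x")
 case True
 have "(LEAST j. heavy j y) = gen x"
 proof (rule Least_equality)
  show "heavy (gen x) y" using selectedD(1)[OF True] eq by simp
  show "gen x <= j" if "heavy j y" for j using selectedD(3)[OF True, of j] eq[of j] that by (meson not_le_imp_less order.strict_implies_order)
 qed
 then show ?thesis using True sel by (simp add: gen_def[of y])
next
 case False
 then show ?thesis using sel by (simp add: gen_def)
qed
show "stop_cell y = stop_cell x" using dcell_eq[OF assms] gen by simp
qed

lemma not_heavy_0: "\<not> heavy 0 x"
proof -
have "emeasure eta (dcell n 0 x) <= emeasure eta (space eta)" by (rule emeasure_space)
then show ?thesis using lam_ge by (auto simp: heavy_def not_less)
qed

text \<open>A selected cell is the first heavy one, so its parent, 2 ^ n times as large, is not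
  heavy; it has a parent because no cell of generation 0 is heavy. The stopping cell of an
  unselected point is itself not heavy.\<close>

lemma emeasure_stop_cell: "emeasure eta (stop_cell x) <= ennreal (2 ^ n * lam * (1 / 2 ^ gen x) ^ n)"
proof (cases "selected x")
case True
have "gen x ~= 0" using selectedD(1)[OF True] not_heavy_0[of x] by (intro notI) simp
then obtain k where k: "gen x = Suc k" by (cases "gen x") auto
have "\<not> heavy k x" using selectedD(3)[OF True] k by simp
have "emeasure eta (stop_cell x) <= emeasure eta (dcell n k x)" by (intro emeasure_mono) (auto simp: dcell_def k sets_eta dcell_sets[unfolded dcell_def] intro: same_cell_mono)
also have "... <= ennreal (lam * (1 / 2 ^ k) ^ n)" using \<open>\<not> heavy k x\<close> by (simp add: heavy_def not_less)
also have "lam * (1 / 2 ^ k) ^ n = 2 ^ n * lam * (1 / 2 ^ gen x) ^ n" by (simp add: k power_mult_distrib power_divide)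
finally show ?thesis .
next
case False
then have "\<not> heavy (gen x) x" by (auto simp: selected_def gen_def)
then have "emeasure eta (stop_cell x) <= ennreal (lam * (1 / 2 ^ gen x) ^ n)" by (simp add: heavy_def not_less)
also have "... <= ennreal (2 ^ n * lam * (1 / 2 ^ gen x) ^ n)" using lam_pos by (intro ennreal_leI mult_right_mono) (auto simp: mult_le_cancel_right1)
finally show ?thesis .
qed

text \<open>\<open>eta\<close> is replaced by its averages over the stopping cells, a measure with
  Lebesgue density at most 2 ^ n * lam. The price is the oscillation of g inside a cell, in the form
  available for a sum of squares: a factor 2 and an additive constant.\<close>

lemma stop_average:
assumes g [measurable]: "g \<in> borel_measurable L"
 and osc: "!!x y. x \<in> space L ==> y \<in> stop_cell x ==> g x <= 2 * g y + (K :: ennreal)"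
shows "(nn_integral eta (%x. g x)) <= 2 * ennreal (2 ^ n * lam) * (nn_integral L (%x. g x)) + K * emeasure eta (space eta)"
proof -
define S where "S x y = (if same_cell n (gen x) x y then 1 else 0 :: ennreal)" for x y
let ?v = "%x. ennreal (2 ^ (gen x * n))"
have gm [measurable]: "g \<in> borel_measurable eta" "gen \<in> measurable eta (count_space UNIV)" using g gen_measurable by (simp_all add: measurable_eta)
have "Measurable.pred (L \<Otimes>\<^sub>M L) (%p. same_cell n (gen (fst p)) (fst p) (snd p))" unfolding same_cell_def by measurable
then have "(%p. S (fst p) (snd p)) \<in> borel_measurable (L \<Otimes>\<^sub>M L)" unfolding S_def by measurable
then have Sp [measurable]: "(%p. S (fst p) (snd p)) \<in> borel_measurable (eta \<Otimes>\<^sub>M L)" by (simp only: measurable_pair_eta)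
have Sy: "S x \<in> borel_measurable L" if "x \<in> space L" for x using measurable_Pair2[OF Sp, of x] that by (simp add: space_eta)
have vol: "?v x * (nn_integral L (%y. S x y)) = 1" if "x \<in> space L" for x
proof -
 have "(nn_integral L (%y. S x y)) = (nn_integral L (%y. indicator (stop_cell x) y))" by (intro nn_integral_cong) (auto simp: dcell_def indicator_def S_def)
 also have "... = ennreal ((1 / 2 ^ gen x) ^ n)" by (simp add: dcell_sets emeasure_dcell)
 finally show ?thesis by (simp add: ennreal_mult[symmetric] power_divide power_mult)
qed
have "(nn_integral eta (%x. g x)) <= (nn_integral eta (%x. (nn_integral L (%y. 2 * (?v x * S x y * g y) + K * (?v x * S x y)))))"
proof (rule nn_integral_mono)
 fix x assume "x \<in> space eta"
 then have x: "x \<in> space L" by (simp add: space_eta)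
 note [measurable] = Sy[OF x]
 have "g x = (nn_integral L (%y. ?v x * S x y * g x))"
 proof -
  have "(nn_integral L (%y. ?v x * S x y * g x)) = (nn_integral L (%y. (?v x * g x) * S x y))" by (simp add: mult_ac)
  also have "... = (?v x * g x) * (nn_integral L (%y. S x y))" by (rule nn_integral_cmult[OF Sy[OF x]])
  also have "... = (?v x * (nn_integral L (%y. S x y))) * g x" by (simp add: mult_ac)
  finally have "(nn_integral L (%y. ?v x * S x y * g x)) = (?v x * (nn_integral L (%y. S x y))) * g x" .
  then show ?thesis by (simp only: vol[OF x]) simp
 qed
 also have "... <= (nn_integral L (%y. 2 * (?v x * S x y * g y) + K * (?v x * S x y)))"
 proof (rule nn_integral_mono)
  fix y assume y: "y \<in> space L"
  show "?v x * S x y * g x <= 2 * (?v x * S x y * g y) + K * (?v x * S x y)"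
  proof (cases "same_cell n (gen x) x y")
   case True
   then have "g x <= 2 * g y + K" using osc[OF x, of y] y by (simp add: dcell_def)
   then have "?v x * g x <= ?v x * (2 * g y + K)" by (rule mult_left_mono) simp
   also have "?v x * (2 * g y + K) = 2 * (?v x * S x y * g y) + K * (?v x * S x y)" using True by (simp add: S_def distrib_left distrib_right mult_ac)
   finally show ?thesis using True by (simp add: S_def)
  qed (simp add: S_def)
 qed
 finally show "g x <= (nn_integral L (%y. 2 * (?v x * S x y * g y) + K * (?v x * S x y)))" .
qed
also have "... = (nn_integral eta (%x. 2 * (nn_integral L (%y. ?v x * S x y * g y)) + K))"
proof (rule nn_integral_cong)
 fix x assume "x \<in> space eta"
 then have x: "x \<in> space L" by (simp add: space_eta)
 note [measurable] = Sy[OF x]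
 have "(nn_integral L (%y. 2 * (?v x * S x y * g y) + K * (?v x * S x y)))
  = 2 * (nn_integral L (%y. ?v x * S x y * g y)) + K * (?v x * (nn_integral L (%y. S x y)))"
 proof -
  have m1: "(%y. ?v x * S x y * g y) \<in> borel_measurable L" "(%y. ?v x * S x y) \<in> borel_measurable L" by measurable
  show ?thesis by (simp only: nn_integral_add[OF borel_measurable_times_ennreal[OF borel_measurable_const m1(1)] borel_measurable_times_ennreal[OF borel_measurable_const m1(2)]]
    nn_integral_cmult[OF m1(1)] nn_integral_cmult[OF m1(2)] nn_integral_cmult[OF Sy[OF x]])
 qed
 then show "(nn_integral L (%y. 2 * (?v x * S x y * g y) + K * (?v x * S x y))) = 2 * (nn_integral L (%y. ?v x * S x y * g y)) + K" by (simp only: vol[OF x] mult_1_right)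
qed
also have "... = 2 * (nn_integral eta (%x. (nn_integral L (%y. ?v x * S x y * g y)))) + K * emeasure eta (space eta)"
proof -
 have "(%x. \<integral>\<^sup>+y. ?v x * S x y * g y \<partial>L) \<in> borel_measurable eta" by (intro sigma_finite_measure.borel_measurable_nn_integral[OF sigma_finite_Leb]) measurable
 then show ?thesis by (simp add: nn_integral_add nn_integral_cmult)
qed
also have "(nn_integral eta (%x. (nn_integral L (%y. ?v x * S x y * g y)))) = (nn_integral L (%y. (nn_integral eta (%x. ?v x * S x y * g y))))" by (rule pair_sigma_finite.Fubini'[OF pair_eta(1), symmetric]) measurable
also have "... <= (nn_integral L (%y. ennreal (2 ^ n * lam) * g y))"
proof (rule nn_integral_mono)
 fix y assume y: "y \<in> space L"
 have "(nn_integral eta (%x. ?v x * S x y * g y)) = (nn_integral eta (%x. (?v y * g y) * indicator (stop_cell y) x))"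
 proof (rule nn_integral_cong)
  fix x assume "x \<in> space eta"
  then have x: "x \<in> space L" by (simp add: space_eta)
  \<comment> \<open>The stopping cells form a partition, so lying in the stopping cell of the other
    point is a symmetric relation. After Fubini the inner integral therefore runs over the stopping
    cell of y.\<close>
  have "same_cell n (gen x) x y \<longleftrightarrow> same_cell n (gen y) y x" using stop_cell_cong(1)[of x y] stop_cell_cong(1)[of y x] same_cell_sym by metis
  moreover have "same_cell n (gen x) x y ==> gen y = gen x" by (rule stop_cell_cong(1))
  ultimately show "?v x * S x y * g y = (?v y * g y) * indicator (stop_cell y) x" using x by (auto simp: dcell_def indicator_def S_def)
 qed
 also have "... = (?v y * g y) * emeasure eta (stop_cell y)" by (rule nn_integral_cmult_indicator) (simp add: sets_eta dcell_sets)
 also have "... <= (?v y * g y) * ennreal (2 ^ n * lam * (1 / 2 ^ gen y) ^ n)" by (intro mult_left_mono emeasure_stop_cell) simp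
 also have "... = (?v y * ennreal (2 ^ n * lam * (1 / 2 ^ gen y) ^ n)) * g y" by (simp add: mult_ac)
 also have "?v y * ennreal (2 ^ n * lam * (1 / 2 ^ gen y) ^ n) = ennreal (2 ^ n * lam)" using lam_pos by (subst ennreal_mult[symmetric]) (auto simp: power_divide power_mult)
 finally show "(nn_integral eta (%x. ?v x * S x y * g y)) <= ennreal (2 ^ n * lam) * g y" .
qed
also have "... = ennreal (2 ^ n * lam) * (nn_integral L (%y. g y))" by (rule nn_integral_cmult) measurable
finally show ?thesis by (simp add: mult.assoc add_mono mult_left_mono)
qed

text \<open>Encodes the neighbourhood of the selected cells without choosing representatives for
  them. With the factor 1 / (lam * volume), a selected cell near y contributes at least 1 to the
  integral, because it is heavy. The radius 3 is 2 for the neighbourhood of x plus 1 for moving x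
  within its cell.\<close>

definition halo_weight :: "(nat => real) => ennreal" where
"halo_weight y = (nn_integral eta (%x. ennreal (2 ^ (gen x * n) / lam) *
 (if selected x \<and> (ALL i<n. \<bar>y i - x i\<bar> <= 3 / 2 ^ gen x) then 1 else 0)))"

definition halo :: "(nat => real) set" where
"halo = {y \<in> space L. 1 <= halo_weight y}"

lemma halo_kernel_measurable:
"(%(y, x). ennreal (2 ^ (gen x * n) / lam) * (if selected x \<and> (ALL i<n. \<bar>y i - x i\<bar> <= 3 / 2 ^ gen x) then 1 else 0))
 \<in> borel_measurable (L \<Otimes>\<^sub>M eta)"
proof -
have 1: "Measurable.pred (L \<Otimes>\<^sub>M L) (%p. selected (snd p))" by (rule measurable_compose[OF measurable_snd selected_measurable])
have gs [measurable]: "(%p. gen (snd p)) \<in> measurable (L \<Otimes>\<^sub>M L) (count_space UNIV)" by (rule measurable_compose[OF measurable_snd gen_measurable])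
have 2: "Measurable.pred (L \<Otimes>\<^sub>M L) (%p. \<bar>fst p i - snd p i\<bar> <= 3 / 2 ^ gen (snd p))" if "i < n" for i
proof -
 have i: "i \<in> {..<n}" using that by simp
 have ci: "(%x. x i) \<in> borel_measurable L" using measurable_component_singleton[OF i, of "%_. lborel :: real measure"] by simp
 have [measurable]: "(%p. fst p i) \<in> borel_measurable (L \<Otimes>\<^sub>M L)" "(%p. snd p i) \<in> borel_measurable (L \<Otimes>\<^sub>M L)" by (rule measurable_compose[OF measurable_fst ci], rule measurable_compose[OF measurable_snd ci])
 have a: "(%p. \<bar>fst p i - snd p i\<bar>) \<in> borel_measurable (L \<Otimes>\<^sub>M L)" by measurable
 have c: "(%p. 3 / 2 ^ gen (snd p) :: real) \<in> borel_measurable (L \<Otimes>\<^sub>M L)" using measurable_compose[OF gs, of "%k. 3 / 2 ^ k :: real" borel] by simp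
 show ?thesis unfolding pred_def by (rule borel_measurable_le[OF a c])
qed
have 3: "Measurable.pred (L \<Otimes>\<^sub>M L) (%p. selected (snd p) \<and> (\<forall>i\<in>{..<n}. \<bar>fst p i - snd p i\<bar> <= 3 / 2 ^ gen (snd p)))" by (rule pred_intros_logic(3)[OF 1 pred_intros_finite(3)[OF finite_lessThan 2]]) simp
have "(%p. ennreal (2 ^ (gen (snd p) * n) / lam) * (if selected (snd p) \<and> (\<forall>i\<in>{..<n}. \<bar>fst p i - snd p i\<bar> <= 3 / 2 ^ gen (snd p)) then 1 else 0))
 \<in> borel_measurable (L \<Otimes>\<^sub>M L)"
proof (rule borel_measurable_times_ennreal)
 show "(%p. ennreal (2 ^ (gen (snd p) * n) / lam)) \<in> borel_measurable (L \<Otimes>\<^sub>M L)" using measurable_compose[OF gs, of "%k. ennreal (2 ^ (k * n) / lam)" borel] by simp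
qed (intro measurable_If borel_measurable_const 3[unfolded pred_def])
then have "(%p. ennreal (2 ^ (gen (snd p) * n) / lam) * (if selected (snd p) \<and> (ALL i<n. \<bar>fst p i - snd p i\<bar> <= 3 / 2 ^ gen (snd p)) then 1 else 0))
 \<in> borel_measurable (L \<Otimes>\<^sub>M L)" by (simp only: Ball_def lessThan_iff)
then show ?thesis unfolding case_prod_beta by (simp only: measurable_pair_eta)
qed

lemma halo_weight_measurable [measurable]: "halo_weight \<in> borel_measurable L" unfolding halo_weight_def[abs_def] by (rule sigma_finite_measure.borel_measurable_nn_integral[OF sigma_finite_eta halo_kernel_measurable])

lemma halo_sets [measurable]: "halo \<in> sets L" unfolding halo_def by measurable

text \<open>Markov's inequality for \<open>halo_weight\<close> and Fubini: each selected x accounts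
  for a cube of volume (6 / 2 ^ gen x) ^ n, which cancels against the normalisation up to the factor
  6 ^ n / lam.\<close>

lemma emeasure_halo: "emeasure L halo <= ennreal (6 ^ n / lam) * emeasure eta (space eta)"
proof -
have "emeasure L halo = (nn_integral L (%y. indicator halo y))" by simp
also have "... <= (nn_integral L (%y. halo_weight y))" by (intro nn_integral_mono) (auto simp: halo_def indicator_def)
also have "... = (nn_integral eta (%x. (nn_integral L (%y. ennreal (2 ^ (gen x * n) / lam) *
 (if selected x \<and> (ALL i<n. \<bar>y i - x i\<bar> <= 3 / 2 ^ gen x) then 1 else 0)))))" unfolding halo_weight_def by (rule pair_sigma_finite.Fubini'[OF pair_eta(2) halo_kernel_measurable, symmetric])
also have "... <= (nn_integral eta (%x. ennreal (6 ^ n / lam)))"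
proof (rule nn_integral_mono)
 fix x assume x: "x \<in> space eta"
 let ?Q = "PiE {..<n} (%i. {x i - 3 / 2 ^ gen x .. x i + 3 / 2 ^ gen x})"
 have "(nn_integral L (%y. ennreal (2 ^ (gen x * n) / lam) * (if selected x \<and> (ALL i<n. \<bar>y i - x i\<bar> <= 3 / 2 ^ gen x) then 1 else 0)))
  <= (nn_integral L (%y. ennreal (2 ^ (gen x * n) / lam) * indicator ?Q y))"
 proof (intro nn_integral_mono mult_left_mono)
  fix y assume "y \<in> space L"
  then show "(if selected x \<and> (ALL i<n. \<bar>y i - x i\<bar> <= 3 / 2 ^ gen x) then 1 else 0) <= (indicator ?Q y :: ennreal)" by (auto simp: indicator_def PiE_iff space_Leb abs_le_iff algebra_simps)
 qed simp
 also have "... = ennreal (2 ^ (gen x * n) / lam) * emeasure L ?Q" by (intro nn_integral_cmult_indicator sets_PiM_I_finite) auto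
 also have "emeasure L ?Q = ennreal ((6 / 2 ^ gen x) ^ n)" by (subst lebesgue_prod.emeasure_PiM) (auto simp: ennreal_power)
 also have "ennreal (2 ^ (gen x * n) / lam) * ennreal ((6 / 2 ^ gen x) ^ n) = ennreal (6 ^ n / lam)" using lam_pos by (subst ennreal_mult[symmetric]) (auto simp: power_divide power_mult)
 finally show "(nn_integral L (%y. ennreal (2 ^ (gen x * n) / lam) * (if selected x \<and> (ALL i<n. \<bar>y i - x i\<bar> <= 3 / 2 ^ gen x) then 1 else 0)))
  <= ennreal (6 ^ n / lam)" .
qed
also have "... = ennreal (6 ^ n / lam) * emeasure eta (space eta)" by simp
finally show ?thesis .
qed

lemma halo_nbhd:
assumes x: "x \<in> space L" "selected x" and y: "y \<in> space L" and near: "!!i. i < n ==> \<bar>y i - x i\<bar> <= 2 * (1 / 2 ^ gen x)"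
shows "y \<in> halo"
proof -
have "1 = ennreal (2 ^ (gen x * n) / lam) * ennreal (lam * (1 / 2 ^ gen x) ^ n)" using lam_pos by (subst ennreal_mult[symmetric]) (auto simp: power_divide power_mult)
also have "... <= ennreal (2 ^ (gen x * n) / lam) * emeasure eta (stop_cell x)" using selectedD(1)[OF x(2)] by (intro mult_left_mono) (auto simp: heavy_def)
also have "... = (nn_integral eta (%x'. ennreal (2 ^ (gen x * n) / lam) * indicator (stop_cell x) x'))" by (rule nn_integral_cmult_indicator[symmetric]) (simp add: sets_eta dcell_sets)
also have "... <= halo_weight y" unfolding halo_weight_def
proof (rule nn_integral_mono)
 fix x' assume "x' \<in> space eta"
 show "ennreal (2 ^ (gen x * n) / lam) * indicator (stop_cell x) x' <= ennreal (2 ^ (gen x' * n) / lam) *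
  (if selected x' \<and> (ALL i<n. \<bar>y i - x' i\<bar> <= 3 / 2 ^ gen x') then 1 else 0)"
 proof (cases "x' \<in> stop_cell x")
  case True
  then have same: "same_cell n (gen x) x x'" by (simp add: dcell_def)
  have "\<bar>y i - x' i\<bar> <= 3 / 2 ^ gen x" if "i < n" for i
  proof -
   have "\<bar>y i - x' i\<bar> <= 2 * (1 / 2 ^ gen x) + 1 / 2 ^ gen x" using near[OF that] same_cell_near[OF same that] by linarith
   then show ?thesis by simp
  qed
  then show ?thesis using True stop_cell_cong(1,2)[OF same] x(2) by simp
 qed simp
qed
finally show ?thesis using y by (simp add: halo_def)
qed

end

section \<open>Small open covers of null sets and the test field\<close>

text \<open>Outer regularity is a statement about Borel measures on a topological space. The measure
  is therefore cut down to a bounded box, which makes it finite, and transported to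
  \<open>nat => real\<close> by extending points with 0. Openness of the cover is expressed by
  coordinate cubes.\<close>

lemma null_set_open_cover:
assumes B: "B \<in> null_sets (Leb n)" and bd: "!!x i. x \<in> B ==> i < n ==> \<bar>x i\<bar> < R" and dl: "dl > 0"
obtains U where "U \<in> sets (Leb n)" "B \<subseteq> U" "emeasure (Leb n) U <= ennreal dl"
 "!!x. x \<in> U ==> EX eps>0. \<forall>y\<in>space (Leb n). (ALL k<n. \<bar>y k - x k\<bar> < eps) --> y \<in> U"
proof -
let ?L = "Leb n" and ?I = "{- R<..<R}"
let ?box = "PiE {..<n} (%_. ?I)"
define e where "e x = (%i. if i < n then x i else 0 :: real)" for x :: "nat => real"
define \<mu> where "\<mu> = density ?L (indicator ?box)"
define M where "M = distr \<mu> borel e"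
have box: "?box \<in> sets ?L" by (rule sets_PiM_I_finite) auto
have Bs: "B \<in> sets ?L" using B by auto
have sub: "B \<subseteq> ?box" using bd sets.sets_into_space[OF Bs] by (force simp: space_Leb PiE_iff abs_less_iff)
have eL: "e \<in> measurable ?L borel"
proof (rule measurable_coordinatewise_then_product)
 fix i show "(%x. e x i) \<in> borel_measurable ?L"
 proof (cases "i < n")
  case True
  then have "i \<in> {..<n}" by simp
  from measurable_component_singleton[OF this, of "%_. lborel :: real measure"] True
  show ?thesis by (simp add: e_def)
 qed (simp add: e_def)
qed
then have e\<mu>: "e \<in> measurable \<mu> borel" by (simp add: \<mu>_def)
have \<rho>: "(%w. \<lambda>i\<in>{..<n}. w i) \<in> measurable (borel :: (nat => real) measure) ?L" by (rule measurable_restrict) simp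
define B' where "B' = (%w. \<lambda>i\<in>{..<n}. w i) -` B"
have B': "B' \<in> sets borel" using measurable_sets[OF \<rho> Bs] by (simp add: B'_def)
have re: "(\<lambda>i\<in>{..<n}. e x i) = x" if "x \<in> space ?L" for x using that by (auto simp: e_def space_Leb PiE_iff extensional_def)
have pre: "e -` B' \<inter> space ?L = B" using re sets.sets_into_space[OF Bs] by (auto simp: B'_def)
have emM: "emeasure M S = emeasure ?L (?box \<inter> (e -` S \<inter> space ?L))" if S: "S \<in> sets borel" for S
proof -
 have S': "e -` S \<inter> space ?L \<in> sets ?L" using measurable_sets[OF eL S] .
 have "emeasure M S = emeasure \<mu> (e -` S \<inter> space ?L)" unfolding M_def by (subst emeasure_distr[OF e\<mu> S]) (simp add: \<mu>_def)
 also have "... = (nn_integral ?L (%x. indicator ?box x * indicator (e -` S \<inter> space ?L) x))" unfolding \<mu>_def using box S' by (intro emeasure_density) auto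
 also have "... = (nn_integral ?L (%x. indicator (?box \<inter> (e -` S \<inter> space ?L)) x))" by (intro nn_integral_cong) (auto simp: indicator_def)
 finally show ?thesis using box S' by simp
qed
have "emeasure ?L ?box = (\<Prod>i<n. emeasure lborel ?I)" by (rule lebesgue_prod.emeasure_PiM) auto
also have "... ~= \<infinity>" using emeasure_bounded_finite[of ?I] by (auto simp: ennreal_prod_eq_top less_top power_less_top_ennreal)
finally have finbox: "emeasure ?L ?box ~= \<infinity>" .
have fin: "emeasure M (space M) ~= \<infinity>"
proof -
 have "emeasure M (space M) <= emeasure ?L ?box" using emM[of UNIV] box by (auto simp: M_def intro!: emeasure_mono)
 then show ?thesis using finbox by (auto simp: top_unique)
qed
have "emeasure M B' = 0" unfolding emM[OF B'] pre using sub B by (simp add: Int_absorb1 null_setsD1)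
moreover have "emeasure M B' = (INF U\<in>{U. B' \<subseteq> U \<and> open U}. emeasure M U)" by (rule outer_regular[OF _ fin B']) (simp add: M_def)
ultimately have "(INF U\<in>{U. B' \<subseteq> U \<and> open U}. emeasure M U) < ennreal dl" using dl by simp
then obtain U where U: "B' \<subseteq> U" "open U" "emeasure M U < ennreal dl" by (auto simp: INF_less_iff)
define V where "V = ?box \<inter> (e -` U \<inter> space ?L)"
have Us: "U \<in> sets borel" using U(2) by simp
show ?thesis
proof
 show "V \<in> sets ?L" unfolding V_def using box measurable_sets[OF eL Us] by auto
 show "B \<subseteq> V" unfolding V_def using sub pre U(1) by auto
 show "emeasure ?L V <= ennreal dl" using U(3) emM[OF Us] by (simp add: V_def less_imp_le)
 fix x assume x: "x \<in> V"
 then have ex: "e x \<in> U" and xb: "x \<in> ?box" and xs: "x \<in> space ?L" by (auto simp: V_def)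
 \<comment> \<open>The coordinates from n on are 0 throughout the image of \<open>e\<close>, so only
   the first n factors of the basic open set impose a restriction.\<close>
 have "openin (product_topology (%i. euclidean) UNIV) U" using U(2) by (simp add: open_fun_def)
 from product_topology_open_contains_basis[OF this ex]
 obtain X where X: "e x \<in> PiE UNIV X" "!!i. open (X i)" "PiE UNIV X \<subseteq> U" by auto
 have "\<forall>i\<in>{..<n}. EX d>0. ALL t. \<bar>t - x i\<bar> < d --> t \<in> X i \<inter> ?I"
 proof
  fix i assume i: "i \<in> {..<n}"
  have "x i \<in> X i \<inter> ?I" using PiE_mem[OF X(1), of i] xb i by (auto simp: e_def PiE_iff)
  moreover have "open (X i \<inter> ?I)" using X(2) by auto
  ultimately show "EX d>0. ALL t. \<bar>t - x i\<bar> < d --> t \<in> X i \<inter> ?I" unfolding open_dist by (auto simp: dist_real_def)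
 qed
 then obtain d where d: "!!i. i < n ==> d i > 0" "!!i t. i < n ==> \<bar>t - x i\<bar> < d i ==> t \<in> X i \<inter> ?I" by (metis lessThan_iff)
 define d0 where "d0 = Min (insert 1 (d ` {..<n}))"
 have d0: "d0 > 0" "!!i. i < n ==> d0 <= d i" unfolding d0_def using d(1) by (auto simp: Min_gr_iff)
 show "EX eps>0. \<forall>y\<in>space ?L. (ALL k<n. \<bar>y k - x k\<bar> < eps) --> y \<in> V"
 proof (intro exI[of _ d0] conjI ballI impI d0)
  fix y assume y: "y \<in> space ?L" "ALL k<n. \<bar>y k - x k\<bar> < d0"
  have yi: "y i \<in> X i \<inter> ?I" if "i < n" for i using y(2) d0(2)[OF that] that by (intro d(2)) (auto intro: less_le_trans)
  have "e y i \<in> X i" for i using yi[of i] PiE_mem[OF X(1), of i] by (cases "i < n") (auto simp: e_def)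
  then have "e y \<in> U" using X(3) by (auto simp: PiE_iff)
  moreover have "y \<in> ?box" using yi y(1) by (auto simp: space_Leb PiE_iff)
  ultimately show "y \<in> V" using y(1) by (simp add: V_def)
 qed
qed
qed

text \<open>The trace kernel is positive. This allows a set to be enlarged after its trace has been
  bounded below.\<close>

lemma drki_trace_mono:
assumes "eps > 0" "U \<in> sets (Leb n)" "A \<in> sets (Leb n)" "emeasure (Leb n) A < \<infinity>" "U \<subseteq> A"
 "x \<in> space (Leb n)"
shows "(\<Sum>i<n. drki n eps U i i x) <= (\<Sum>i<n. drki n eps A i i x)"
proof -
have finU: "emeasure (Leb n) U < \<infinity>" using emeasure_mono[OF assms(5,3)] assms(4) by (rule order_le_less_trans)
have "ennreal (\<Sum>i<n. drki n eps U i i x) <= ennreal (\<Sum>i<n. drki n eps A i i x)" unfolding drki_trace_ennreal[OF assms(1,2) finU assms(6)] drki_trace_ennreal[OF assms(1,3,4,6)] using assms(5) by (intro nn_integral_mono mult_right_mono) (auto simp: indicator_def)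
then show ?thesis using drki_trace_nonneg[OF assms(1,3,4,6)] by (simp add: ennreal_le_iff)
qed

text \<open>Three contributions per unit of mass: |t| \<le> 1 + t^2 for the n^2 entries, the
  averaged L2 bound with lam times the volume of \<open>A\<close> at most (1 + 6 ^ n) * ka, and the
  oscillation inside the cells.\<close>

definition field_const :: "nat => real" where
"field_const n = (real n)^2 + 2 * (2 ^ n * ((trace_const n)^2 * (1 + 6 ^ n))) + 2 * (real n)^2 * (osc_const n + 1)^2"

lemma osc_const_nonneg: "osc_const n >= 0" by (simp add: osc_const_def tail_const_nonneg)

text \<open>The vector field is the convolution of the regularised Riesz kernel with the indicator of
a set \<open>A\<close> of small volume. On the mass of \<open>eta\<close> the derivatives are controlled as in the
Calderon-Zygmund decomposition: in \<open>L\<^sup>2\<close> on the average over a stopping cube, and by the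
oscillation inside a cube since \<open>A\<close> contains a neighbourhood of all the selected cubes.\<close>

lemma test_field:
fixes sig eta :: "(nat => real) measure"
assumes n: "n >= 1"
 and sig: "sets sig = sets (Leb n)" "finite_measure sig"
 and eta: "sets eta = sets (Leb n)" "finite_measure eta"
 and B: "B \<in> null_sets (Leb n)" "AE x in sig. x \<in> B" "!!x i. x \<in> B ==> i < n ==> \<bar>x i\<bar> < R"
 and ka: "ka > 0" "measure eta (space eta) <= ka" and dl: "dl > 0"
obtains eps A where "eps > 0" "A \<in> sets (Leb n)" "emeasure (Leb n) A < \<infinity>"
 "cube_const n / 2 * measure sig (space sig) <= (LINT x|sig. (\<Sum>i<n. drki n eps A i i x))"
 "(LINT x|eta. (\<Sum>i<n. \<Sum>j<n. \<bar>drki n eps A i j x\<bar>)) <= field_const n * ka"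
 "!!x i. x \<in> space (Leb n) ==> i < n ==> \<bar>rki n eps A i x\<bar> <= dl"
proof -
let ?L = "Leb n"
interpret sig: finite_measure sig by fact
interpret eta: finite_measure eta by fact
have spsig: "space sig = space ?L" by (rule sets_eq_imp_space_eq[OF sig(1)])
have speta: "space eta = space ?L" by (rule sets_eq_imp_space_eq[OF eta(1)])
have mesig: "measurable sig N = measurable ?L N" for N :: "real measure" by (rule measurable_cong_sets[OF sig(1) refl])
have meeta: "measurable eta N = measurable ?L N" for N :: "real measure" by (rule measurable_cong_sets[OF eta(1) refl])
define C where "C = 2 ^ (n - 1) * (2 * real n) ^ n"
have C: "C > 0" using n by (simp add: C_def)
\<comment> \<open>With \<open>eps \<le> r\<close> the near part in \<open>rki_bound\<close> is at
  most C * 2 r = dl / 2.\<close>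
define r where "r = dl / (4 * C)"
have r: "r > 0" using C dl by (simp add: r_def)
\<comment> \<open>The first entry of the maximum keeps the unit cells light, the second makes the
  far part of the field at most dl / 2. Since lam times the volume bound \<open>a\<close> equals (1
  + 6 ^ n) * ka, a large lam does no harm to the L2 estimate.\<close>
define lam where "lam = max ka ((1 + 6 ^ n) * ka / (dl / 2 * r ^ (n - 1)))"
have lam: "lam > 0" "ka <= lam" using ka by (auto simp: lam_def)
define a where "a = (1 + 6 ^ n) * ka / lam"
have a: "a >= 0" "a / r ^ (n - 1) <= dl / 2"
proof -
 show "a >= 0" using lam ka by (simp add: a_def)
 have "(1 + 6 ^ n) * ka / (dl / 2 * r ^ (n - 1)) <= lam" by (simp add: lam_def)
 then show "a / r ^ (n - 1) <= dl / 2" unfolding a_def using lam(1) r dl ka by (simp add: field_simps)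
qed
obtain U where U: "U \<in> sets ?L" "B \<subseteq> U" "emeasure ?L U <= ennreal (ka / lam)"
 and Uo: "!!x. x \<in> U ==> EX eps>0. \<forall>y\<in>space ?L. (ALL k<n. \<bar>y k - x k\<bar> < eps) --> y \<in> U"
proof (rule null_set_open_cover[where B = B and R = R and n = n and dl = "ka / lam"])
 show "\<bar>x i\<bar> < R" if "x \<in> B" "i < n" for x i using B(3) that .
qed (use B(1) ka lam in auto)
have finU: "emeasure ?L U < \<infinity>" using U(3) by (rule order_le_less_trans) simp
\<comment> \<open>How small a cube must be to fit into \<open>U\<close> depends on the point, so a
  sequence of scales is used and Fatou's lemma yields one that works. Halving
  \<open>cube_const n\<close> provides the strict inequality that the liminf requires.\<close>
define ep where "ep k = r / real (Suc k)" for k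
have ep: "ep k > 0" "ep k <= r" for k using r by (auto simp: ep_def field_simps)
have ep0: "ep ---> 0" using tendsto_mult_right_zero[OF LIMSEQ_inverse_real_of_nat, of r] by (simp add: ep_def[abs_def] divide_inverse)
let ?T = "%k x. \<Sum>i<n. drki n (ep k) U i i x"
have Tm [measurable]: "?T k \<in> borel_measurable ?L" for k using U(1) by measurable
have "EX k. cube_const n / 2 * measure sig (space sig) <= (LINT x|sig. ?T k x)"
proof (cases "measure sig (space sig) = 0")
 case True
 have "0 <= (LINT x|sig. ?T 0 x)" using drki_trace_nonneg[OF ep(1) U(1) finU] by (intro Bochner_Integration.integral_nonneg) (auto simp: spsig)
 then show ?thesis using True by auto
next
 case False
 then have pos: "measure sig (space sig) > 0" by (simp add: less_le)
 have cc: "cube_const n > 0" using n by (simp add: cube_const_def)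
 have lb: "ennreal (cube_const n) <= liminf (%k. ennreal (?T k x))" if xU: "x \<in> U" for x
 proof -
  have xs: "x \<in> space ?L" using xU sets.sets_into_space[OF U(1)] by auto
  obtain e where e: "e > 0" "!!y. y \<in> space ?L ==> (!!k. k < n ==> \<bar>y k - x k\<bar> < e) ==> y \<in> U" using Uo[OF xU] by auto
  have "eventually (%k. ep k < e) sequentially" using ep0 e(1) by (rule order_tendstoD)
  then have "eventually (%k. ennreal (cube_const n) <= ennreal (?T k x)) sequentially"
  proof eventually_elim
   case (elim k)
   show ?case
   proof (intro ennreal_leI drki_trace_lower[OF n ep(1) xs U(1) finU])
    fix y assume "y \<in> space ?L" "!!j. j < n ==> \<bar>y j - x j\<bar> < ep k"
    then show "y \<in> U" using elim by (intro e(2)) (auto intro: less_trans)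
   qed
  qed
  then show ?thesis by (rule Liminf_bounded)
 qed
 have "ennreal (cube_const n) * emeasure sig (space sig) = (nn_integral sig (%x. ennreal (cube_const n)))" by simp
 also have "... <= (nn_integral sig (%x. liminf (%k. ennreal (?T k x))))" by (rule nn_integral_mono_AE) (use B(2) in \<open>eventually_elim, use lb U(2) in auto\<close>)
 also have "... <= liminf (%k. \<integral>\<^sup>+x. ennreal (?T k x) \<partial>sig)" by (rule nn_integral_liminf) (simp add: mesig measurable_compose[OF Tm] measurable_cong_sets[OF sig(1) refl])
 finally have le: "ennreal (cube_const n) * emeasure sig (space sig) <= liminf (%k. \<integral>\<^sup>+x. ennreal (?T k x) \<partial>sig)" .
 have "ennreal (cube_const n / 2 * measure sig (space sig)) < ennreal (cube_const n) * emeasure sig (space sig)" using cc pos by (simp add: sig.emeasure_eq_measure ennreal_mult[symmetric] ennreal_less_iff)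
 then have "ennreal (cube_const n / 2 * measure sig (space sig)) < liminf (%k. \<integral>\<^sup>+x. ennreal (?T k x) \<partial>sig)" using le by (rule less_le_trans)
 then have "eventually (%k. ennreal (cube_const n / 2 * measure sig (space sig)) < (nn_integral sig (%x. ennreal (?T k x)))) sequentially" by (rule less_LiminfD)
 then obtain k where k: "ennreal (cube_const n / 2 * measure sig (space sig)) < (nn_integral sig (%x. ennreal (?T k x)))" by (auto simp: eventually_sequentially)
 have int: "integrable sig (?T k)" using drki_trace_nonneg[OF ep(1) U(1) finU] drki_trace_le[OF n ep(1) U(1) finU] by (intro sig.integrable_const_bound[of _ "trace_const n"] AE_I2) (auto simp: spsig mesig)
 have "(nn_integral sig (%x. ennreal (?T k x))) = ennreal (LINT x|sig. ?T k x)" using drki_trace_nonneg[OF ep(1) U(1) finU] by (intro nn_integral_eq_integral int AE_I2) (auto simp: spsig)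
 then have "cube_const n / 2 * measure sig (space sig) <= (LINT x|sig. ?T k x)" using k cc pos by (simp add: ennreal_less_iff)
 then show ?thesis by blast
qed
then obtain k where k: "cube_const n / 2 * measure sig (space sig) <= (LINT x|sig. ?T k x)" by blast
define eps where "eps = ep k"
have eps: "eps > 0" "eps <= r" using ep by (auto simp: eps_def)
\<comment> \<open>A Lipschitz constant of the derivatives, up to the side of the cell.
  \<open>m\<close> is chosen after \<open>eps\<close> so that the cells of generation m are too
  small for an oscillation above 1.\<close>
define D where "D = real n * (real n * (real n + 5) / eps ^ (n + 1)) * a"
obtain m where m: "D < 2 ^ m" using real_arch_pow[of 2 D] by auto
interpret S: stopping n eta lam m
proof
 show "emeasure eta (space eta) <= ennreal lam" using ka lam by (simp add: eta.emeasure_eq_measure ennreal_leI)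
qed (use n eta lam in auto)
\<comment> \<open>The stopping cells, and hence the halo, are known only after \<open>eps\<close>
  has been chosen for \<open>U\<close>; by positivity of the trace kernel, adding the halo does not
  lower the trace.\<close>
define A where "A = U \<union> S.halo"
have A: "A \<in> sets ?L" using U(1) S.halo_sets by (auto simp: A_def)
have eA: "emeasure ?L A <= ennreal a"
proof -
 have "emeasure ?L A <= emeasure ?L U + emeasure ?L S.halo" unfolding A_def by (rule emeasure_subadditive[OF U(1) S.halo_sets])
 also have "... <= ennreal (ka / lam) + ennreal (6 ^ n / lam) * ennreal ka"
 proof (rule add_mono[OF U(3)])
  have "emeasure eta (space eta) <= ennreal ka" using ka by (simp add: eta.emeasure_eq_measure ennreal_leI)
  then show "emeasure ?L S.halo <= ennreal (6 ^ n / lam) * ennreal ka" by (intro order_trans[OF S.emeasure_halo] mult_left_mono) auto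
 qed
 also have "... = ennreal (ka / lam + 6 ^ n / lam * ka)" using ka lam by (subst ennreal_mult[symmetric]) auto
 also have "ka / lam + 6 ^ n / lam * ka = a" by (simp add: a_def add_divide_distrib distrib_right)
 finally show ?thesis .
qed
then have finA: "emeasure ?L A < \<infinity>" by (rule order_le_less_trans) simp
have mA: "measure ?L A <= a" using eA a(1) finA by (simp add: emeasure_eq_ennreal_measure)
show ?thesis
proof (rule that[OF eps(1) A finA])
 have intA: "integrable sig (%x. \<Sum>i<n. drki n eps V i i x)" if "V \<in> sets ?L" "emeasure ?L V < \<infinity>" for V
 proof -
  have "(%x. \<Sum>i<n. drki n eps V i i x) \<in> borel_measurable ?L" using that(1) by measurable
  then show ?thesis using drki_trace_nonneg[OF eps(1) that] drki_trace_le[OF n eps(1) that] by (intro sig.integrable_const_bound[of _ "trace_const n"] AE_I2) (auto simp: spsig mesig)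
 qed
 have "(LINT x|sig. (\<Sum>i<n. drki n eps U i i x)) <= (LINT x|sig. (\<Sum>i<n. drki n eps A i i x))" by (intro integral_mono intA U(1) finU A finA drki_trace_mono eps(1)) (auto simp: A_def spsig)
 then show "cube_const n / 2 * measure sig (space sig) <= (LINT x|sig. (\<Sum>i<n. drki n eps A i i x))" using k by (simp add: eps_def)
next
 fix x i assume x: "x \<in> space ?L" "i < n"
 have "\<bar>rki n eps A i x\<bar> <= C * (r + eps) + measure ?L A / r ^ (n - 1)" unfolding C_def by (rule rki_bound[OF n eps(1) r x(1) A finA x(2)])
 also have "... <= C * (r + r) + a / r ^ (n - 1)" using C eps(2) mA r by (intro add_mono mult_left_mono divide_right_mono) auto
 also have "C * (r + r) = dl / 2" using C by (simp add: r_def field_simps)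
 finally show "\<bar>rki n eps A i x\<bar> <= dl" using a(2) by linarith
next
 let ?g = "%x. \<Sum>i<n. \<Sum>j<n. (drki n eps A i j x)^2"
 let ?oc = "osc_const n + 1"
 have gm: "?g \<in> borel_measurable ?L" using A by measurable
 have osc: "\<bar>drki n eps A i j y - drki n eps A i j x\<bar> <= ?oc"
  if x: "x \<in> space ?L" and y: "y \<in> S.stop_cell x" and ij: "i < n" "j < n" for x y i j
 proof -
  have same: "same_cell n (S.gen x) x y" and ys: "y \<in> space ?L" using y by (auto simp: dcell_def)
  have near: "\<bar>x k - y k\<bar> <= 1 / 2 ^ S.gen x" if "k < n" for k by (rule same_cell_near[OF same that])
  show ?thesis
  proof (cases "S.selected x")
   case True
   have "\<bar>drki n eps A i j y - drki n eps A i j x\<bar> <= osc_const n"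
   proof (rule drki_oscillation[OF n eps(1) _ x ys near A finA _ ij])
    fix z assume "z \<in> space ?L" "!!k. k < n ==> \<bar>z k - x k\<bar> <= 2 * (1 / 2 ^ S.gen x)"
    then show "z \<in> A" using S.halo_nbhd[OF x True] by (auto simp: A_def)
   qed auto
   then show ?thesis by simp
  next
   case False
   then have "S.gen x = m" by (simp add: S.gen_def)
   have "\<bar>drki n eps A i j y - drki n eps A i j x\<bar>
    <= real n * (real n * (real n + 5) / eps ^ (n + 1) * (1 / 2 ^ S.gen x)) * measure ?L A" by (rule drki_lipschitz[OF n eps(1) x ys near A finA ij])
   also have "... <= real n * (real n * (real n + 5) / eps ^ (n + 1) * (1 / 2 ^ S.gen x)) * a" using eps(1) by (intro mult_left_mono mA) auto
   also have "... = D / 2 ^ m" using \<open>S.gen x = m\<close> by (simp add: D_def)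
   also have "... <= 1" using m by simp
   finally show ?thesis using osc_const_nonneg[of n] by linarith
  qed
 qed
 have gosc: "?g x <= 2 * ?g y + 2 * (real n)^2 * ?oc^2" if x: "x \<in> space ?L" and y: "y \<in> S.stop_cell x" for x y
 proof -
  have "?g x <= (\<Sum>i<n. \<Sum>j<n. 2 * (drki n eps A i j y)^2 + 2 * ?oc^2)"
  proof (intro sum_mono)
   fix i j assume "i \<in> {..<n}" "j \<in> {..<n}"
   then have "\<bar>drki n eps A i j y - drki n eps A i j x\<bar> <= ?oc" using osc[OF x y] by simp
   then have "(drki n eps A i j y - drki n eps A i j x)^2 <= ?oc^2" using power_mono[of "\<bar>drki n eps A i j y - drki n eps A i j x\<bar>" ?oc 2] by simp
   moreover have "2 * p^2 + 2 * (p - q)^2 - q\<^sup>2 = (2 * p - q)^2" for p q :: real by (simp add: power2_eq_square algebra_simps)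
   ultimately show "(drki n eps A i j x)^2 <= 2 * (drki n eps A i j y)^2 + 2 * ?oc^2" using zero_le_power2[of "2 * drki n eps A i j y - drki n eps A i j x"] by (smt (verit))
  qed
  also have "... = 2 * ?g y + 2 * (real n)^2 * ?oc^2" by (simp add: sum.distrib sum_distrib_left power2_eq_square)
  finally show ?thesis .
 qed
 have g0: "?g x >= 0" for x by (intro sum_nonneg) auto
 have "(nn_integral eta (%x. ennreal (?g x))) <= 2 * ennreal (2 ^ n * lam) * (nn_integral ?L (%x. ennreal (?g x)))
   + ennreal (2 * (real n)^2 * ?oc^2) * emeasure eta (space eta)"
 proof (rule S.stop_average)
  show "(%x. ennreal (?g x)) \<in> borel_measurable ?L" using gm by measurable
  fix x y assume "x \<in> space ?L" "y \<in> S.stop_cell x"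
  from ennreal_leI[OF gosc[OF this]]
  show "ennreal (?g x) <= 2 * ennreal (?g y) + ennreal (2 * (real n)^2 * ?oc^2)" using g0[of y] by (simp add: ennreal_mult)
 qed
 also have "(nn_integral ?L (%x. ennreal (?g x))) = ennreal (LINT x|?L. ?g x)" by (rule nn_integral_eq_integral[OF drki_L2_bound(1)[OF n eps(1) A finA]]) (simp add: g0)
 also have "2 * ennreal (2 ^ n * lam) * ennreal (LINT x|?L. ?g x) + ennreal (2 * (real n)^2 * ?oc^2) * emeasure eta (space eta)
  = ennreal (2 * (2 ^ n * lam) * (LINT x|?L. ?g x) + 2 * (real n)^2 * ?oc^2 * measure eta (space eta))" using lam(1) g0 by (simp add: eta.emeasure_eq_measure ennreal_mult Bochner_Integration.integral_nonneg)
 finally have ge: "(nn_integral eta (%x. ennreal (?g x))) <= ennreal (2 * (2 ^ n * lam) * (LINT x|?L. ?g x) + 2 * (real n)^2 * ?oc^2 * measure eta (space eta))" .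
 have gint: "integrable eta ?g" using ge gm g0 by (intro integrableI_bounded) (auto simp: meeta intro: order_le_less_trans)
 have "(LINT x|eta. ?g x) = enn2real (nn_integral eta (%x. ennreal (?g x)))" by (rule integral_eq_nn_integral) (use gm g0 in \<open>auto simp: meeta\<close>)
 also have "... <= 2 * (2 ^ n * lam) * (LINT x|?L. ?g x) + 2 * (real n)^2 * ?oc^2 * measure eta (space eta)" by (rule order_trans[OF enn2real_mono[OF ge ennreal_less_top]])
   (use lam(1) g0 in \<open>simp add: Bochner_Integration.integral_nonneg ennreal_plus[symmetric] del: ennreal_plus\<close>)
 also have "... <= 2 * (2 ^ n * lam) * ((trace_const n)^2 * a) + 2 * (real n)^2 * ?oc^2 * ka"
 proof (intro add_mono mult_left_mono)
  show "(LINT x|?L. ?g x) <= (trace_const n)^2 * a" by (rule order_trans[OF drki_L2_bound(2)[OF n eps(1) A finA]]) (simp add: mA mult_left_mono)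
 qed (use lam ka in auto)
 also have "2 * (2 ^ n * lam) * ((trace_const n)^2 * a) = 2 * (2 ^ n * ((trace_const n)^2 * (1 + 6 ^ n))) * ka" using lam(1) by (simp add: a_def)
 finally have gI: "(LINT x|eta. ?g x) <= 2 * (2 ^ n * ((trace_const n)^2 * (1 + 6 ^ n))) * ka + 2 * (real n)^2 * ?oc^2 * ka" .
 have "(LINT x|eta. (\<Sum>i<n. \<Sum>j<n. \<bar>drki n eps A i j x\<bar>)) <= (LINT x|eta. (real n)^2 + ?g x)"
 proof (rule integral_mono)
  have le: "(\<Sum>i<n. \<Sum>j<n. \<bar>drki n eps A i j x\<bar>) <= (real n)^2 + ?g x" for x
  proof -
   have "(\<Sum>i<n. \<Sum>j<n. \<bar>drki n eps A i j x\<bar>) <= (\<Sum>i<n. \<Sum>j<n. 1 + (drki n eps A i j x)^2)"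
   proof (intro sum_mono)
    fix i j
    have "0 <= (\<bar>drki n eps A i j x\<bar> - 1)^2 + \<bar>drki n eps A i j x\<bar>" by simp
    also have "... = 1 + (drki n eps A i j x)^2 - \<bar>drki n eps A i j x\<bar>" by (simp add: power2_eq_square algebra_simps)
    finally show "\<bar>drki n eps A i j x\<bar> <= 1 + (drki n eps A i j x)^2" by simp
   qed
   then show ?thesis by (simp add: sum.distrib power2_eq_square)
  qed
  show ig: "integrable eta (%x. (real n)^2 + ?g x)" using gint by simp
  show "(\<Sum>i<n. \<Sum>j<n. \<bar>drki n eps A i j x\<bar>) <= (real n)^2 + ?g x" for x by (rule le)
  have "(%x. \<Sum>i<n. \<Sum>j<n. \<bar>drki n eps A i j x\<bar>) \<in> borel_measurable ?L" using A by measurable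
  then show "integrable eta (%x. \<Sum>i<n. \<Sum>j<n. \<bar>drki n eps A i j x\<bar>)" by (intro integrable_dom[OF ig] AE_I2)
    (auto simp: meeta sum_nonneg abs_of_nonneg intro!: order_trans[OF le])
 qed
 also have "... = (real n)^2 * measure eta (space eta) + (LINT x|eta. ?g x)" using gint by simp
 also have "... <= (real n)^2 * ka + (2 * (2 ^ n * ((trace_const n)^2 * (1 + 6 ^ n))) * ka + 2 * (real n)^2 * ?oc^2 * ka)" using ka by (intro add_mono mult_left_mono gI) auto
 also have "... = field_const n * ka" by (simp add: field_const_def distrib_right)
 finally show "(LINT x|eta. (\<Sum>i<n. \<Sum>j<n. \<bar>drki n eps A i j x\<bar>)) <= field_const n * ka" .
qed
qed

section \<open>Elementary properties of Dirichlet structures\<close>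

lemma quadratic_nonneg_imp:
fixes a b c :: real
assumes a: "0 <= a" and q: "!!t. 0 <= t^2 * a + 2 * t * b + c"
shows "b^2 <= a * c"
proof (cases "a = 0")
case True
have "b = 0"
proof (rule ccontr)
 assume "b ~= 0"
 then have "2 * (- (c + 1) / (2 * b)) * b = - (c + 1)" by (simp add: field_simps)
 then show False using q[of "- (c + 1) / (2 * b)"] True by simp
qed
then show ?thesis using True by simp
next
case False
then have a: "a > 0" using a by simp
have "0 <= (- b / a)^2 * a + 2 * (- b / a) * b + c" by (rule q)
also have "... = c - b\<^sup>2 / a" using a by (simp add: power2_eq_square field_simps)
finally show ?thesis using a by (simp add: field_simps)
qed

text \<open>An inequality with a parameter holds outside one common null set for countably many
  values of it; continuity then extends it from rational to real t.\<close>

lemma quadratic_nonneg_rat: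
fixes a b c :: real
assumes "!!t. t \<in> \<rat> ==> 0 <= t^2 * a + 2 * t * b + c"
shows "0 <= t^2 * a + 2 * t * b + c"
proof (rule ccontr)
let ?f = "%t. t^2 * a + 2 * t * b + c"
assume "\<not> 0 <= ?f t"
moreover have "isCont ?f t" by (intro continuous_intros)
ultimately have "eventually (%s. ?f s < 0) (at t)" by (intro order_tendstoD(2)[of ?f "?f t"]) (auto simp: isCont_def)
then obtain d where d: "d > 0" "!!s. s ~= t ==> dist s t < d ==> ?f s < 0" by (auto simp: eventually_at)
obtain r where "r \<in> \<rat>" "t < r" "r < t + d" using Rats_dense_in_real[of t "t + d"] d(1) by auto
then show False using d(2)[of r] assms[of r] by (auto simp: dist_real_def)
qed

locale dirichlet_structure =
fixes M :: "'a measure" and D :: "('a => real) set" and e :: "('a => real) => ('a => real) => real"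
 and gam :: "('a => real) => ('a => real) => 'a => real"
assumes sf: "sigma_finite_measure M" and df: "dirichlet_form M D e" and lf: "local_form D e"
 and cdc: "carre_du_champ M D e gam"
begin

lemmas dirichlet_form_parts = df[unfolded dirichlet_form_def]

lemmas D_zero = dirichlet_form_parts[THEN conjunct1, rule_format]
lemmas D_lin = dirichlet_form_parts[THEN conjunct2, THEN conjunct1, rule_format]
lemmas D_AE = dirichlet_form_parts[THEN conjunct2, THEN conjunct2, THEN conjunct1, rule_format]
lemmas D_l2_dense = dirichlet_form_parts[THEN conjunct2, THEN conjunct2, THEN conjunct2, THEN conjunct1, rule_format]
lemmas e_sym = dirichlet_form_parts[THEN conjunct2, THEN conjunct2, THEN conjunct2, THEN conjunct2, THEN conjunct1, rule_format]
lemmas e_lin = dirichlet_form_parts[THEN conjunct2, THEN conjunct2, THEN conjunct2, THEN conjunct2, THEN conjunct2, THEN conjunct1, rule_format]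
lemmas e_nonneg = dirichlet_form_parts[THEN conjunct2, THEN conjunct2, THEN conjunct2, THEN conjunct2, THEN conjunct2, THEN conjunct2, THEN conjunct1, rule_format]
lemmas e_AE = dirichlet_form_parts[THEN conjunct2, THEN conjunct2, THEN conjunct2, THEN conjunct2, THEN conjunct2, THEN conjunct2, THEN conjunct2, THEN conjunct1, rule_format]
lemmas form_complete = dirichlet_form_parts[THEN conjunct2, THEN conjunct2, THEN conjunct2, THEN conjunct2, THEN conjunct2, THEN conjunct2, THEN conjunct2, THEN conjunct2, THEN conjunct1, rule_format]
lemmas unit_contraction = dirichlet_form_parts[THEN conjunct2, THEN conjunct2, THEN conjunct2, THEN conjunct2, THEN conjunct2, THEN conjunct2, THEN conjunct2, THEN conjunct2, THEN conjunct2, rule_format]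
lemmas D_unit = unit_contraction[THEN conjunct1]
lemmas e_unit = unit_contraction[THEN conjunct2]

lemma e_AE2: "f \<in> D ==> g \<in> D ==> (AE x in M. f x = g x) ==> e f f = e g g" using e_AE[of f g f] e_AE[of f g g] e_sym[of f g] by simp

lemma D_measurable: "f \<in> D ==> f \<in> borel_measurable M"
and D_sq_integrable: "f \<in> D ==> integrable M (%x. (f x)^2)" using D_l2_dense by (auto simp: l2_dense_def l2_space_def)

lemma D_add:
assumes "f \<in> D" "g \<in> D"
shows "(%x. f x + g x) \<in> D"
proof -
have "(%x. 1 * f x + g x) \<in> D" using assms by (rule D_lin)
then show ?thesis by (simp only: mult_1)
qed

lemma D_scale:
assumes "f \<in> D"
shows "(%x. c * f x) \<in> D"
proof -
have "(%x. c * f x + 0) \<in> D" using assms D_zero by (rule D_lin)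
then show ?thesis by (simp only: add_0_right)
qed

lemma D_minus:
assumes "f \<in> D"
shows "(%x. - f x) \<in> D"
proof -
have "(%x. (- 1) * f x) \<in> D" using assms by (rule D_scale)
then show ?thesis by (simp only: mult_minus1)
qed

lemma D_diff:
assumes "f \<in> D" "g \<in> D"
shows "(%x. f x - g x) \<in> D"
proof -
have "(%x. f x + - g x) \<in> D" using assms by (intro D_add D_minus)
then show ?thesis by (simp only: diff_conv_add_uminus)
qed

lemma D_sum: "finite I ==> (!!i. i \<in> I ==> f i \<in> D) ==> (%x. \<Sum>i\<in>I. f i x) \<in> D" by (induction I rule: finite_induct) (auto intro: D_zero D_add)

lemma e_zero: "h \<in> D ==> e (%x. 0) h = 0" using e_lin[OF D_zero D_zero, of h 1] by simp

lemma e_add_left: "f \<in> D ==> g \<in> D ==> h \<in> D ==> e (%x. f x + g x) h = e f h + e g h" using e_lin[of f g h 1] by simp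

lemma e_scale_left: "f \<in> D ==> h \<in> D ==> e (%x. c * f x) h = c * e f h" using e_lin[OF _ D_zero, of f h c] by (simp add: e_zero)

lemma e_diff_left: "f \<in> D ==> g \<in> D ==> h \<in> D ==> e (%x. f x - g x) h = e f h - e g h" using e_lin[of g f h "-1"] by simp

lemma e_add_right: "f \<in> D ==> g \<in> D ==> h \<in> D ==> e h (%x. f x + g x) = e h f + e h g" using e_add_left[of f g h] by (simp add: e_sym D_add)

lemma e_scale_right: "f \<in> D ==> h \<in> D ==> e h (%x. c * f x) = c * e h f" using e_scale_left[of f h c] by (simp add: e_sym D_scale)

lemma e_diff_right: "f \<in> D ==> g \<in> D ==> h \<in> D ==> e h (%x. f x - g x) = e h f - e h g" using e_diff_left[of f g h] by (simp add: e_sym D_diff)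

lemma e_sum_left: "finite I ==> (!!i. i \<in> I ==> f i \<in> D) ==> h \<in> D ==> e (%x. \<Sum>i\<in>I. f i x) h = (\<Sum>i\<in>I. e (f i) h)" by (induction I rule: finite_induct) (auto simp: e_zero e_add_left D_sum)

lemma e_sum_right: "finite I ==> (!!i. i \<in> I ==> f i \<in> D) ==> h \<in> D ==> e h (%x. \<Sum>i\<in>I. f i x) = (\<Sum>i\<in>I. e h (f i))" using e_sum_left[of I f h] by (simp add: e_sym D_sum)

lemma e_quadratic:
assumes "f \<in> D" "g \<in> D"
shows "e (%x. t * f x + g x) (%x. t * f x + g x) = t^2 * e f f + 2 * t * e f g + e g g"
proof -
have h: "(%x. t * f x + g x) \<in> D" using assms by (rule D_lin)
have "e (%x. t * f x + g x) (%x. t * f x + g x) = t * e f (%x. t * f x + g x) + e g (%x. t * f x + g x)" by (rule e_lin[OF assms h])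
also have "e f (%x. t * f x + g x) = t * e f f + e g f" using e_lin[OF assms assms(1), of t] e_sym[OF h assms(1)] by simp
also have "e g (%x. t * f x + g x) = t * e f g + e g g" using e_lin[OF assms assms(2), of t] e_sym[OF h assms(2)] by simp
finally show ?thesis using e_sym[OF assms] by (simp add: power2_eq_square algebra_simps)
qed

lemma e_cauchy_schwarz:
assumes "f \<in> D" "g \<in> D"
shows "(e f g)^2 <= e f f * e g g"
proof (rule quadratic_nonneg_imp)
show "0 <= e f f" by (rule e_nonneg[OF assms(1)])
show "0 <= t^2 * e f f + 2 * t * e f g + e g g" for t using e_nonneg[OF D_lin[OF assms]] by (simp only: e_quadratic[OF assms])
qed

lemma e_scale2: "f \<in> D ==> e (%x. c * f x) (%x. c * f x) = c^2 * e f f" by (simp add: e_scale_left e_scale_right D_scale power2_eq_square)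

lemma e_sum_sq: "f \<in> D ==> g \<in> D ==> e (%x. f x + g x) (%x. f x + g x) = e f f + 2 * e f g + e g g" using e_quadratic[of f g 1] by simp

lemma e_diff_sq: "f \<in> D ==> g \<in> D ==> e (%x. f x - g x) (%x. f x - g x) = e f f - 2 * e f g + e g g" by (simp add: e_diff_left e_diff_right D_diff e_sym[of g f])

lemma e_sum_le:
assumes "f \<in> D" "g \<in> D"
shows "e (%x. f x + g x) (%x. f x + g x) <= 2 * e f f + 2 * e g g" using e_sum_sq[OF assms] e_diff_sq[OF assms] e_nonneg[OF D_diff[OF assms]] by linarith

lemma sq_diff_integrable:
assumes "integrable M (%x. (f x)^2)" "integrable M (%x. (g x)^2)" "f \<in> borel_measurable M" "g \<in> borel_measurable M"
shows "integrable M (%x. (f x - g x :: real)^2)"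
proof (rule integrable_dom)
show "integrable M (%x. 2 * (f x)^2 + 2 * (g x)^2)" using assms by simp
show "AE x in M. norm ((f x - g x)^2) <= norm (2 * (f x)^2 + 2 * (g x)^2)"
proof (rule AE_I2)
 fix x
 have "2 * (f x)^2 + 2 * (g x)^2 - (f x - g x)\<^sup>2 = (f x + g x)^2" by (simp add: power2_eq_square algebra_simps)
 then have "(f x - g x)^2 <= 2 * (f x)^2 + 2 * (g x)^2" using zero_le_power2[of "f x + g x"] by linarith
 then show "norm ((f x - g x)^2) <= norm (2 * (f x)^2 + 2 * (g x)^2)" by (simp add: abs_of_nonneg)
qed
qed (use assms in measurable)

lemma mult_integrable:
assumes "integrable M (%x. (f x)^2)" "integrable M (%x. (g x)^2)" "f \<in> borel_measurable M" "g \<in> borel_measurable M"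
shows "integrable M (%x. f x * g x :: real)"
proof (rule integrable_dom)
show "integrable M (%x. (f x)^2 + (g x)^2)" using assms by simp
show "AE x in M. norm (f x * g x) <= norm ((f x)^2 + (g x)^2)"
proof (rule AE_I2)
 fix x
 have "2 * \<bar>f x * g x\<bar> <= (f x)^2 + (g x)^2" using sum_squares_bound[of "\<bar>f x\<bar>" "\<bar>g x\<bar>"] by (simp add: abs_mult)
 moreover have "0 <= \<bar>f x * g x\<bar>" by simp
 ultimately show "norm (f x * g x) <= norm ((f x)^2 + (g x)^2)" unfolding real_norm_def by linarith
qed
qed (use assms in measurable)

lemma sq_triangle_integral:
fixes f g u :: "'a => real"
assumes f: "integrable M (%x. (f x - u x)^2)" and g: "integrable M (%x. (g x - u x)^2)"
 and m: "f \<in> borel_measurable M" "g \<in> borel_measurable M" "u \<in> borel_measurable M"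
shows "(LINT x|M. (f x - g x)^2) <= 2 * (LINT x|M. (f x - u x)^2) + 2 * (LINT x|M. (g x - u x)^2)"
proof -
have le: "(f x - g x)^2 <= 2 * (f x - u x)^2 + 2 * (g x - u x)^2" for x
proof -
 have "2 * (f x - u x)^2 + 2 * (g x - u x)^2 - (f x - g x)\<^sup>2 = (f x + g x - 2 * u x)^2" by (simp add: power2_eq_square algebra_simps)
 then show ?thesis using zero_le_power2[of "f x + g x - 2 * u x"] by linarith
qed
have "integrable M (%x. ((f x - u x) - (g x - u x))^2)" by (rule sq_diff_integrable[OF f g]) (use m in measurable)
then have "(LINT x|M. (f x - g x)^2) <= (LINT x|M. 2 * (f x - u x)^2 + 2 * (g x - u x)^2)" using f g by (intro integral_mono le) auto
then show ?thesis using f g by simp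
qed

lemma AE_eq_of_sq_integral_zero:
assumes "integrable M (%x. (f x - g x)^2)" "(LINT x|M. (f x - g x)^2) = (0::real)"
shows "AE x in M. f x = (g x :: real)" using integral_nonneg_eq_0_iff_AE[OF assms(1)] assms(2) by auto

lemma form_norm_sq: "f \<in> D ==> (form_norm M e f)\<^sup>2 = (LINT x|M. (f x)^2) + e f f" using e_nonneg[of f] by (simp add: form_norm_def l2_norm_def)

text \<open>Closedness, with the limit identified by its \<open>L\<^sup>2\<close> limit.\<close>

lemma form_limit:
assumes S: "!!k. S k \<in> D" and cauchy: "!!eps. eps > 0 ==> EX K. ALL j>=K. ALL k>=K. e (%x. S j x - S k x) (%x. S j x - S k x) < eps"
 and u: "u \<in> borel_measurable M" and int: "!!k. integrable M (%x. (S k x - u x)^2)"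
 and lim: "(%k. \<integral>x. (S k x - u x)^2 \<partial>M) ---> 0"
shows "u \<in> D" "(%k. e (%x. S k x - u x) (%x. S k x - u x)) ---> 0"
proof -
have Sm [measurable]: "S k \<in> borel_measurable M" for k using S by (rule D_measurable)
have "ALL eps>0. EX K. ALL j>=K. ALL k>=K. form_norm M e (%x. S j x - S k x) < eps"
proof (intro allI impI)
 fix eps :: real assume eps: "eps > 0"
 then have e2: "eps\<^sup>2 > 0" by simp
 obtain K1 where K1: "!!j k. j >= K1 ==> k >= K1 ==> e (%x. S j x - S k x) (%x. S j x - S k x) < eps\<^sup>2 / 4" using cauchy[of "eps\<^sup>2 / 4"] e2 by auto
 have "eventually (%k. (LINT x|M. (S k x - u x)^2) < eps\<^sup>2 / 8) sequentially" using lim e2 by (intro order_tendstoD(2)[OF lim]) auto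
 then obtain K2 where K2: "!!k. k >= K2 ==> (LINT x|M. (S k x - u x)^2) < eps\<^sup>2 / 8" by (auto simp: eventually_sequentially)
 show "EX K. ALL j>=K. ALL k>=K. form_norm M e (%x. S j x - S k x) < eps"
 proof (intro exI[of _ "max K1 K2"] allI impI)
  fix j k assume jk: "max K1 K2 <= j" "max K1 K2 <= k"
  have "(form_norm M e (%x. S j x - S k x))^2 = (LINT x|M. (S j x - S k x)^2) + e (%x. S j x - S k x) (%x. S j x - S k x)" by (rule form_norm_sq[OF D_diff[OF S S]])
  also have "(LINT x|M. (S j x - S k x)^2) <= 2 * (LINT x|M. (S j x - u x)^2) + 2 * (LINT x|M. (S k x - u x)^2)" by (intro sq_triangle_integral int Sm u)
  finally have "(form_norm M e (%x. S j x - S k x))^2 <= 2 * (LINT x|M. (S j x - u x)^2) + 2 * (LINT x|M. (S k x - u x)^2)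
    + e (%x. S j x - S k x) (%x. S j x - S k x)" by simp
  moreover have "(LINT x|M. (S j x - u x)^2) < eps\<^sup>2 / 8" "(LINT x|M. (S k x - u x)^2) < eps\<^sup>2 / 8"
   "e (%x. S j x - S k x) (%x. S j x - S k x) < eps\<^sup>2 / 4" using K2[of j] K2[of k] K1[of j k] jk by simp_all
  ultimately have "(form_norm M e (%x. S j x - S k x))^2 < eps\<^sup>2" using e2 by linarith
  then show "form_norm M e (%x. S j x - S k x) < eps" using eps by (rule power2_less_imp_less[OF _ less_imp_le])
 qed
qed
then have "\<exists>f\<in>D. (%k. form_norm M e (%x. S k x - f x)) ---> 0" using S by (intro form_complete) auto
then obtain f where f: "f \<in> D" "(%k. form_norm M e (%x. S k x - f x)) ---> 0" by blast
have [measurable]: "f \<in> borel_measurable M" using f(1) by (rule D_measurable)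
have fn: "(%k. (LINT x|M. (S k x - f x)^2) + e (%x. S k x - f x) (%x. S k x - f x)) ---> 0" using tendsto_power[OF f(2), of 2] by (simp add: form_norm_sq[OF D_diff[OF S f(1)]])
have nn: "0 <= (LINT x|M. (S k x - f x)^2)" "0 <= e (%x. S k x - f x) (%x. S k x - f x)" for k using e_nonneg[OF D_diff[OF S f(1)]] by auto
have l2: "(%k. \<integral>x. (S k x - f x)^2 \<partial>M) ---> 0" by (rule tendsto_sandwich[OF _ _ tendsto_const fn]) (use nn in auto)
have le: "(%k. e (%x. S k x - f x) (%x. S k x - f x)) ---> 0" by (rule tendsto_sandwich[OF _ _ tendsto_const fn]) (use nn in auto)
have intf: "integrable M (%x. (S k x - f x)^2)" for k by (rule D_sq_integrable[OF D_diff[OF S f(1)]])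
have flip: "(S k x - u x)^2 = (u x - S k x)^2" "(S k x - f x)^2 = (f x - S k x)^2" for k x by (auto simp: power2_commute)
have intu: "integrable M (%x. (f x - u x)^2)"
proof -
 have "integrable M (%x. ((S 0 x - u x) - (S 0 x - f x))^2)" by (intro sq_diff_integrable int intf) (use u in measurable)
 then show ?thesis by simp
qed
have "(LINT x|M. (f x - u x)^2) <= 2 * (LINT x|M. (S k x - f x)^2) + 2 * (LINT x|M. (S k x - u x)^2)" for k using sq_triangle_integral[of f "S k" u] int intf u unfolding flip by simp
moreover have "(%k. 2 * (LINT x|M. (S k x - f x)^2) + 2 * (LINT x|M. (S k x - u x)^2)) ---> 2 * 0 + 2 * 0" by (intro tendsto_intros l2 lim)
ultimately have "(LINT x|M. (f x - u x)^2) <= 0" using LIMSEQ_le_const[of "%k. 2 * (LINT x|M. (S k x - f x)^2) + 2 * (LINT x|M. (S k x - u x)^2)" 0 "\<integral>x. (f x - u x)^2 \<partial>M"] by auto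
moreover have "0 <= (LINT x|M. (f x - u x)^2)" by simp
ultimately have ae: "AE x in M. f x = u x" by (intro AE_eq_of_sq_integral_zero intu) linarith
show uD: "u \<in> D" by (rule D_AE[OF f(1) u ae])
have "e (%x. S k x - u x) (%x. S k x - u x) = e (%x. S k x - f x) (%x. S k x - f x)" for k by (intro e_AE2 D_diff S uD f(1)) (use ae in auto)
then show "(%k. e (%x. S k x - u x) (%x. S k x - u x)) ---> 0" using le by simp
qed

lemma energy_limit_le:
assumes S: "!!k. S k \<in> D" and u: "u \<in> D" and lim: "(%k. e (%x. S k x - u x) (%x. S k x - u x)) ---> 0"
 and le: "!!k. e (S k) (S k) <= C"
shows "e u u <= C"
proof (rule LIMSEQ_le_const)
let ?d = "%k. e (%x. S k x - u x) (%x. S k x - u x)"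
have C: "C >= 0" using le[of 0] e_nonneg[OF S, of 0] by linarith
show "(%k. C + 2 * sqrt (C * ?d k) + ?d k) ---> C" using tendsto_add[OF tendsto_add[OF tendsto_const tendsto_mult[OF tendsto_const tendsto_real_sqrt[OF tendsto_mult[OF tendsto_const lim]]]] lim, of C 2 C] by simp
show "EX N. ALL k>=N. e u u <= C + 2 * sqrt (C * ?d k) + ?d k"
proof (intro exI allI impI)
 fix k
 have dD: "(%x. S k x - u x) \<in> D" by (rule D_diff[OF S u])
 have "e (%x. S k x - (S k x - u x)) (%x. S k x - (S k x - u x))
  = e (S k) (S k) - 2 * e (S k) (%x. S k x - u x) + ?d k" by (rule e_diff_sq[OF S dD])
 then have "e u u = e (S k) (S k) - 2 * e (S k) (%x. S k x - u x) + ?d k" by simp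
 moreover have "\<bar>e (S k) (%x. S k x - u x)\<bar> <= sqrt (C * ?d k)"
 proof -
  have "(e (S k) (%x. S k x - u x))^2 <= e (S k) (S k) * ?d k" by (rule e_cauchy_schwarz[OF S dD])
  also have "... <= C * ?d k" using le e_nonneg[OF dD] by (intro mult_right_mono)
  finally have "sqrt ((e (S k) (%x. S k x - u x))^2) <= sqrt (C * ?d k)" by (rule real_sqrt_le_mono)
  then show ?thesis by simp
 qed
 ultimately show "e u u <= C + 2 * sqrt (C * ?d k) + ?d k" using le[of k] by linarith
qed
qed


lemmas carre_parts = cdc[unfolded carre_du_champ_def]
lemmas gam_int = carre_parts[THEN conjunct1, rule_format]
lemmas gam_sym = carre_parts[THEN conjunct2, THEN conjunct1, rule_format]
lemmas gam_lin = carre_parts[THEN conjunct2, THEN conjunct2, THEN conjunct1, rule_format]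
lemmas gam_AE = carre_parts[THEN conjunct2, THEN conjunct2, THEN conjunct2, THEN conjunct1, rule_format]
lemmas gam_nonneg = carre_parts[THEN conjunct2, THEN conjunct2, THEN conjunct2, THEN conjunct2, THEN conjunct1, rule_format]
lemmas e_gam = carre_parts[THEN conjunct2, THEN conjunct2, THEN conjunct2, THEN conjunct2, THEN conjunct2, THEN conjunct1, rule_format]
lemmas gam_identity = carre_parts[THEN conjunct2, THEN conjunct2, THEN conjunct2, THEN conjunct2, THEN conjunct2, THEN conjunct2, rule_format]

lemma gam_measurable: "f \<in> D ==> g \<in> D ==> gam f g \<in> borel_measurable M" using gam_int by (rule borel_measurable_integrable)

lemma gam_zero: "h \<in> D ==> AE x in M. gam (%x. 0) h x = 0" using gam_lin[OF D_zero D_zero, of h 1] by (simp add: eventually_mono)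

lemma gam_add: "f \<in> D ==> g \<in> D ==> h \<in> D ==> AE x in M. gam (%y. f y + g y) h x = gam f h x + gam g h x" using gam_lin[of f g h 1] by simp

lemma gam_scale: "f \<in> D ==> h \<in> D ==> AE x in M. gam (%y. c * f y) h x = c * gam f h x" using gam_lin[OF _ D_zero, of f h c] gam_zero[of h] by (auto elim: eventually_elim2)

lemma gam_diff: "f \<in> D ==> g \<in> D ==> h \<in> D ==> AE x in M. gam (%y. f y - g y) h x = gam f h x - gam g h x" using gam_lin[of g f h "-1"] by simp

lemma gam_sum:
assumes "finite I" "!!i. i \<in> I ==> f i \<in> D" "h \<in> D"
shows "AE x in M. gam (%y. \<Sum>i\<in>I. f i y) h x = (\<Sum>i\<in>I. gam (f i) h x)" using assms(1,2)
proof (induction I rule: finite_induct)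
case empty
then show ?case using gam_zero[OF assms(3)] by simp
next
case (insert i I)
have "AE x in M. gam (%y. f i y + (\<Sum>i\<in>I. f i y)) h x = gam (f i) h x + gam (%y. \<Sum>i\<in>I. f i y) h x" using insert by (intro gam_add D_sum assms(3)) auto
moreover have "AE x in M. gam (%y. \<Sum>i\<in>I. f i y) h x = (\<Sum>i\<in>I. gam (f i) h x)" using insert by auto
ultimately show ?case by eventually_elim (simp add: insert(1,2))
qed

lemma gam_cauchy_schwarz:
assumes f: "f \<in> D" and g: "g \<in> D"
shows "AE x in M. (gam f g x)^2 <= gam f f x * gam g g x"
proof -
have "AE x in M. \<forall>t\<in>\<rat>. 0 <= t^2 * gam f f x + 2 * t * gam f g x + gam g g x"
proof (rule AE_ball_countable')
 show "countable (\<rat> :: real set)" by (rule countable_rat)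
 fix t :: real
 have h: "(%x. t * f x + g x) \<in> D" using f g by (rule D_lin)
 show "AE x in M. 0 <= t^2 * gam f f x + 2 * t * gam f g x + gam g g x" using gam_nonneg[OF h] gam_lin[OF f g h, of t] gam_sym[OF f h] gam_sym[OF g h] gam_lin[OF f g f, of t] gam_lin[OF f g g, of t] gam_sym[OF f g]
 proof eventually_elim
  case (elim x)
  then show ?case by (simp add: power2_eq_square algebra_simps)
 qed
qed
then show ?thesis using gam_nonneg[OF f]
proof eventually_elim
 case (elim x)
 then show ?case using quadratic_nonneg_rat[of "gam f f x" "gam f g x" "gam g g x"] by (intro quadratic_nonneg_imp) auto
qed
qed

lemma abs_le_weighted:
fixes a b c tau :: real
assumes "c^2 <= a * b" "a >= 0" "b >= 0" "tau > 0"
shows "\<bar>c\<bar> <= (tau * a + b / tau) / 2"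
proof (rule power2_le_imp_le)
have "\<bar>c\<bar>\<^sup>2 <= (tau * a) * (b / tau)" using assms by simp
also have "... <= ((tau * a + b / tau) / 2)^2"
proof -
 have "((p + q) / 2)^2 - p * q = ((p - q) / 2)^2" for p q :: real by (simp add: power2_eq_square field_simps)
 then show ?thesis using zero_le_power2[of "(tau * a - b / tau) / 2"] by (metis diff_ge_0_iff_ge)
qed
finally show "\<bar>c\<bar>\<^sup>2 <= ((tau * a + b / tau) / 2)^2" .
show "0 <= (tau * a + b / tau) / 2" using assms by simp
qed

lemma gam_abs_le:
assumes f: "f \<in> D" and g: "g \<in> D" and tau: "tau > 0"
shows "AE x in M. \<bar>gam f g x\<bar> <= (tau * gam f f x + gam g g x / tau) / 2" using gam_cauchy_schwarz[OF f g] gam_nonneg[OF f] gam_nonneg[OF g] by eventually_elim (rule abs_le_weighted[OF _ _ _ tau])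

lemma e_gam2: "f \<in> D ==> (LINT x|M. gam f f x) = 2 * e f f" using e_gam[of f f] by simp

text \<open>The weight tau stands in for the square root of the product of the energies: the energy
  of f may be large as long as that of g is made small afterwards, even relative to tau.\<close>

lemma gam_L1:
assumes f: "f \<in> D" and g: "g \<in> D" and tau: "tau > 0"
shows "(LINT x|M. \<bar>gam f g x\<bar>) <= tau * e f f + e g g / tau"
proof -
have "(LINT x|M. \<bar>gam f g x\<bar>) <= (LINT x|M. (tau * gam f f x + gam g g x / tau) / 2)" using gam_int[OF f g] gam_int[OF f f] gam_int[OF g g] by (intro integral_mono_AE gam_abs_le f g tau) auto
also have "... = tau * e f f + e g g / tau" using gam_int[OF f f] gam_int[OF g g] by (simp add: e_gam2[OF f] e_gam2[OF g] field_simps)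
finally show ?thesis .
qed

lemma gam_zero_of_diag: "f \<in> D ==> g \<in> D ==> AE x in M. gam f f x = 0 --> gam f g x = 0" using gam_cauchy_schwarz[of f g] by (auto elim!: eventually_mono)

section \<open>Slices by level and contractions\<close>

lemma clamp_eq: "c > 0 ==> min c (max 0 t) = c * min 1 (max 0 ((1 / c) * t :: real))" by (auto simp: min_def max_def field_simps)

lemma D_clamp:
assumes "c >= 0" "u \<in> D"
shows "(%x. min c (max 0 (u x))) \<in> D"
proof (cases "c = 0")
case True
then have "(%x. min c (max 0 (u x))) = (%x. 0)" by auto
then show ?thesis using D_zero by simp
next
case False
then have c: "c > 0" using assms by simp
have "(%x. c * min 1 (max 0 ((1 / c) * u x))) \<in> D" by (intro D_scale D_unit assms)
then show ?thesis by (simp only: clamp_eq[OF c])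
qed

lemma e_clamp:
assumes "c > 0" "u \<in> D"
shows "e (%x. min c (max 0 (u x))) (%x. min c (max 0 (u x))) <= e u u"
proof -
have v: "(%x. (1 / c) * u x) \<in> D" by (intro D_scale assms)
have "e (%x. c * min 1 (max 0 ((1 / c) * u x))) (%x. c * min 1 (max 0 ((1 / c) * u x)))
 = c^2 * e (%x. min 1 (max 0 ((1 / c) * u x))) (%x. min 1 (max 0 ((1 / c) * u x)))" by (rule e_scale2[OF D_unit[OF v]])
also have "... <= c^2 * e (%x. (1 / c) * u x) (%x. (1 / c) * u x)" by (intro mult_left_mono e_unit v) simp
also have "... = e u u" using assms by (simp only: e_scale2) (simp add: power2_eq_square)
finally show ?thesis by (simp only: clamp_eq[OF assms(1)])
qed

lemma D_slice:
assumes "u \<in> D" "0 <= a" "a <= b" and nn: "!!x. 0 <= u x"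
shows "(%x. min b (u x) - min a (u x)) \<in> D"
proof -
have "(%x. min b (max 0 (u x)) - min a (max 0 (u x))) \<in> D" using assms by (intro D_diff D_clamp) auto
then show ?thesis by (simp only: max_absorb2[OF nn])
qed

text \<open>A normal contraction fixes the lower slice and kills a small multiple of the upper one.\<close>

lemma e_slices_nonneg:
assumes u: "u \<in> D" and nn: "!!x. 0 <= u x" and abcd: "0 <= a" "a < b" "b <= c" "c < d"
shows "0 <= e (%x. min b (u x) - min a (u x)) (%x. min d (u x) - min c (u x))" (is "0 <= e ?p ?q")
proof (rule ccontr)
assume "\<not> 0 <= e ?p ?q"
then have neg: "e ?p ?q < 0" by simp
have p: "?p \<in> D" and q: "?q \<in> D" using abcd by (auto intro!: D_slice u nn)
have le: "e ?p ?p <= e (%x. t * ?q x + ?p x) (%x. t * ?q x + ?p x)" if t: "t > 0" for t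
proof -
 have h: "(%x. t * ?q x + ?p x) \<in> D" by (rule D_lin[OF q p])
 have "min (b - a) (max 0 (t * ?q x + ?p x)) = ?p x" for x
 proof (cases "u x <= c")
  case True
  then have "?q x = 0" using abcd by auto
  moreover have "0 <= ?p x" "?p x <= b - a" using abcd nn[of x] by auto
  ultimately show ?thesis by simp
 next
  case False
  then have "?p x = b - a" "?q x >= 0" using abcd by auto
  moreover have "t * ?q x >= 0" using t \<open>?q x >= 0\<close> by simp
  ultimately show ?thesis using abcd by simp
 qed
 then show ?thesis using e_clamp[of "b - a", OF _ h] abcd by simp
qed
\<comment> \<open>Small enough for the quadratic term t * e q q not to outweigh the negative mixed
  term; the 1 in the denominator covers e q q = 0.\<close>
define t where "t = - e ?p ?q / (e ?q ?q + 1)"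
have q0: "e ?q ?q >= 0" by (rule e_nonneg[OF q])
have t: "t > 0" using neg q0 unfolding t_def by (intro divide_pos_pos) auto
have "e (%x. t * ?q x + ?p x) (%x. t * ?q x + ?p x) = t^2 * e ?q ?q + 2 * t * e ?q ?p + e ?p ?p" by (rule e_quadratic[OF q p])
with le[OF t] have "0 <= t * (t * e ?q ?q + 2 * e ?p ?q)" by (simp add: e_sym[OF q p] power2_eq_square algebra_simps)
then have "0 <= t * e ?q ?q + 2 * e ?p ?q" using t by (simp add: zero_le_mult_iff)
moreover have "t * e ?q ?q <= - e ?p ?q"
proof -
 have "t * e ?q ?q <= t * (e ?q ?q + 1)" using t by simp
 also have "... = - e ?p ?q" using q0 by (simp add: t_def)
 finally show ?thesis .
qed
ultimately show False using neg by linarith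
qed

text \<open>The value at t \<ge> 0 of the piecewise linear function that vanishes at 0, has slope s
  k between k h and (k + 1) h, and is constant beyond m h.\<close>

definition slices :: "real => nat => (nat => real) => real => real" where
"slices h m s t = (\<Sum>k<m. s k * (min (real (Suc k) * h) t - min (real k * h) t))"

abbreviation slice :: "('a => real) => real => nat => 'a => real" where
"slice u h k \<equiv> (%x. min (real (Suc k) * h) (u x) - min (real k * h) (u x))"

lemma slice_D: "u \<in> D ==> (!!x. 0 <= u x) ==> h > 0 ==> slice u h k \<in> D" by (intro D_slice) auto

lemma slice_e_nonneg:
assumes "u \<in> D" "!!x. 0 <= u x" "h > 0"
shows "0 <= e (slice u h j) (slice u h k)"
proof -
have lt: "0 <= e (slice u h j) (slice u h k)" if "j < k" for j k using that assms by (intro e_slices_nonneg) auto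
show ?thesis using lt[of j k] lt[of k j] e_nonneg[OF slice_D[OF assms, of j]] e_sym[OF slice_D[OF assms, of j] slice_D[OF assms, of k]] by (cases j k rule: linorder_cases) auto
qed

lemma slices_D:
assumes "u \<in> D" "!!x. 0 <= u x" "h > 0"
shows "(%x. slices h m s (u x)) \<in> D" unfolding slices_def by (intro D_sum D_scale slice_D assms) auto

lemma slices_bilinear:
assumes "u \<in> D" "!!x. 0 <= u x" "h > 0"
shows "e (%x. slices h m s (u x)) (%x. slices h m t (u x)) = (\<Sum>j<m. \<Sum>k<m. (s j * t k) * e (slice u h j) (slice u h k))"
proof -
note P = slice_D[OF assms]
have aP: "(%x. a k * slice u h k x) \<in> D" for a k by (intro D_scale P)
have sum: "(%x. \<Sum>k<m. t k * slice u h k x) \<in> D" by (intro D_sum aP) auto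
have "e (%x. slices h m s (u x)) (%x. slices h m t (u x)) = (\<Sum>j<m. e (%x. s j * slice u h j x) (%x. \<Sum>k<m. t k * slice u h k x))" unfolding slices_def by (intro e_sum_left aP sum) auto
also have "... = (\<Sum>j<m. \<Sum>k<m. e (%x. s j * slice u h j x) (%x. t k * slice u h k x))" by (intro sum.cong refl e_sum_right aP) auto
also have "... = (\<Sum>j<m. \<Sum>k<m. (s j * t k) * e (slice u h j) (slice u h k))" by (intro sum.cong refl) (simp only: e_scale_left[OF P aP] e_scale_right[OF P P] mult.assoc)
finally show ?thesis .
qed

text \<open>The mutual energies of slices are nonnegative, so the bilinear expansion increases with
  the slopes. Comparison with constant slopes gives the contraction property for piecewise linear
  functions.\<close>

lemma slices_mono:
assumes "u \<in> D" "!!x. 0 <= u x" "h > 0"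
 and "!!k. k < m ==> \<bar>s k\<bar> <= s' k" "!!k. k < m ==> \<bar>t k\<bar> <= t' k"
shows "e (%x. slices h m s (u x)) (%x. slices h m t (u x)) <= e (%x. slices h m s' (u x)) (%x. slices h m t' (u x))" unfolding slices_bilinear[OF assms(1-3)]
proof (intro sum_mono mult_right_mono slice_e_nonneg[OF assms(1-3)])
fix j k assume "j \<in> {..<m}" "k \<in> {..<m}"
then have "\<bar>s j * t k\<bar> <= s' j * t' k" unfolding abs_mult using assms(4,5) by (intro mult_mono) (auto intro: order_trans[OF abs_ge_zero])
then show "s j * t k <= s' j * t' k" by simp
qed

lemma slices_1:
assumes "h > 0" "0 <= t" "t <= real m * h"
shows "slices h m (%k. c) t = c * t"
proof -
have "(\<Sum>k<m. min (real (Suc k) * h) t - min (real k * h) t) = min (real m * h) t - min (real 0 * h) t" by (rule sum_lessThan_telescope)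
then show ?thesis using assms by (simp add: slices_def sum_distrib_left[symmetric])
qed

lemma slices_D_energy:
assumes u: "u \<in> D" and nn: "!!x. 0 <= u x" and h: "h > 0" and um: "!!x. u x <= real m * h"
 and s: "!!k. k < m ==> \<bar>s k\<bar> <= S"
shows "(%x. slices h m s (u x)) \<in> D"
 and "e (%x. slices h m s (u x)) (%x. slices h m s (u x)) <= S^2 * e u u"
proof -
show "(%x. slices h m s (u x)) \<in> D" by (rule slices_D[OF u nn h])
have "e (%x. slices h m s (u x)) (%x. slices h m s (u x)) <= e (%x. slices h m (%k. S) (u x)) (%x. slices h m (%k. S) (u x))" by (rule slices_mono[OF u nn h s s])
also have "... = S^2 * e u u" by (simp only: slices_1[OF h nn um] e_scale2[OF u])
finally show "e (%x. slices h m s (u x)) (%x. slices h m s (u x)) <= S^2 * e u u" .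
qed

lemma slices_refine:
assumes q: "q > 0"
shows "slices h m s t = slices (h / real q) (m * q) (%k. s (k div q)) t"
proof -
let ?g = "%k. s (k div q) * (min (real (Suc k) * (h / real q)) t - min (real k * (h / real q)) t)"
have "slices (h / real q) (m * q) (%k. s (k div q)) t = (\<Sum>j<m. sum ?g {j * q ..< j * q + q})" unfolding slices_def by (rule sum.nat_group[symmetric])
also have "... = (\<Sum>j<m. s j * (min (real (Suc j) * h) t - min (real j * h) t))"
proof (rule sum.cong[OF refl])
 fix j
 have "sum ?g {j * q ..< j * q + q} = (\<Sum>k\<in>{j * q ..< j * q + q}. s j * (min (real (Suc k) * (h / real q)) t - min (real k * (h / real q)) t))"
 proof (rule sum.cong[OF refl])
  fix k assume k: "k \<in> {j * q ..< j * q + q}"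
  have "k div q = j" using k q by (intro div_nat_eqI) (auto simp: mult.commute)
  then show "?g k = s j * (min (real (Suc k) * (h / real q)) t - min (real k * (h / real q)) t)" by simp
 qed
 also have "... = s j * (min (real (j * q + q) * (h / real q)) t - min (real (j * q) * (h / real q)) t)" by (simp only: sum_distrib_left[symmetric] sum_Suc_diff'[of "j * q" "j * q + q" "%k. min (real k * (h / real q)) t", OF le_add1])
 also have "real (j * q + q) * (h / real q) = real (Suc j) * h" using q by (simp add: field_simps)
 also have "real (j * q) * (h / real q) = real j * h" using q by simp
 finally show "sum ?g {j * q ..< j * q + q} = s j * (min (real (Suc j) * h) t - min (real j * h) t)" .
qed
finally show ?thesis by (simp add: slices_def)
qed

lemma slices_diff: "slices h m s t - slices h m s' t = slices h m (%k. s k - s' k) t" by (simp add: slices_def sum_subtractf left_diff_distrib)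

lemma slices_approx:
assumes h: "h > 0" and t: "0 <= t" "t <= real m * h"
 and F: "!!s. 0 <= s ==> s <= real m * h ==> (F has_real_derivative psi s) (at s)"
 and L: "!!r s. 0 <= r ==> r <= real m * h ==> 0 <= s ==> s <= real m * h ==> \<bar>psi r - psi s\<bar> <= L * \<bar>r - s\<bar>" and L0: "L >= 0"
shows "\<bar>slices h m (%k. psi (real k * h)) t - (F t - F 0)\<bar> <= L * h * t"
proof -
let ?c = "%k. min (real k * h) t"
have tele: "(\<Sum>k<m. G (?c (Suc k)) - G (?c k)) = G t - G 0" for G :: "real => real"
proof -
 have "(\<Sum>k<m. G (?c (Suc k)) - G (?c k)) = G (?c m) - G (?c 0)" by (rule sum_lessThan_telescope)
 then show ?thesis using t by simp
qed
have "\<bar>slices h m (%k. psi (real k * h)) t - (F t - F 0)\<bar>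
  = \<bar>\<Sum>k<m. psi (real k * h) * (?c (Suc k) - ?c k) - (F (?c (Suc k)) - F (?c k))\<bar>" unfolding tele[of F, symmetric] slices_def by (simp only: sum_subtractf[symmetric])
also have "... <= (\<Sum>k<m. \<bar>psi (real k * h) * (?c (Suc k) - ?c k) - (F (?c (Suc k)) - F (?c k))\<bar>)" by (rule sum_abs)
also have "... <= (\<Sum>k<m. L * h * (?c (Suc k) - ?c k))"
proof (rule sum_mono)
 fix k assume k: "k \<in> {..<m}"
 show "\<bar>psi (real k * h) * (?c (Suc k) - ?c k) - (F (?c (Suc k)) - F (?c k))\<bar> <= L * h * (?c (Suc k) - ?c k)"
 proof (cases "t <= real k * h")
  case True
  then have "?c (Suc k) = t" "?c k = t" using h by (auto simp: min_def distrib_right)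
  then show ?thesis by simp
 next
  case False
  then have c: "?c k = real k * h" "?c k < ?c (Suc k)" "?c (Suc k) <= real (Suc k) * h" "?c (Suc k) <= t" using h by (auto simp: min_def distrib_right)
  have k0: "0 <= real k * h" using h by simp
  obtain z where z: "?c k < z" "z < ?c (Suc k)" "F (?c (Suc k)) - F (?c k) = (?c (Suc k) - ?c k) * psi z"
  proof -
   have "EX z>?c k. z < ?c (Suc k) \<and> F (?c (Suc k)) - F (?c k) = (?c (Suc k) - ?c k) * psi z" using c k0 t by (intro MVT2[OF c(2)] F) auto
   then show ?thesis using that by blast
  qed
  have "\<bar>psi (real k * h) - psi z\<bar> <= L * \<bar>real k * h - z\<bar>" using z c k0 t False by (intro L) auto
  also have "... <= L * h" using z c L0 by (intro mult_left_mono) (auto simp: distrib_right)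
  finally have *: "\<bar>psi (real k * h) - psi z\<bar> <= L * h" .
  have "psi (real k * h) * (?c (Suc k) - ?c k) - (F (?c (Suc k)) - F (?c k)) = (psi (real k * h) - psi z) * (?c (Suc k) - ?c k)" by (simp only: z(3) left_diff_distrib mult.commute[of _ "psi z"])
  moreover have "\<bar>(psi (real k * h) - psi z) * d\<bar> <= L * h * d" if "d > 0" for d using mult_right_mono[OF *, of d] that by (simp add: abs_mult)
  moreover have "?c (Suc k) - ?c k > 0" using c(2) by linarith
  ultimately show ?thesis by (simp only:)
 qed
qed
also have "... = L * h * (\<Sum>k<m. ?c (Suc k) - ?c k)" by (simp only: sum_distrib_left)
also have "(\<Sum>k<m. ?c (Suc k) - ?c k) = t" using tele[of "%x. x"] by simp
finally show ?thesis .
qed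

text \<open>The dyadic piecewise linear approximants take their slopes from \<open>psi\<close> at
  the nodes. Between a level i and a finer one the slopes differ by at most L h i, so the
  approximants are Cauchy in energy, and closedness identifies the limit. The last two claims keep
  the approximants available for computing mutual energies.\<close>

lemma contraction_nonneg:
assumes u: "u \<in> D" and nn: "!!x. 0 <= u x" and B: "!!x. u x <= B" "B > 0"
 and F: "!!s. 0 <= s ==> s <= B ==> (F has_real_derivative psi s) (at s)"
 and L: "!!r s. 0 <= r ==> r <= B ==> 0 <= s ==> s <= B ==> \<bar>psi r - psi s\<bar> <= L * \<bar>r - s\<bar>" and L0: "L >= 0"
 and S: "!!s. 0 <= s ==> s <= B ==> \<bar>psi s\<bar> <= S"
shows "(%x. F (u x) - F 0) \<in> D"
 and "e (%x. F (u x) - F 0) (%x. F (u x) - F 0) <= S^2 * e u u"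
 and "!!j. (%x. slices (B / 2 ^ j) (2 ^ j) (%k. psi (real k * (B / 2 ^ j))) (u x)) \<in> D"
 and "(%j. e (%x. slices (B / 2 ^ j) (2 ^ j) (%k. psi (real k * (B / 2 ^ j))) (u x) - (F (u x) - F 0))
      (%x. slices (B / 2 ^ j) (2 ^ j) (%k. psi (real k * (B / 2 ^ j))) (u x) - (F (u x) - F 0))) ---> 0"
proof -
define h where "h j = B / 2 ^ j" for j :: nat
have h: "h j > 0" "real (2 ^ j) * h j = B" for j using B by (auto simp: h_def)
define G where "G j x = slices (h j) (2 ^ j) (%k. psi (real k * h j)) (u x)" for j x
have node: "0 <= real k * h j" "real k * h j <= B" if "k < 2 ^ j" for k j
proof -
 show "0 <= real k * h j" using h(1)[of j] by simp
 have "real k * h j <= real (2 ^ j) * h j" using that h(1)[of j] by (intro mult_right_mono) auto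
 then show "real k * h j <= B" using h(2) by simp
qed
have GD: "G j \<in> D" and Ge: "e (G j) (G j) <= S^2 * e u u" for j
proof -
 have um: "u x <= real (2 ^ j) * h j" for x using B(1) h(2) by simp
 have s: "\<bar>psi (real k * h j)\<bar> <= S" if "k < 2 ^ j" for k using node[OF that] by (rule S)
 show "G j \<in> D" "e (G j) (G j) <= S^2 * e u u" unfolding G_def[abs_def] by (rule slices_D_energy[where S = S, OF u nn h(1) um s]; assumption)+
qed
have um [measurable]: "u \<in> borel_measurable M" by (rule D_measurable[OF u])
have Fm: "(%x. F (u x) - F 0) \<in> borel_measurable M"
proof -
 have "continuous_on {0..B} F" by (rule DERIV_continuous_on[of "{0..B}" F psi], rule has_field_derivative_at_within, rule F) auto
 then have "(%s. indicator {0..B} s *\<^sub>R F s) \<in> borel_measurable borel" by (intro borel_measurable_continuous_on_indicator) auto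
 then have "(%x. indicator {0..B} (u x) *\<^sub>R F (u x)) \<in> borel_measurable M" by (rule measurable_compose[OF um])
 moreover have "indicator {0..B} (u x) *\<^sub>R F (u x) = F (u x)" for x using nn[of x] B(1)[of x] by simp
 ultimately have "(%x. F (u x)) \<in> borel_measurable M" by (simp only:)
 then show ?thesis by (intro borel_measurable_diff) auto
qed
have appr: "\<bar>G j x - (F (u x) - F 0)\<bar> <= L * h j * u x" for j x unfolding G_def using B nn h L0 by (intro slices_approx) (auto intro!: F L)
have intu: "integrable M (%x. (u x)^2)" by (rule D_sq_integrable[OF u])
have sq: "(G j x - (F (u x) - F 0))^2 <= (L * h j)^2 * (u x)^2" for j x using power_mono[OF appr[of j x] abs_ge_zero, of 2] by (simp add: power_mult_distrib)
have Gm [measurable]: "G j \<in> borel_measurable M" for j by (rule D_measurable[OF GD])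
have int: "integrable M (%x. (G j x - (F (u x) - F 0))^2)" for j by (rule integrable_dom[OF integrable_mult_right[OF intu, of "(L * h j)^2"]])
  (use Fm sq in \<open>auto intro!: AE_I2\<close>)
have hlim: "h ---> 0" unfolding h_def by real_asymp
have lim: "(%j. \<integral>x. (G j x - (F (u x) - F 0))^2 \<partial>M) ---> 0"
proof (rule tendsto_sandwich[OF _ _ tendsto_const])
 show "(%j. (L * h j)^2 * (LINT x|M. (u x)^2)) ---> 0" using tendsto_mult[OF tendsto_power[OF tendsto_mult[OF tendsto_const hlim], of L 2] tendsto_const, of "\<integral>x. (u x)^2 \<partial>M"] by simp
 show "eventually (%j. (LINT x|M. (G j x - (F (u x) - F 0))^2) <= (L * h j)^2 * (LINT x|M. (u x)^2)) sequentially"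
 proof (intro always_eventually allI)
  fix j
  have "(LINT x|M. (G j x - (F (u x) - F 0))^2) <= (LINT x|M. (L * h j)^2 * (u x)^2)" by (intro integral_mono int integrable_mult_right intu sq)
  then show "(LINT x|M. (G j x - (F (u x) - F 0))^2) <= (L * h j)^2 * (LINT x|M. (u x)^2)" by simp
 qed
qed (auto intro!: always_eventually)
have step: "e (%x. G j x - G i x) (%x. G j x - G i x) <= (L * h i)^2 * e u u" if "i <= j" for i j
proof -
 \<comment> \<open>Both approximants are written on the finer grid; its node k lies in the coarse
   interval with number \<open>k div q\<close>.\<close>
 define q where "q = (2::nat) ^ (j - i)"
 have q: "q > 0" "2 ^ i * q = 2 ^ j" using that by (auto simp: q_def power_add[symmetric])
 have hq: "h i / real q = h j"
 proof -
  have "(2::real) ^ i * real q = 2 ^ j" using q(2) by (metis of_nat_mult of_nat_numeral of_nat_power)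
  then show ?thesis unfolding h_def by (simp add: divide_divide_eq_left)
 qed
 have Gi: "G i x = slices (h j) (2 ^ j) (%k. psi (real (k div q) * h i)) (u x)" for x unfolding G_def by (subst slices_refine[OF q(1)]) (simp only: hq q(2))
 have eq: "G j x - G i x = slices (h j) (2 ^ j) (%k. psi (real k * h j) - psi (real (k div q) * h i)) (u x)" for x unfolding Gi unfolding G_def by (rule slices_diff)
 show ?thesis unfolding eq
 proof (rule slices_D_energy(2)[OF u nn h(1)])
  show "u x <= real (2 ^ j) * h j" for x using B(1) h(2) by simp
  fix k assume k: "k < (2::nat) ^ j"
  have kq: "k div q < 2 ^ i" using k q by (simp add: div_less_iff_less_mult)
  have hj: "h i = real q * h j" using hq q(1) by (simp add: field_simps)
  have "real k * h j - real (k div q) * h i = (real k - real (k div q) * real q) * h j" by (simp add: hj algebra_simps)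
  also have "real k - real (k div q) * real q = real (k mod q)"
  proof -
   have "real k = real (k div q * q + k mod q)" by simp
   then show ?thesis by (simp only: of_nat_add of_nat_mult)
  qed
  finally have d: "real k * h j - real (k div q) * h i = real (k mod q) * h j" .
  have "real (k mod q) * h j <= real q * h j" using q(1) h(1)[of j] by (intro mult_right_mono) (auto simp: less_imp_le)
  then have "\<bar>real k * h j - real (k div q) * h i\<bar> <= h i" unfolding d using h(1)[of j] by (simp add: hj)
  then have "L * \<bar>real k * h j - real (k div q) * h i\<bar> <= L * h i" using L0 by (rule mult_left_mono)
  then show "\<bar>psi (real k * h j) - psi (real (k div q) * h i)\<bar> <= L * h i" using L[OF node[OF k] node[OF kq]] by linarith
 qed
qed
have cauchy: "EX K. ALL j>=K. ALL k>=K. e (%x. G j x - G k x) (%x. G j x - G k x) < eps" if eps: "eps > 0" for eps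
proof -
 have "(%j. (L * h j)^2 * e u u) ---> 0" using tendsto_mult[OF tendsto_power[OF tendsto_mult[OF tendsto_const hlim], of L 2] tendsto_const, of "e u u"] by simp
 from order_tendstoD(2)[OF this eps] obtain K where K: "!!j. j >= K ==> (L * h j)\<^sup>2 * e u u < eps" by (auto simp: eventually_sequentially)
 have "e (%x. G j x - G k x) (%x. G j x - G k x) < eps" if jk: "j >= K" "k >= K" for j k
 proof (cases "k <= j")
  case True
  then show ?thesis using step[OF True] K[OF jk(2)] by linarith
 next
  case False
  then have "e (%x. G k x - G j x) (%x. G k x - G j x) < eps" using step[of j k] K[OF jk(1)] by linarith
  moreover have "e (%x. G k x - G j x) (%x. G k x - G j x) = e (%x. G j x - G k x) (%x. G j x - G k x)" using e_diff_sq[OF GD[of j] GD[of k]] e_diff_sq[OF GD[of k] GD[of j]] e_sym[OF GD[of j] GD[of k]] by simp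
  ultimately show ?thesis by simp
 qed
 then show ?thesis by blast
qed
show FD: "(%x. F (u x) - F 0) \<in> D" by (rule form_limit(1)[OF GD cauchy Fm int lim])
show "e (%x. F (u x) - F 0) (%x. F (u x) - F 0) <= S^2 * e u u" by (rule energy_limit_le[OF GD FD form_limit(2)[OF GD cauchy Fm int lim] Ge])
show "(%x. slices (B / 2 ^ j) (2 ^ j) (%k. psi (real k * (B / 2 ^ j))) (u x)) \<in> D" for j using GD[of j] unfolding G_def[abs_def] h_def .
show "(%j. e (%x. slices (B / 2 ^ j) (2 ^ j) (%k. psi (real k * (B / 2 ^ j))) (u x) - (F (u x) - F 0))
      (%x. slices (B / 2 ^ j) (2 ^ j) (%k. psi (real k * (B / 2 ^ j))) (u x) - (F (u x) - F 0))) ---> 0" using form_limit(2)[OF GD cauchy Fm int lim] unfolding G_def h_def .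
qed

end

section \<open>Smooth bump functions\<close>

text \<open>The functions p(1/t) exp(-1/t), flat at 0, form a class closed under differentiation;
  hence the polynomial parameter.\<close>

definition flat_exp :: "real poly => real => real" where
"flat_exp p t = (if t <= 0 then 0 else poly p (1 / t) * exp (- (1 / t)))"

lemma poly_exp_tendsto_0: "((%t. poly p t * exp (- t)) \<longlongrightarrow> (0::real)) at_top"
proof -
have "((%t. \<Sum>i\<le>degree p. coeff p i * (t ^ i / exp t)) \<longlongrightarrow> (\<Sum>i\<le>degree p. coeff p i * 0)) at_top" by (intro tendsto_sum tendsto_mult tendsto_const tendsto_power_div_exp_0)
then show ?thesis by (simp add: poly_altdef sum_distrib_right exp_minus divide_inverse mult.assoc)
qed

lemma flat_exp_tendsto_0: "(flat_exp p \<longlongrightarrow> 0) (at_right 0)"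
proof -
have "((%t. poly p (1 / t) * exp (- (1 / t))) \<longlongrightarrow> 0) (at_right (0::real))" using filterlim_compose[OF poly_exp_tendsto_0[of p] filterlim_inverse_at_top_right] by (simp add: inverse_eq_divide)
then show ?thesis by (rule Lim_transform_eventually) (auto simp: flat_exp_def eventually_at_filter)
qed

lemma flat_exp_deriv: "(flat_exp p has_real_derivative flat_exp (monom 1 2 * (p - pderiv p)) t) (at t)"
proof (cases t "0::real" rule: linorder_cases)
case less
have "((%t. 0) has_real_derivative 0) (at t)" by simp
then have "(flat_exp p has_real_derivative 0) (at t)" by (rule has_field_derivative_transform_within_open[of _ _ _ "{..<0}"]) (use less in \<open>auto simp: flat_exp_def\<close>)
then show ?thesis using less by (simp add: flat_exp_def)
next
case greater
have "((%t. poly p (1 / t) * exp (- (1 / t))) has_real_derivative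
  poly (pderiv p) (1 / t) * (- (1 / t^2)) * exp (- (1 / t)) + poly p (1 / t) * (exp (- (1 / t)) * (1 / t^2))) (at t)" using greater by (auto intro!: derivative_eq_intros DERIV_chain2[OF poly_DERIV] simp: power2_eq_square divide_simps)
then have "(flat_exp p has_real_derivative
  poly (pderiv p) (1 / t) * (- (1 / t^2)) * exp (- (1 / t)) + poly p (1 / t) * (exp (- (1 / t)) * (1 / t^2))) (at t)" by (rule has_field_derivative_transform_within_open[of _ _ _ "{0<..}"]) (use greater in \<open>auto simp: flat_exp_def\<close>)
then show ?thesis by (rule DERIV_cong) (use greater in \<open>simp add: flat_exp_def poly_monom power_divide algebra_simps\<close>)
next
case equal
have "((%h. (flat_exp p h - flat_exp p 0) / (h - 0)) \<longlongrightarrow> 0) (at 0)"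
proof (rule filterlim_split_at)
 have "((%h. 0) \<longlongrightarrow> (0::real)) (at_left 0)" by simp
 then show "((%h. (flat_exp p h - flat_exp p 0) / (h - 0)) \<longlongrightarrow> 0) (at_left 0)" by (rule Lim_transform_eventually) (auto simp: flat_exp_def eventually_at_filter)
 show "((%h. (flat_exp p h - flat_exp p 0) / (h - 0)) \<longlongrightarrow> 0) (at_right 0)" by (rule Lim_transform_eventually[OF flat_exp_tendsto_0[of "monom 1 1 * p"]]) (auto simp: flat_exp_def eventually_at_filter poly_monom)
qed
then show ?thesis using equal by (simp add: has_field_derivative_iff flat_exp_def)
qed

text \<open>A family closed under \<open>deriv\<close>, so that the iterated derivatives in
  \<open>smooth_compactly_supported\<close> never leave it. Differences suffice, since the factor in
  be - t brings a minus sign into the product rule.\<close>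

inductive_set bumps :: "real => real => (real => real) set" for al be where
product: "(%t. flat_exp p (t - al) * flat_exp q (be - t)) \<in> bumps al be"
| diff: "f \<in> bumps al be ==> g \<in> bumps al be ==> (%t. f t - g t) \<in> bumps al be"

lemma flat_exp_product_deriv:
"((%t. flat_exp p (t - al) * flat_exp q (be - t)) has_real_derivative
 flat_exp (monom 1 2 * (p - pderiv p)) (t - al) * flat_exp q (be - t)
  - flat_exp p (t - al) * flat_exp (monom 1 2 * (q - pderiv q)) (be - t)) (at t)" by (auto intro!: derivative_eq_intros DERIV_chain2[where f = "flat_exp _", OF flat_exp_deriv])

lemma bumps_deriv: "f \<in> bumps al be ==> \<exists>g\<in>bumps al be. ALL t. (f has_real_derivative g t) (at t)"
proof (induction rule: bumps.induct)
case (product p q)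
show ?case by (rule bexI[where x = "%t. flat_exp (monom 1 2 * (p - pderiv p)) (t - al) * flat_exp q (be - t)
   - flat_exp p (t - al) * flat_exp (monom 1 2 * (q - pderiv q)) (be - t)"], rule allI, rule flat_exp_product_deriv)
  (intro bumps.intros)
next
case (diff f g)
then obtain f' g' where "f' \<in> bumps al be" "g' \<in> bumps al be" "!!t. (f has_real_derivative f' t) (at t)" "!!t. (g has_real_derivative g' t) (at t)" by blast
then show ?case by (intro bexI[of _ "%t. f' t - g' t"]) (auto intro!: bumps.intros DERIV_diff)
qed

lemma bumps_deriv_iterate: "f \<in> bumps al be ==> (deriv ^^ k) f \<in> bumps al be"
proof (induction k)
case (Suc k)
then obtain g where "g \<in> bumps al be" "!!t. ((deriv ^^ k) f has_real_derivative g t) (at t)" using bumps_deriv by blast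
moreover from this(2) have "deriv ((deriv ^^ k) f) = g" by (intro ext DERIV_imp_deriv)
ultimately show ?case by simp
qed simp

lemma bumps_zero: "f \<in> bumps al be ==> t \<notin> {al..be} ==> f t = 0" by (induction rule: bumps.induct) (auto simp: flat_exp_def)

lemma bumps_support: "f \<in> bumps al be ==> closure {t. f t ~= 0} \<subseteq> {al..be}" by (intro closure_minimal subsetI; (rule ccontr, drule (1) bumps_zero)?) auto

lemma bumps_smooth:
assumes f: "f \<in> bumps al be"
shows "smooth_compactly_supported f" unfolding smooth_compactly_supported_def
proof (intro conjI allI)
fix k
obtain g where "!!t. ((deriv ^^ k) f has_real_derivative g t) (at t)" using bumps_deriv[OF bumps_deriv_iterate[OF f]] by blast
then show "(deriv ^^ k) f differentiable_on UNIV" unfolding differentiable_on_def by (auto intro!: differentiableI_vector simp: has_real_derivative_iff_has_vector_derivative)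
show "compact (closure {t. f t ~= 0})" unfolding compact_closure using bounded_subset[OF bounded_closed_interval subset_trans[OF closure_subset bumps_support[OF f]]] .
qed

lemma bumps_reflect: "f \<in> bumps al be ==> (%t. f (- t)) \<in> bumps (- be) (- al)"
proof (induction rule: bumps.induct)
case (product p q)
have "(%t. flat_exp p (- t - al) * flat_exp q (be - - t)) = (%t. flat_exp q (t - - be) * flat_exp p (- al - t))"
proof
 fix t
 have "- t - al = - al - t" "be - - t = t - - be" by linarith+
 then show "flat_exp p (- t - al) * flat_exp q (be - - t) = flat_exp q (t - - be) * flat_exp p (- al - t)" by (simp only: mult.commute)
qed
then show ?case by (simp only: bumps.product)
qed (rule bumps.diff)

text \<open>The function \<open>exp (-1 / (t - al) - 1 / (be - t))\<close> increases up to the midpoint.\<close>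

lemma bump_exists:
fixes al be a b :: real
assumes ab: "al < a" "a <= b" "2 * b < al + be"
obtains f f' f'' where "f \<in> bumps al be" "f' \<in> bumps al be" "f'' \<in> bumps al be"
 "!!t. (f has_real_derivative f' t) (at t)" "!!t. (f' has_real_derivative f'' t) (at t)"
 "!!t. a <= t ==> t <= b ==> f' t > 0" "!!t. al <= t ==> t <= b ==> f' t >= 0"
proof -
define f where "f = (%t. flat_exp 1 (t - al) * flat_exp 1 (be - t))"
have f: "f \<in> bumps al be" unfolding f_def by (rule bumps.intros)
obtain f' where f': "f' \<in> bumps al be" "!!t. (f has_real_derivative f' t) (at t)" using bumps_deriv[OF f] by blast
obtain f'' where f'': "f'' \<in> bumps al be" "!!t. (f' has_real_derivative f'' t) (at t)" using bumps_deriv[OF f'(1)] by blast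
have eq: "f' t = flat_exp (monom 1 2) (t - al) * flat_exp 1 (be - t) - flat_exp 1 (t - al) * flat_exp (monom 1 2) (be - t)" for t using DERIV_unique[OF f'(2)[of t]] flat_exp_product_deriv[of 1 al 1 be t] unfolding f_def by simp
have pos: "f' t > 0" if t: "al < t" "t <= b" for t
proof -
 have *: "f' t = exp (- (1 / (t - al))) * exp (- (1 / (be - t))) * ((1 / (t - al))^2 - (1 / (be - t))\<^sup>2)" using t ab unfolding eq by (simp add: flat_exp_def poly_monom algebra_simps)
 have "1 / (be - t) < 1 / (t - al)" using t ab by (intro divide_strict_left_mono) auto
 then have "(1 / (be - t))^2 < (1 / (t - al))^2" using t ab by (intro power_strict_mono) auto
 then show ?thesis unfolding * by simp
qed
have "f' al = 0" unfolding eq by (simp add: flat_exp_def)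
then have "f' t >= 0" if "al <= t" "t <= b" for t using pos[of t] that by (cases "t = al") auto
with f f' f'' pos ab show ?thesis by (intro that[of f f' f'']) auto
qed

section \<open>Functions with Lipschitz derivative\<close>

definition lips :: "real => real => (real => real) => bool" where
"lips a b psi \<longleftrightarrow> (EX L>=0. \<forall>r\<in>{a..b}. \<forall>s\<in>{a..b}. \<bar>psi r - psi s\<bar> <= L * \<bar>r - s\<bar>)"

lemma lips_bounded:
assumes "lips a b psi" "a <= b"
obtains S where "S >= 0" "!!s. s \<in> {a..b} ==> \<bar>psi s\<bar> <= S"
proof -
obtain L where L: "L >= 0" "!!r s. r \<in> {a..b} ==> s \<in> {a..b} ==> \<bar>psi r - psi s\<bar> <= L * \<bar>r - s\<bar>" using assms(1) by (auto simp: lips_def)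
show ?thesis
proof (rule that[of "\<bar>psi a\<bar> + L * (b - a)"])
 show "\<bar>psi a\<bar> + L * (b - a) >= 0" using L(1) assms(2) by simp
 fix s assume s: "s \<in> {a..b}"
 have "\<bar>psi s - psi a\<bar> <= L * \<bar>s - a\<bar>" using s by (intro L) auto
 also have "... <= L * (b - a)" using s L(1) by (intro mult_left_mono) auto
 finally show "\<bar>psi s\<bar> <= \<bar>psi a\<bar> + L * (b - a)" by linarith
qed
qed

lemma lips_const: "lips a b (%t. c)" and lips_id: "lips a b (%t. t)" unfolding lips_def by (rule exI[of _ 0], simp) (rule exI[of _ 1], simp)

lemma lips_add:
assumes "lips a b f" "lips a b g"
shows "lips a b (%t. f t + g t)"
proof -
obtain K L where K: "K >= 0" "!!r s. r \<in> {a..b} ==> s \<in> {a..b} ==> \<bar>f r - f s\<bar> <= K * \<bar>r - s\<bar>"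
 and L: "L >= 0" "!!r s. r \<in> {a..b} ==> s \<in> {a..b} ==> \<bar>g r - g s\<bar> <= L * \<bar>r - s\<bar>" using assms unfolding lips_def by metis
have "\<bar>(f r + g r) - (f s + g s)\<bar> <= (K + L) * \<bar>r - s\<bar>" if "r \<in> {a..b}" "s \<in> {a..b}" for r s using K(2)[OF that] L(2)[OF that] by (simp add: distrib_right)
then show ?thesis using K(1) L(1) unfolding lips_def by (intro exI[of _ "K + L"]) auto
qed

lemma lips_mult:
assumes "a <= b" "lips a b f" "lips a b g"
shows "lips a b (%t. f t * g t)"
proof -
obtain K L where K: "K >= 0" "!!r s. r \<in> {a..b} ==> s \<in> {a..b} ==> \<bar>f r - f s\<bar> <= K * \<bar>r - s\<bar>"
 and L: "L >= 0" "!!r s. r \<in> {a..b} ==> s \<in> {a..b} ==> \<bar>g r - g s\<bar> <= L * \<bar>r - s\<bar>" using assms unfolding lips_def by metis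
obtain S where S: "S >= 0" "!!s. s \<in> {a..b} ==> \<bar>f s\<bar> <= S" using lips_bounded[OF assms(2,1)] by blast
obtain T where T: "T >= 0" "!!s. s \<in> {a..b} ==> \<bar>g s\<bar> <= T" using lips_bounded[OF assms(3,1)] by blast
have "\<bar>f r * g r - f s * g s\<bar> <= (K * T + S * L) * \<bar>r - s\<bar>" if rs: "r \<in> {a..b}" "s \<in> {a..b}" for r s
proof -
 have "f r * g r - f s * g s = (f r - f s) * g r + f s * (g r - g s)" by (simp add: algebra_simps)
 then have "\<bar>f r * g r - f s * g s\<bar> <= \<bar>f r - f s\<bar> * \<bar>g r\<bar> + \<bar>f s\<bar> * \<bar>g r - g s\<bar>" using abs_triangle_ineq[of "(f r - f s) * g r" "f s * (g r - g s)"] by (simp add: abs_mult)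
 also have "... <= (K * \<bar>r - s\<bar>) * T + S * (L * \<bar>r - s\<bar>)" using K L S T rs by (intro add_mono mult_mono) auto
 finally show ?thesis by (simp add: algebra_simps)
qed
then show ?thesis using K(1) L(1) S(1) T(1) unfolding lips_def by (intro exI[of _ "K * T + S * L"]) auto
qed

lemma lips_deriv:
assumes ab: "a <= b" and d: "!!s. s \<in> {a..b} ==> (F has_real_derivative psi s) (at s)" and l: "lips a b psi"
shows "lips a b F"
proof -
obtain S where S: "S >= 0" "!!s. s \<in> {a..b} ==> \<bar>psi s\<bar> <= S" using lips_bounded[OF l ab] by blast
have "\<bar>F r - F s\<bar> <= S * \<bar>r - s\<bar>" if "r \<in> {a..b}" "s \<in> {a..b}" for r s using field_differentiable_bound[of "{a..b}" F psi S r s] S that has_field_derivative_at_within[OF d] by (simp add: convex_real_interval)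
then show ?thesis using S(1) unfolding lips_def by blast
qed

text \<open>Lipschitz derivatives are what the approximation by dyadic slopes asks for. The
  derivatives at the endpoints are two-sided.\<close>

definition C11 :: "real => real => (real => real) => (real => real) => bool" where
"C11 a b F psi \<longleftrightarrow> a <= b \<and> (\<forall>s\<in>{a..b}. (F has_real_derivative psi s) (at s)) \<and> lips a b psi"

lemma C11_lips: "C11 a b F psi ==> lips a b F" unfolding C11_def by (auto intro: lips_deriv)

lemma C11_id: "a <= b ==> C11 a b (%t. t) (%t. 1)" by (simp add: C11_def lips_const)

lemma C11_mult: "C11 a b F psi ==> C11 a b G eta ==> C11 a b (%t. F t * G t) (%t. psi t * G t + F t * eta t)" using C11_lips[of a b F psi] C11_lips[of a b G eta] unfolding C11_def by (auto intro!: lips_add lips_mult derivative_eq_intros)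

lemma C11_diff_const: "C11 a b F psi ==> C11 a b (%t. F t - c) psi" unfolding C11_def by (auto intro!: derivative_eq_intros)

section \<open>Locality and the chain rule\<close>

context dirichlet_structure
begin

lemma e_tendsto:
assumes S: "!!n. S n \<in> D" "f \<in> D" "(%n. e (%x. S n x - f x) (%x. S n x - f x)) ---> 0"
 and T: "!!n. T n \<in> D" "g \<in> D" "(%n. e (%x. T n x - g x) (%x. T n x - g x)) ---> 0"
shows "(%n. e (S n) (T n)) ---> e f g"
proof -
define s t where "s n = (%x. S n x - f x)" and "t n = (%x. T n x - g x)" for n
have sD: "s n \<in> D" and tD: "t n \<in> D" for n unfolding s_def t_def by (intro D_diff S T)+
have s0: "(%n. e (s n) (s n)) ---> 0" and t0: "(%n. e (t n) (t n)) ---> 0" using S(3) T(3) by (simp_all add: s_def t_def)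
have eq: "e (S n) (T n) = e f g + (e (s n) (t n) + e (s n) g + e f (t n))" for n unfolding s_def t_def by (simp add: e_diff_left e_diff_right S T D_diff)
have null: "a ---> 0" if "!!n. (a n)^2 <= b n" "b ---> 0" for a b :: "nat => real"
proof -
 have "(%n. (a n)^2) ---> 0" by (rule tendsto_sandwich[OF _ _ tendsto_const that(2)]) (use that(1) in auto)
 then show ?thesis by simp
qed
have "(%n. e (s n) (t n)) ---> 0" by (rule null[OF e_cauchy_schwarz[OF sD tD]]) (use tendsto_mult[OF s0 t0] in simp)
moreover have "(%n. e (s n) g) ---> 0" by (rule null[OF e_cauchy_schwarz[OF sD T(2)]]) (use tendsto_mult[OF s0 tendsto_const] in simp)
moreover have "(%n. e f (t n)) ---> 0" by (rule null[OF e_cauchy_schwarz[OF S(2) tD]]) (use tendsto_mult[OF tendsto_const t0] in simp)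
ultimately have "(%n. e f g + (e (s n) (t n) + e (s n) g + e f (t n))) ---> e f g + (0 + 0 + 0)" by (intro tendsto_intros)
then show ?thesis by (simp add: eq)
qed

abbreviation dyadic :: "('a => real) => real => (real => real) => nat => 'a => real" where
"dyadic u B psi n \<equiv> (%x. slices (B / 2 ^ n) (2 ^ n) (%k. psi (real k * (B / 2 ^ n))) (u x))"

lemma C11_contraction:
assumes u: "u \<in> D" and nn: "!!x. 0 <= u x" and B: "!!x. u x <= B" "B > 0" and F: "C11 0 B F psi"
shows "(%x. F (u x) - F 0) \<in> D" "!!n. dyadic u B psi n \<in> D"
 "(%n. e (%x. dyadic u B psi n x - (F (u x) - F 0)) (%x. dyadic u B psi n x - (F (u x) - F 0))) ---> 0"
proof -
have l: "lips 0 B psi" using F by (simp add: C11_def)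
obtain S where S: "!!s. s \<in> {0..B} ==> \<bar>psi s\<bar> <= S" using lips_bounded[OF l] B(2) by (metis less_imp_le)
obtain L where L: "L >= 0" "!!r s. r \<in> {0..B} ==> s \<in> {0..B} ==> \<bar>psi r - psi s\<bar> <= L * \<bar>r - s\<bar>" using l by (auto simp: lips_def)
have d: "(F has_real_derivative psi s) (at s)" if "0 <= s" "s <= B" for s using F that by (simp add: C11_def)
have L': "\<bar>psi r - psi s\<bar> <= L * \<bar>r - s\<bar>" if "0 <= r" "r <= B" "0 <= s" "s <= B" for r s using L(2)[of r s] that by simp
have S': "\<bar>psi s\<bar> <= S" if "0 <= s" "s <= B" for s using S[of s] that by simp
note * = contraction_nonneg[where F = F and psi = psi and L = L and S = S, OF u nn B]
show "(%x. F (u x) - F 0) \<in> D" by (rule *(1)) (blast intro: d L' L(1) S')+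
show "!!n. dyadic u B psi n \<in> D" by (rule *(3)) (blast intro: d L' L(1) S')+
show "(%n. e (%x. dyadic u B psi n x - (F (u x) - F 0)) (%x. dyadic u B psi n x - (F (u x) - F 0))) ---> 0" by (rule *(4)) (blast intro: d L' L(1) S')+
qed

lemma e_dyadic_tendsto:
assumes u: "u \<in> D" and nn: "!!x. 0 <= u x" and B: "!!x. u x <= B" "B > 0" and F: "C11 0 B F psi" and G: "C11 0 B G eta"
shows "(%n. e (dyadic u B psi n) (dyadic u B eta n)) ---> e (%x. F (u x) - F 0) (%x. G (u x) - G 0)" by (rule e_tendsto[where S = "dyadic u B psi" and T = "dyadic u B eta"];
  rule C11_contraction[OF u nn B F] C11_contraction[OF u nn B G])

lemma bumps_C11:
assumes "!!t. (f has_real_derivative f' t) (at t)" "f' \<in> bumps al be" "a <= b"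
shows "C11 a b f f'"
proof -
obtain f2 where f2: "f2 \<in> bumps al be" "!!t. (f' has_real_derivative f2 t) (at t)" using bumps_deriv[OF assms(2)] by blast
obtain f3 where f3: "!!t. (f2 has_real_derivative f3 t) (at t)" using bumps_deriv[OF f2(1)] by blast
have "continuous_on {a..b} f2" by (rule DERIV_continuous_on[OF has_field_derivative_at_within[OF f3]])
then have "compact (f2 ` {a..b})" by (intro compact_continuous_image) auto
then obtain S where S: "!!s. s \<in> {a..b} ==> \<bar>f2 s\<bar> <= S" using compact_imp_bounded by (fastforce simp: bounded_iff)
have "\<bar>f' r - f' s\<bar> <= S * \<bar>r - s\<bar>" if "r \<in> {a..b}" "s \<in> {a..b}" for r s using field_differentiable_bound[of "{a..b}" f' f2 S r s] S that has_field_derivative_at_within[OF f2(2)] by (simp add: convex_real_interval)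
moreover have "S >= 0" using S[of a] assms(3) by auto
ultimately show ?thesis using assms(1,3) by (auto simp: C11_def lips_def)
qed

text \<open>Smooth functions with separated supports dominate the two slices from above, so locality
together with the positivity of the form on increasing functions makes their mutual energy vanish.\<close>

lemma slice_disjoint:
assumes u: "u \<in> D" and nn: "!!x. 0 <= u x" and B: "!!x. u x <= B" "B > 0"
 and jk: "Suc j < k" "k < 2 ^ i"
shows "e (slice u (B / 2 ^ i) j) (slice u (B / 2 ^ i) k) = 0"
proof -
define h where "h = B / 2 ^ i"
have h: "h > 0" "2 ^ i * h = B" using B by (auto simp: h_def)
define p q where "p = real (Suc j) * h" and "q = real k * h"
have pq: "0 < p" "p + h <= q" "q <= B"
proof -
 show "0 < p" using h by (simp add: p_def)
 have "(real (Suc j) + 1) * h <= real k * h" using jk h by (intro mult_right_mono) auto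
 then show "p + h <= q" by (simp add: p_def q_def distrib_right)
 have "real k <= real (2 ^ i)" using jk(2) by (intro of_nat_mono) simp
 then have "real k * h <= 2 ^ i * h" using h by (intro mult_right_mono) auto
 then show "q <= B" by (simp add: q_def h)
qed
\<comment> \<open>The lower slice ends at p and the upper one begins at q \<ge> p + h; margins of h
  / 3 keep the supports apart. The lower function F is a reflected bump, decreasing on [0, p] and
  nonzero at 0, which is allowed as locality concerns F(u) - F(0).\<close>
have "- (p + h / 3) < - p" "- p <= 0" "2 * 0 < - (p + h / 3) + (p + h)" using h pq by auto
from bump_exists[OF this] obtain f f' f2 where f: "f \<in> bumps (- (p + h / 3)) (p + h)" "f' \<in> bumps (- (p + h / 3)) (p + h)"
 "!!t. (f has_real_derivative f' t) (at t)" "!!t. (f' has_real_derivative f2 t) (at t)"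
 "!!t. - p <= t ==> t <= 0 ==> f' t > 0" "!!t. - (p + h / 3) <= t ==> t <= 0 ==> f' t >= 0" by metis
have "q - h / 3 < q" "q <= B" "2 * B < (q - h / 3) + (2 * B + 1)" using h pq by auto
from bump_exists[OF this] obtain g g' g2 where g: "g \<in> bumps (q - h / 3) (2 * B + 1)" "g' \<in> bumps (q - h / 3) (2 * B + 1)"
 "!!t. (g has_real_derivative g' t) (at t)" "!!t. (g' has_real_derivative g2 t) (at t)"
 "!!t. q <= t ==> t <= B ==> g' t > 0" "!!t. q - h / 3 <= t ==> t <= B ==> g' t >= 0" by metis
define F F' where "F t = f (- t)" and "F' t = - f' (- t)" for t
have Fb: "F \<in> bumps (- (p + h)) (p + h / 3)" using bumps_reflect[OF f(1)] unfolding F_def[abs_def] minus_minus .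
have F'b: "F' \<in> bumps (- (p + h)) (p + h / 3)" using bumps.diff[OF bumps.product bumps_reflect[OF f(2)], of 0 0] unfolding F'_def[abs_def] minus_minus by (simp add: flat_exp_def cong: if_cong del: minus_add_distrib)
have Fd: "(F has_real_derivative F' t) (at t)" for t
proof -
 have "(uminus has_real_derivative - 1) (at t)" by (auto intro!: derivative_eq_intros)
 with f(3)[of "- t"] have "((%s. f (- s)) has_real_derivative f' (- t) * - 1) (at t)" by (rule DERIV_chain2[where f = f and g = uminus])
 then show ?thesis by (simp add: F_def[abs_def] F'_def)
qed
have F11: "C11 0 B F F'" and G11: "C11 0 B g g'" using Fd F'b g(2,3) B by (auto intro!: bumps_C11)
have nF: "C11 0 B (%t. - F t) (%t. - F' t)" using F11 lips_mult[OF _ lips_const[of 0 B "-1"], of F'] unfolding C11_def by (auto intro!: DERIV_minus)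
have "e (%x. F (u x) - F 0) (%x. g (u x) - g 0) = 0"
proof -
 have "closure {t. F t ~= 0} \<inter> closure {t. g t ~= 0} = {}" using bumps_support[OF Fb] bumps_support[OF g(1)] pq h by force
 then show ?thesis using lf u bumps_smooth[OF Fb] bumps_smooth[OF g(1)] unfolding local_form_def by blast
qed
moreover have "e (%x. - F (u x) - - F 0) (%x. g (u x) - g 0) = - e (%x. F (u x) - F 0) (%x. g (u x) - g 0)" using e_scale_left[OF C11_contraction(1)[OF u nn B F11] C11_contraction(1)[OF u nn B G11], of "-1"] by simp
ultimately have lim: "(%n. e (dyadic u B (%t. - F' t) n) (dyadic u B g' n)) ---> 0" using e_dyadic_tendsto[OF u nn B nF G11] by (simp only: minus_zero)
have low: "EX c>0. \<forall>t\<in>{r..s}. c <= psi t" if "r <= s" "!!t. t \<in> {r..s} ==> 0 < psi t" "!!t. (psi has_real_derivative psi' t) (at t)" for r s :: real and psi psi'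
proof -
 have "continuous_on {r..s} psi" by (rule DERIV_continuous_on[OF has_field_derivative_at_within[OF that(3)]])
 then have "\<exists>t\<in>{r..s}. \<forall>x\<in>{r..s}. psi t <= psi x" using continuous_attains_inf[of "{r..s}" psi] that(1) by simp
 then show ?thesis using that(2) by blast
qed
obtain c where c: "c > 0" "!!t. t \<in> {- p..0} ==> c <= f' t" using low[of "- p" 0 f' f2] f(4,5) pq by auto
obtain d where d: "d > 0" "!!t. t \<in> {q..B} ==> d <= g' t" using low[of q B g' g2] g(4,5) pq by auto
have F'0: "- F' t >= 0" if "0 <= t" "t <= B" for t using f(6)[of "- t"] bumps_zero[OF f(2), of "- t"] that by (cases "- (p + h / 3) <= - t") (auto simp: F'_def)
have g'0: "g' t >= 0" if "0 <= t" "t <= B" for t using g(6)[of t] bumps_zero[OF g(2), of t] that by (cases "q - h / 3 <= t") auto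
have slice_eq: "slice u h l x = slices h (2 ^ i) (%k. if k = l then 1 else 0) (u x)" if "l < 2 ^ i" for l x using that by (simp add: slices_def if_distrib[of "%z. z * _"] cong: if_cong)
\<comment> \<open>From level i on, c and d times the slopes of the two slices lie below the dyadic
  slopes of -F and g, so monotonicity in the slopes applies.\<close>
have le: "c * d * e (slice u h j) (slice u h k) <= e (dyadic u B (%t. - F' t) n) (dyadic u B g' n)" if n: "i <= n" for n
proof -
 define Q where "Q = (2::nat) ^ (n - i)"
 have Q: "Q > 0" "2 ^ i * Q = 2 ^ n" using n by (auto simp: Q_def power_add[symmetric])
 have hn: "B / 2 ^ n > 0" using B by simp
 have hQ: "h / real Q = B / 2 ^ n"
 proof -
  have "(2::real) ^ i * real Q = 2 ^ n" using Q(2) by (metis of_nat_mult of_nat_numeral of_nat_power)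
  then show ?thesis unfolding h_def by (simp add: divide_divide_eq_left)
 qed
 have hQ': "real Q * (B / 2 ^ n) = h" using hQ Q(1) by (simp add: field_simps)
 have sl: "slice u h l = (%x. slices (B / 2 ^ n) (2 ^ n) (%k. if k div Q = l then 1 else 0) (u x))" if "l < 2 ^ i" for l unfolding slice_eq[OF that] slices_refine[OF Q(1), of h "2 ^ i"] hQ Q(2) ..
 have cs: "(%x. a * slices h' m s (u x)) = (%x. slices h' m (%k. a * s k) (u x))" for a h' m s by (simp add: slices_def sum_distrib_left mult.assoc)
 have j: "j < 2 ^ i" using jk by simp
 have D: "slice u h j \<in> D" "slice u h k \<in> D" by (rule slice_D[OF u nn h(1)])+
 have node: "real (l div Q) * h <= real l * (B / 2 ^ n)" "real l * (B / 2 ^ n) <= real (Suc (l div Q)) * h" for l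
 proof -
  have "real (l div Q * Q) <= real l" "real l <= real (Suc (l div Q) * Q)" using dividend_less_div_times[OF Q(1), of l] by (simp_all only: of_nat_le_iff) auto
  then have "real (l div Q * Q) * (B / 2 ^ n) <= real l * (B / 2 ^ n)" "real l * (B / 2 ^ n) <= real (Suc (l div Q) * Q) * (B / 2 ^ n)" using hn by (intro mult_right_mono; simp)+
  then show "real (l div Q) * h <= real l * (B / 2 ^ n)" "real l * (B / 2 ^ n) <= real (Suc (l div Q)) * h" unfolding hQ'[symmetric] by (simp_all only: of_nat_mult mult.assoc)
 qed
 have range: "0 <= real l * (B / 2 ^ n)" "real l * (B / 2 ^ n) <= B" if "l < 2 ^ n" for l
 proof -
  show "0 <= real l * (B / 2 ^ n)" using hn by (intro mult_nonneg_nonneg) auto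
  have "real l <= real (2 ^ n)" using that by (intro of_nat_mono) simp
  then have "real l * (B / 2 ^ n) <= 2 ^ n * (B / 2 ^ n)" using hn by (intro mult_right_mono) auto
  then show "real l * (B / 2 ^ n) <= B" by simp
 qed
 have "c * d * e (slice u h j) (slice u h k) = e (%x. c * slice u h j x) (%x. d * slice u h k x)" using e_scale_left[OF D(1) D_scale[OF D(2)]] e_scale_right[OF D(2) D(1)] by simp
 also have "e (%x. c * slice u h j x) (%x. d * slice u h k x) = e (%x. slices (B / 2 ^ n) (2 ^ n) (%l. c * (if l div Q = j then 1 else 0)) (u x))
   (%x. slices (B / 2 ^ n) (2 ^ n) (%l. d * (if l div Q = k then 1 else 0)) (u x))" by (simp only: sl[OF j, THEN fun_cong] sl[OF jk(2), THEN fun_cong] cs)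
 also have "... <= e (dyadic u B (%t. - F' t) n) (dyadic u B g' n)"
 proof (rule slices_mono[OF u nn hn])
  fix l :: nat assume l: "l < 2 ^ n"
  show "\<bar>c * (if l div Q = j then 1 else 0)\<bar> <= - F' (real l * (B / 2 ^ n))"
  proof (cases "l div Q = j")
   case True
   then have "real l * (B / 2 ^ n) <= p" using node(2)[of l] by (simp only: p_def)
   then show ?thesis using c(2)[of "- (real l * (B / 2 ^ n))"] range(1)[OF l] True c(1) by (simp only: F'_def) simp
  next
   case False
   then show ?thesis using F'0[OF range[OF l]] by simp
  qed
  show "\<bar>d * (if l div Q = k then 1 else 0)\<bar> <= g' (real l * (B / 2 ^ n))"
  proof (cases "l div Q = k")
   case True
   then have "q <= real l * (B / 2 ^ n)" using node(1)[of l] by (simp only: q_def)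
   then have "d <= g' (real l * (B / 2 ^ n))" using range(2)[OF l] by (intro d(2)) (simp only: atLeastAtMost_iff)
   then show ?thesis using True d(1) by (simp only:) simp
  next
   case False
   then show ?thesis using g'0[OF range[OF l]] by simp
  qed
 qed
 finally show ?thesis .
qed
have "c * d * e (slice u h j) (slice u h k) <= 0" by (rule LIMSEQ_le_const[OF lim]) (use le in blast)
then have "e (slice u h j) (slice u h k) <= 0" using c(1) d(1) by (simp add: mult_le_0_iff)
then show ?thesis using slice_e_nonneg[OF u nn h(1), of j k] by (simp add: h_def)
qed

end

lemma nonneg_of_rat:
fixes p :: "real => real"
assumes c: "!!t. isCont p t" and nn: "!!t. t \<in> \<rat> ==> 0 <= p t"
shows "0 <= p t"
proof (rule ccontr)
assume "\<not> 0 <= p t"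
with c[of t] have "eventually (%s. p s < 0) (at t)" by (intro order_tendstoD(2)[of p "p t"]) (auto simp: isCont_def)
then obtain d where d: "d > 0" "!!s. s ~= t ==> dist s t < d ==> p s < 0" by (auto simp: eventually_at)
obtain r where "r \<in> \<rat>" "t < r" "r < t + d" using Rats_dense_in_real[of t "t + d"] d(1) by auto
then show False using d(2)[of r] nn[of r] by (auto simp: dist_real_def)
qed

context dirichlet_structure
begin

lemma mult_gam_integrable:
assumes "f \<in> D" "g \<in> D" "h \<in> borel_measurable M" "!!x. \<bar>h x\<bar> <= (C::real)"
shows "integrable M (%x. h x * gam f g x)"
proof (rule integrable_dom[OF integrable_mult_right[OF integrable_abs[OF gam_int[OF assms(1,2)]], of C]])
show "(%x. h x * gam f g x) \<in> borel_measurable M" using assms(3) gam_measurable[OF assms(1,2)] by measurable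
have "0 <= C" using assms(4)[of undefined] by linarith
then show "AE x in M. norm (h x * gam f g x) <= norm (C * \<bar>gam f g x\<bar>)" using assms(4) by (intro AE_I2) (auto simp: abs_mult intro!: mult_right_mono)
qed

text \<open>Polarisation of \<open>gam_identity\<close>. Membership of the products is assumed,
  because the lemma serves to prove the chain rule: there all functions depend on a single u, and
  \<open>C11_contraction\<close> supplies the products.\<close>

lemma gam_identity_polar:
assumes f: "f \<in> D" "!!x. \<bar>f x\<bar> <= C" and g: "g \<in> D" "!!x. \<bar>g x\<bar> <= C" and h: "h \<in> D" "!!x. \<bar>h x\<bar> <= C"
 and prod: "(%x. f x * h x) \<in> D" "(%x. g x * h x) \<in> D" "(%x. (f x)^2) \<in> D" "(%x. (g x)^2) \<in> D" "(%x. f x * g x) \<in> D"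
shows "(LINT x|M. h x * gam f g x) = e (%x. f x * h x) g + e (%x. g x * h x) f - e h (%x. f x * g x)"
proof -
have arith: "I = c + b - q" if "2 * I = 2 * ((a + b) + (c + d)) - (p + (2 * q + r)) - (2 * a - p) - (2 * d - r)"
 for I a b c d p q r :: real using that by simp
have bd: "ess_bounded M k" if "!!x. \<bar>k x\<bar> <= c" for k c using that by (auto simp: ess_bounded_def)
define s where "s = (%x. f x + g x)"
have s: "s \<in> D" unfolding s_def by (intro D_add f g)
have sb: "\<bar>s x\<bar> <= 2 * C" for x using f(2)[of x] g(2)[of x] by (simp add: s_def)
have hm: "h \<in> borel_measurable M" by (rule D_measurable[OF h(1)])
note I = mult_gam_integrable[OF _ _ hm h(2)]
have "(LINT x|M. h x * gam s s x) = (LINT x|M. h x * gam f f x + (2 * (h x * gam f g x) + h x * gam g g x))"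
proof (rule integral_cong_AE)
 show "(%x. h x * gam s s x) \<in> borel_measurable M"
  "(%x. h x * gam f f x + (2 * (h x * gam f g x) + h x * gam g g x)) \<in> borel_measurable M" using I[OF s s] I[OF f(1) f(1)] I[OF f(1) g(1)] I[OF g(1) g(1)] by auto
 show "AE x in M. h x * gam s s x = h x * gam f f x + (2 * (h x * gam f g x) + h x * gam g g x)" using gam_add[OF f(1) g(1) s] gam_sym[OF f(1) s] gam_sym[OF g(1) s] gam_add[OF f(1) g(1) f(1)] gam_add[OF f(1) g(1) g(1)] gam_sym[OF f(1) g(1)] unfolding s_def[symmetric] by eventually_elim (simp add: algebra_simps)
qed
also have "... = (LINT x|M. h x * gam f f x) + (2 * (LINT x|M. h x * gam f g x) + (LINT x|M. h x * gam g g x))" using I[OF f(1) f(1)] I[OF f(1) g(1)] I[OF g(1) g(1)] by simp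
finally have "2 * (LINT x|M. h x * gam f g x) = (LINT x|M. h x * gam s s x) - (LINT x|M. h x * gam f f x) - (LINT x|M. h x * gam g g x)" by simp
also have "(LINT x|M. h x * gam s s x) = 2 * e (%x. s x * h x) s - e h (%x. (s x)^2)" by (intro gam_identity s h conjI bd[OF sb] bd[OF h(2)])
also have "(LINT x|M. h x * gam f f x) = 2 * e (%x. f x * h x) f - e h (%x. (f x)^2)" by (intro gam_identity f h conjI bd[OF f(2)] bd[OF h(2)])
also have "(LINT x|M. h x * gam g g x) = 2 * e (%x. g x * h x) g - e h (%x. (g x)^2)" by (intro gam_identity g h conjI bd[OF g(2)] bd[OF h(2)])
also have "e (%x. s x * h x) s = (e (%x. f x * h x) f + e (%x. g x * h x) f) + (e (%x. f x * h x) g + e (%x. g x * h x) g)" unfolding s_def distrib_right using prod f g by (simp add: e_add_left e_add_right D_add)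
also have "e h (%x. (s x)^2) = e h (%x. (f x)^2) + (2 * e h (%x. f x * g x) + e h (%x. (g x)^2))"
proof -
 have "(s x)^2 = (f x)^2 + (2 * (f x * g x) + (g x)^2)" for x by (simp add: s_def power2_eq_square algebra_simps)
 then show ?thesis using prod h by (simp add: e_add_right e_scale_right D_add D_scale)
qed
finally show ?thesis by (rule arith)
qed

text \<open>One null set for all real a at once, so that a may be replaced by the pointwise value
  \<open>psi (u x)\<close>.\<close>

lemma gam_cauchy_schwarz_affine:
assumes f: "f \<in> D" and u: "u \<in> D" and g: "g \<in> D"
shows "AE x in M. ALL a. (gam f g x - a * gam u g x)^2 <= (gam f f x - 2 * a * gam f u x + a^2 * gam u u x) * gam g g x
 \<and> 0 <= gam f f x - 2 * a * gam f u x + a^2 * gam u u x"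
proof -
have "AE x in M. \<forall>a\<in>\<rat>. 0 <= (gam f f x - 2 * a * gam f u x + a^2 * gam u u x) * gam g g x - (gam f g x - a * gam u g x)\<^sup>2
 \<and> 0 <= gam f f x - 2 * a * gam f u x + a^2 * gam u u x"
proof (rule AE_ball_countable')
 show "countable (\<rat> :: real set)" by (rule countable_rat)
 fix a :: real
 define k where "k = (%x. (- a) * u x + f x)"
 have k: "k \<in> D" unfolding k_def using u f by (rule D_lin)
 show "AE x in M. 0 <= (gam f f x - 2 * a * gam f u x + a^2 * gam u u x) * gam g g x - (gam f g x - a * gam u g x)\<^sup>2
  \<and> 0 <= gam f f x - 2 * a * gam f u x + a^2 * gam u u x" using gam_lin[OF u f k, of "- a", folded k_def] gam_sym[OF u k] gam_sym[OF f k] gam_lin[OF u f u, of "- a", folded k_def]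
   gam_lin[OF u f f, of "- a", folded k_def] gam_lin[OF u f g, of "- a", folded k_def] gam_sym[OF f u] gam_cauchy_schwarz[OF k g] gam_nonneg[OF k]
 proof eventually_elim
  case (elim x)
  have "gam k k x = gam f f x - 2 * a * gam f u x + a^2 * gam u u x" using elim(1-5,7) by (simp add: power2_eq_square algebra_simps)
  moreover have "gam k g x = gam f g x - a * gam u g x" using elim(6) by simp
  ultimately show ?case using elim(8,9) by simp
 qed
qed
then show ?thesis
proof eventually_elim
 case (elim x)
 show ?case
 proof
  fix a
  have "0 <= (gam f f x - 2 * a * gam f u x + a^2 * gam u u x) * gam g g x - (gam f g x - a * gam u g x)\<^sup>2" by (rule nonneg_of_rat[of "%a. (gam f f x - 2 * a * gam f u x + a^2 * gam u u x) * gam g g x - (gam f g x - a * gam u g x)\<^sup>2"])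
    (use elim in \<open>auto intro!: continuous_intros\<close>)
  moreover have "0 <= gam f f x - 2 * a * gam f u x + a^2 * gam u u x" by (rule nonneg_of_rat[of "%a. gam f f x - 2 * a * gam f u x + a^2 * gam u u x"])
    (use elim in \<open>auto intro!: continuous_intros\<close>)
  ultimately show "(gam f g x - a * gam u g x)^2 <= (gam f f x - 2 * a * gam f u x + a^2 * gam u u x) * gam g g x
   \<and> 0 <= gam f f x - 2 * a * gam f u x + a^2 * gam u u x" by simp
 qed
qed
qed

text \<open>A Riemann sum of th against the distribution of the energy of u over its levels: the
  mutual energies of slice j with all slices sum to the share of level j. Linearity in th reduces
  identities between energies to identities between functions of t.\<close>

definition dyadic_energy :: "('a => real) => real => nat => (real => real) => real" where
"dyadic_energy u B n th = (\<Sum>j<2^n. \<Sum>k<2^n. th (real j * (B / 2 ^ n)) * e (slice u (B / 2 ^ n) j) (slice u (B / 2 ^ n) k))"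

text \<open>By \<open>slice_disjoint\<close> only slices with |j - k| \<le> 1 interact, and for
  these replacing \<open>eta\<close> at node k by its value at node j costs at most L h. In the
  limit the mutual energy thus depends on the product \<open>psi * eta\<close> alone.\<close>

lemma dyadic_energy_tendsto:
assumes u: "u \<in> D" and nn: "!!x. 0 <= u x" and B: "!!x. u x <= B" "B > 0" and F: "C11 0 B F psi" and G: "C11 0 B G eta"
shows "(%n. dyadic_energy u B n (%t. psi t * eta t)) ---> e (%x. F (u x) - F 0) (%x. G (u x) - G 0)"
proof -
obtain S where S: "S >= 0" "!!s. s \<in> {0..B} ==> \<bar>psi s\<bar> <= S" using lips_bounded[of 0 B psi] F B unfolding C11_def by (metis less_imp_le)
obtain L where L: "L >= 0" "!!r s. r \<in> {0..B} ==> s \<in> {0..B} ==> \<bar>eta r - eta s\<bar> <= L * \<bar>r - s\<bar>" using G unfolding C11_def lips_def by auto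
define h where "h n = B / 2 ^ n" for n :: nat
have h: "h n > 0" "real (2 ^ n) * h n = B" for n using B by (auto simp: h_def)
have hlim: "h ---> 0" unfolding h_def by real_asymp
define E where "E n j k = e (slice u (h n) j) (slice u (h n) k)" for n j k
have E0: "E n j k >= 0" for n j k unfolding E_def by (rule slice_e_nonneg[OF u nn h(1)])
have node: "real j * h n \<in> {0..B}" if "j < 2 ^ n" for j n
proof -
 have "real j * h n <= real (2 ^ n) * h n" using that h(1)[of n] by (intro mult_right_mono) auto
 then have "real j * h n <= B" unfolding h(2) .
 then show ?thesis using h(1)[of n] by simp
qed
have diff: "\<bar>e (dyadic u B psi n) (dyadic u B eta n) - dyadic_energy u B n (%t. psi t * eta t)\<bar> <= S * L * h n * e u u" for n
proof -
 have "e (dyadic u B psi n) (dyadic u B eta n) - dyadic_energy u B n (%t. psi t * eta t)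
  = (\<Sum>j<2^n. \<Sum>k<2^n. psi (real j * h n) * (eta (real k * h n) - eta (real j * h n)) * E n j k)" unfolding dyadic_energy_def h_def[symmetric] slices_bilinear[OF u nn h(1)] E_def[symmetric] by (simp only: sum_subtractf[symmetric] left_diff_distrib right_diff_distrib)
 also have "\<bar>...\<bar> <= (\<Sum>j<2^n. \<Sum>k<2^n. S * L * h n * E n j k)"
 proof (intro order_trans[OF sum_abs] sum_mono)
  fix j k assume j: "j \<in> {..<2 ^ n :: nat}" and k: "k \<in> {..<2 ^ n :: nat}"
  show "\<bar>psi (real j * h n) * (eta (real k * h n) - eta (real j * h n)) * E n j k\<bar> <= S * L * h n * E n j k"
  proof (cases "Suc j < k \<or> Suc k < j")
   case True
   then have "E n j k = 0" using slice_disjoint[OF u nn B, of j k n] slice_disjoint[OF u nn B, of k j n] j k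
     e_sym[OF slice_D[OF u nn h(1), of j n] slice_D[OF u nn h(1), of k n]] unfolding E_def h_def by auto
   then show ?thesis by simp
  next
   case False
   then have "\<bar>real k - real j\<bar> <= 1" by auto
   moreover have "\<bar>real k * h n - real j * h n\<bar> = \<bar>real k - real j\<bar> * h n" using h(1)[of n] by (simp add: left_diff_distrib[symmetric] abs_mult)
   ultimately have "\<bar>real k * h n - real j * h n\<bar> <= h n" using h(1)[of n] mult_right_mono[of "\<bar>real k - real j\<bar>" 1 "h n"] by simp
   then have "L * \<bar>real k * h n - real j * h n\<bar> <= L * h n" using L(1) by (rule mult_left_mono)
   then have "\<bar>eta (real k * h n) - eta (real j * h n)\<bar> <= L * h n" using L(2)[OF node node, of k n j n] j k by simp
   then have "\<bar>psi (real j * h n)\<bar> * \<bar>eta (real k * h n) - eta (real j * h n)\<bar> <= S * (L * h n)" using S(2)[OF node, of j n] S(1) j by (intro mult_mono) auto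
   then have "\<bar>psi (real j * h n)\<bar> * \<bar>eta (real k * h n) - eta (real j * h n)\<bar> * E n j k <= S * (L * h n) * E n j k" by (rule mult_right_mono[OF _ E0])
   then show ?thesis by (simp only: abs_mult abs_of_nonneg[OF E0] mult.assoc)
  qed
 qed
 also have "... = S * L * h n * e u u"
 proof -
  have um: "u x <= real (2 ^ n) * h n" for x using B(1) h(2)[of n] by simp
  have "(\<Sum>j<2^n. \<Sum>k<2^n. S * L * h n * E n j k) = S * L * h n * (\<Sum>j<2^n. \<Sum>k<2^n. (1 * 1) * E n j k)" by (simp add: sum_distrib_left)
  also have "(\<Sum>j<2^n. \<Sum>k<2^n. (1 * 1) * E n j k) = e u u" using slices_bilinear[OF u nn h(1), of n "2 ^ n" "%k. 1" "%k. 1"] unfolding E_def slices_1[OF h(1) nn um] mult_1 by simp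
  finally show ?thesis .
 qed
 finally show ?thesis .
qed
have "(%n. e (dyadic u B psi n) (dyadic u B eta n) - dyadic_energy u B n (%t. psi t * eta t)) ---> 0"
proof (rule Lim_null_comparison)
 show "eventually (%n. norm (e (dyadic u B psi n) (dyadic u B eta n) - dyadic_energy u B n (%t. psi t * eta t)) <= S * L * h n * e u u) sequentially" using diff by (intro always_eventually) simp
 show "(%n. S * L * h n * e u u) ---> 0" using tendsto_mult[OF tendsto_mult[OF tendsto_const hlim] tendsto_const, of "S * L" "e u u"] by simp
qed
from tendsto_diff[OF e_dyadic_tendsto[OF u nn B F G] this] show ?thesis by simp
qed

lemma dyadic_energy_add: "dyadic_energy u B n (%t. f t + g t) = dyadic_energy u B n f + dyadic_energy u B n g" by (simp add: dyadic_energy_def distrib_right sum.distrib)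

lemma dyadic_energy_scale: "dyadic_energy u B n (%t. c * f t) = c * dyadic_energy u B n f" by (simp add: dyadic_energy_def sum_distrib_left mult.assoc)

text \<open>V is formally \<gamma> of F(u) - a u with a frozen at psi(u x). The identity for
  \<gamma> expresses its integral by energies of functions of u, that is, as a limit of
  \<open>dyadic_energy\<close>, where the functions of t cancel. As V is nonnegative, it vanishes
  almost everywhere, and Cauchy-Schwarz against g gives the claim.\<close>

lemma chain_rule_nonneg:
assumes u: "u \<in> D" and nn: "!!x. 0 <= u x" and B: "!!x. u x <= B" "B > 0"
 and F: "C11 0 B F psi" and psi: "C11 0 B psi psi1" and g: "g \<in> D"
shows "AE x in M. gam (%x. F (u x) - F 0) g x = psi (u x) * gam u g x"
proof -
let ?L = "dyadic_energy u B"
\<comment> \<open>Functions of u lie in the domain once their value at 0 is removed; psi and its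
  square therefore enter through H1 and H2.\<close>
define P where "P t = F t - F 0" for t
define H1 where "H1 t = psi t - psi 0" for t
define H2 where "H2 t = psi t * psi t - psi 0 * psi 0" for t
have P: "C11 0 B P psi" "P 0 = 0" using C11_diff_const[OF F, of "F 0"] by (simp_all add: P_def[abs_def])
have H1: "C11 0 B H1 psi1" "H1 0 = 0" using C11_diff_const[OF psi, of "psi 0"] by (simp_all add: H1_def[abs_def])
have H2: "C11 0 B H2 (%t. psi1 t * psi t + psi t * psi1 t)" "H2 0 = 0" using C11_diff_const[OF C11_mult[OF psi psi], of "psi 0 * psi 0"] by (simp_all add: H2_def[abs_def])
have I: "C11 0 B (%t. t) (%t. 1)" using B by (intro C11_id) simp
have mem: "(%x. Q (u x)) \<in> D" if "C11 0 B Q eta" "Q 0 = 0" for Q eta using C11_contraction(1)[OF u nn B that(1)] that(2) by simp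
have lim: "(%n. ?L n (%t. eta t * th t)) ---> e (%x. Q (u x)) (%x. R (u x))" if "C11 0 B Q eta" "Q 0 = 0" "C11 0 B R th" "R 0 = 0" for Q eta R th using dyadic_energy_tendsto[OF u nn B that(1,3)] that(2,4) by simp
have bound: "EX C. ALL x. \<bar>Q (u x)\<bar> <= C" if "C11 0 B Q eta" for Q eta using lips_bounded[OF C11_lips[OF that]] nn B by (metis atLeastAtMost_iff less_imp_le)
obtain C1 where C1: "!!x. \<bar>P (u x)\<bar> <= C1" using bound[OF P(1)] by blast
obtain C2 where C2: "!!x. \<bar>H1 (u x)\<bar> <= C2" using bound[OF H1(1)] by blast
obtain C3 where C3: "!!x. \<bar>H2 (u x)\<bar> <= C3" using bound[OF H2(1)] by blast
define C where "C = max B (max C1 (max C2 C3))"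
have C: "\<bar>P (u x)\<bar> <= C" "\<bar>H1 (u x)\<bar> <= C" "\<bar>H2 (u x)\<bar> <= C" "\<bar>u x\<bar> <= C" for x using C1[of x] C2[of x] C3[of x] nn[of x] B(1)[of x] by (auto simp: C_def)
let ?f = "%x. P (u x)" and ?h1 = "%x. H1 (u x)" and ?h2 = "%x. H2 (u x)"
have fD: "?f \<in> D" and h1D: "?h1 \<in> D" and h2D: "?h2 \<in> D" by (rule mem[OF P] mem[OF H1] mem[OF H2])+
have i1: "(LINT x|M. ?h1 x * gam ?f u x) = e (%x. P (u x) * H1 (u x)) u + e (%x. u x * H1 (u x)) ?f - e ?h1 (%x. P (u x) * u x)" by (rule gam_identity_polar[OF fD C(1) u C(4) h1D C(2)]; (unfold power2_eq_square)?, rule mem[OF C11_mult])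
  (use P H1 I in auto)
have i2: "(LINT x|M. ?h2 x * gam u u x) = e (%x. u x * H2 (u x)) u + e (%x. u x * H2 (u x)) u - e ?h2 (%x. u x * u x)" by (rule gam_identity_polar[OF u C(4) u C(4) h2D C(3)]; (unfold power2_eq_square)?, rule mem[OF C11_mult])
  (use H2 I in auto)
define V where "V x = gam ?f ?f x - 2 * psi (u x) * gam ?f u x + (psi (u x))^2 * gam u u x" for x
have um: "u \<in> borel_measurable M" by (rule D_measurable[OF u])
have V_eq: "V x = gam ?f ?f x - 2 * (?h1 x * gam ?f u x) - 2 * psi 0 * gam ?f u x + ?h2 x * gam u u x + (psi 0)^2 * gam u u x" for x by (simp add: V_def H1_def H2_def power2_eq_square algebra_simps)
have int: "integrable M (gam ?f ?f)" "integrable M (%x. ?h1 x * gam ?f u x)" "integrable M (gam ?f u)"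
 "integrable M (%x. ?h2 x * gam u u x)" "integrable M (gam u u)" by (rule gam_int[OF fD fD] mult_gam_integrable[OF fD u D_measurable[OF h1D] C(2)] gam_int[OF fD u]
  mult_gam_integrable[OF u u D_measurable[OF h2D] C(3)] gam_int[OF u u])+
have V_int: "integrable M V" unfolding V_eq[abs_def] using int by auto
have efu: "(LINT x|M. gam ?f u x) = 2 * e ?f u" using e_gam[OF fD u] by simp
have "(LINT x|M. V x) = (LINT x|M. gam ?f ?f x) - 2 * (LINT x|M. ?h1 x * gam ?f u x) - 2 * psi 0 * (LINT x|M. gam ?f u x)
 + (LINT x|M. ?h2 x * gam u u x) + (psi 0)^2 * (LINT x|M. gam u u x)" unfolding V_eq using int by simp
also have "... = 2 * e ?f ?f - 2 * (e (%x. P (u x) * H1 (u x)) u + e (%x. u x * H1 (u x)) ?f - e ?h1 (%x. P (u x) * u x))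
 - 2 * psi 0 * (2 * e ?f u) + (e (%x. u x * H2 (u x)) u + e (%x. u x * H2 (u x)) u - e ?h2 (%x. u x * u x)) + (psi 0)^2 * (2 * e u u)" by (simp only: i1 i2 e_gam2[OF fD] e_gam2[OF u] efu)
finally have V_val: "(LINT x|M. V x) = ..." .
have PH: "C11 0 B (%t. P t * H1 t) (%t. psi t * H1 t + P t * psi1 t)" by (rule C11_mult[OF P(1) H1(1)])
have IH: "C11 0 B (%t. t * H1 t) (%t. 1 * H1 t + t * psi1 t)" by (rule C11_mult[OF I H1(1)])
have PI: "C11 0 B (%t. P t * t) (%t. psi t * t + P t * 1)" by (rule C11_mult[OF P(1) I])
have IH2: "C11 0 B (%t. t * H2 t) (%t. 1 * H2 t + t * (psi1 t * psi t + psi t * psi1 t))" by (rule C11_mult[OF I H2(1)])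
have II: "C11 0 B (%t. t * t) (%t. 1 * t + t * 1)" by (rule C11_mult[OF I I])
have "(%n. 2 * ?L n (%t. psi t * psi t) - 2 * (?L n (%t. (psi t * H1 t + P t * psi1 t) * 1) + ?L n (%t. (1 * H1 t + t * psi1 t) * psi t) - ?L n (%t. psi1 t * (psi t * t + P t * 1)))
 - 2 * psi 0 * (2 * ?L n (%t. psi t * 1)) + (?L n (%t. (1 * H2 t + t * (psi1 t * psi t + psi t * psi1 t)) * 1) + ?L n (%t. (1 * H2 t + t * (psi1 t * psi t + psi t * psi1 t)) * 1) - ?L n (%t. (psi1 t * psi t + psi t * psi1 t) * (1 * t + t * 1))) + (psi 0)^2 * (2 * ?L n (%t. 1 * 1)))
 ---> (LINT x|M. V x)" unfolding V_val by (intro tendsto_add tendsto_diff tendsto_mult tendsto_const lim[OF P P] lim[OF PH _ I] lim[OF IH _ P] lim[OF H1 PI] lim[OF P I]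
  lim[OF IH2 _ I] lim[OF H2 II] lim[OF I _ I]) (simp_all add: P(2) H1(2))
moreover have "(2 * ?L n (%t. psi t * psi t) - 2 * (?L n (%t. (psi t * H1 t + P t * psi1 t) * 1) + ?L n (%t. (1 * H1 t + t * psi1 t) * psi t) - ?L n (%t. psi1 t * (psi t * t + P t * 1)))
 - 2 * psi 0 * (2 * ?L n (%t. psi t * 1)) + (?L n (%t. (1 * H2 t + t * (psi1 t * psi t + psi t * psi1 t)) * 1) + ?L n (%t. (1 * H2 t + t * (psi1 t * psi t + psi t * psi1 t)) * 1) - ?L n (%t. (psi1 t * psi t + psi t * psi1 t) * (1 * t + t * 1))) + (psi 0)^2 * (2 * ?L n (%t. 1 * 1)))
 = 0" (is "?lhs = 0") for n
proof -
 have "?lhs = ?L n (%t. 2 * (psi t * psi t) + ((- 2) * ((psi t * H1 t + P t * psi1 t) * 1) + ((- 2) * ((1 * H1 t + t * psi1 t) * psi t) + (2 * (psi1 t * (psi t * t + P t * 1))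
  + ((- 4 * psi 0) * (psi t * 1) + (2 * ((1 * H2 t + t * (psi1 t * psi t + psi t * psi1 t)) * 1) + ((- 1) * ((psi1 t * psi t + psi t * psi1 t) * (1 * t + t * 1)) + (2 * (psi 0)^2) * (1 * 1))))))))" by (simp only: dyadic_energy_add dyadic_energy_scale) (simp add: algebra_simps)
 \<comment> \<open>By the ordinary product rule the terms with psi1 cancel among themselves, as do
   those with psi 0, and 2 psi^2 - 4 psi^2 + 2 psi^2 = 0 remains.\<close>
 also have "... = ?L n (%t. 0 * (1 * 1))" by (rule arg_cong[of _ _ "?L n"]) (intro ext, simp add: H1_def H2_def power2_eq_square algebra_simps)
 also have "... = 0" by (subst dyadic_energy_scale) simp
 finally show ?thesis .
qed
ultimately have V0: "(LINT x|M. V x) = 0" by (simp only: LIMSEQ_const_iff)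
have ae: "AE x in M. ALL a. (gam ?f g x - a * gam u g x)^2 <= (gam ?f ?f x - 2 * a * gam ?f u x + a^2 * gam u u x) * gam g g x
 \<and> 0 <= gam ?f ?f x - 2 * a * gam ?f u x + a^2 * gam u u x" by (rule gam_cauchy_schwarz_affine[OF fD u g])
then have "AE x in M. 0 <= V x" unfolding V_def by eventually_elim blast
with V0 V_int have "AE x in M. V x = 0" by (simp add: integral_nonneg_eq_0_iff_AE)
with ae have "AE x in M. gam ?f g x = psi (u x) * gam u g x"
proof eventually_elim
 case (elim x)
 have "(gam ?f g x - psi (u x) * gam u g x)^2 <= V x * gam g g x" using elim(1) unfolding V_def by blast
 then show ?case using elim(2) by simp
qed
then show ?thesis by (simp only: P_def)
qed

text \<open>The function \<open>t - t\<^sup>2 / (2 c)\<close> on \<open>{0..c}\<close>, continued by \<open>c / 2\<close>, tends to \<open>0\<close> while its derivative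
at \<open>0\<close> is \<open>1\<close>; replaced by a smooth function, it shows that the energy does not charge \<open>{u = 0}\<close>.\<close>

lemma gam_zero_level:
assumes u: "u \<in> D" and nn: "!!x. 0 <= u x" and B: "!!x. u x <= B" "B > 0" and g: "g \<in> D"
shows "AE x in M. u x = 0 --> gam u g x = 0"
proof -
\<comment> \<open>The smooth replacement: for t \<ge> 0 and n \<ge> 1 it is at most 1 / n, while its
  derivative psi n is 1 at 0 and tends to 0 elsewhere.\<close>
define F where "F n t = t / (1 + real n * t)" for n and t :: real
define psi where "psi n t = 1 / (1 + real n * t)^2" for n and t :: real
define psi1 where "psi1 n t = - (2 * real n / (1 + real n * t) ^ 3)" for n and t :: real
define psi2 where "psi2 n t = 6 * (real n)^2 / (1 + real n * t) ^ 4" for n and t :: real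
have pos: "1 + real n * t > 0" if "t >= 0" for n t using that by (simp add: add_pos_nonneg)
have d0: "(F n has_real_derivative psi n t) (at t)" if "t >= 0" for n t unfolding F_def[abs_def] psi_def using pos[OF that, of n] by (auto intro!: derivative_eq_intros simp: power2_eq_square divide_simps) (simp add: algebra_simps)?
have d1: "(psi n has_real_derivative psi1 n t) (at t)" if "t >= 0" for n t unfolding psi_def[abs_def] psi1_def using pos[OF that, of n] by (auto intro!: derivative_eq_intros simp: power2_eq_square power3_eq_cube divide_simps) (simp add: algebra_simps)?
have d2: "(psi1 n has_real_derivative psi2 n t) (at t)" if "t >= 0" for n t unfolding psi1_def[abs_def] psi2_def using pos[OF that, of n] by (auto intro!: derivative_eq_intros simp: eval_nat_numeral divide_simps) (simp add: algebra_simps)?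
have l1: "lips 0 B (psi1 n)" for n
proof -
 have "\<bar>psi2 n t\<bar> <= 6 * (real n)^2" if "t \<in> {0..B}" for t
 proof -
  have "1 ^ 4 <= (1 + real n * t) ^ 4" using that by (intro power_mono) auto
  then show ?thesis using that by (simp add: psi2_def divide_le_eq mult_left_le_one_le zero_le_mult_iff mult_le_cancel_left1)
 qed
 then have "\<bar>psi1 n r - psi1 n s\<bar> <= (6 * (real n)^2) * \<bar>r - s\<bar>" if "r \<in> {0..B}" "s \<in> {0..B}" for r s using field_differentiable_bound[of "{0..B}" "psi1 n" "psi2 n" "6 * (real n)^2" r s] that has_field_derivative_at_within[OF d2] by (simp add: convex_real_interval)
 then show ?thesis unfolding lips_def by (intro exI[of _ "6 * (real n)^2"]) auto
qed
have l0: "lips 0 B (psi n)" for n using B lips_deriv[of 0 B "psi n" "psi1 n"] l1[of n] d1[of _ n] by auto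
have F: "C11 0 B (F n) (psi n)" and psi: "C11 0 B (psi n) (psi1 n)" for n using d0 d1 l0 l1 B by (auto simp: C11_def)
have chain: "AE x in M. gam (%x. F n (u x) - F n 0) h x = psi n (u x) * gam u h x" if "h \<in> D" for n h by (rule chain_rule_nonneg[OF u nn B F psi that])
have F0: "F n 0 = 0" for n by (simp add: F_def)
define f where "f n x = F n (u x)" for n x
have fD: "f n \<in> D" for n using C11_contraction(1)[OF u nn B F, of n] unfolding F0 f_def[abs_def] by simp
have c1: "AE x in M. gam (f n) h x = psi n (u x) * gam u h x" if "h \<in> D" for n h using chain[OF that, of n] unfolding F0 f_def[abs_def] by simp
have fe: "AE x in M. gam (%x. f n x - f m x) (%x. f n x - f m x) x = (psi n (u x) - psi m (u x))^2 * gam u u x" for n m using gam_diff[OF fD fD D_diff[OF fD fD], of n m n m] c1[OF D_diff[OF fD[of n] fD[of m]], of n] c1[OF D_diff[OF fD[of n] fD[of m]], of m]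
  gam_sym[OF u D_diff[OF fD[of n] fD[of m]]] gam_diff[OF fD fD u, of n m] c1[OF u, of n] c1[OF u, of m] by eventually_elim (simp add: power2_eq_square algebra_simps)
define I where "I n = (LINT x|M. (psi n (u x))^2 * gam u u x)" for n
have um [measurable]: "u \<in> borel_measurable M" by (rule D_measurable[OF u])
have gm [measurable]: "gam u u \<in> borel_measurable M" by (rule gam_measurable[OF u u])
have psim [measurable]: "(%x. psi n (u x)) \<in> borel_measurable M" for n unfolding psi_def by measurable
have psi01: "0 <= psi n t" "psi n t <= 1" if "t >= 0" for n t
proof -
 have "1 ^ 2 <= (1 + real n * t)^2" using that by (intro power_mono) auto
 then show "0 <= psi n t" "psi n t <= 1" by (auto simp: psi_def divide_le_eq)
qed
have limpsi: "(%n. psi n t) ---> (if t = 0 then 1 else 0)" if "t >= 0" for t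
proof (cases "t = 0")
 case False
 then have "t > 0" using that by simp
 then have "(%n. 1 / (1 + real n * t)^2) ---> 0" by real_asymp
 then show ?thesis using False by (simp add: psi_def)
qed (simp add: psi_def)
let ?z = "%x. if u x = 0 then 1 else 0 :: real"
\<comment> \<open>In L2 with weight \<open>gam u u\<close> the derivatives converge to the indicator
  of {u = 0}, so f n is Cauchy in energy. As f n tends to 0 in L2, closedness forces its energy to
  0, although twice that energy dominates the integral of \<open>gam u u\<close> over {u =
  0}.\<close>
have E1: "(%n. \<integral>x. (psi n (u x) - ?z x)^2 * gam u u x \<partial>M) ---> (LINT x|M. 0)"
proof (rule integral_dominated_convergence[where w = "gam u u"])
 show "AE x in M. (%n. (psi n (u x) - ?z x)^2 * gam u u x) ---> 0"
 proof (rule AE_I2)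
  fix x
  have "(%n. (psi n (u x) - ?z x)^2 * gam u u x) ---> (?z x - ?z x)\<^sup>2 * gam u u x" by (intro tendsto_intros limpsi nn)
  then show "(%n. (psi n (u x) - ?z x)^2 * gam u u x) ---> 0" by simp
 qed
 show "AE x in M. norm ((psi n (u x) - ?z x)^2 * gam u u x) <= gam u u x" for n using gam_nonneg[OF u]
 proof eventually_elim
  case (elim x)
  have "\<bar>psi n (u x) - ?z x\<bar> <= 1" using psi01[OF nn, of n x] by (auto simp: abs_if)
  then have "(psi n (u x) - ?z x)^2 <= 1" by (simp add: abs_square_le_1)
  then show ?case using elim by (simp add: mult_left_le_one_le abs_mult)
 qed
qed (use gam_int[OF u u] in auto)
have e_le: "e (%x. f j x - f k x) (%x. f j x - f k x) <= (LINT x|M. (psi j (u x) - ?z x)^2 * gam u u x) + (LINT x|M. (psi k (u x) - ?z x)^2 * gam u u x)" for j k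
proof -
 have int: "integrable M (%x. (psi n (u x) - ?z x)^2 * gam u u x)" for n
 proof (rule mult_gam_integrable[OF u u, of _ 1])
  show "\<bar>(psi n (u x) - ?z x)\<^sup>2\<bar> <= 1" for x using psi01[OF nn, of n x] by (auto simp: abs_if abs_square_le_1)
 qed measurable
 have "2 * e (%x. f j x - f k x) (%x. f j x - f k x) = (LINT x|M. gam (%x. f j x - f k x) (%x. f j x - f k x) x)" by (rule e_gam2[symmetric, OF D_diff[OF fD fD]])
 also have "... <= (LINT x|M. 2 * ((psi j (u x) - ?z x)^2 * gam u u x) + 2 * ((psi k (u x) - ?z x)^2 * gam u u x))"
 proof (rule integral_mono_AE)
  show "AE x in M. gam (%x. f j x - f k x) (%x. f j x - f k x) x <= 2 * ((psi j (u x) - ?z x)^2 * gam u u x) + 2 * ((psi k (u x) - ?z x)^2 * gam u u x)" using fe[of j k] gam_nonneg[OF u]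
  proof eventually_elim
   case (elim x)
   have "(p - q)^2 <= 2 * (p - z)^2 + 2 * (q - z)^2" for p q z :: real using zero_le_power2[of "p + q - 2 * z"] by (simp add: power2_eq_square algebra_simps)
   from mult_right_mono[OF this[of "psi j (u x)" "psi k (u x)" "?z x"] elim(2)] show ?case unfolding elim(1) by (simp only: distrib_right mult.assoc)
  qed
 qed (use int gam_int[OF D_diff[OF fD fD] D_diff[OF fD fD]] in auto)
 also have "... = 2 * (LINT x|M. (psi j (u x) - ?z x)^2 * gam u u x) + 2 * (LINT x|M. (psi k (u x) - ?z x)^2 * gam u u x)" using int by simp
 finally show ?thesis by simp
qed
have cauchy: "EX K. ALL j>=K. ALL k>=K. e (%x. f j x - f k x) (%x. f j x - f k x) < eps" if eps: "eps > 0" for eps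
proof -
 have "eps / 2 > 0" using eps by simp
 from order_tendstoD(2)[OF E1[simplified] this]
 obtain K where K: "!!j. j >= K ==> (LINT x|M. (psi j (u x) - ?z x)^2 * gam u u x) < eps / 2" by (auto simp: eventually_sequentially)
 show ?thesis using e_le K by (intro exI[of _ K]) (smt (verit) field_sum_of_halves)
qed
have fle: "(f n x)^2 <= (u x)^2" for n x
proof (rule power_mono)
 show "f n x <= u x" "0 <= f n x" using nn[of x] pos[OF nn, of n x] by (auto simp: f_def F_def divide_le_eq mult_le_cancel_left1 zero_le_mult_iff distrib_left)
qed
have fint: "integrable M (%x. (f n x - 0)^2)" for n using D_sq_integrable[OF fD] by simp
have L2: "(%n. \<integral>x. (f n x - 0)^2 \<partial>M) ---> (LINT x|M. 0)"
proof (rule integral_dominated_convergence[where w = "%x. (u x)^2"])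
 show "AE x in M. (%n. (f n x - 0)^2) ---> 0"
 proof (rule AE_I2)
  fix x
  show "(%n. (f n x - 0)^2) ---> 0"
  proof (cases "u x = 0")
   case False
   then have t: "u x > 0" using nn[of x] by simp
   then have "(%n. (u x / (1 + real n * u x) - 0)^2) ---> 0" by real_asymp
   then show ?thesis by (simp add: f_def F_def)
  qed (simp add: f_def F_def)
 qed
qed (use fle D_sq_integrable[OF u] D_measurable[OF fD] in auto)
have "(%n. e (%x. f n x - 0) (%x. f n x - 0)) ---> 0" by (rule form_limit(2)[OF fD cauchy _ fint]) (use L2 in auto)
then have "(%n. 2 * e (f n) (f n)) ---> 2 * 0" by (intro tendsto_intros) simp
moreover have "2 * e (f n) (f n) = I n" for n unfolding I_def e_gam2[OF fD, symmetric]
proof (rule integral_cong_AE)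
 show "AE x in M. gam (f n) (f n) x = (psi n (u x))^2 * gam u u x" using c1[OF fD[of n], of n] gam_sym[OF u fD[of n]] c1[OF u, of n] by eventually_elim (simp add: power2_eq_square)
qed (use gam_measurable[OF fD fD] in auto)
ultimately have I0: "I ---> 0" by simp
have "{x\<in>space M. u x = 0} \<in> sets M" by measurable
then have zm: "?z \<in> borel_measurable M" by (intro measurable_If) auto
have zint: "integrable M (%x. ?z x * gam u u x)" by (rule mult_gam_integrable[OF u u zm, of 1]) auto
have "(LINT x|M. ?z x * gam u u x) <= I n" for n unfolding I_def
proof (rule integral_mono_AE[OF zint])
 show "integrable M (%x. (psi n (u x))^2 * gam u u x)" by (rule mult_gam_integrable[OF u u, of _ 1]) (measurable, use psi01[OF nn] in \<open>auto simp: power_le_one\<close>)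
 show "AE x in M. ?z x * gam u u x <= (psi n (u x))^2 * gam u u x" using gam_nonneg[OF u] by eventually_elim (auto simp: psi_def)
qed
then have "(LINT x|M. ?z x * gam u u x) <= 0" by (intro LIMSEQ_le_const[OF I0]) auto
moreover have nnz: "AE x in M. 0 <= ?z x * gam u u x" using gam_nonneg[OF u] by eventually_elim auto
ultimately have "(LINT x|M. ?z x * gam u u x) = 0" using integral_nonneg_AE[OF nnz] by simp
then have "AE x in M. ?z x * gam u u x = 0" using integral_nonneg_eq_0_iff_AE[OF zint nnz] by simp
then show ?thesis using gam_zero_of_diag[OF u g] by eventually_elim auto
qed

lemma C11_reflect:
assumes "C11 a b F psi" "a <= c" "d <= b" "c <= d"
shows "C11 (- d) (- c) (%t. F (- t)) (%t. - psi (- t))" unfolding C11_def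
proof (intro conjI ballI)
show "- d <= - c" using assms by simp
fix s assume "s \<in> {- d..- c}"
then have "- s \<in> {a..b}" using assms by auto
then have "(F has_real_derivative psi (- s)) (at (- s))" using assms by (simp add: C11_def)
moreover have "(uminus has_real_derivative - 1) (at s)" by (auto intro!: derivative_eq_intros)
ultimately have "((%s. F (- s)) has_real_derivative psi (- s) * - 1) (at s)" by (rule DERIV_chain2[where f = F and g = uminus])
then show "((%s. F (- s)) has_real_derivative - psi (- s)) (at s)" by simp
next
obtain L where L: "L >= 0" "!!r s. r \<in> {a..b} ==> s \<in> {a..b} ==> \<bar>psi r - psi s\<bar> <= L * \<bar>r - s\<bar>" using assms(1) unfolding C11_def lips_def by auto
have "\<bar>- psi (- r) - - psi (- s)\<bar> <= L * \<bar>r - s\<bar>" if "r \<in> {- d..- c}" "s \<in> {- d..- c}" for r s using L(2)[of "- s" "- r"] that assms by auto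
then show "lips (- d) (- c) (%t. - psi (- t))" using L(1) unfolding lips_def by blast
qed

lemma C11_subset: "C11 a b F psi ==> a <= c ==> d <= b ==> c <= d ==> C11 c d F psi" unfolding C11_def lips_def by (intro conjI; (elim conjE exE)?; (rule exI)?) auto

text \<open>u is split into positive and negative part, and F(u) - F(0) splits with it. At each
  point at least one part is 0, and \<open>gam_zero_level\<close> removes its contribution
  there.\<close>

theorem chain_rule:
assumes u: "u \<in> D" and ab: "!!x. a <= u x" "!!x. u x <= b" "a < 0" "0 < b"
 and F: "C11 a b F psi" and psi: "C11 a b psi psi1"
shows "(%x. F (u x) - F 0) \<in> D"
 and "g \<in> D ==> AE x in M. gam (%x. F (u x) - F 0) g x = psi (u x) * gam u g x"
proof -
let ?p = "%x. min b (max 0 (u x))" and ?n = "%x. min (- a) (max 0 (- u x))"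
have p: "?p \<in> D" by (rule D_clamp) (use ab u in auto)
have n: "?n \<in> D" by (rule D_clamp) (use ab D_minus[OF u] in auto)
have pn: "0 <= ?p x" "?p x <= b" "0 <= ?n x" "?n x <= - a" for x using ab by auto
have Fp: "C11 0 b F psi" "C11 0 b psi psi1" using F psi ab by (auto intro: C11_subset)
have Fn: "C11 0 (- a) (%t. F (- t)) (%t. - psi (- t))" using C11_reflect[OF F, of a 0] ab by simp
have psin: "C11 0 (- a) (%t. - psi (- t)) (%t. psi1 (- t))"
proof -
 have "C11 0 (- a) (%t. psi (- t)) (%t. - psi1 (- t))" using C11_reflect[OF psi, of a 0] ab by simp
 moreover have "C11 0 (- a) (%t. - 1) (%t. 0)" using ab by (simp add: C11_def lips_const)
 ultimately show ?thesis using C11_mult[of 0 "- a" "%t. - 1" "%t. 0" "%t. psi (- t)" "%t. - psi1 (- t)"] by simp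
qed
have b: "0 < - a" using ab by simp
have P: "(%x. F (?p x) - F 0) \<in> D" by (rule C11_contraction(1)[OF p pn(1,2) ab(4) Fp(1)])
have N: "(%x. F (- ?n x) - F (- 0)) \<in> D" by (rule C11_contraction(1)[OF n pn(3,4) b Fn])
have split: "F (u x) - F 0 = (F (?p x) - F 0) + (F (- ?n x) - F (- 0))" for x using ab(1,2)[of x] ab(3,4) by (cases "0 <= u x") auto
show "(%x. F (u x) - F 0) \<in> D" unfolding split by (intro D_add P N)
assume g: "g \<in> D"
have pu: "u x = ?p x - ?n x" for x using ab(1,2)[of x] ab(3,4) by auto
have "AE x in M. gam u g x = gam ?p g x - gam ?n g x" using gam_diff[OF p n g] unfolding pu[symmetric] .
moreover have "AE x in M. gam (%x. F (u x) - F 0) g x = gam (%x. F (?p x) - F 0) g x + gam (%x. F (- ?n x) - F (- 0)) g x" unfolding split by (rule gam_add[OF P N g])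
moreover have "AE x in M. gam (%x. F (?p x) - F 0) g x = psi (?p x) * gam ?p g x" by (rule chain_rule_nonneg[OF p pn(1,2) ab(4) Fp g])
moreover have "AE x in M. gam (%x. F (- ?n x) - F (- 0)) g x = - psi (- ?n x) * gam ?n g x" by (rule chain_rule_nonneg[OF n pn(3,4) b Fn psin g])
moreover have "AE x in M. ?p x = 0 --> gam ?p g x = 0" by (rule gam_zero_level[OF p pn(1,2) ab(4) g])
moreover have "AE x in M. ?n x = 0 --> gam ?n g x = 0" by (rule gam_zero_level[OF n pn(3,4) b g])
ultimately show "AE x in M. gam (%x. F (u x) - F 0) g x = psi (u x) * gam u g x"
proof eventually_elim
 case (elim x)
 show ?case
 proof (cases "0 <= u x")
  case True
  then have 0: "?n x = 0" "?p x = u x" using ab by auto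
  then have "gam ?n g x = 0" using elim(6) by blast
  then show ?thesis using elim(1-4) 0(2) by simp
 next
  case False
  then have 0: "?p x = 0" "?n x = - u x" using ab(1)[of x] ab(4) by auto
  then have "gam ?p g x = 0" using elim(5) by blast
  then show ?thesis using elim(1-4) 0(2) by simp
 qed
qed
qed


section \<open>The resolvent and the density of the generator domain\<close>

lemma integral_cauchy_schwarz:
assumes "integrable M (%x. (f x)^2)" "integrable M (%x. (g x)^2)" "f \<in> borel_measurable M" "g \<in> borel_measurable M"
shows "(LINT x|M. f x * g x)^2 <= (LINT x|M. (f x)^2) * (\<integral>x. (g x)^2 \<partial>M :: real)"
proof (rule quadratic_nonneg_imp)
show "0 <= (LINT x|M. (f x)^2)" by simp
fix t :: real
have "0 <= (LINT x|M. (t * f x + g x)^2)" by simp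
also have "(LINT x|M. (t * f x + g x)^2) = (LINT x|M. t^2 * (f x)^2 + (2 * t * (f x * g x) + (g x)^2))" by (simp add: power2_eq_square algebra_simps)
also have "... = t^2 * (LINT x|M. (f x)^2) + (2 * t * (LINT x|M. f x * g x) + (LINT x|M. (g x)^2))" using assms mult_integrable[OF assms] by simp
finally show "0 <= t^2 * (LINT x|M. (f x)^2) + 2 * t * (LINT x|M. f x * g x) + (LINT x|M. (g x)^2)" by simp
qed

lemma D_mult_integrable: "f \<in> D ==> g \<in> D ==> integrable M (%x. f x * g x)" by (intro mult_integrable D_sq_integrable D_measurable)

text \<open>v minimises the energy plus lam times the squared L2 distance to f, and the claim is the
  Euler equation of this problem; in other words, v is the resolvent applied to lam f.\<close>

lemma resolvent_exists:
assumes f: "f \<in> D" and lam: "lam > 0"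
obtains v where "v \<in> D" "!!h. h \<in> D ==> e v h = - (LINT x|M. (lam * (v x - f x)) * h x)"
proof -
define J where "J v = e v v + lam * (LINT x|M. (v x - f x)^2)" for v
define Q where "Q h = e h h + lam * (LINT x|M. (h x)^2)" for h
define b where "b v h = e v h + lam * (LINT x|M. (v x - f x) * h x)" for v h
have J0: "0 <= J v" if "v \<in> D" for v using e_nonneg[OF that] lam by (simp add: J_def)
have Q0: "0 <= Q v" if "v \<in> D" for v using e_nonneg[OF that] lam by (simp add: Q_def)
have expand: "J (%x. t * h x + v x) = J v + 2 * t * b v h + t^2 * Q h" if v: "v \<in> D" and h: "h \<in> D" for v h t
proof -
 have vf: "(%x. v x - f x) \<in> D" by (intro D_diff v f)
 have "(LINT x|M. ((t * h x + v x) - f x)^2) = (LINT x|M. t^2 * (h x)^2 + (2 * t * ((v x - f x) * h x) + (v x - f x)^2))" by (rule lint_cong) (simp_all add: power2_eq_square algebra_simps)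
 also have "... = t^2 * (LINT x|M. (h x)^2) + (2 * t * (LINT x|M. (v x - f x) * h x) + (LINT x|M. (v x - f x)^2))" using D_mult_integrable[OF vf h] D_sq_integrable[OF vf] D_sq_integrable[OF h] by simp
 finally show ?thesis unfolding J_def b_def Q_def e_quadratic[OF h v] by (simp add: e_sym[OF h v] algebra_simps)
qed
define m where "m = Inf (J ` D)"
have bdd: "bdd_below (J ` D)" by (rule bdd_belowI[of _ 0]) (use J0 in auto)
have m_le: "m <= J v" if "v \<in> D" for v unfolding m_def using bdd that by (intro cInf_lower) auto
have "\<exists>v\<in>D. J v < m + 1 / real (Suc n)" for n
proof -
 have "m < m + 1 / real (Suc n)" by simp
 then show ?thesis unfolding m_def[of] using cInf_less_iff[of "J ` D" "m + 1 / real (Suc n)"] bdd f by (auto simp: m_def)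
qed
then obtain S where S: "!!n. S n \<in> D" "!!n. J (S n) < m + 1 / real (Suc n)" by metis
define r where "r n = 1 / real (Suc n)" for n
have Sr: "J (S n) < m + r n" for n using S(2)[of n] by (simp only: r_def)
have r_mono: "r i <= r k" if "k <= i" for i k unfolding r_def using that by (intro divide_left_mono) auto
\<comment> \<open>The infimum is tested at the midpoint of S k and S j, as in the parallelogram
  law.\<close>
have QS: "Q (%x. S j x - S k x) <= 2 * (r j + r k)" for j k
proof -
 let ?d = "%x. S j x - S k x"
 have d: "?d \<in> D" by (intro D_diff S)
 have "J (S j) = J (S k) + 2 * b (S k) ?d + Q ?d" using expand[OF S(1)[of k] d, of 1] by simp
 moreover have "m <= J (S k) + b (S k) ?d + Q ?d / 4" using expand[OF S(1)[of k] d, of "1/2"] m_le[OF D_lin[OF d S(1), of "1/2" k]] by (simp add: power2_eq_square)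
 ultimately show ?thesis using Sr[of j] Sr[of k] by (simp add: field_simps)
qed
define L where "L = max 1 (1 / lam)"
have fn: "(form_norm M e h)^2 <= L * Q h" if h: "h \<in> D" for h
proof -
 have "(LINT x|M. (h x)^2) = (1 / lam) * (lam * (LINT x|M. (h x)^2))" using lam by simp
 also have "... <= L * (lam * (LINT x|M. (h x)^2))" using lam by (intro mult_right_mono) (auto simp: L_def)
 finally have "(LINT x|M. (h x)^2) <= L * (lam * (LINT x|M. (h x)^2))" .
 moreover have "e h h <= L * e h h" using e_nonneg[OF h] mult_right_mono[of 1 L "e h h"] by (simp add: L_def)
 ultimately show ?thesis unfolding form_norm_sq[OF h] Q_def distrib_left by linarith
qed
have L: "L > 0" by (simp add: L_def)
have "\<exists>v\<in>D. (%k. form_norm M e (%x. S k x - v x)) ---> 0"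
proof (rule form_complete, intro conjI allI impI S(1))
 fix eps :: real assume eps: "eps > 0"
 obtain K where K: "4 * L / eps\<^sup>2 < real K" using reals_Archimedean2 by blast
 show "EX K. ALL j>=K. ALL k>=K. form_norm M e (%x. S j x - S k x) < eps"
 proof (intro exI[of _ K] allI impI)
  fix j k assume jk: "j >= K" "k >= K"
  have "Q (%x. S j x - S k x) <= 4 * r K" by (rule order_trans[OF QS]) (use r_mono[OF jk(1)] r_mono[OF jk(2)] in simp)
  then have "Q (%x. S j x - S k x) <= 4 * (1 / real (Suc K))" by (simp only: r_def)
  then have "(form_norm M e (%x. S j x - S k x))^2 <= L * (4 * (1 / real (Suc K)))" using fn[OF D_diff[OF S(1) S(1)], of j k] L by (meson mult_left_mono less_imp_le order_trans)
  also have "... < eps\<^sup>2"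
  proof -
   have "4 * L < real K * eps\<^sup>2" using K eps by (simp add: divide_less_eq)
   also have "... <= real (Suc K) * eps\<^sup>2" by (intro mult_right_mono) auto
   finally show ?thesis by (simp add: divide_less_eq mult.commute)
  qed
  finally show "form_norm M e (%x. S j x - S k x) < eps" using eps by (rule power2_less_imp_less[OF _ less_imp_le])
 qed
qed
then obtain v where v: "v \<in> D" and lim: "(%k. form_norm M e (%x. S k x - v x)) ---> 0" by blast
have sq: "(%k. (LINT x|M. (S k x - v x)^2) + e (%x. S k x - v x) (%x. S k x - v x)) ---> 0" using tendsto_power[OF lim, of 2] by (simp add: form_norm_sq[OF D_diff[OF S(1) v]])
have null: "a ---> 0" if "!!n. (a n)^2 <= c n" "c ---> 0" for a c :: "nat => real"
proof -
 have "(%n. (a n)^2) ---> 0" by (rule tendsto_sandwich[OF _ _ tendsto_const that(2)]) (use that(1) in auto)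
 then show ?thesis by simp
qed
have inv0: "(%n. 1 / real (Suc n)) ---> 0" by real_asymp
have "e v h = - (LINT x|M. (lam * (v x - f x)) * h x)" if h: "h \<in> D" for h
proof -
 have "(%n. b (S n) h) ---> 0"
 proof (rule null)
  fix n
  \<comment> \<open>J(S n + t h) - m is a quadratic in t with nonnegative values; its discriminant
    shows that S n almost solves the Euler equation.\<close>
  have "(b (S n) h)^2 <= Q h * (J (S n) - m)"
  proof (rule quadratic_nonneg_imp[OF Q0[OF h]])
   fix t show "0 <= t^2 * Q h + 2 * t * b (S n) h + (J (S n) - m)" using m_le[OF D_lin[OF h S(1)], of t n] expand[OF S(1) h, of t n] by simp
  qed
  also have "... <= Q h * (1 / real (Suc n))" using S(2)[of n] by (intro mult_left_mono Q0[OF h]) simp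
  finally show "(b (S n) h)^2 <= Q h * (1 / real (Suc n))" .
  show "(%n. Q h * (1 / real (Suc n))) ---> 0" using tendsto_mult[OF tendsto_const inv0, of "Q h"] by simp
 qed
 moreover have "(%n. b (S n) h - b v h) ---> 0"
 proof -
  have eq: "b (S n) h - b v h = e (%x. S n x - v x) h + lam * (LINT x|M. (S n x - v x) * h x)" for n
  proof -
   have "(LINT x|M. (S n x - v x) * h x) = (LINT x|M. (S n x - f x) * h x - (v x - f x) * h x)" by (simp add: algebra_simps)
   also have "... = (LINT x|M. (S n x - f x) * h x) - (LINT x|M. (v x - f x) * h x)" by (intro lint_diff D_mult_integrable D_diff S v f h)
   finally have *: "(LINT x|M. (S n x - v x) * h x) = ..." .
   show ?thesis unfolding b_def e_diff_left[OF S(1) v h] * right_diff_distrib by linarith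
  qed
  have sD: "(%x. S n x - v x) \<in> D" for n by (intro D_diff S v)
  have bnd: "e (%x. S n x - v x) (%x. S n x - v x) * c <= ((LINT x|M. (S n x - v x)^2) + e (%x. S n x - v x) (%x. S n x - v x)) * c"
   "(LINT x|M. (S n x - v x)^2) * c <= ((LINT x|M. (S n x - v x)^2) + e (%x. S n x - v x) (%x. S n x - v x)) * c" if "c >= 0" for n c using e_nonneg[OF sD, of n] that by (auto intro!: mult_right_mono)
  have "(%n. e (%x. S n x - v x) h) ---> 0" by (rule null[OF order_trans[OF e_cauchy_schwarz[OF sD h] bnd(1)[OF e_nonneg[OF h]]]])
    (use tendsto_mult[OF sq tendsto_const, of "e h h"] in simp)
  moreover have "(%n. \<integral>x. (S n x - v x) * h x \<partial>M) ---> 0" by (rule null[OF order_trans[OF integral_cauchy_schwarz[OF D_sq_integrable[OF sD] D_sq_integrable[OF h] D_measurable[OF sD] D_measurable[OF h]] bnd(2)]])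
    (use tendsto_mult[OF sq tendsto_const, of "\<integral>x. (h x)^2 \<partial>M"] in auto)
  ultimately have "(%n. e (%x. S n x - v x) h + lam * (LINT x|M. (S n x - v x) * h x)) ---> 0 + lam * 0" by (intro tendsto_intros)
  then show ?thesis unfolding eq by simp
 qed
 ultimately have "(%n. b (S n) h - (b (S n) h - b v h)) ---> 0 - 0" by (rule tendsto_diff)
 then have "b v h = 0" by (simp add: LIMSEQ_const_iff)
 then show ?thesis by (simp add: b_def mult.assoc)
qed
then show ?thesis using that v by blast
qed

text \<open>The energies increase and are bounded, hence converge, and their increments dominate the
  energies of the differences.\<close>

lemma energy_monotone_cauchy:
fixes S :: "nat => 'a => real"
assumes S: "!!n. S n \<in> D" and le: "!!n. e (S n) (S n) <= C"
 and mono: "!!l m. l < m ==> e (%x. S m x - S l x) (%x. S m x - S l x) <= e (S m) (S m) - e (S l) (S l)"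
 and eps: "eps > 0"
shows "EX K. ALL j>=K. ALL k>=K. e (%x. S j x - S k x) (%x. S j x - S k x) < eps"
proof -
define E where "E n = e (S n) (S n)" for n
have "incseq E"
proof (rule incseq_SucI)
 fix n show "E n <= E (Suc n)" using mono[of n "Suc n"] e_nonneg[OF D_diff[OF S(1) S(1)], of "Suc n" n] by (simp add: E_def)
qed
moreover have "!!n. E n <= C" using le by (simp add: E_def)
ultimately have "Cauchy E" using incseq_convergent[of E "C"] LIMSEQ_imp_Cauchy by blast
obtain K where K: "!!j k. j >= K ==> k >= K ==> dist (E j) (E k) < eps" using metric_CauchyD[OF \<open>Cauchy E\<close> eps] by blast
have "e (%x. S j x - S k x) (%x. S j x - S k x) < eps" if jk: "j >= K" "k >= K" for j k
proof (cases j k rule: linorder_cases)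
 case less
 have "e (%x. S j x - S k x) (%x. S j x - S k x) = e (%x. S k x - S j x) (%x. S k x - S j x)" using e_diff_sq[OF S(1) S(1), of j k] e_diff_sq[OF S(1) S(1), of k j] e_sym[OF S(1) S(1), of j k] by simp
 then show ?thesis using mono[OF less] K[OF jk] by (simp add: E_def dist_real_def)
next
 case equal
 then show ?thesis using eps e_zero[OF D_zero] by simp
next
 case greater
 then show ?thesis using mono[OF greater] K[OF jk] by (simp add: E_def dist_real_def)
qed
then show ?thesis by blast
qed

text \<open>The resolvents of f with parameters n + 1, normalised, lie in the generator domain. The
  Euler equation bounds their energies and their L2 distance to f; monotonicity of the energies
  upgrades L2 convergence to convergence in energy.\<close>

lemma generator_domain_dense:
assumes f: "f \<in> D" and dl: "dl > 0"
obtains g a where "is_generator_value M D e g a" "e (%x. g x - f x) (%x. g x - f x) < dl"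
proof -
have "EX v. v \<in> D \<and> (\<forall>h\<in>D. e v h = - (LINT x|M. (real (Suc n) * (v x - f x)) * h x))" for n using resolvent_exists[OF f, of "real (Suc n)"] by (metis of_nat_0_less_iff zero_less_Suc)
then obtain S where S: "!!n. S n \<in> D" "!!n h. h \<in> D ==> e (S n) h = - (LINT x|M. (real (Suc n) * (S n x - f x)) * h x)" by metis
have sf: "(%x. S n x - f x) \<in> D" for n by (intro D_diff S f)
have S2: "e (S n) h = - (real (Suc n) * (LINT x|M. (S n x - f x) * h x))" if "h \<in> D" for n h by (simp only: S(2)[OF that] mult.assoc Bochner_Integration.integral_mult_right_zero)
have gen: "is_generator_value M D e (S n) (%x. real (Suc n) * (S n x - f x))" for n unfolding is_generator_value_def l2_space_def using S D_measurable[OF D_scale[OF sf]] D_sq_integrable[OF D_scale[OF sf]] by (auto simp del: of_nat_Suc)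
define I where "I n = (LINT x|M. (S n x - f x)^2)" for n
have I0: "I n >= 0" for n by (simp add: I_def)
have bound: "e (S n) (S n) <= e f f" "I n <= e f f / real (Suc n)" for n
proof -
 have "e (S n) (%x. S n x - f x) = - (real (Suc n) * I n)" unfolding S2[OF sf] I_def power2_eq_square ..
 then have 1: "e (S n) (S n) - e (S n) f = - (real (Suc n) * I n)" by (simp add: e_diff_right S f)
 have "0 <= e (%x. S n x - f x) (%x. S n x - f x)" by (rule e_nonneg[OF sf])
 then have 2: "2 * e (S n) f <= e (S n) (S n) + e f f" by (simp add: e_diff_sq S f)
 have p: "0 <= real (Suc n) * I n" using I0[of n] by (intro mult_nonneg_nonneg) auto
 show "e (S n) (S n) <= e f f" using 1 2 p by linarith
 have "real (Suc n) * I n <= e f f" using 1 2 p e_nonneg[OF S(1)[of n]] by linarith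
 then show "I n <= e f f / real (Suc n)" by (simp add: le_divide_eq mult.commute del: of_nat_Suc)
qed
have mono: "e (%x. S m x - S l x) (%x. S m x - S l x) <= e (S m) (S m) - e (S l) (S l)" if ml: "l < m" for l m
proof -
 let ?d = "%x. S m x - S l x"
 have d: "?d \<in> D" by (intro D_diff S)
 \<comment> \<open>The two Euler equations are tested with the difference of the resolvents;
   nonnegativity of its energy determines the sign of T, and with it the monotonicity.\<close>
 define T U where "T = - (LINT x|M. (S m x - f x) * ?d x)" and "U = - (LINT x|M. (S l x - f x) * ?d x)"
 have UT: "U = (LINT x|M. (?d x)^2) + T"
 proof -
  have "(LINT x|M. (?d x)^2) = (LINT x|M. (S m x - f x) * ?d x - (S l x - f x) * ?d x)" by (simp add: power2_eq_square algebra_simps)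
  also have "... = (LINT x|M. (S m x - f x) * ?d x) - (LINT x|M. (S l x - f x) * ?d x)" by (intro lint_diff D_mult_integrable sf d)
  finally show ?thesis by (simp add: T_def U_def)
 qed
 have N: "0 <= (LINT x|M. (?d x)^2)" by simp
 have em: "e (S m) ?d = real (Suc m) * T" and el: "e (S l) ?d = real (Suc l) * U" unfolding S2[OF d] T_def U_def by simp_all
 have "0 <= e ?d ?d" by (rule e_nonneg[OF d])
 also have "e ?d ?d = real (Suc m) * T - real (Suc l) * U" unfolding em[symmetric] el[symmetric] by (rule e_diff_left[OF S(1) S(1) d])
 finally have "real (Suc l) * U <= real (Suc m) * T" by simp
 then have "real (Suc l) * (LINT x|M. (?d x)^2) <= (real (Suc m) - real (Suc l)) * T" unfolding UT by (simp add: algebra_simps)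
 moreover have "0 <= real (Suc l) * (LINT x|M. (?d x)^2)" using N by (intro mult_nonneg_nonneg) auto
 ultimately have "0 <= (real (Suc m) - real (Suc l)) * T" by linarith
 then have "T >= 0" using ml by (simp add: zero_le_mult_iff)
 then have "0 <= U" using UT N by linarith
 then have "0 <= real (Suc l) * U" by simp
 then have "e (S l) (S l) <= e (S l) (S m)" unfolding el[symmetric] e_diff_right[OF S(1) S(1) S(1)] by simp
 then show ?thesis using e_diff_sq[OF S(1) S(1), of m l] e_sym[OF S(1) S(1), of m l] by linarith
qed
note cauchy = energy_monotone_cauchy[OF S(1) bound(1) mono]
have "I ---> 0"
proof (rule tendsto_sandwich[OF _ _ tendsto_const])
 have "(%n. 1 / real (Suc n)) ---> 0" by real_asymp
 from tendsto_mult[OF tendsto_const[of "e f f"] this] show "(%n. e f f / real (Suc n)) ---> 0" by simp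
qed (use I0 bound(2) in \<open>auto intro!: always_eventually simp del: of_nat_Suc\<close>)
then have "(%n. e (%x. S n x - f x) (%x. S n x - f x)) ---> 0" unfolding I_def using D_measurable[OF f] D_sq_integrable[OF sf] by (intro form_limit(2)[OF S(1) cauchy]) auto
from order_tendstoD(2)[OF this dl] obtain n where "e (%x. S n x - f x) (%x. S n x - f x) < dl" by (auto simp: eventually_sequentially)
then show ?thesis using that gen by blast
qed

end

section \<open>Calculus for bounded elements and integration by parts with the kernel\<close>

lemma lips_C1:
assumes "a <= b" "!!s. s \<in> {a..b} ==> (F has_real_derivative psi s) (at s)" "continuous_on {a..b} psi"
shows "lips a b F"
proof -
have "compact (psi ` {a..b})" using assms(3) by (intro compact_continuous_image) auto
then obtain S where S: "!!s. s \<in> {a..b} ==> \<bar>psi s\<bar> <= S" using compact_imp_bounded by (fastforce simp: bounded_iff)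
have "\<bar>F r - F s\<bar> <= S * \<bar>r - s\<bar>" if "r \<in> {a..b}" "s \<in> {a..b}" for r s using field_differentiable_bound[of "{a..b}" F psi S r s] S that has_field_derivative_at_within[OF assms(2)] by (simp add: convex_real_interval)
moreover have "S >= 0" using S[of a] assms(1) by auto
ultimately show ?thesis by (auto simp: lips_def)
qed

lemma C11_poly: "a <= b ==> C11 a b (poly p) (poly (pderiv p))" unfolding C11_def by (auto intro!: poly_DERIV lips_C1[where psi = "poly (pderiv (pderiv p))"] continuous_intros)

lemma inverse_sqrt_power_deriv:
assumes "c + t > (0::real)"
shows "((%t. K / sqrt (c + t) ^ m) has_real_derivative - (K * real m / 2) / sqrt (c + t) ^ (m + 2)) (at t)"
proof -
have s: "sqrt (c + t) > 0" using assms by simp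
have "((%t. sqrt (c + t)) has_real_derivative inverse (sqrt (c + t)) / 2) (at t)"
proof -
 have "((%t. c + t) has_real_derivative 1) (at t)" by (auto intro!: derivative_eq_intros)
 from DERIV_chain2[where f = sqrt and g = "%t. c + t", OF DERIV_real_sqrt[OF assms] this] show ?thesis by simp
qed
then have "((%t. sqrt (c + t) ^ m) has_real_derivative real m * sqrt (c + t) ^ (m - 1) * (inverse (sqrt (c + t)) / 2)) (at t)" by (rule DERIV_cong[OF DERIV_power]) simp
then have "((%t. K / sqrt (c + t) ^ m) has_real_derivative
  (0 * sqrt (c + t) ^ m - K * (real m * sqrt (c + t) ^ (m - 1) * (inverse (sqrt (c + t)) / 2))) / (sqrt (c + t) ^ m * sqrt (c + t) ^ m)) (at t)" using s by (intro DERIV_divide DERIV_const) auto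
then show ?thesis by (rule DERIV_cong) (use s in \<open>cases m; simp add: field_simps\<close>)
qed

lemma C11_inverse_sqrt_power:
assumes "a <= b" "c + a > 0"
shows "C11 a b (%t. K / sqrt (c + t) ^ m) (%t. - (K * real m / 2) / sqrt (c + t) ^ (m + 2))" unfolding C11_def
proof (intro conjI ballI assms(1))
fix s assume "s \<in> {a..b}"
then show "((%t. K / sqrt (c + t) ^ m) has_real_derivative - (K * real m / 2) / sqrt (c + s) ^ (m + 2)) (at s)" using assms by (intro inverse_sqrt_power_deriv) auto
next
have pos: "c + t > 0" if "t \<in> {a..b}" for t using that assms by auto
show "lips a b (%t. - (K * real m / 2) / sqrt (c + t) ^ (m + 2))" by (rule lips_C1[OF assms(1) inverse_sqrt_power_deriv[OF pos]]) (use pos in \<open>fastforce intro!: continuous_intros\<close>)+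
qed

context dirichlet_structure
begin

lemma bounded_add: "(EX C. ALL x. \<bar>u x\<bar> <= C) ==> (EX C. ALL x. \<bar>v x\<bar> <= C) ==> EX C. ALL x. \<bar>u x + v x :: real\<bar> <= C" by (meson abs_triangle_ineq add_mono order_trans)

lemma bounded_mult: "(EX C. ALL x. \<bar>u x\<bar> <= C) ==> (EX C. ALL x. \<bar>v x\<bar> <= C) ==> EX C. ALL x. \<bar>u x * v x :: real\<bar> <= C" unfolding abs_mult by (meson mult_mono abs_ge_zero order_trans)

lemma bounded_sum: "finite I ==> (!!i. i \<in> I ==> EX C. ALL x. \<bar>f i x\<bar> <= C) ==> EX C. ALL x. \<bar>\<Sum>i\<in>I. f i x :: real\<bar> <= C" by (induction I rule: finite_induct) (auto intro!: bounded_add)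

lemma bounded_const: "EX C. ALL x. \<bar>c :: real\<bar> <= C" by blast

lemma bounded_pos: "(EX C. ALL x. \<bar>u x :: real\<bar> <= C) ==> EX C>0. ALL x. \<bar>u x\<bar> <= C" by (metis gt_ex le_less_trans less_imp_le linorder_not_le max.cobounded1 max.strict_coboundedI2 max.cobounded2 order_trans)

lemma poly_chain:
assumes u: "u \<in> D" "EX C. ALL x. \<bar>u x\<bar> <= C"
shows "(%x. poly p (u x) - poly p 0) \<in> D"
 and "g \<in> D ==> AE x in M. gam (%x. poly p (u x) - poly p 0) g x = poly (pderiv p) (u x) * gam u g x"
proof -
obtain C where C: "C > 0" "!!x. \<bar>u x\<bar> <= C" using bounded_pos[OF u(2)] by blast
have "- C <= u x" "u x <= C" for x using C(2)[of x] by auto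
note * = chain_rule[OF u(1) this _ C(1) C11_poly C11_poly]
show "(%x. poly p (u x) - poly p 0) \<in> D" using C(1) by (intro *(1)) auto
show "g \<in> D ==> AE x in M. gam (%x. poly p (u x) - poly p 0) g x = poly (pderiv p) (u x) * gam u g x" using C(1) by (intro *(2)) auto
qed

lemma square_chain:
assumes u: "u \<in> D" "EX C. ALL x. \<bar>u x\<bar> <= C"
shows "(%x. u x * u x) \<in> D"
 and "g \<in> D ==> AE x in M. gam (%x. u x * u x) g x = 2 * u x * gam u g x" using poly_chain[OF u, where p = "monom 1 2"] by (simp_all add: poly_monom pderiv_monom power2_eq_square)

text \<open>Polarisation of the chain rule for the square.\<close>

lemma leibniz:
assumes u: "u \<in> D" "EX C. ALL x. \<bar>u x\<bar> <= C" and v: "v \<in> D" "EX C. ALL x. \<bar>v x\<bar> <= C"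
shows "(%x. u x * v x) \<in> D"
 and "g \<in> D ==> AE x in M. gam (%x. u x * v x) g x = u x * gam v g x + v x * gam u g x"
proof -
let ?s = "%x. u x + v x"
have s: "?s \<in> D" "EX C. ALL x. \<bar>?s x\<bar> <= C" by (rule D_add[OF u(1) v(1)]) (rule bounded_add[OF u(2) v(2)])
have eq: "u x * v x = (1/2) * (?s x * ?s x - (u x * u x + v x * v x))" for x by (simp add: algebra_simps)
have D1: "(%x. u x * u x + v x * v x) \<in> D" by (intro D_add square_chain u v)
have D2: "(%x. ?s x * ?s x - (u x * u x + v x * v x)) \<in> D" by (intro D_diff D1 square_chain(1) s)
show "(%x. u x * v x) \<in> D" unfolding eq by (rule D_scale[OF D2])
assume g: "g \<in> D"
show "AE x in M. gam (%x. u x * v x) g x = u x * gam v g x + v x * gam u g x" unfolding eq using gam_scale[OF D2 g, of "1/2"] gam_diff[OF square_chain(1)[OF s] D1 g] gam_add[OF square_chain(1)[OF u] square_chain(1)[OF v] g]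
  square_chain(2)[OF s g] square_chain(2)[OF u g] square_chain(2)[OF v g] gam_add[OF u(1) v(1) g] by eventually_elim (simp add: algebra_simps)
qed

text \<open>The chain rule for the regularised kernel, which depends on \<open>f\<close> through \<open>f i - y i\<close> and
through the single element \<open>\<Sum>i. (f i - y i)^2 - (y i)\<^sup>2\<close> of the domain.\<close>

lemma kernel_chain:
assumes f: "!!j. j < n ==> f j \<in> D" "!!j. j < n ==> EX C. ALL x. \<bar>f j x\<bar> <= C" and eps: "eps > 0" and i: "i < n"
obtains q c where "q \<in> D" "EX C. ALL x. \<bar>q x\<bar> <= C" "!!x. rk n eps i (dif n (\<lambda>j\<in>{..<n}. f j x) y) = q x - c"
 "!!g. g \<in> D ==> AE x in M. gam q g x = (\<Sum>j<n. drk n eps i j (dif n (\<lambda>j\<in>{..<n}. f j x) y) * gam (f j) g x)"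
proof -
define Y where "Y = (\<Sum>j<n. (y j)^2)"
define w where "w x = (\<Sum>j<n. f j x * f j x + (- 2 * y j) * f j x)" for x
define c where "c = eps\<^sup>2 + Y"
define F where "F t = 1 / sqrt (c + t) ^ n" for t
define psi where "psi t = - (1 * real n / 2) / sqrt (c + t) ^ (n + 2)" for t
have wterm: "(%x. f j x * f j x + (- 2 * y j) * f j x) \<in> D" if "j < n" for j using f that by (intro D_add D_scale square_chain) auto
have wD: "w \<in> D" unfolding w_def[abs_def] by (intro D_sum wterm) auto
have wb: "EX C. ALL x. \<bar>w x\<bar> <= C" unfolding w_def[abs_def] by (intro bounded_sum bounded_add bounded_mult bounded_const) (use f in auto)
have cw: "c + w x = eps\<^sup>2 + (\<Sum>j<n. (dif n (\<lambda>j\<in>{..<n}. f j x) y j)^2)" for x by (simp add: c_def Y_def w_def sum.distrib[symmetric] power2_eq_square algebra_simps)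
have wt_eq: "wt n eps (dif n (\<lambda>j\<in>{..<n}. f j x) y) = sqrt (c + w x)" for x by (simp only: wt_def cw)
obtain C where C: "C > 0" "!!x. \<bar>w x\<bar> <= C" using bounded_pos[OF wb] by blast
\<comment> \<open>Always w \<ge> -Y, so on the interval from a on the argument of the root stays
  above c + a = eps^2 / 2. The slack eps^2 / 2 makes a negative even when Y = 0, as
  \<open>chain_rule\<close> requires.\<close>
define a where "a = - (Y + eps\<^sup>2 / 2)"
have e2: "eps\<^sup>2 > 0" using eps by simp
have Y0: "Y >= 0" unfolding Y_def by (intro sum_nonneg) auto
have a: "a < 0" "c + a > 0" unfolding a_def c_def using Y0 e2 by linarith+
have aw: "a <= w x" for x
proof -
 have "0 <= (\<Sum>j<n. (dif n (\<lambda>j\<in>{..<n}. f j x) y j)^2)" by (rule sum_nonneg) (rule zero_le_power2)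
 then have "eps\<^sup>2 <= c + w x" unfolding cw by linarith
 then show ?thesis unfolding a_def c_def using e2 by linarith
qed
have wC: "w x <= C" for x using C(2)[of x] by simp
have aC: "a <= C" using a C(1) by simp
have CF: "C11 a C F psi" and Cpsi: "C11 a C psi (%t. - (- (1 * real n / 2) * real (n + 2) / 2) / sqrt (c + t) ^ (n + 2 + 2))" unfolding F_def[abs_def] psi_def[abs_def] by (rule C11_inverse_sqrt_power[OF aC a(2)])+
define P where "P x = F (w x) - F 0" for x
have PD: "P \<in> D" and Pgam: "!!g. g \<in> D ==> AE x in M. gam P g x = psi (w x) * gam w g x" unfolding P_def[abs_def] using chain_rule[OF wD aw wC a(1) C(1) CF Cpsi] by auto
have Pb: "EX C. ALL x. \<bar>P x\<bar> <= C"
proof -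
 obtain S where S: "!!s. s \<in> {a..C} ==> \<bar>F s\<bar> <= S" using lips_bounded[OF C11_lips[OF CF] aC] by blast
 have "\<bar>P x\<bar> <= S + S" for x using S[of "w x"] S[of 0] aw wC a(1) C(1) by (auto simp: P_def)
 then show ?thesis by blast
qed
have fi: "f i \<in> D" "EX C. ALL x. \<bar>f i x\<bar> <= C" using f i by auto
note fP = leibniz[OF fi PD Pb]
\<comment> \<open>The remaining term - y i * F 0 is a constant, which need not belong to the domain;
  it becomes the additive constant of the conclusion.\<close>
define q where "q x = (f i x * P x + F 0 * f i x) + (- y i) * P x" for x
have D1: "(%x. f i x * P x + F 0 * f i x) \<in> D" and D2: "(%x. (- y i) * P x) \<in> D" by (intro D_add D_scale fP(1) fi PD)+
have qD: "q \<in> D" unfolding q_def[abs_def] by (rule D_add[OF D1 D2])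
have qb: "EX C. ALL x. \<bar>q x\<bar> <= C" unfolding q_def[abs_def] by (intro bounded_add bounded_mult bounded_const fi Pb)
have rk_eq: "rk n eps i (dif n (\<lambda>j\<in>{..<n}. f j x) y) = q x - y i * F 0" for x using i by (simp add: rk_def wt_eq q_def P_def F_def diff_divide_distrib algebra_simps)
have "AE x in M. gam q g x = (\<Sum>j<n. drk n eps i j (dif n (\<lambda>j\<in>{..<n}. f j x) y) * gam (f j) g x)" if g: "g \<in> D" for g
proof -
 have "AE x in M. \<forall>j\<in>{..<n}. gam (%x. f j x * f j x + (- 2 * y j) * f j x) g x = 2 * (f j x - y j) * gam (f j) g x"
 proof (rule AE_ball_countable')
  show "countable {..<n}" by simp
  fix j assume "j \<in> {..<n}"
  then have fj: "f j \<in> D" "EX C. ALL x. \<bar>f j x\<bar> <= C" using f by auto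
  show "AE x in M. gam (%x. f j x * f j x + (- 2 * y j) * f j x) g x = 2 * (f j x - y j) * gam (f j) g x" using gam_add[OF square_chain(1)[OF fj] D_scale[OF fj(1), of "- 2 * y j"] g] square_chain(2)[OF fj g] gam_scale[OF fj(1) g, of "- 2 * y j"] by eventually_elim (simp add: algebra_simps)
 qed
 moreover have "AE x in M. gam w g x = (\<Sum>j<n. gam (%x. f j x * f j x + (- 2 * y j) * f j x) g x)" unfolding w_def[abs_def] by (intro gam_sum wterm g) auto
 moreover note Pgam[OF g] fP(2)[OF g] gam_add[OF D1 D2 g] gam_add[OF fP(1) D_scale[OF fi(1), of "F 0"] g] gam_scale[OF fi(1) g, of "F 0"] gam_scale[OF PD g, of "- y i"]
 ultimately show ?thesis
 proof eventually_elim
  case (elim x)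
  let ?z = "dif n (\<lambda>j\<in>{..<n}. f j x) y"
  have Fw: "F (w x) = P x + F 0" by (simp add: P_def)
  have z: "?z j = f j x - y j" if "j < n" for j using that by simp
  have "gam q g x = F (w x) * gam (f i) g x + ?z i * gam P g x" using elim(4-8) unfolding q_def[abs_def] z[OF i] Fw by (simp add: algebra_simps)
  also have "gam P g x = (\<Sum>j<n. 2 * psi (w x) * ?z j * gam (f j) g x)" unfolding elim(3) elim(2) sum_distrib_left
  proof (rule sum.cong[OF refl])
   fix j assume j: "j \<in> {..<n}"
   have zj: "?z j = f j x - y j" using j by simp
   show "psi (w x) * gam (%x. f j x * f j x + (- 2 * y j) * f j x) g x = 2 * psi (w x) * ?z j * gam (f j) g x" unfolding elim(1)[rule_format, OF j] zj by (simp only: mult_ac)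
  qed
  also have "F (w x) * gam (f i) g x = (\<Sum>j<n. kd i j / wt n eps ?z ^ n * gam (f j) g x)"
  proof -
   have "(\<Sum>j<n. kd i j / wt n eps ?z ^ n * gam (f j) g x) = (\<Sum>j<n. if i = j then gam (f j) g x / wt n eps ?z ^ n else 0)" by (intro sum.cong) (auto simp: kd_def)
   then show ?thesis using i by (simp add: wt_eq F_def)
  qed
  finally have "gam q g x = (\<Sum>j<n. kd i j / wt n eps ?z ^ n * gam (f j) g x + ?z i * (2 * psi (w x) * ?z j * gam (f j) g x))" by (simp only: sum.distrib sum_distrib_left)
  also have "... = (\<Sum>j<n. drk n eps i j ?z * gam (f j) g x)" unfolding drk_def wt_eq psi_def by (intro sum.cong refl) (simp add: algebra_simps)
  finally show ?case .
 qed
qed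
then show ?thesis by (rule that[OF qD qb rk_eq])
qed

text \<open>Integration by parts against an element of the generator's domain, localised by the cutoff \<open>k\<close>.
As \<open>r\<close> has integral \<open>0\<close>, the additive constant in the kernel is harmless.\<close>

lemma kernel_integration_by_parts:
assumes k: "k \<in> D" "EX C. ALL x. \<bar>k x\<bar> <= C" and g: "is_generator_value M D e g a"
obtains r where "integrable M r"
 "!!n f eps i y. (!!j. j < n ==> f j \<in> D) ==> (!!j. j < n ==> EX C. ALL x. \<bar>f j x\<bar> <= C) ==> eps > 0 ==> i < n ==>
  (LINT x|M. k x * (\<Sum>j<n. drk n eps i j (dif n (\<lambda>j\<in>{..<n}. f j x) y) * gam (f j) g x))
   = (LINT x|M. rk n eps i (dif n (\<lambda>j\<in>{..<n}. f j x) y) * r x)"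
proof -
have gD: "g \<in> D" and a: "a \<in> borel_measurable M" "integrable M (%x. (a x)^2)" and ea: "!!h. h \<in> D ==> e g h = - (LINT x|M. a x * h x)" using g by (auto simp: is_generator_value_def l2_space_def)
have aint: "integrable M (%x. a x * h x)" if "h \<in> D" for h using that by (intro mult_integrable a D_sq_integrable D_measurable)
define r where "r x = - (2 * (a x * k x) + gam k g x)" for x
have rint: "integrable M r" unfolding r_def[abs_def] using aint[OF k(1)] gam_int[OF k(1) gD] by simp
have eg: "(LINT x|M. gam h g x) = - 2 * (LINT x|M. a x * h x)" if "h \<in> D" for h using e_gam[OF that gD] ea[OF that] e_sym[OF that gD] by simp
have r0: "(LINT x|M. r x) = 0" unfolding r_def using aint[OF k(1)] gam_int[OF k(1) gD] eg[OF k(1)] by simp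
show ?thesis
proof (rule that[OF rint])
 fix n i :: nat and f :: "nat => 'a => real" and eps :: real and y :: "nat => real"
 assume f: "!!j. j < n ==> f j \<in> D" "!!j. j < n ==> EX C. ALL x. \<bar>f j x\<bar> <= C" and eps: "eps > (0::real)" and i: "i < n"
 obtain q c where q: "q \<in> D" "EX C. ALL x. \<bar>q x\<bar> <= C" "!!x. rk n eps i (dif n (\<lambda>j\<in>{..<n}. f j x) y) = q x - c"
  "!!g. g \<in> D ==> AE x in M. gam q g x = (\<Sum>j<n. drk n eps i j (dif n (\<lambda>j\<in>{..<n}. f j x) y) * gam (f j) g x)" by (rule kernel_chain[of n f eps i y]) (erule f(1), erule f(2), rule eps, rule i, blast)
 have kq: "(%x. k x * q x) \<in> D" by (rule leibniz[OF k q(1,2)])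
 obtain C where C: "!!x. \<bar>q x\<bar> <= C" using q(2) by blast
 have qk_int: "integrable M (%x. q x * gam k g x)" by (rule mult_gam_integrable[OF k(1) gD D_measurable[OF q(1)] C])
 have "(LINT x|M. k x * (\<Sum>j<n. drk n eps i j (dif n (\<lambda>j\<in>{..<n}. f j x) y) * gam (f j) g x))
  = (LINT x|M. gam (%x. k x * q x) g x - q x * gam k g x)"
 proof (rule integral_cong_AE)
  have dm: "(%x. (\<lambda>j\<in>{..<n}. f j x)) \<in> measurable M (Leb n)" using f by (intro measurable_restrict) (simp add: D_measurable)
  have [measurable]: "(%x. drk n eps i j (dif n (\<lambda>j\<in>{..<n}. f j x) y)) \<in> borel_measurable M" if "j < n" for j
  proof -
   have "(\<lambda>j\<in>{..<n}. y j) \<in> space (Leb n)" by (simp add: space_Leb)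
   then have "(%x. dif n (\<lambda>j\<in>{..<n}. f j x) (\<lambda>j\<in>{..<n}. y j)) \<in> measurable M (Leb n)" by (intro dif_measurable dm measurable_const)
   moreover have "dif n z (\<lambda>j\<in>{..<n}. y j) = dif n z y" for z by (auto simp: dif_def restrict_def fun_eq_iff)
   ultimately have "(%x. dif n (\<lambda>j\<in>{..<n}. f j x) y) \<in> measurable M (Leb n)" by simp
   then show ?thesis by (rule measurable_compose[OF _ drk_measurable[OF i that]])
  qed
  have [measurable]: "k \<in> borel_measurable M" by (rule D_measurable[OF k(1)])
  have [measurable]: "gam (f j) g \<in> borel_measurable M" if "j < n" for j using that by (intro gam_measurable f gD)
  show "(%x. k x * (\<Sum>j<n. drk n eps i j (dif n (\<lambda>j\<in>{..<n}. f j x) y) * gam (f j) g x)) \<in> borel_measurable M" by (intro borel_measurable_times borel_measurable_sum) simp_all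
  show "(%x. gam (%x. k x * q x) g x - q x * gam k g x) \<in> borel_measurable M" using gam_measurable[OF kq gD] qk_int by (intro borel_measurable_diff) auto
  show "AE x in M. k x * (\<Sum>j<n. drk n eps i j (dif n (\<lambda>j\<in>{..<n}. f j x) y) * gam (f j) g x) = gam (%x. k x * q x) g x - q x * gam k g x" using q(4)[OF gD] leibniz(2)[OF k q(1,2) gD] by eventually_elim simp
 qed
 also have "... = (LINT x|M. gam (%x. k x * q x) g x) - (LINT x|M. q x * gam k g x)" by (rule lint_diff[OF gam_int[OF kq gD] qk_int])
 also have "... = (LINT x|M. - 2 * (a x * (k x * q x)) - q x * gam k g x)" unfolding eg[OF kq] using aint[OF kq] qk_int by simp
 also have "... = (LINT x|M. q x * r x)" by (rule lint_cong) (simp_all add: r_def algebra_simps)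
 also have "... = (LINT x|M. q x * r x) - c * (LINT x|M. r x)" using r0 by simp
 also have "... = (LINT x|M. q x * r x - c * r x)"
 proof -
  have "integrable M (%x. - 2 * (a x * (k x * q x)) - q x * gam k g x)" using aint[OF kq] qk_int by simp
  moreover have "- 2 * (a x * (k x * q x)) - q x * gam k g x = q x * r x" for x by (simp add: r_def algebra_simps)
  ultimately show ?thesis using rint by simp
 qed
 also have "... = (LINT x|M. rk n eps i (dif n (\<lambda>j\<in>{..<n}. f j x) y) * r x)" by (simp only: q(3) left_diff_distrib)
 finally show "(LINT x|M. k x * (\<Sum>j<n. drk n eps i j (dif n (\<lambda>j\<in>{..<n}. f j x) y) * gam (f j) g x))
   = (LINT x|M. rk n eps i (dif n (\<lambda>j\<in>{..<n}. f j x) y) * r x)" .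
qed
qed

end

section \<open>The energy image density property for bounded functions\<close>

text \<open>The inverse Gram matrix varies with the point. Rounding its entries to rationals leaves
  countably many candidates, so that one constant matrix serves on a set of positive
  measure.\<close>

lemma approximate_inverse:
fixes G :: "nat => nat => real"
assumes det: "Determinant.det (Matrix.mat n n (%(i, j). G i j)) ~= 0" and dl: "dl > 0"
shows "\<exists>A\<in>({..<n} \<times> {..<n}) \<rightarrow>\<^sub>E \<rat>. ALL i<n. ALL j<n. \<bar>(\<Sum>l<n. A (i, l) * G l j) - kd i j\<bar> <= dl"
proof -
let ?G = "Matrix.mat n n (%(i, j). G i j)"
have Gc: "?G \<in> carrier_mat n n" by simp
define X where "X i l = adj_mat ?G $$ (i, l) / Determinant.det ?G" for i l
have X: "(\<Sum>l<n. X i l * G l j) = kd i j" if ij: "i < n" "j < n" for i j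
proof -
 have "(adj_mat ?G * ?G) $$ (i, j) = (Determinant.det ?G \<cdot>\<^sub>m 1\<^sub>m n) $$ (i, j)" by (simp only: adj_mat(3)[OF Gc])
 moreover have "(adj_mat ?G * ?G) $$ (i, j) = (\<Sum>l<n. adj_mat ?G $$ (i, l) * G l j)" using ij adj_mat(1)[OF Gc] by (simp add: scalar_prod_def lessThan_atLeast0)
 ultimately have "(\<Sum>l<n. adj_mat ?G $$ (i, l) * G l j) = Determinant.det ?G * kd i j" using ij by (simp add: kd_def)
 then show ?thesis using det by (simp add: X_def sum_divide_distrib[symmetric] divide_eq_eq mult.commute)
qed
define S where "S = 1 + (\<Sum>l<n. \<Sum>j<n. \<bar>G l j\<bar>)"
have S: "S > 0" unfolding S_def by (intro add_pos_nonneg sum_nonneg) auto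
have "\<exists>q\<in>\<rat>. \<bar>q - X i l\<bar> < dl / S" for i l
proof -
 obtain q where "q \<in> \<rat>" "X i l - dl / S < q" "q < X i l + dl / S" using Rats_dense_in_real[of "X i l - dl / S" "X i l + dl / S"] dl S by auto
 then show ?thesis by (intro bexI[of _ q]) auto
qed
then obtain q where q: "!!i l. q i l \<in> \<rat>" "!!i l. \<bar>q i l - X i l\<bar> < dl / S" by metis
show ?thesis
proof (intro bexI[of _ "\<lambda>p\<in>{..<n} \<times> {..<n}. q (fst p) (snd p)"] allI impI)
 fix i j assume ij: "i < n" "j < n"
 have "(\<Sum>l<n. (\<lambda>p\<in>{..<n} \<times> {..<n}. q (fst p) (snd p)) (i, l) * G l j) - kd i j = (\<Sum>l<n. (q i l - X i l) * G l j)" using ij by (simp add: X[OF ij, symmetric] sum_subtractf[symmetric] left_diff_distrib)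
 also have "\<bar>...\<bar> <= (\<Sum>l<n. dl / S * (\<Sum>j<n. \<bar>G l j\<bar>))"
 proof (intro order_trans[OF sum_abs] sum_mono)
  fix l
  have "\<bar>G l j\<bar> <= (\<Sum>j<n. \<bar>G l j\<bar>)" using ij by (intro member_le_sum) auto
  then show "\<bar>(q i l - X i l) * G l j\<bar> <= dl / S * (\<Sum>j<n. \<bar>G l j\<bar>)" unfolding abs_mult using q(2)[of i l] dl S by (intro mult_mono) auto
 qed
 also have "... = dl * ((S - 1) / S)" by (simp only: sum_distrib_left[symmetric]) (simp add: S_def)
 also have "... <= dl * 1" using S dl by (intro mult_left_mono) auto
 finally show "\<bar>(\<Sum>l<n. (\<lambda>p\<in>{..<n} \<times> {..<n}. q (fst p) (snd p)) (i, l) * G l j) - kd i j\<bar> <= dl" by simp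
qed (use q(1) in auto)
qed

lemma kernel_fubini:
assumes M: "sigma_finite_measure M" and r: "integrable M r" and \<Phi>: "\<Phi> \<in> measurable M (Leb n)"
 and A: "A \<in> sets (Leb n)" "emeasure (Leb n) A < \<infinity>"
 and \<rho>: "\<rho> \<in> borel_measurable (Leb n)" "!!z. \<bar>\<rho> z\<bar> <= (C::real)"
shows kernel_slice_integrable: "integrable (Leb n) (%y. indicator A y * (LINT x|M. \<rho> (dif n (\<Phi> x) y) * r x))"
 and "(LINT y|Leb n. indicator A y * (LINT x|M. \<rho> (dif n (\<Phi> x) y) * r x))
  = (LINT x|M. (LINT y|Leb n. indicator A y * \<rho> (dif n (\<Phi> x) y)) * r x)"
proof -
interpret M: sigma_finite_measure M by fact
interpret L: sigma_finite_measure "Leb n" by (rule sigma_finite_Leb)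
interpret P: pair_sigma_finite M "Leb n" ..
have [measurable]: "\<Phi> \<in> measurable M (Leb n)" "A \<in> sets (Leb n)" "\<rho> \<in> borel_measurable (Leb n)" "r \<in> borel_measurable M" using assms by auto
have dm: "(%p. dif n (\<Phi> (fst p)) (snd p)) \<in> measurable (M \<Otimes>\<^sub>M Leb n) (Leb n)" by (intro dif_measurable) measurable
have \<rho>m: "(%p. \<rho> (dif n (\<Phi> (fst p)) (snd p))) \<in> borel_measurable (M \<Otimes>\<^sub>M Leb n)" by (rule measurable_compose[OF dm]) measurable
have C: "C >= 0" using \<rho>(2)[of undefined] by linarith
have Ai: "integrable (Leb n) (%y. indicator A y :: real)" using A by simp
have dom: "integrable (M \<Otimes>\<^sub>M Leb n) (%(x, y). C * \<bar>r x\<bar> * indicator A y)"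
proof (rule P.Fubini_integrable)
 show "(%(x, y). C * \<bar>r x\<bar> * indicator A y) \<in> borel_measurable (M \<Otimes>\<^sub>M Leb n)" by measurable
 show "integrable M (%x. \<integral>y. norm (case (x, y) of (x, y) => C * \<bar>r x\<bar> * indicator A y) \<partial>Leb n)" using r C by (simp add: abs_mult)
 show "AE x in M. integrable (Leb n) (%y. case (x, y) of (x, y) => C * \<bar>r x\<bar> * indicator A y)" using Ai by simp
qed
have int: "integrable (M \<Otimes>\<^sub>M Leb n) (%(x, y). indicator A y * (\<rho> (dif n (\<Phi> x) y) * r x))"
proof (rule integrable_dom[OF dom])
 show "(%(x, y). indicator A y * (\<rho> (dif n (\<Phi> x) y) * r x)) \<in> borel_measurable (M \<Otimes>\<^sub>M Leb n)" using \<rho>m unfolding split_beta by measurable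
 show "AE p in M \<Otimes>\<^sub>M Leb n. norm (case p of (x, y) => indicator A y * (\<rho> (dif n (\<Phi> x) y) * r x))
   <= norm (case p of (x, y) => C * \<bar>r x\<bar> * indicator A y)" using \<rho>(2) C by (intro AE_I2) (auto simp: abs_mult indicator_def intro!: mult_right_mono)
qed
show "integrable (Leb n) (%y. indicator A y * (LINT x|M. \<rho> (dif n (\<Phi> x) y) * r x))" using P.integrable_snd[OF int] by simp
have "(LINT y|Leb n. indicator A y * (LINT x|M. \<rho> (dif n (\<Phi> x) y) * r x))
  = (LINT y|Leb n. (LINT x|M. indicator A y * (\<rho> (dif n (\<Phi> x) y) * r x)))" by simp
also have "... = (LINT x|M. (LINT y|Leb n. indicator A y * (\<rho> (dif n (\<Phi> x) y) * r x)))" by (rule P.Fubini_integral[OF int])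
also have "... = (LINT x|M. (LINT y|Leb n. indicator A y * \<rho> (dif n (\<Phi> x) y)) * r x)" by (simp add: mult.assoc[symmetric])
finally show "(LINT y|Leb n. indicator A y * (LINT x|M. \<rho> (dif n (\<Phi> x) y) * r x))
  = (LINT x|M. (LINT y|Leb n. indicator A y * \<rho> (dif n (\<Phi> x) y)) * r x)" .
qed

lemma kernel_times_integrable:
assumes r: "integrable M r" and \<Phi>: "\<Phi> \<in> measurable M (Leb n)" and y: "y \<in> space (Leb n)"
 and \<rho>: "\<rho> \<in> borel_measurable (Leb n)" "!!z. \<bar>\<rho> z\<bar> <= (C::real)"
shows "integrable M (%x. \<rho> (dif n (\<Phi> x) y) * r x)"
proof (rule integrable_dom[OF integrable_mult_right[OF integrable_abs[OF r], of C]])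
have "(%x. dif n (\<Phi> x) y) \<in> measurable M (Leb n)" by (intro dif_measurable \<Phi> measurable_const y)
then have "(%x. \<rho> (dif n (\<Phi> x) y)) \<in> borel_measurable M" by (rule measurable_compose[OF _ \<rho>(1)])
then show "(%x. \<rho> (dif n (\<Phi> x) y) * r x) \<in> borel_measurable M" using r by (intro borel_measurable_times) auto
have "C >= 0" using \<rho>(2)[of undefined] by linarith
then show "AE x in M. norm (\<rho> (dif n (\<Phi> x) y) * r x) <= norm (C * \<bar>r x\<bar>)" using \<rho>(2) by (intro AE_I2) (auto simp: abs_mult intro!: mult_right_mono)
qed

context dirichlet_structure
begin

text \<open>Density in L2, clamping to [0, 1], and a subsequence converging almost everywhere, for
  which w is an integrable majorant.\<close>

lemma cutoff_approx:
assumes W: "W \<in> sets M" "emeasure M W < \<infinity>" and w: "integrable M w" "!!x. 0 <= w x" and dl: "dl > 0"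
obtains k where "k \<in> D" "!!x. 0 <= k x" "!!x. k x <= 1" "(LINT x|M. \<bar>k x - indicator W x\<bar> * w x) < dl"
proof -
let ?I = "indicator W :: 'a => real"
have "(norm (?I x))^2 = ?I x" for x by (simp add: indicator_def)
then have Il2: "?I \<in> l2_space M" using W by (simp add: l2_space_def)
have "\<exists>g\<in>D. l2_norm M (%x. ?I x - g x) < 1 / real (Suc m)" for m using D_l2_dense Il2 unfolding l2_dense_def by auto
then obtain g where g: "!!m. g m \<in> D" "!!m. l2_norm M (%x. ?I x - g m x) < 1 / real (Suc m)" by metis
define k where "k m x = min 1 (max 0 (g m x))" for m x
have kD: "k m \<in> D" for m unfolding k_def[abs_def] by (rule D_unit[OF g(1)])
have k01: "0 <= k m x" "k m x <= 1" for m x by (auto simp: k_def)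
have km [measurable]: "k m \<in> borel_measurable M" and gm [measurable]: "g m \<in> borel_measurable M" for m using kD g(1) by (auto intro: D_measurable)
have Iint: "integrable M (%x. (?I x)^2)" using Il2 by (simp add: l2_space_def)
have [measurable]: "W \<in> sets M" by (rule W(1))
have gi: "integrable M (%x. (?I x - g m x)^2)" and ki: "integrable M (%x. (k m x - ?I x)^2)" for m by (intro sq_diff_integrable Iint D_sq_integrable g kD; measurable)+
have le: "(LINT x|M. (k m x - ?I x)^2) <= 1 / real (Suc m)" for m
proof -
 have "(LINT x|M. (k m x - ?I x)^2) <= (LINT x|M. (?I x - g m x)^2)"
 proof (rule integral_mono[OF ki gi])
  fix x
  have "\<bar>k m x - ?I x\<bar> <= \<bar>?I x - g m x\<bar>" by (auto simp: k_def indicator_def)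
  then show "(k m x - ?I x)^2 <= (?I x - g m x)^2" by (rule abs_le_square_iff[THEN iffD1])
 qed
 also have "... = (l2_norm M (%x. ?I x - g m x))^2" by (simp add: l2_norm_def)
 also have "... <= (1 / real (Suc m))^2" using g(2)[of m] by (intro power_mono) (auto simp: l2_norm_def)
 also have "... <= 1 / real (Suc m)" unfolding power2_eq_square by (rule mult_left_le) auto
 finally show ?thesis .
qed
have "(%m. \<integral>x. norm ((k m x - ?I x)^2) \<partial>M) ---> 0"
proof (rule tendsto_sandwich[OF _ _ tendsto_const])
 show "(%m. 1 / real (Suc m)) ---> 0" by real_asymp
qed (use le in \<open>auto intro!: always_eventually simp del: of_nat_Suc\<close>)
from tendsto_L1_AE_subseq[OF ki this] obtain r where r: "strict_mono r" "AE x in M. (%n. (k (r n) x - ?I x)^2) ---> 0" by blast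
have "(%n. \<integral>x. \<bar>k (r n) x - ?I x\<bar> * w x \<partial>M) ---> (LINT x|M. 0)"
proof (rule integral_dominated_convergence[where w = w])
 show "AE x in M. (%n. \<bar>k (r n) x - ?I x\<bar> * w x) ---> 0" using r(2)
 proof eventually_elim
  case (elim x)
  then have "(%n. \<bar>k (r n) x - ?I x\<bar>) ---> 0" by (simp add: tendsto_rabs_zero_iff)
  from tendsto_mult[OF this tendsto_const, of "w x"] show ?case by simp
 qed
 show "AE x in M. norm (\<bar>k (r n) x - ?I x\<bar> * w x) <= w x" for n
 proof (rule AE_I2)
  fix x
  have "\<bar>k (r n) x - ?I x\<bar> <= 1" using k01[of "r n" x] by (auto simp: indicator_def)
  then show "norm (\<bar>k (r n) x - ?I x\<bar> * w x) <= w x" using w(2)[of x] by (simp add: abs_mult mult_left_le_one_le)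
 qed
qed (use w in auto)
then have "(%n. \<integral>x. \<bar>k (r n) x - ?I x\<bar> * w x \<partial>M) ---> 0" by simp
from order_tendstoD(2)[OF this dl] obtain n where "(LINT x|M. \<bar>k (r n) x - ?I x\<bar> * w x) < dl" by (auto simp: eventually_sequentially)
then show ?thesis using that kD k01 by blast
qed

lemma gram_det_measurable:
assumes "!!j. j < n ==> f j \<in> D"
shows "gram_det gam n f \<in> borel_measurable M"
proof -
have "gram_det gam n f = (%x. \<Sum>p\<in>{p. p permutes {0..<n}}. signof p * (\<Prod>i = 0..<n. gam (f i) (f (p i)) x))"
proof
 fix x
 have "Determinant.det (Matrix.mat n n (%(i, j). gam (f i) (f j) x)) = (\<Sum>p\<in>{p. p permutes {0..<n}}. signof p * (\<Prod>i = 0..<n. Matrix.mat n n (%(i, j). gam (f i) (f j) x) $$ (i, p i)))" by (rule det_def') simp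
 also have "... = (\<Sum>p\<in>{p. p permutes {0..<n}}. signof p * (\<Prod>i = 0..<n. gam (f i) (f (p i)) x))" by (intro sum.cong arg_cong2[where f = "(*)"] prod.cong refl) (auto dest: permutes_in_image)
 finally show "gram_det gam n f x = (\<Sum>p\<in>{p. p permutes {0..<n}}. signof p * (\<Prod>i = 0..<n. gam (f i) (f (p i)) x))" by (simp add: gram_det_def)
qed
then show ?thesis using assms by (auto intro!: borel_measurable_sum borel_measurable_times borel_measurable_prod gam_measurable dest: permutes_in_image)
qed


lemma pos_subset_of_finite_measure:
assumes "Z \<in> sets M" "emeasure M Z > 0"
obtains W where "W \<in> sets M" "W \<subseteq> Z" "emeasure M W > 0" "emeasure M W < \<infinity>"
proof -
interpret sigma_finite_measure M by (rule sf)
obtain S :: "nat => 'a set" where S: "range S \<subseteq> sets M" "(\<Union>i. S i) = space M" "!!i. emeasure M (S i) ~= \<infinity>" using sigma_finite by (metis)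
have "EX i. emeasure M (S i \<inter> Z) > 0"
proof (rule ccontr)
 assume "\<not> ?thesis"
 then have "emeasure M (\<Union>i. S i \<inter> Z) = 0" using S(1) assms(1) by (intro emeasure_UN_eq_0) auto
 moreover have "(\<Union>i. S i \<inter> Z) = Z" using S(2) sets.sets_into_space[OF assms(1)] by auto
 ultimately show False using assms(2) by simp
qed
then obtain i where i: "emeasure M (S i \<inter> Z) > 0" by blast
have "emeasure M (S i \<inter> Z) <= emeasure M (S i)" using S(1) by (intro emeasure_mono) auto
then show ?thesis using i S assms(1) by (intro that[of "S i \<inter> Z"]) (auto simp: less_top order.strict_trans1)
qed

text \<open>The energy image density property on the bounded elements of the domain. If it failed, the
rational approximation of the inverse Gram matrix would give a set \<open>W\<close> of positive measure, mapped by
\<open>f\<close> into a null set, on which \<open>gam (f j) (g i)\<close> is almost the identity matrix; testing the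
integration by parts with the field of \<open>test_field\<close> then bounds \<open>\<nu> W\<close> by a small multiple of itself.\<close>

theorem energy_image_density_bounded:
assumes n: "n >= 1" and f: "!!j. j < n ==> f j \<in> D" "!!j. j < n ==> EX C. ALL x. \<bar>f j x\<bar> <= C"
 and B: "B \<in> null_sets (Leb n)"
shows "AE x in M. (\<lambda>j\<in>{..<n}. f j x) \<in> B --> gram_det gam n f x = 0"
proof (rule ccontr)
assume contr: "\<not> ?thesis"
let ?L = "Leb n" and ?\<Phi> = "%x. \<lambda>j\<in>{..<n}. f j x"
have fm: "f j \<in> borel_measurable M" if "j < n" for j using f(1)[OF that] by (rule D_measurable)
have \<Phi> [measurable]: "?\<Phi> \<in> measurable M ?L" using fm by (intro measurable_restrict) simp
have [measurable]: "gram_det gam n f \<in> borel_measurable M" by (rule gram_det_measurable[OF f(1)])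
have [measurable]: "B \<in> sets ?L" using B by auto
have [measurable]: "gam (f i) (f j) \<in> borel_measurable M" if "i < n" "j < n" for i j using that by (intro gam_measurable f)
have "EX R. ALL j<n. ALL x. \<bar>f j x\<bar> < R"
proof -
 have "ALL j. EX C. j < n --> (ALL x. \<bar>f j x\<bar> <= C)" using f(2) by blast
 then obtain C where C: "!!j x. j < n ==> \<bar>f j x\<bar> <= C j" by metis
 have "\<bar>f j x\<bar> < 1 + (\<Sum>j<n. \<bar>C j\<bar>)" if "j < n" for j x
 proof -
  have "\<bar>C j\<bar> <= (\<Sum>j<n. \<bar>C j\<bar>)" using that by (intro member_le_sum) auto
  then show ?thesis using C[OF that, of x] by linarith
 qed
 then show ?thesis by blast
qed
then obtain R where R: "!!j x. j < n ==> \<bar>f j x\<bar> < R" by blast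
define c where "c = cube_const n"
define F where "F = field_const n"
have c: "c > 0" using n by (simp add: c_def cube_const_def)
have F: "F >= 0" by (simp add: F_def field_const_def add_nonneg_nonneg)
\<comment> \<open>The error measure will have mass at most ka = 3 n^2 dl1 m; this choice makes the
  derivative term F * ka at most c m / 8.\<close>
define dl1 where "dl1 = c / (24 * (real n)^2 * (F + 1))"
have n2: "(real n)^2 > 0" using n by simp
have dl1: "dl1 > 0" unfolding dl1_def using c F n2 by (intro divide_pos_pos mult_pos_pos) auto
have Fdl1: "F * (3 * (real n)^2 * dl1) <= c / 8"
proof -
 have F1: "F + 1 > 0" using F by simp
 have "dl1 * (24 * (real n)^2 * (F + 1)) = c" using n2 F1 by (simp add: dl1_def)
 then have "(F * (3 * (real n)^2 * dl1) * 8) * (F + 1) = F * c" by (simp add: algebra_simps)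
 also have "... <= c * (F + 1)" using c by (simp add: algebra_simps)
 finally have "F * (3 * (real n)^2 * dl1) * 8 <= c" using F1 by (rule mult_right_le_imp_le)
 then show ?thesis by simp
qed
define IA where "IA = ({..<n} \<times> {..<n}) \<rightarrow>\<^sub>E (\<rat> :: real set)"
have cIA: "countable IA" unfolding IA_def by (intro countable_PiE countable_rat) auto
define Z where "Z = {x\<in>space M. ?\<Phi> x \<in> B \<and> gram_det gam n f x ~= 0}"
have Z [measurable]: "Z \<in> sets M" unfolding Z_def by measurable
define ZA where "ZA A = {x\<in>Z. \<forall>i\<in>{..<n}. \<forall>j\<in>{..<n}. \<bar>(\<Sum>l<n. A (i, l) * gam (f l) (f j) x) - kd i j\<bar> <= dl1}" for A
have ZA [measurable]: "ZA A \<in> sets M" for A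
proof -
 have "ZA A = Z \<inter> {x\<in>space M. \<forall>i\<in>{..<n}. \<forall>j\<in>{..<n}. \<bar>(\<Sum>l<n. A (i, l) * gam (f l) (f j) x) - kd i j\<bar> <= dl1}" unfolding ZA_def Z_def by auto
 moreover have "{x\<in>space M. \<forall>i\<in>{..<n}. \<forall>j\<in>{..<n}. \<bar>(\<Sum>l<n. A (i, l) * gam (f l) (f j) x) - kd i j\<bar> <= dl1} \<in> sets M"
 proof (intro sets.sets_Collect_finite_All finite_lessThan)
  fix i j assume ij: "i \<in> {..<n}" "j \<in> {..<n}"
  have [measurable]: "(%x. \<Sum>l<n. A (i, l) * gam (f l) (f j) x) \<in> borel_measurable M" using ij f by (intro borel_measurable_sum borel_measurable_times borel_measurable_const gam_measurable) auto
  show "{x\<in>space M. \<bar>(\<Sum>l<n. A (i, l) * gam (f l) (f j) x) - kd i j\<bar> <= dl1} \<in> sets M" by measurable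
 qed
 ultimately show ?thesis by simp
qed
have Zeq: "Z = (\<Union>A\<in>IA. ZA A)"
proof (intro subset_antisym subsetI)
 fix x assume x: "x \<in> Z"
 then have "Determinant.det (Matrix.mat n n (%(i, j). gam (f i) (f j) x)) ~= 0" by (simp add: Z_def gram_det_def)
 from approximate_inverse[OF this dl1] x show "x \<in> (\<Union>A\<in>IA. ZA A)" unfolding IA_def ZA_def by auto
qed (auto simp: ZA_def)
have Zpos: "emeasure M Z > 0"
proof (rule ccontr)
 assume "\<not> ?thesis"
 then have "emeasure M Z = 0" by simp
 then have "Z \<in> null_sets M" by auto
 then have "AE x in M. x \<notin> Z" by (rule AE_not_in)
 then have "AE x in M. ?\<Phi> x \<in> B --> gram_det gam n f x = 0" using AE_space by eventually_elim (auto simp: Z_def)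
 then show False using contr by simp
qed
have "\<exists>A\<in>IA. emeasure M (ZA A) > 0"
proof -
 have "emeasure M (\<Union>A\<in>IA. ZA A) = 0" if "!!A. A \<in> IA ==> emeasure M (ZA A) = 0"
 proof -
  have "(\<Union>A\<in>IA. ZA A) \<in> null_sets M" by (intro null_sets_UN' cIA null_setsI that ZA)
  then show ?thesis by auto
 qed
 then show ?thesis using Zpos Zeq by (metis less_numeral_extra(3) zero_less_iff_neq_zero)
qed
then obtain A where A: "emeasure M (ZA A) > 0" by blast
obtain W where W: "W \<in> sets M" "W \<subseteq> ZA A" "emeasure M W > 0" "emeasure M W < \<infinity>" by (rule pos_subset_of_finite_measure[OF ZA A])
have [measurable]: "W \<in> sets M" by (rule W(1))
define m where "m = measure M W"
have m: "m > 0" "emeasure M W = ennreal m"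
proof -
 show "emeasure M W = ennreal m" unfolding m_def using W(4) by (intro emeasure_eq_ennreal_measure) auto
 then show "m > 0" using W(3) by simp
qed
let ?I = "indicator W :: 'a => real"
have Iint: "integrable M ?I" using W by simp
\<comment> \<open>Row i of the constant matrix applied to f: on W the entries
  \<open>gam (f j) (g0 i)\<close> are within dl1 of the identity matrix.\<close>
define g0 where "g0 i x = (\<Sum>l<n. A (i, l) * f l x)" for i x
have g0: "g0 i \<in> D" for i unfolding g0_def[abs_def] by (intro D_sum D_scale f) auto
have g0_I: "AE x in M. ?I x * \<bar>gam (f j) (g0 i) x - kd i j\<bar> <= dl1 * ?I x" if ij: "i < n" "j < n" for i j
proof -
 have Af: "(%x. A (i, l) * f l x) \<in> D" if "l < n" for l using f that by (intro D_scale)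
 have "AE x in M. gam (g0 i) (f j) x = (\<Sum>l<n. gam (%x. A (i, l) * f l x) (f j) x)" unfolding g0_def[abs_def] using f ij by (intro gam_sum Af) auto
 moreover have "AE x in M. \<forall>l\<in>{..<n}. gam (%x. A (i, l) * f l x) (f j) x = A (i, l) * gam (f l) (f j) x" using f ij by (intro AE_ball_countable' gam_scale) auto
 moreover have "AE x in M. gam (g0 i) (f j) x = gam (f j) (g0 i) x" by (intro gam_sym g0 f ij)
 ultimately show ?thesis
 proof eventually_elim
  case (elim x)
  have eq: "gam (f j) (g0 i) x = (\<Sum>l<n. A (i, l) * gam (f l) (f j) x)" using elim by simp
  show ?case
  proof (cases "x \<in> W")
   case True
   then have "x \<in> ZA A" using W(2) by blast
   then show ?thesis using ij True unfolding eq ZA_def by simp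
  qed simp
 qed
qed
define w where "w x = (\<Sum>i<n. \<Sum>j<n. \<bar>gam (f j) (g0 i) x\<bar>)" for x
have wint: "integrable M w" unfolding w_def[abs_def] using f g0 by (intro integrable_setsum integrable_abs gam_int) auto
have w0: "0 <= w x" for x unfolding w_def by (intro sum_nonneg) auto
have d1m: "dl1 * m > 0" using dl1 m by simp
obtain k where k: "k \<in> D" "!!x. 0 <= k x" "!!x. k x <= 1" "(LINT x|M. \<bar>k x - ?I x\<bar> * w x) < dl1 * m" using cutoff_approx[OF W(1,4) wint w0 d1m] by blast
have km [measurable]: "k \<in> borel_measurable M" by (rule D_measurable[OF k(1)])
have kb: "EX C. ALL x. \<bar>k x\<bar> <= C" using k(2,3) by (intro exI[of _ 1]) simp
define E where "E = 1 + (\<Sum>j<n. e (f j) (f j))"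
have E: "E > 0" unfolding E_def using f e_nonneg by (intro add_pos_nonneg sum_nonneg) auto
have fE: "e (f j) (f j) <= E" if "j < n" for j
proof -
 have "e (f j) (f j) <= (\<Sum>j<n. e (f j) (f j))" using that f e_nonneg by (intro member_le_sum) auto
 then show ?thesis by (simp add: E_def)
qed
\<comment> \<open>tau is small against the energies of f, and the energy of g i - g0 i is then made
  small even against tau; each of the two terms in \<open>gam_L1\<close> is at most dl1 * m /
  2.\<close>
define tau where "tau = dl1 * m / (2 * E)"
have tau: "tau > 0" using d1m E by (simp add: tau_def)
have "EX g a. is_generator_value M D e g a \<and> e (%x. g x - g0 i x) (%x. g x - g0 i x) < tau * (dl1 * m / 2)" for i
proof -
 have "tau * (dl1 * m / 2) > 0" using tau d1m by simp
 from generator_domain_dense[OF g0 this] show ?thesis by metis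
qed
then obtain g a where g: "!!i. is_generator_value M D e (g i) (a i)" "!!i. e (%x. g i x - g0 i x) (%x. g i x - g0 i x) < tau * (dl1 * m / 2)" by metis
have gD: "g i \<in> D" for i using g(1)[of i] by (simp add: is_generator_value_def)
have dD: "(%x. g i x - g0 i x) \<in> D" for i by (intro D_diff gD g0)
have gg0: "(LINT x|M. \<bar>gam (f j) (%x. g i x - g0 i x) x\<bar>) <= dl1 * m" if "j < n" for i j
proof -
 have "(LINT x|M. \<bar>gam (f j) (%x. g i x - g0 i x) x\<bar>) <= tau * e (f j) (f j) + e (%x. g i x - g0 i x) (%x. g i x - g0 i x) / tau" by (rule gam_L1[OF f(1)[OF that] dD tau])
 also have "... <= tau * E + (tau * (dl1 * m / 2)) / tau" using tau g(2)[of i] fE[OF that] by (intro add_mono mult_left_mono divide_right_mono) auto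
 also have "... = dl1 * m" using tau E by (simp add: tau_def field_simps)
 finally show ?thesis .
qed
define G where "G i j x = k x * gam (f j) (g i) x" for i j x
have Gint: "integrable M (G i j)" if "j < n" for i j unfolding G_def[abs_def] by (rule mult_gam_integrable[OF f(1)[OF that] gD km, of 1]) (use k(2,3) in simp)
\<comment> \<open>The pointwise deviation of k * \<gamma>(f j, g i) from the identity matrix times
  the indicator of W. Its image under f is the measure eta, of which only the total mass is
  controlled.\<close>
define h where "h x = (\<Sum>i<n. \<Sum>j<n. \<bar>G i j x - kd i j * ?I x\<bar>)" for x
have hint: "integrable M h" unfolding h_def[abs_def] using Gint Iint by (intro integrable_setsum integrable_abs Bochner_Integration.integrable_diff integrable_mult_right) auto
have h0: "0 <= h x" for x unfolding h_def by (intro sum_nonneg) auto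
have hm [measurable]: "h \<in> borel_measurable M" using hint by auto
define ka where "ka = 3 * (real n)^2 * dl1 * m"
have ka: "ka > 0" using n2 dl1 m by (simp add: ka_def)
\<comment> \<open>Each entry carries three errors of size dl1 * m: from g0 to g, from the indicator
  of W to the cutoff k, and from the inverse Gram matrix to the constant matrix.\<close>
have hka: "(LINT x|M. h x) <= ka"
proof -
 have kw: "integrable M (%x. \<bar>k x - ?I x\<bar> * w x)"
 proof (rule integrable_dom[OF wint])
  show "(%x. \<bar>k x - ?I x\<bar> * w x) \<in> borel_measurable M" using wint by measurable
  have "\<bar>k x - ?I x\<bar> <= 1" for x using k(2,3)[of x] by (auto simp: indicator_def)
  then show "AE x in M. norm (\<bar>k x - ?I x\<bar> * w x) <= norm (w x)" using w0 by (intro AE_I2) (simp add: abs_mult mult_left_le_one_le)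
 qed
 have ij: "(LINT x|M. \<bar>G i j x - kd i j * ?I x\<bar>) <= 3 * (dl1 * m)" if ij: "i < n" "j < n" for i j
 proof -
  have "(LINT x|M. \<bar>G i j x - kd i j * ?I x\<bar>) <= (LINT x|M. \<bar>gam (f j) (%x. g i x - g0 i x) x\<bar> + \<bar>k x - ?I x\<bar> * w x + dl1 * ?I x)"
  proof (rule integral_mono_AE)
   show "integrable M (%x. \<bar>G i j x - kd i j * ?I x\<bar>)" using Gint[OF ij(2), of i] Iint by auto
   show "integrable M (%x. \<bar>gam (f j) (%x. g i x - g0 i x) x\<bar> + \<bar>k x - ?I x\<bar> * w x + dl1 * ?I x)" using kw gam_int[OF f(1)[OF ij(2)] dD] Iint by auto
   show "AE x in M. \<bar>G i j x - kd i j * ?I x\<bar> <= \<bar>gam (f j) (%x. g i x - g0 i x) x\<bar> + \<bar>k x - ?I x\<bar> * w x + dl1 * ?I x" using g0_I[OF ij] gam_diff[OF gD g0 f(1)[OF ij(2)], of i i] gam_sym[OF dD f(1)[OF ij(2)], of i] gam_sym[OF gD f(1)[OF ij(2)], of i] gam_sym[OF g0 f(1)[OF ij(2)], of i]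
   proof eventually_elim
    case (elim x)
    let ?d = "gam (f j) (%x. g i x - g0 i x) x" and ?g = "gam (f j) (g0 i) x"
    have gg: "gam (f j) (g i) x = ?d + ?g" using elim(2-5) by simp
    have "?g <= \<bar>?g\<bar>" by simp
    have gw: "\<bar>?g\<bar> <= w x"
    proof -
     have "\<bar>?g\<bar> <= (\<Sum>j<n. \<bar>gam (f j) (g0 i) x\<bar>)" using ij by (intro member_le_sum) auto
     also have "... <= w x" unfolding w_def using ij by (intro member_le_sum[of i "{..<n}" "%i. \<Sum>j<n. \<bar>gam (f j) (g0 i) x\<bar>"] sum_nonneg) auto
     finally show ?thesis .
    qed
    have "G i j x - kd i j * ?I x = k x * ?d + (k x - ?I x) * ?g + ?I x * (?g - kd i j)" unfolding G_def gg by (simp add: algebra_simps)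
    also have "\<bar>...\<bar> <= \<bar>k x * ?d\<bar> + \<bar>(k x - ?I x) * ?g\<bar> + \<bar>?I x * (?g - kd i j)\<bar>" by linarith
    also have "\<bar>k x * ?d\<bar> <= \<bar>?d\<bar>" using k(2,3)[of x] by (simp add: abs_mult mult_left_le_one_le)
    also have "\<bar>(k x - ?I x) * ?g\<bar> <= \<bar>k x - ?I x\<bar> * w x" unfolding abs_mult using gw by (intro mult_left_mono) auto
    also have "\<bar>?I x * (?g - kd i j)\<bar> <= dl1 * ?I x" using elim(1) by (simp add: abs_mult)
    finally show ?case by simp
   qed
  qed
  also have "... = (LINT x|M. \<bar>gam (f j) (%x. g i x - g0 i x) x\<bar>) + (LINT x|M. \<bar>k x - ?I x\<bar> * w x) + dl1 * m"
  proof -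
   have Wm: "measure M (W \<inter> space M) = m" using sets.sets_into_space[OF W(1)] by (simp add: m_def Int_absorb2)
   show ?thesis using kw gam_int[OF f(1)[OF ij(2)] dD, of i] Iint Wm by simp
  qed
  also have "... <= 3 * (dl1 * m)" using gg0[OF ij(2), of i] k(4) by simp
  finally show ?thesis .
 qed
 have "(LINT x|M. h x) = (\<Sum>i<n. \<Sum>j<n. (LINT x|M. \<bar>G i j x - kd i j * ?I x\<bar>))"
 proof -
  have I: "integrable M (%x. \<bar>G i j x - kd i j * ?I x\<bar>)" if "j < n" for i j using Gint[OF that, of i] Iint by auto
  have "(LINT x|M. h x) = (\<Sum>i<n. \<integral>x. (\<Sum>j<n. \<bar>G i j x - kd i j * ?I x\<bar>) \<partial>M)" unfolding h_def by (intro integral_setsum integrable_setsum I) auto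
  also have "... = (\<Sum>i<n. \<Sum>j<n. (LINT x|M. \<bar>G i j x - kd i j * ?I x\<bar>))" by (intro sum.cong refl integral_setsum I) auto
  finally show ?thesis .
 qed
 also have "... <= (\<Sum>i<n. \<Sum>j<n. 3 * (dl1 * m))" by (intro sum_mono ij) auto
 also have "... = ka" by (simp add: ka_def power2_eq_square)
 finally show ?thesis .
qed
define IBP where "IBP i r \<longleftrightarrow> integrable M r \<and> (ALL eps y. eps > 0 --> i < n -->
  (LINT x|M. k x * (\<Sum>j<n. drk n eps i j (dif n (?\<Phi> x) y) * gam (f j) (g i) x)) = (LINT x|M. rk n eps i (dif n (?\<Phi> x) y) * r x))" for i r
have "EX r. IBP i r" for i
proof (rule kernel_integration_by_parts[OF k(1) kb g(1)[of i]], goal_cases)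
 case (1 r)
 have "(LINT x|M. k x * (\<Sum>j<n. drk n eps i j (dif n (?\<Phi> x) y) * gam (f j) (g i) x)) = (LINT x|M. rk n eps i (dif n (?\<Phi> x) y) * r x)"
  if "eps > 0" "i < n" for eps y by (rule 1(2)[of n f, OF _ _ that]) (erule f)+
 with 1(1) have "IBP i r" unfolding IBP_def by simp
 then show ?case by (intro exI[of "IBP i" r])
qed
then obtain r where rI: "!!i. IBP i (r i)" by metis
have r: "integrable M (r i)" for i using rI[of i] unfolding IBP_def by (rule conjunct1)
have r2: "(LINT x|M. k x * (\<Sum>j<n. drk n eps i j (dif n (?\<Phi> x) y) * gam (f j) (g i) x)) = (LINT x|M. rk n eps i (dif n (?\<Phi> x) y) * r i x)"
 if "eps > 0" "i < n" for i eps y using rI[of i] that unfolding IBP_def by (elim conjE allE impE) assumption+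
define Q where "Q = 1 + (\<Sum>i<n. \<integral>x. \<bar>r i x\<bar> \<partial>M)"
have Q: "Q > 0" unfolding Q_def by (intro add_pos_nonneg sum_nonneg) auto
\<comment> \<open>The functions r i are determined by k and g before the field is chosen, so the
  field can be taken small relative to their L1 norms.\<close>
define dl0 where "dl0 = c * m / (8 * Q)"
have dl0: "dl0 > 0" using c m Q by (simp add: dl0_def)
define sig where "sig = distr (density M (%x. ennreal (?I x))) ?L ?\<Phi>"
define eta where "eta = distr (density M (%x. ennreal (h x))) ?L ?\<Phi>"
have sigint: "(LINT x|sig. u x) = (LINT x|M. ?I x * u (?\<Phi> x))" and etaint: "(LINT x|eta. u x) = (LINT x|M. h x * u (?\<Phi> x))"
 if [measurable]: "u \<in> borel_measurable ?L" for u :: "(nat => real) => real" unfolding sig_def eta_def using h0 by (simp_all add: integral_distr integral_density)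
have \<Phi>s: "?\<Phi> -` space ?L \<inter> space M = space M" using measurable_space[OF \<Phi>] by blast
have sige: "emeasure sig (space sig) = ennreal m"
proof -
 have "emeasure sig (space sig) = emeasure (density M (%x. ennreal (?I x))) (space M)" unfolding sig_def by (simp add: emeasure_distr \<Phi>s)
 also have "... = (nn_integral M (%x. ennreal (?I x)))" by (subst emeasure_density) (auto intro!: nn_integral_cong)
 also have "(nn_integral M (%x. ennreal (?I x))) = (nn_integral M (%x. indicator W x))" by (intro nn_integral_cong) (simp add: indicator_def)
 finally show ?thesis using m(2) by simp
qed
have etae: "emeasure eta (space eta) = ennreal (LINT x|M. h x)"
proof -
 have "emeasure eta (space eta) = emeasure (density M (%x. ennreal (h x))) (space M)" unfolding eta_def by (simp add: emeasure_distr \<Phi>s)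
 also have "... = (nn_integral M (%x. ennreal (h x)))" by (subst emeasure_density) (auto intro!: nn_integral_cong)
 finally have "emeasure eta (space eta) = (nn_integral M (%x. ennreal (h x)))" .
 then show ?thesis using nn_integral_eq_integral[OF hint] h0 by simp
qed
have sigf: "finite_measure sig" and etaf: "finite_measure eta" using sige etae by (auto intro!: finite_measureI)
have sigm: "measure sig (space sig) = m" using sige m(1) by (simp add: measure_def)
have etam: "measure eta (space eta) <= ka" using etae hka h0 by (simp add: measure_def)
\<comment> \<open>The measure sig is carried by this bounded part of B, because f is bounded;
  boundedness is what the open cover of the null set asks for.\<close>
define B' where "B' = {z\<in>space ?L. z \<in> B \<and> (\<forall>i\<in>{..<n}. \<bar>z i\<bar> < R)}"
have B's: "B' \<in> sets ?L" unfolding B'_def by measurable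
have B': "B' \<in> null_sets ?L" by (rule null_sets_subset[OF B B's]) (auto simp: B'_def)
have sigB: "AE z in sig. z \<in> B'"
proof -
 have "AE x in density M (%x. ennreal (?I x)). ?\<Phi> x \<in> B'"
 proof -
  have "AE x in M. 0 < ennreal (?I x) --> ?\<Phi> x \<in> B'"
  proof (rule AE_I2)
   fix x assume x: "x \<in> space M"
   show "0 < ennreal (?I x) --> ?\<Phi> x \<in> B'"
   proof
    assume "0 < ennreal (?I x)"
    then have "x \<in> W" by (simp add: indicator_def split: if_splits)
    then have "x \<in> Z" using W(2) by (auto simp: ZA_def)
    then show "?\<Phi> x \<in> B'" using measurable_space[OF \<Phi> x] R by (auto simp: Z_def B'_def)
   qed
  qed
  then show ?thesis by (subst AE_density) auto
 qed
 then show ?thesis unfolding sig_def using B's by (subst AE_distr_iff) auto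
qed
have B'R: "!!x i. x \<in> B' ==> i < n ==> \<bar>x i\<bar> < R" by (auto simp: B'_def)
have sigs: "sets sig = sets ?L" and etas: "sets eta = sets ?L" by (simp_all add: sig_def eta_def)
obtain eps S where S: "eps > 0" "S \<in> sets ?L" "emeasure ?L S < \<infinity>"
 "cube_const n / 2 * measure sig (space sig) <= (LINT x|sig. (\<Sum>i<n. drki n eps S i i x))"
 "(LINT x|eta. (\<Sum>i<n. \<Sum>j<n. \<bar>drki n eps S i j x\<bar>)) <= field_const n * ka"
 "!!x i. x \<in> space ?L ==> i < n ==> \<bar>rki n eps S i x\<bar> <= dl0" by (rule test_field[where n = n and sig = sig and eta = eta and B = B' and R = R and ka = ka and dl = dl0],
   rule n, rule sigs, rule sigf, rule etas, rule etaf, rule B', rule sigB, erule (1) B'R, rule ka, rule etam, rule dl0, (rule that; assumption))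
note drkim [measurable] = drki_measurable[OF _ _ S(2)] and rkim [measurable] = rki_measurable[OF _ S(2)]
define K where "K i j x = drki n eps S i j (?\<Phi> x)" for i j x
have Km [measurable]: "K i j \<in> borel_measurable M" if "i < n" "j < n" for i j unfolding K_def[abs_def] by (rule measurable_compose[OF \<Phi> drkim[OF that]])
define CK where "CK = (1 + real n) / eps ^ n * measure ?L S"
have Kb: "\<bar>K i j x\<bar> <= CK" if "i < n" "j < n" "x \<in> space M" for i j x unfolding K_def CK_def using that S(1-3) measurable_space[OF \<Phi> that(3)] by (intro drki_sup_bound) auto
have KI: "integrable M (%x. K i j x * u x)" if ij: "i < n" "j < n" and u: "integrable M u" for i j u
proof (rule integrable_dom[OF integrable_mult_right[OF integrable_abs[OF u], of CK]])
 show "(%x. K i j x * u x) \<in> borel_measurable M" using ij u by measurable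
 have "\<bar>K i j x\<bar> * \<bar>u x\<bar> <= \<bar>CK * \<bar>u x\<bar>\<bar>" if "x \<in> space M" for x
 proof -
  have "\<bar>K i j x\<bar> * \<bar>u x\<bar> <= CK * \<bar>u x\<bar>" using Kb[OF ij that] by (intro mult_right_mono) auto
  then show ?thesis by linarith
 qed
 then show "AE x in M. norm (K i j x * u x) <= norm (CK * \<bar>u x\<bar>)" by (intro AE_I2) (simp add: abs_mult)
qed
\<comment> \<open>Integration by parts holds for every translate y of the kernel and is integrated
  over y in S. It trades the derivatives of the field for its values, which are at most dl0.\<close>
have lhs: "(LINT x|M. (\<Sum>j<n. K i j x * G i j x)) <= dl0 * (LINT x|M. \<bar>r i x\<bar>)" if i: "i < n" for i
proof -
 have "(LINT x|M. (\<Sum>j<n. K i j x * G i j x)) = (\<Sum>j<n. \<integral>x. K i j x * G i j x \<partial>M)" by (intro integral_setsum KI Gint i) auto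
 also have "... = (\<Sum>j<n. \<integral>y. indicator S y * (LINT x|M. drk n eps i j (dif n (?\<Phi> x) y) * G i j x) \<partial>?L)" unfolding K_def drki_def
 proof (intro sum.cong refl)
  fix j assume j: "j \<in> {..<n}"
  show "(LINT x|M. (LINT y|?L. indicator S y * drk n eps i j (dif n (?\<Phi> x) y)) * G i j x)
   = (LINT y|?L. indicator S y * (LINT x|M. drk n eps i j (dif n (?\<Phi> x) y) * G i j x))" using j by (intro kernel_fubini(2)[OF sf Gint \<Phi> S(2,3) drk_measurable[OF i] drk_sup_bound[OF S(1) i], symmetric]) auto
 qed
 also have "... = (LINT y|?L. (\<Sum>j<n. indicator S y * (LINT x|M. drk n eps i j (dif n (?\<Phi> x) y) * G i j x)))"
 proof (rule integral_setsum[symmetric])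
  fix j assume j: "j \<in> {..<n}"
  then have jn: "j < n" by simp
  show "integrable ?L (%y. indicator S y * (LINT x|M. drk n eps i j (dif n (?\<Phi> x) y) * G i j x))" using kernel_slice_integrable[OF sf Gint[OF jn] \<Phi> S(2,3) drk_measurable[OF i jn] drk_sup_bound[OF S(1) i jn]] .
 qed
 also have "... = (LINT y|?L. indicator S y * (LINT x|M. rk n eps i (dif n (?\<Phi> x) y) * r i x))"
 proof (rule lint_cong[OF refl])
  fix y assume y: "y \<in> space ?L"
  have int: "integrable M (%x. drk n eps i j (dif n (?\<Phi> x) y) * G i j x)" if "j < n" for j by (rule kernel_times_integrable[OF Gint[OF that] \<Phi> y drk_measurable[OF i that] drk_sup_bound[OF S(1) i that]])
  have "(\<Sum>j<n. indicator S y * (LINT x|M. drk n eps i j (dif n (?\<Phi> x) y) * G i j x))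
   = indicator S y * (LINT x|M. (\<Sum>j<n. drk n eps i j (dif n (?\<Phi> x) y) * G i j x))" using int by (subst integral_setsum) (auto simp: sum_distrib_left)
  also have "(LINT x|M. (\<Sum>j<n. drk n eps i j (dif n (?\<Phi> x) y) * G i j x)) = (LINT x|M. k x * (\<Sum>j<n. drk n eps i j (dif n (?\<Phi> x) y) * gam (f j) (g i) x))" by (simp add: G_def sum_distrib_left mult_ac)
  also have "... = (LINT x|M. rk n eps i (dif n (?\<Phi> x) y) * r i x)" by (rule r2[OF S(1) i])
  finally show "(\<Sum>j<n. indicator S y * (LINT x|M. drk n eps i j (dif n (?\<Phi> x) y) * G i j x))
   = indicator S y * (LINT x|M. rk n eps i (dif n (?\<Phi> x) y) * r i x)" .
 qed
 also have "... = (LINT x|M. rki n eps S i (?\<Phi> x) * r i x)" unfolding rki_def by (rule kernel_fubini(2)[OF sf r \<Phi> S(2,3) rk_measurable[OF i] rk_sup_bound[OF S(1) i]])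
 also have "... <= (LINT x|M. dl0 * \<bar>r i x\<bar>)"
 proof (rule integral_mono)
  have b: "\<bar>rki n eps S i (?\<Phi> x) * r i x\<bar> <= dl0 * \<bar>r i x\<bar>" if "x \<in> space M" for x unfolding abs_mult using S(6)[OF measurable_space[OF \<Phi> that] i] by (intro mult_right_mono) auto
  then show "rki n eps S i (?\<Phi> x) * r i x <= dl0 * \<bar>r i x\<bar>" if "x \<in> space M" for x using that by fastforce
  show di: "integrable M (%x. dl0 * \<bar>r i x\<bar>)" using r by auto
  show "integrable M (%x. rki n eps S i (?\<Phi> x) * r i x)"
  proof (rule integrable_dom[OF di])
   have "(%x. rki n eps S i (?\<Phi> x)) \<in> borel_measurable M" by (rule measurable_compose[OF \<Phi> rkim[OF i]])
   then show "(%x. rki n eps S i (?\<Phi> x) * r i x) \<in> borel_measurable M" using r by (intro borel_measurable_times) auto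
   show "AE x in M. norm (rki n eps S i (?\<Phi> x) * r i x) <= norm (dl0 * \<bar>r i x\<bar>)" using b by (intro AE_I2) (fastforce intro: order_trans)
  qed
 qed
 also have "... = dl0 * (LINT x|M. \<bar>r i x\<bar>)" by simp
 finally show ?thesis .
qed
have "c / 2 * m <= (LINT x|M. ?I x * (\<Sum>i<n. K i i x))"
proof -
 have "(LINT x|sig. (\<Sum>i<n. drki n eps S i i x)) = (LINT x|M. ?I x * (\<Sum>i<n. drki n eps S i i (?\<Phi> x)))" by (rule sigint) (intro borel_measurable_sum drkim; simp)
 then show ?thesis using S(4) sigm by (simp add: c_def K_def)
qed
\<comment> \<open>On W the trace is the pairing of the derivative matrix K with the identity;
  replacing the identity by G costs at most h times the entries of K.\<close>
also have "... <= (LINT x|M. (\<Sum>i<n. \<Sum>j<n. K i j x * G i j x) + h x * (\<Sum>i<n. \<Sum>j<n. \<bar>K i j x\<bar>))"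
proof (rule integral_mono)
 have "integrable M (%x. \<Sum>i<n. K i i x * ?I x)" by (intro integrable_setsum KI Iint) auto
 then show "integrable M (%x. ?I x * (\<Sum>i<n. K i i x))" by (simp add: sum_distrib_left mult.commute)
 have "integrable M (%x. \<Sum>i<n. \<Sum>j<n. \<bar>K i j x * h x\<bar>)" by (intro integrable_setsum integrable_abs KI hint) auto
 then have "integrable M (%x. h x * (\<Sum>i<n. \<Sum>j<n. \<bar>K i j x\<bar>))" using h0 by (simp add: sum_distrib_left mult.commute abs_mult)
 then show "integrable M (%x. (\<Sum>i<n. \<Sum>j<n. K i j x * G i j x) + h x * (\<Sum>i<n. \<Sum>j<n. \<bar>K i j x\<bar>))" by (intro Bochner_Integration.integrable_add integrable_setsum KI Gint) auto
 fix x
 have "?I x * (\<Sum>i<n. K i i x) = (\<Sum>i<n. \<Sum>j<n. K i j x * (kd i j * ?I x))"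
 proof -
  have "(\<Sum>j<n. K i j x * (kd i j * ?I x)) = K i i x * ?I x" if "i < n" for i
  proof -
   have "(\<Sum>j<n. K i j x * (kd i j * ?I x)) = (\<Sum>j<n. if i = j then K i j x * ?I x else 0)" by (intro sum.cong) (auto simp: kd_def)
   then show ?thesis using that by simp
  qed
  then show ?thesis by (simp add: sum_distrib_left mult.commute)
 qed
 also have "... = (\<Sum>i<n. \<Sum>j<n. K i j x * G i j x) + (\<Sum>i<n. \<Sum>j<n. K i j x * (kd i j * ?I x - G i j x))" by (simp add: sum.distrib[symmetric] right_diff_distrib)
 also have "(\<Sum>i<n. \<Sum>j<n. K i j x * (kd i j * ?I x - G i j x)) <= (\<Sum>i<n. \<Sum>j<n. h x * \<bar>K i j x\<bar>)"
 proof (intro sum_mono)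
  fix i j assume ij: "i \<in> {..<n}" "j \<in> {..<n}"
  have "\<bar>G i j x - kd i j * ?I x\<bar> <= (\<Sum>j<n. \<bar>G i j x - kd i j * ?I x\<bar>)" using ij by (intro member_le_sum[of j "{..<n}" "%j. \<bar>G i j x - kd i j * ?I x\<bar>"]) auto
  also have "... <= h x" unfolding h_def using ij by (intro member_le_sum[of i "{..<n}" "%i. \<Sum>j<n. \<bar>G i j x - kd i j * ?I x\<bar>"] sum_nonneg) auto
  finally have "\<bar>kd i j * ?I x - G i j x\<bar> <= h x" by (simp add: abs_minus_commute)
  then have "\<bar>K i j x\<bar> * \<bar>kd i j * ?I x - G i j x\<bar> <= \<bar>K i j x\<bar> * h x" by (intro mult_left_mono) auto
  then show "K i j x * (kd i j * ?I x - G i j x) <= h x * \<bar>K i j x\<bar>" using abs_ge_self[of "K i j x * (kd i j * ?I x - G i j x)"] unfolding abs_mult by (simp only: mult.commute[of "h x"])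
 qed
 finally show "?I x * (\<Sum>i<n. K i i x) <= (\<Sum>i<n. \<Sum>j<n. K i j x * G i j x) + h x * (\<Sum>i<n. \<Sum>j<n. \<bar>K i j x\<bar>)" by (simp add: sum_distrib_left)
qed
also have "... = (\<Sum>i<n. \<integral>x. (\<Sum>j<n. K i j x * G i j x) \<partial>M) + (LINT x|M. h x * (\<Sum>i<n. \<Sum>j<n. \<bar>K i j x\<bar>))"
proof -
 have "integrable M (%x. \<Sum>i<n. \<Sum>j<n. \<bar>K i j x * h x\<bar>)" by (intro integrable_setsum integrable_abs KI hint) auto
 then have 1: "integrable M (%x. h x * (\<Sum>i<n. \<Sum>j<n. \<bar>K i j x\<bar>))" using h0 by (simp add: sum_distrib_left mult.commute abs_mult)
 have 2: "integrable M (%x. \<Sum>j<n. K i j x * G i j x)" if "i < n" for i using that by (intro integrable_setsum KI Gint) auto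
 have 3: "integrable M (%x. \<Sum>i<n. \<Sum>j<n. K i j x * G i j x)" by (intro integrable_setsum[OF 2]) auto
 show ?thesis using 2 by (simp only: Bochner_Integration.integral_add[OF 3 1]) (subst integral_setsum, auto)
qed
also have "... <= (\<Sum>i<n. dl0 * (LINT x|M. \<bar>r i x\<bar>)) + F * ka"
proof (intro add_mono sum_mono)
 show "(LINT x|M. h x * (\<Sum>i<n. \<Sum>j<n. \<bar>K i j x\<bar>)) <= F * ka"
 proof -
  have "(LINT x|eta. (\<Sum>i<n. \<Sum>j<n. \<bar>drki n eps S i j x\<bar>)) = (LINT x|M. h x * (\<Sum>i<n. \<Sum>j<n. \<bar>drki n eps S i j (?\<Phi> x)\<bar>))" by (rule etaint) (intro borel_measurable_sum borel_measurable_abs drkim; simp)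
  then show ?thesis using S(5) by (simp add: F_def K_def)
 qed
qed (use lhs in auto)
also have "... <= c * m / 8 + c / 8 * m"
proof (rule add_mono)
 have "(\<Sum>i<n. dl0 * (LINT x|M. \<bar>r i x\<bar>)) = dl0 * (Q - 1)" by (simp add: Q_def sum_distrib_left)
 also have "... <= dl0 * Q" using dl0 by (intro mult_left_mono) auto
 also have "... = c * m / 8" using Q by (simp add: dl0_def)
 finally show "(\<Sum>i<n. dl0 * (LINT x|M. \<bar>r i x\<bar>)) <= c * m / 8" .
 show "F * ka <= c / 8 * m" using mult_right_mono[OF Fdl1, of m] m(1) by (simp add: ka_def mult.assoc)
qed
finally have "c / 2 * m <= c * m / 8 + c / 8 * m" .
then show False using c m(1) by simp
qed


section \<open>Unbounded functions and level sets\<close>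

text \<open>Truncations at growing heights have increasing energies, since successive slices have
  nonnegative mutual energy; being bounded in energy, they are Cauchy.\<close>

lemma D_pos_part:
assumes u: "u \<in> D"
shows "(%x. max 0 (u x)) \<in> D"
 and "(%k. e (%x. min (real (Suc k)) (max 0 (u x)) - max 0 (u x)) (%x. min (real (Suc k)) (max 0 (u x)) - max 0 (u x))) ---> 0"
proof -
define S where "S k x = min (real (Suc k)) (max 0 (u x))" for k x
have S: "S k \<in> D" for k unfolding S_def[abs_def] by (intro D_clamp u) simp
have mono: "e (%x. S m x - S l x) (%x. S m x - S l x) <= e (S m) (S m) - e (S l) (S l)" if ml: "l < m" for l m
proof -
 have "0 <= e (%x. min (real (Suc l)) (S m x) - min 0 (S m x)) (%x. min (real (Suc m)) (S m x) - min (real (Suc l)) (S m x))" using ml by (intro e_slices_nonneg S) (auto simp: S_def)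
 moreover have "min (real (Suc l)) (S m x) - min 0 (S m x) = S l x" "min (real (Suc m)) (S m x) - min (real (Suc l)) (S m x) = S m x - S l x" for x using ml by (auto simp: S_def min_def max_def)
 ultimately have "0 <= e (S l) (%x. S m x - S l x)" by simp
 then have "e (S l) (S l) <= e (S l) (S m)" by (simp add: e_diff_right S)
 then show ?thesis using e_diff_sq[OF S S, of m l] e_sym[OF S S, of m l] by linarith
qed
have "e (S n) (S n) <= e u u" for n unfolding S_def[abs_def] by (rule e_clamp[OF _ u]) simp
note cauchy = energy_monotone_cauchy[OF S this mono]
have um [measurable]: "u \<in> borel_measurable M" by (rule D_measurable[OF u])
have Sm [measurable]: "S k \<in> borel_measurable M" for k by (rule D_measurable[OF S])
have uint: "integrable M (%x. (u x)^2)" by (rule D_sq_integrable[OF u])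
have le: "(S k x - max 0 (u x))^2 <= (u x)^2" for k x by (rule abs_le_square_iff[THEN iffD1]) (auto simp: S_def)
have int: "integrable M (%x. (S k x - max 0 (u x))^2)" for k by (rule integrable_dom[OF uint]) (use le in auto)
have lim: "(%k. \<integral>x. (S k x - max 0 (u x))^2 \<partial>M) ---> (LINT x|M. 0)"
proof (rule integral_dominated_convergence[where w = "%x. (u x)^2"])
 show "AE x in M. (%k. (S k x - max 0 (u x))^2) ---> 0"
 proof (rule AE_I2)
  fix x
  obtain K where K: "u x <= real K" using real_arch_simple by blast
  have "(S k x - max 0 (u x))^2 = 0" if "k >= K" for k using K that by (auto simp: S_def)
  then show "(%k. (S k x - max 0 (u x))^2) ---> 0" by (intro tendsto_eventually) (auto simp: eventually_sequentially)
 qed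
qed (use le uint in auto)
have pm: "(%x. max 0 (u x)) \<in> borel_measurable M" by measurable
note fl = form_limit[OF S cauchy pm int lim[simplified]]
show "(%x. max 0 (u x)) \<in> D" by (rule fl(1))
show "(%k. e (%x. min (real (Suc k)) (max 0 (u x)) - max 0 (u x)) (%x. min (real (Suc k)) (max 0 (u x)) - max 0 (u x))) ---> 0" using fl(2) unfolding S_def .
qed

text \<open>On {u \<le> 0} the truncations of the positive part contribute nothing by
  \<open>gam_zero_level\<close>. There \<gamma> of the positive part is \<gamma> of the truncation
  error, whose energy tends to 0.\<close>

lemma gam_pos_part_zero:
assumes u: "u \<in> D" and g: "g \<in> D"
shows "AE x in M. u x <= 0 --> gam (%x. max 0 (u x)) g x = 0"
proof -
let ?p = "%x. max 0 (u x)" and ?v = "%k x. min (real (Suc k)) (max 0 (u x))"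
have p: "?p \<in> D" by (rule D_pos_part[OF u])
have v: "?v k \<in> D" for k by (intro D_clamp u) simp
have d: "(%x. ?v k x - ?p x) \<in> D" for k by (intro D_diff v p)
let ?z = "%x. if u x <= 0 then 1 else 0 :: real"
have um [measurable]: "u \<in> borel_measurable M" by (rule D_measurable[OF u])
have "{x\<in>space M. u x <= 0} \<in> sets M" by measurable
then have zm: "?z \<in> borel_measurable M" by (intro measurable_If) auto
have zint: "integrable M (%x. ?z x * gam ?p ?p x)" by (rule mult_gam_integrable[OF p p zm, of 1]) auto
have nnz: "AE x in M. 0 <= ?z x * gam ?p ?p x" using gam_nonneg[OF p] by eventually_elim auto
have "(LINT x|M. ?z x * gam ?p ?p x) <= 2 * e (%x. ?v k x - ?p x) (%x. ?v k x - ?p x)" for k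
proof -
 have "(LINT x|M. ?z x * gam ?p ?p x) <= (LINT x|M. gam (%x. ?v k x - ?p x) (%x. ?v k x - ?p x) x)"
 proof (rule integral_mono_AE[OF zint gam_int[OF d d]])
  have "AE x in M. ?v k x = 0 --> gam (?v k) h x = 0" if "h \<in> D" for h by (rule gam_zero_level[OF v _ _ _ that, of k "real (Suc k)"]) auto
  from this[OF d[of k]] this[OF p]
  show "AE x in M. ?z x * gam ?p ?p x <= gam (%x. ?v k x - ?p x) (%x. ?v k x - ?p x) x" using gam_diff[OF v p d, of k k] gam_sym[OF p d, of k] gam_diff[OF v p p, of k] gam_nonneg[OF d, of k]
  proof eventually_elim
   case (elim x)
   show ?case
   proof (cases "u x <= 0")
    case True
    then have "?v k x = 0" by auto
    then show ?thesis using elim True by auto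
   qed (use elim in auto)
  qed
 qed
 then show ?thesis unfolding e_gam2[OF d] .
qed
moreover have "(%k. 2 * e (%x. ?v k x - ?p x) (%x. ?v k x - ?p x)) ---> 2 * 0" by (intro tendsto_mult tendsto_const D_pos_part(2)[OF u])
ultimately have "(LINT x|M. ?z x * gam ?p ?p x) <= 2 * 0" by (intro LIMSEQ_le_const) blast+
then have "(LINT x|M. ?z x * gam ?p ?p x) = 0" using integral_nonneg_AE[OF nnz] by simp
then have "AE x in M. ?z x * gam ?p ?p x = 0" using integral_nonneg_eq_0_iff_AE[OF zint nnz] by simp
then show ?thesis using gam_zero_of_diag[OF p g] by eventually_elim auto
qed

lemma gam_zero_set:
assumes u: "u \<in> D" and g: "g \<in> D"
shows "AE x in M. u x = 0 --> gam u g x = 0"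
proof -
have mu: "(%x. - u x) \<in> D" by (rule D_minus[OF u])
have "AE x in M. gam (%x. max 0 (u x) - max 0 (- u x)) g x = gam (%x. max 0 (u x)) g x - gam (%x. max 0 (- u x)) g x" by (intro gam_diff D_pos_part u mu g)
moreover have "(%x. max 0 (u x) - max 0 (- u x)) = u" by (auto simp: max_def)
ultimately have "AE x in M. gam u g x = gam (%x. max 0 (u x)) g x - gam (%x. max 0 (- u x)) g x" by simp
then show ?thesis using gam_pos_part_zero[OF u g] gam_pos_part_zero[OF mu g] by eventually_elim auto
qed

text \<open>For m \<ge> 0 this is u clamped to [-m, m], written with clamps of u and -u at 0 and m,
  under which the domain is stable.\<close>

definition trunc :: "real => ('a => real) => 'a => real" where
"trunc m u x = min m (max 0 (u x)) - min m (max 0 (- u x))"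

lemma trunc:
assumes u: "u \<in> D" and m: "m >= 0"
shows "trunc m u \<in> D" "EX C. ALL x. \<bar>trunc m u x\<bar> <= C" "\<bar>u x\<bar> <= m ==> trunc m u x = u x"
 and "g \<in> D ==> AE x in M. \<bar>u x\<bar> <= m --> gam (trunc m u) g x = gam u g x"
proof -
show T: "trunc m u \<in> D" unfolding trunc_def[abs_def] by (intro D_diff D_clamp D_minus u m)
show "EX C. ALL x. \<bar>trunc m u x\<bar> <= C" using m by (intro exI[of _ m]) (auto simp: trunc_def)
show eq: "\<bar>u x\<bar> <= m ==> trunc m u x = u x" for x by (auto simp: trunc_def)
assume g: "g \<in> D"
show "AE x in M. \<bar>u x\<bar> <= m --> gam (trunc m u) g x = gam u g x" using gam_zero_set[OF D_diff[OF u T] g] gam_diff[OF u T g] by eventually_elim (auto simp: eq)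
qed

lemma singleton_null: "{\<lambda>i\<in>{..<1::nat}. c} \<in> null_sets (Leb 1)"
proof -
have eq: "{\<lambda>i\<in>{..<1::nat}. c} = PiE {..<1} (%_. {c})" by (auto simp: PiE_iff extensional_def fun_eq_iff)
have "emeasure (Leb 1) (PiE {..<1} (%_. {c})) = (\<Prod>i<1::nat. emeasure lborel {c})" by (rule lebesgue_prod.emeasure_PiM) auto
moreover have "PiE {..<1::nat} (%_. {c}) \<in> sets (Leb 1)" by (intro sets_PiM_I_finite) auto
ultimately show ?thesis unfolding eq by (intro null_setsI) auto
qed

text \<open>The one-dimensional case of \<open>energy_image_density_bounded\<close>, with the null
  set {c}. Truncation at height |c| makes u bounded without changing it where u = c.\<close>

lemma gam_level_set:
assumes u: "u \<in> D" and g: "g \<in> D"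
shows "AE x in M. u x = c --> gam u g x = 0"
proof -
have m: "\<bar>c\<bar> >= 0" by simp
let ?t = "trunc \<bar>c\<bar> u"
have "AE x in M. (\<lambda>j\<in>{..<1}. (%_. ?t) j x) \<in> {\<lambda>i\<in>{..<1::nat}. c} --> gram_det gam 1 (%_. ?t) x = 0" using trunc[OF u m] by (intro energy_image_density_bounded singleton_null) auto
moreover have "gram_det gam 1 (%_. ?t) x = gam ?t ?t x" for x unfolding gram_det_def by (subst det_single) auto
ultimately have "AE x in M. ?t x = c --> gam ?t ?t x = 0" by (elim eventually_mono) simp
moreover note gam_zero_of_diag[OF trunc(1)[OF u m] g] trunc(4)[OF u m g]
ultimately show ?thesis
proof eventually_elim
 case (elim x)
 then show ?case using trunc(3)[OF u m, of x] by auto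
qed
qed

end

section \<open>Counts of a Poisson random measure\<close>

locale poisson_measure =
fixes \<nu> :: "'a measure" and P :: "'a measure measure"
assumes poisson: "poisson_random_measure \<nu> P"
begin

sublocale prob_space P using poisson by (simp add: poisson_random_measure_def)

lemma space_P: "space P = configurations \<nu>"
and sets_P: "sets P = sigma_sets (configurations \<nu>)
  {{om \<in> configurations \<nu>. emeasure om A \<in> B} | A B. A \<in> sets \<nu> \<and> B \<in> sets (borel :: ennreal measure)}"
and count_prob: "A \<in> sets \<nu> ==> emeasure \<nu> A < \<infinity> ==>
   measure P {om \<in> space P. emeasure om A = of_nat k} = exp (- measure \<nu> A) * measure \<nu> A ^ k / fact k"
and count_indep: "(!!i. i < m ==> S i \<in> sets \<nu>) ==> disjoint_family_on S {..<m} ==>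
   indep_vars (%_. borel) (%i om. emeasure om (S i)) {..<m::nat}" using poisson unfolding poisson_random_measure_def by blast+

lemma sets_configuration: "om \<in> space P ==> sets om = sets \<nu>" by (auto simp: space_P configurations_def)

lemma space_configuration: "om \<in> space P ==> space om = space \<nu>" by (rule sets_eq_imp_space_eq[OF sets_configuration])

lemma count_measurable [measurable]: "A \<in> sets \<nu> ==> (%om. emeasure om A) \<in> borel_measurable P"
proof (rule measurableI)
fix B :: "ennreal set" assume "A \<in> sets \<nu>" "B \<in> sets borel"
then have "{om \<in> configurations \<nu>. emeasure om A \<in> B} \<in> sets P" unfolding sets_P by (intro sigma_sets.Basic) blast
moreover have "(%om. emeasure om A) -` B \<inter> space P = {om \<in> configurations \<nu>. emeasure om A \<in> B}" by (auto simp: space_P)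
ultimately show "(%om. emeasure om A) -` B \<inter> space P \<in> sets P" by simp
qed simp

lemma measurable_configuration: "om \<in> space P ==> f \<in> measurable \<nu> N ==> f \<in> measurable om N" using measurable_cong_sets[OF sets_configuration refl] by blast

lemma nn_integral_configuration_measurable:
"g \<in> borel_measurable \<nu> ==> (%om. \<integral>\<^sup>+x. g x \<partial>om) \<in> borel_measurable P"
proof (induction rule: borel_measurable_induct)
case (cong f g)
have "(nn_integral om (%x. f x)) = (nn_integral om (%x. g x))" if "om \<in> space P" for om using cong(3) by (intro nn_integral_cong) (simp add: space_configuration[OF that])
then have "(%om. \<integral>\<^sup>+x. f x \<partial>om) \<in> borel_measurable P \<longleftrightarrow> (%om. \<integral>\<^sup>+x. g x \<partial>om) \<in> borel_measurable P" by (intro measurable_cong)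
then show ?case using cong by blast
next
case (set A)
have "(nn_integral om (%x. indicator A x)) = emeasure om A" if "om \<in> space P" for om using set by (intro nn_integral_indicator) (simp add: sets_configuration[OF that])
then show ?case using count_measurable[OF set] by (subst measurable_cong[of P _ "%om. emeasure om A"]) auto
next
case (mult u c)
have "(nn_integral om (%x. c * u x)) = c * (nn_integral om (%x. u x))" if "om \<in> space P" for om by (intro nn_integral_cmult measurable_configuration[OF that] mult)
then show ?case using mult(4) by (subst measurable_cong[of P _ "%om. c * (nn_integral om (%x. u x))"]) auto
next
case (add u v)
have "(nn_integral om (%x. v x + u x)) = (nn_integral om (%x. v x)) + (nn_integral om (%x. u x))" if "om \<in> space P" for om by (intro nn_integral_add measurable_configuration[OF that] add)
then show ?case using add by (subst measurable_cong[of P _ "%om. (nn_integral om (%x. v x)) + (nn_integral om (%x. u x))"]) auto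
next
case (seq U)
have "(nn_integral om (%x. (SUP i. U i) x)) = (SUP i. \<integral>\<^sup>+x. U i x \<partial>om)" if "om \<in> space P" for om using seq(4) unfolding SUP_apply by (intro nn_integral_monotone_convergence_SUP measurable_configuration[OF that] seq)
then have "(%om. \<integral>\<^sup>+x. (SUP i. U i) x \<partial>om) \<in> borel_measurable P \<longleftrightarrow> (%om. SUP i. \<integral>\<^sup>+x. U i x \<partial>om) \<in> borel_measurable P" by (intro measurable_cong)
moreover have "(%om. SUP i. \<integral>\<^sup>+x. U i x \<partial>om) \<in> borel_measurable P" by (intro borel_measurable_SUP) (auto intro: seq)
ultimately show ?case by blast
qed

lemma integral_configuration_measurable:
assumes f: "f \<in> borel_measurable \<nu>"
shows "(%om. \<integral>x. f x \<partial>om :: real) \<in> borel_measurable P"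
proof -
have [measurable]: "f \<in> borel_measurable \<nu>" by fact
\<comment> \<open>The Bochner integral is 0 by convention on configurations where f is not
  integrable; the case distinction reproduces this.\<close>
have eq: "(LINT x|om. f x) = (if (nn_integral om (%x. ennreal \<bar>f x\<bar>)) < \<infinity> then enn2real (nn_integral om (%x. ennreal (f x))) - enn2real (nn_integral om (%x. ennreal (- f x))) else 0)"
 if om: "om \<in> space P" for om
proof (cases "integrable om f")
 case True
 then show ?thesis using real_lebesgue_integral_def[OF True] by (simp add: integrable_iff_bounded)
next
 case False
 then show ?thesis using measurable_configuration[OF om f] by (simp add: integrable_iff_bounded not_integrable_integral_eq)
qed
have [measurable]: "(%om. \<integral>\<^sup>+x. ennreal \<bar>f x\<bar> \<partial>om) \<in> borel_measurable P" "(%om. \<integral>\<^sup>+x. ennreal (f x) \<partial>om) \<in> borel_measurable P"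
 "(%om. \<integral>\<^sup>+x. ennreal (- f x) \<partial>om) \<in> borel_measurable P" by (intro nn_integral_configuration_measurable; measurable)+
show ?thesis by (subst measurable_cong[OF eq]) (assumption, measurable)
qed

lemma count_AE_nat:
assumes A: "A \<in> sets \<nu>" "emeasure \<nu> A < \<infinity>"
shows "AE om in P. EX k. emeasure om A = of_nat k"
proof -
let ?E = "%k. {om \<in> space P. emeasure om A = of_nat k}"
have [measurable]: "A \<in> sets \<nu>" by fact
have sums: "(%k. exp (- measure \<nu> A) * measure \<nu> A ^ k / fact k) sums 1" using sums_mult[OF exp_converges[of "measure \<nu> A"], of "exp (- measure \<nu> A)"] by (simp add: exp_minus field_simps)
have meas: "?E k \<in> sets P" for k by measurable
have "disjoint_family ?E" by (auto simp: disjoint_family_on_def)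
then have "(%k. measure P (?E k)) sums measure P (\<Union>k. ?E k)" using meas by (intro finite_measure_UNION) auto
then have "measure P (\<Union>k. ?E k) = 1" using sums by (simp add: count_prob[OF A] sums_unique2)
then have "AE om in P. om \<in> (\<Union>k. ?E k)" using meas by (intro AE_prob_1)
then show ?thesis by eventually_elim auto
qed

lemma count_nn_integral:
assumes A: "A \<in> sets \<nu>" "emeasure \<nu> A < \<infinity>" and g: "g \<in> borel_measurable borel"
shows "(nn_integral P (%om. g (emeasure om A))) = (\<Sum>k. g (of_nat k) * ennreal (exp (- measure \<nu> A) * measure \<nu> A ^ k / fact k))"
proof -
let ?E = "%k. {om \<in> space P. emeasure om A = of_nat k}"
have [measurable]: "A \<in> sets \<nu>" by fact
have meas [measurable]: "?E k \<in> sets P" for k by measurable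
have "(nn_integral P (%om. g (emeasure om A))) = (nn_integral P (%om. (\<Sum>k. g (of_nat k) * indicator (?E k) om)))"
proof (rule nn_integral_cong_AE)
 show "AE om in P. g (emeasure om A) = (\<Sum>k. g (of_nat k) * indicator (?E k) om)" using count_AE_nat[OF A] AE_space
 proof eventually_elim
  case (elim om)
  then obtain j where j: "emeasure om A = of_nat j" by blast
  have "(%k. g (of_nat k) * indicator (?E k) om) = (%k. if k = j then g (of_nat j) else 0)" using j elim(2) by (auto simp: indicator_def)
  then show ?case using j sums_unique[OF sums_single[of j "%_. g (of_nat j)"]] by (simp add: eq_commute cong: if_cong)
 qed
qed
also have "... = (\<Sum>k. \<integral>\<^sup>+om. g (of_nat k) * indicator (?E k) om \<partial>P)" by (rule nn_integral_suminf) simp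
also have "... = (\<Sum>k. g (of_nat k) * emeasure P (?E k))" by (simp add: nn_integral_cmult_indicator)
finally show ?thesis by (simp only: emeasure_eq_measure count_prob[OF A])
qed

text \<open>The Poisson weights satisfy k p(k) = \<nu>(A) p(k - 1), so weighting by the count
  amounts to adding one particle. This is Mecke's formula for a single set.\<close>

lemma count_size_bias:
assumes A: "A \<in> sets \<nu>" "emeasure \<nu> A < \<infinity>" and g: "g \<in> borel_measurable borel"
shows "(nn_integral P (%om. g (emeasure om A) * emeasure om A)) = emeasure \<nu> A * (nn_integral P (%om. g (emeasure om A + 1)))"
proof -
define p where "p k = exp (- measure \<nu> A) * measure \<nu> A ^ k / fact k" for k
have p0: "p k >= 0" for k by (simp add: p_def)
have rec: "real (Suc k) * p (Suc k) = measure \<nu> A * p k" for k by (simp add: p_def field_simps del: of_nat_Suc)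
have nA: "emeasure \<nu> A = ennreal (measure \<nu> A)" using A(2) by (intro emeasure_eq_ennreal_measure) auto
have rec': "of_nat (Suc k) * ennreal (p (Suc k)) = emeasure \<nu> A * ennreal (p k)" for k using rec[of k] p0 unfolding nA by (simp only: ennreal_mult[symmetric] ennreal_of_nat_eq_real_of_nat of_nat_0_le_iff measure_nonneg)
note [measurable] = g
have "(nn_integral P (%om. g (emeasure om A) * emeasure om A)) = (\<Sum>k. (g (of_nat k) * of_nat k) * ennreal (p k))" using count_nn_integral[OF A, of "%t. g t * t"] by (simp add: p_def)
also have "... = (\<Sum>k. (g (of_nat (Suc k)) * of_nat (Suc k)) * ennreal (p (Suc k)))" using suminf_offset[of "%k. (g (of_nat k) * of_nat k) * ennreal (p k)" 1] by simp
also have "... = (\<Sum>k. emeasure \<nu> A * (g (of_nat k + 1) * ennreal (p k)))"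
proof (intro suminf_cong)
 fix k
 have "(g (of_nat (Suc k)) * of_nat (Suc k)) * ennreal (p (Suc k)) = g (of_nat (Suc k)) * (emeasure \<nu> A * ennreal (p k))" by (simp only: mult.assoc rec')
 then show "(g (of_nat (Suc k)) * of_nat (Suc k)) * ennreal (p (Suc k)) = emeasure \<nu> A * (g (of_nat k + 1) * ennreal (p k))" by (simp add: mult_ac add.commute)
qed
also have "... = emeasure \<nu> A * (\<Sum>k. g (of_nat k + 1) * ennreal (p k))" by (rule ennreal_suminf_cmult)
also have "(\<Sum>k. g (of_nat k + 1) * ennreal (p k)) = (nn_integral P (%om. g (emeasure om A + 1)))" using count_nn_integral[OF A, of "%t. g (t + 1)"] by (simp add: p_def)
finally show ?thesis .
qed

text \<open>By independence the joint law of the counts is a product, so all counts but the l-th are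
  held fixed and \<open>count_size_bias\<close> is applied to that one.\<close>

lemma counts_size_bias:
fixes S :: "nat => 'a set"
assumes S: "!!i. i < m ==> S i \<in> sets \<nu>" "!!i. i < m ==> emeasure \<nu> (S i) < \<infinity>" "disjoint_family_on S {..<m}"
 and l: "l < m" and \<Psi>: "\<Psi> \<in> borel_measurable (PiM {..<m} (%_. borel :: ennreal measure))"
shows "(nn_integral P (%om. \<Psi> (\<lambda>i\<in>{..<m}. emeasure om (S i)) * emeasure om (S l)))
 = emeasure \<nu> (S l) * (nn_integral P (%om. \<Psi> (\<lambda>i\<in>{..<m}. emeasure om (S i) + (if i = l then 1 else 0))))"
proof -
let ?D = "PiM {..<m} (%_. borel :: ennreal measure)"
let ?X = "%om. \<lambda>i\<in>{..<m}. emeasure om (S i)"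
\<comment> \<open>Indices from m on receive a dummy law, because a product probability space asks
  for a probability measure at every index.\<close>
define \<mu> where "\<mu> i = (if i < m then distr P borel (%om. emeasure om (S i)) else return borel 0)" for i
have rv: "(%om. emeasure om (S i)) \<in> borel_measurable P" if "i < m" for i using S(1)[OF that] by (rule count_measurable)
have \<mu>p: "prob_space (\<mu> i)" for i unfolding \<mu>_def using rv by (auto intro!: prob_space_distr prob_space_return)
have ind: "indep_vars (%_. borel) (%i om. emeasure om (S i)) {..<m}" by (rule count_indep) (use S in auto)
interpret X: product_prob_space \<mu> "{..<m}" using \<mu>p by (intro product_prob_spaceI)
have \<mu>s: "sets (\<mu> i) = sets borel" for i by (simp add: \<mu>_def)
have Xm [measurable]: "?X \<in> measurable P ?D" using rv by (intro measurable_restrict) auto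
have dX: "distr P ?D ?X = PiM {..<m} \<mu>"
proof -
 have "distr P ?D ?X = PiM {..<m} (%i. distr P borel (%om. emeasure om (S i)))" by (rule indep_vars_iff_distr_eq_PiM'[THEN iffD1, OF _ _ ind]) (use l rv in auto)
 also have "... = PiM {..<m} \<mu>" by (intro PiM_cong) (auto simp: \<mu>_def)
 finally show ?thesis .
qed
define J where "J = {..<m} - {l}"
have J: "insert l J = {..<m}" "finite J" "l \<notin> J" using l by (auto simp: J_def)
have Ds: "sets (PiM {..<m} \<mu>) = sets ?D" by (intro sets_PiM_cong) (auto simp: \<mu>s)
have ins: "(nn_integral P (%om. h (?X om))) = (nn_integral (PiM J \<mu>) (%x. \<integral>\<^sup>+y. h (x(l := y)) \<partial>\<mu> l))" if h: "h \<in> borel_measurable ?D" for h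
proof -
 have "(nn_integral P (%om. h (?X om))) = (nn_integral (distr P ?D ?X) (%x. h x))" by (rule nn_integral_distr[symmetric, OF Xm]) (use h in simp)
 also have "... = (nn_integral (PiM (insert l J) \<mu>) (%x. h x))" by (simp add: dX J(1))
 also have "... = (nn_integral (PiM J \<mu>) (%x. \<integral>\<^sup>+y. h (x(l := y)) \<partial>\<mu> l))" using h by (intro X.product_nn_integral_insert J(2,3)) (simp add: J(1) measurable_cong_sets[OF Ds refl])
 finally show ?thesis .
qed
have pl: "(%x. x l) \<in> borel_measurable ?D" using l by simp
define sh where "sh x = (\<lambda>i\<in>{..<m}. x i + (if i = l then 1 else 0 :: ennreal))" for x
have shm: "sh \<in> measurable ?D ?D" unfolding sh_def by (intro measurable_restrict) simp
have "(nn_integral P (%om. \<Psi> (?X om) * emeasure om (S l))) = (nn_integral P (%om. (%x. \<Psi> x * x l) (?X om)))" using l by simp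
also have "... = (nn_integral (PiM J \<mu>) (%x. \<integral>\<^sup>+y. \<Psi> (x(l := y)) * y \<partial>\<mu> l))" using ins[of "%x. \<Psi> x * x l"] \<Psi> pl by simp
also have "... = (nn_integral (PiM J \<mu>) (%x. emeasure \<nu> (S l) * (nn_integral (\<mu> l) (%y. \<Psi> (sh (x(l := y)))))))"
proof (rule nn_integral_cong)
 fix x assume x: "x \<in> space (PiM J \<mu>)"
 have "(%y. x(l := y)) \<in> measurable borel (PiM (insert l J) \<mu>)" using measurable_component_update[OF x J(3)] measurable_cong_sets[OF \<mu>s refl] by blast
 then have upd: "(%y. x(l := y)) \<in> measurable borel ?D" unfolding J(1) by (simp add: measurable_cong_sets[OF refl Ds])
 have g: "(%y. \<Psi> (x(l := y))) \<in> borel_measurable borel" by (rule measurable_compose[OF upd \<Psi>])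
 have shu: "sh (x(l := y)) = x(l := y + 1)" for y
 proof -
  have "x \<in> extensional J" using x by (auto simp: space_PiM PiE_def)
  then show ?thesis using l by (auto simp: sh_def J_def extensional_def fun_eq_iff)
 qed
 have g': "(%y. \<Psi> (x(l := y + 1))) \<in> borel_measurable borel" by (rule measurable_compose[OF _ g]) simp
 have \<mu>l: "\<mu> l = distr P borel (%om. emeasure om (S l))" using l by (simp add: \<mu>_def)
 have "(nn_integral (\<mu> l) (%y. \<Psi> (x(l := y)) * y)) = (nn_integral P (%om. \<Psi> (x(l := emeasure om (S l))) * emeasure om (S l)))" unfolding \<mu>l by (rule nn_integral_distr[OF rv[OF l]]) (use g in simp)
 also have "... = emeasure \<nu> (S l) * (nn_integral P (%om. \<Psi> (x(l := emeasure om (S l) + 1))))" by (rule count_size_bias[OF S(1,2)[OF l] g])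
 also have "(nn_integral P (%om. \<Psi> (x(l := emeasure om (S l) + 1)))) = (nn_integral (\<mu> l) (%y. \<Psi> (x(l := y + 1))))" unfolding \<mu>l by (rule nn_integral_distr[OF rv[OF l], symmetric]) (use g' in simp)
 finally show "(nn_integral (\<mu> l) (%y. \<Psi> (x(l := y)) * y)) = emeasure \<nu> (S l) * (nn_integral (\<mu> l) (%y. \<Psi> (sh (x(l := y)))))" unfolding shu .
qed
also have "... = (nn_integral (PiM J \<mu>) (%x. \<integral>\<^sup>+y. emeasure \<nu> (S l) * \<Psi> (sh (x(l := y))) \<partial>\<mu> l))"
proof (rule nn_integral_cong, rule nn_integral_cmult[symmetric])
 fix x assume x: "x \<in> space (PiM J \<mu>)"
 have "(%y. x(l := y)) \<in> measurable (\<mu> l) (PiM (insert l J) \<mu>)" by (rule measurable_component_update[OF x J(3)])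
 then have "(%y. x(l := y)) \<in> measurable (\<mu> l) ?D" unfolding J(1) by (simp add: measurable_cong_sets[OF refl Ds])
 then show "(%y. \<Psi> (sh (x(l := y)))) \<in> borel_measurable (\<mu> l)" by (intro measurable_compose[OF measurable_compose[OF _ shm] \<Psi>])
qed
also have "... = (nn_integral P (%om. emeasure \<nu> (S l) * \<Psi> (sh (?X om))))" using ins[of "%x. emeasure \<nu> (S l) * \<Psi> (sh x)"] measurable_compose[OF shm \<Psi>] by simp
also have "... = emeasure \<nu> (S l) * (nn_integral P (%om. \<Psi> (sh (?X om))))" by (rule nn_integral_cmult) (rule measurable_compose[OF Xm measurable_compose[OF shm \<Psi>]])
finally have *: "(nn_integral P (%om. \<Psi> (?X om) * emeasure om (S l))) = emeasure \<nu> (S l) * (nn_integral P (%om. \<Psi> (sh (?X om))))" .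
have "sh (?X om) = (\<lambda>i\<in>{..<m}. emeasure om (S i) + (if i = l then 1 else 0))" for om by (auto simp: sh_def fun_eq_iff)
with * show ?thesis by (simp only:)
qed


section \<open>Mecke's formula for vectors of statistics\<close>

definition stat :: "nat => (nat => 'a => real) => 'a measure => nat => real" where
"stat n F om = (\<lambda>i\<in>{..<n}. \<integral>x. F i x \<partial>om)"

definition shift :: "nat => (nat => real) => (nat => 'a => real) => 'a => nat => real" where
"shift n y F x = (\<lambda>i\<in>{..<n}. y i + F i x)"

lemma stat_measurable: "(!!i. i < n ==> F i \<in> borel_measurable \<nu>) ==> stat n F \<in> measurable P (Leb n)" unfolding stat_def[abs_def] by (intro measurable_restrict) (simp add: integral_configuration_measurable)

lemma count_AE_finite: "A \<in> sets \<nu> ==> emeasure \<nu> A < \<infinity> ==> AE om in P. emeasure om A < \<infinity>" by (drule (1) count_AE_nat) (auto elim!: eventually_mono simp: of_nat_less_top)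

text \<open>The Mecke formula for statistics given by simple functions.\<close>

lemma mecke_simple:
fixes F :: "nat => 'a => real"
assumes F: "!!i. i < n ==> simple_function \<nu> (F i)" "!!i. i < n ==> emeasure \<nu> {x\<in>space \<nu>. F i x ~= 0} < \<infinity>"
 and W: "W \<in> sets \<nu>" "emeasure \<nu> W < \<infinity>"
 and phi: "phi \<in> borel_measurable (Leb n)"
shows "(nn_integral P (%om. phi (stat n F om) * emeasure om W)) = (nn_integral \<nu> (%x. (nn_integral P (%om. phi (shift n (stat n F om) F x))) * indicator W x))"
proof -
define h where "h x = (\<lambda>i\<in>{..<n}. F i x, x \<in> W)" for x
\<comment> \<open>The set of points outside W where all F i vanish is left out: it may have infinite
  measure, and it contributes neither to the statistics nor to N(W).\<close>
define V where "V = h ` space \<nu> - {(\<lambda>i\<in>{..<n}. 0, False)}"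
have finV: "finite V"
proof -
 have "h x \<in> PiE {..<n} (%i. F i ` space \<nu>) \<times> UNIV" if "x \<in> space \<nu>" for x unfolding h_def using that by (intro SigmaI restrict_PiE_iff[THEN iffD2]) auto
 then have "h ` space \<nu> \<subseteq> PiE {..<n} (%i. F i ` space \<nu>) \<times> UNIV" by blast
 moreover have "finite (PiE {..<n} (%i. F i ` space \<nu>) \<times> (UNIV :: bool set))" by (intro finite_cartesian_product finite_PiE finite_lessThan simple_functionD(1)[OF F(1)]) auto
 ultimately have "finite (h ` space \<nu>)" by (rule finite_subset)
 then show ?thesis by (simp add: V_def)
qed
define m where "m = card V"
obtain b where b: "bij_betw b {..<m} V" using ex_bij_betw_nat_finite[OF finV] by (auto simp: m_def lessThan_atLeast0)
define S where "S l = {x\<in>space \<nu>. h x = b l}" for l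
have Fm [measurable]: "F i \<in> borel_measurable \<nu>" if "i < n" for i using F(1)[OF that] by (rule borel_measurable_simple_function)
have bV: "b l \<in> V" if "l < m" for l using b that by (auto simp: bij_betw_def)
have b_eq: "fst (b l) \<in> extensional {..<n}" if "l < m" for l using bV[OF that] by (auto simp: V_def h_def)
have S_eq: "S l = {x\<in>space \<nu>. (\<forall>i\<in>{..<n}. F i x = fst (b l) i) \<and> (x \<in> W \<longleftrightarrow> snd (b l))}" if "l < m" for l
proof -
 have "h x = b l \<longleftrightarrow> (\<forall>i\<in>{..<n}. F i x = fst (b l) i) \<and> (x \<in> W \<longleftrightarrow> snd (b l))" for x using b_eq[OF that] by (auto simp: h_def prod_eq_iff fun_eq_iff restrict_def extensional_def)
 then show ?thesis by (simp add: S_def)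
qed
have Ss: "S l \<in> sets \<nu>" if "l < m" for l
proof -
 have "{x\<in>space \<nu>. x \<in> W \<longleftrightarrow> snd (b l)} \<in> sets \<nu>" using W(1) by measurable
 moreover have "{x\<in>space \<nu>. \<forall>i\<in>{..<n}. F i x = fst (b l) i} \<in> sets \<nu>" by (intro sets.sets_Collect_finite_All finite_lessThan) (auto intro!: borel_measurable_eq Fm)
 ultimately show ?thesis unfolding S_eq[OF that] by (intro sets.sets_Collect_conj)
qed
have Sf: "emeasure \<nu> (S l) < \<infinity>" if l: "l < m" for l
proof -
 have "(EX i<n. fst (b l) i ~= 0) \<or> snd (b l)"
 proof (rule ccontr)
  assume "\<not> ?thesis"
  then have "b l = (\<lambda>i\<in>{..<n}. 0, False)" using b_eq[OF l] by (auto simp: prod_eq_iff fun_eq_iff restrict_def extensional_def)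
  then show False using bV[OF l] by (simp add: V_def)
 qed
 then show ?thesis
 proof
  assume "EX i<n. fst (b l) i ~= 0"
  then obtain i where i: "i < n" "fst (b l) i ~= 0" by blast
  have "{x\<in>space \<nu>. F i x ~= 0} \<in> sets \<nu>" using Fm[OF i(1)] by measurable
  then have "emeasure \<nu> (S l) <= emeasure \<nu> {x\<in>space \<nu>. F i x ~= 0}" using i unfolding S_eq[OF l] by (intro emeasure_mono) auto
  then show ?thesis using F(2)[OF i(1)] by (rule le_less_trans)
 next
  assume "snd (b l)"
  then have "emeasure \<nu> (S l) <= emeasure \<nu> W" unfolding S_eq[OF l] by (intro emeasure_mono W) auto
  then show ?thesis using W(2) by (rule le_less_trans)
 qed
qed
have inj: "b l = b k ==> l < m ==> k < m ==> l = k" for l k using b by (auto simp: bij_betw_def inj_on_def)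
have disj: "disjoint_family_on S {..<m}" by (auto simp: disjoint_family_on_def S_def dest: inj)
have ind: "indicator (S l) x = (if h x = b l then 1 else 0 :: 'b::zero_neq_one)" if "x \<in> space \<nu>" for l x using that by (simp add: S_def indicator_def)
have sum_h: "(\<Sum>l<m. indicator (S l) x * g (b l)) = g (h x)" if x: "x \<in> space \<nu>" and g0: "g (\<lambda>i\<in>{..<n}. 0, False) = 0"
 for x and g :: "(nat => real) \<times> bool => 'c::semiring_1"
proof (cases "h x \<in> V")
 case True
 then obtain l where l: "l < m" "b l = h x" using b by (auto simp: bij_betw_def image_iff)
 have "(\<Sum>k<m. indicator (S k) x * g (b k)) = (\<Sum>k<m. if k = l then g (h x) else 0)" using l inj by (intro sum.cong refl) (auto simp: ind[OF x])
 then show ?thesis using l by simp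
next
 case False
 then have "h x = (\<lambda>i\<in>{..<n}. 0, False)" using x by (auto simp: V_def)
 moreover have "(\<Sum>k<m. indicator (S k) x * g (b k)) = 0" using False bV by (intro sum.neutral) (auto simp: ind[OF x])
 ultimately show ?thesis using g0 by simp
qed
\<comment> \<open>\<open>enn2real\<close> sends \<infinity> to 0, so the statistics are linear in
  the counts only where these are finite.\<close>
have good: "AE om in P. om \<in> space P \<and> (\<forall>l\<in>{..<m}. emeasure om (S l) < \<infinity>)" using AE_space by (intro AE_conjI AE_ball_countable' count_AE_finite Ss Sf) auto
have statF: "(LINT x|om. F i x) = (\<Sum>l<m. enn2real (emeasure om (S l)) * fst (b l) i)"
 if om: "om \<in> space P" "\<forall>l\<in>{..<m}. emeasure om (S l) < \<infinity>" and i: "i < n" for om i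
proof -
 have "(LINT x|om. F i x) = (LINT x|om. (\<Sum>l<m. indicator (S l) x * fst (b l) i))"
 proof (rule lint_cong[OF refl])
  fix x assume "x \<in> space om"
  then have x: "x \<in> space \<nu>" by (simp add: space_configuration[OF om(1)])
  show "F i x = (\<Sum>l<m. indicator (S l) x * fst (b l) i)" using sum_h[OF x, of "%p. fst p i"] i by (simp add: h_def)
 qed
 also have "... = (\<Sum>l<m. measure om (S l) * fst (b l) i)"
 proof -
  have "integrable om (%x. indicator (S l) x * fst (b l) i)" if "l < m" for l using Ss[OF that] om that by (intro integrable_mult_left) (simp add: sets_configuration[OF om(1)])
  moreover have "S l \<inter> space om = S l" for l by (auto simp: S_def space_configuration[OF om(1)])
  ultimately show ?thesis by (subst integral_setsum) auto
 qed
 finally show ?thesis by (simp add: measure_def)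
qed
have countW: "emeasure om W = (\<Sum>l<m. emeasure om (S l) * (if snd (b l) then 1 else 0))" if om: "om \<in> space P" for om
proof -
 have "emeasure om W = (nn_integral om (%x. indicator W x))" using W by (simp add: sets_configuration[OF om])
 also have "... = (nn_integral om (%x. (\<Sum>l<m. indicator (S l) x * (if snd (b l) then 1 else 0))))"
 proof (rule nn_integral_cong)
  fix x assume "x \<in> space om"
  then have x: "x \<in> space \<nu>" by (simp add: space_configuration[OF om])
  show "indicator W x = (\<Sum>l<m. indicator (S l) x * (if snd (b l) then 1 else 0 :: ennreal))"
  proof -
   have "(\<Sum>l<m. indicator (S l) x * (if snd (b l) then 1 else 0 :: ennreal)) = (if snd (h x) then 1 else 0)" by (rule sum_h[OF x, of "%p. if snd p then 1 else 0"]) simp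
   moreover have "indicator W x = (if snd (h x) then 1 else 0 :: ennreal)" by (simp add: h_def indicator_def)
   ultimately show ?thesis by simp
  qed
 qed
 also have "... = (\<Sum>l<m. (nn_integral om (%x. indicator (S l) x * (if snd (b l) then 1 else 0))))" using Ss by (intro nn_integral_sum) (auto simp: measurable_cong_sets[OF sets_configuration[OF om] refl])
 also have "... = (\<Sum>l<m. emeasure om (S l) * (if snd (b l) then 1 else 0))" using Ss by (intro sum.cong refl) (auto simp: nn_integral_multc sets_configuration[OF om])
 finally show ?thesis .
qed
let ?X = "%om. \<lambda>l\<in>{..<m}. emeasure om (S l)"
define Y where "Y X = (\<lambda>i\<in>{..<n}. \<Sum>l<m. enn2real (X l) * fst (b l) i)" for X
have Ym: "Y \<in> measurable (PiM {..<m} (%_. borel)) (Leb n)" unfolding Y_def[abs_def] by (intro measurable_restrict) simp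
have \<Psi>: "(%X. phi (Y X)) \<in> borel_measurable (PiM {..<m} (%_. borel))" by (rule measurable_compose[OF Ym phi])
have Xm: "?X \<in> measurable P (PiM {..<m} (%_. borel))" using Ss by (intro measurable_restrict) simp
have YX: "Y (?X om) = stat n F om" if "om \<in> space P \<and> (\<forall>l\<in>{..<m}. emeasure om (S l) < \<infinity>)" for om using that statF[of om] by (auto simp: Y_def stat_def fun_eq_iff)
have YX1: "Y (\<lambda>k\<in>{..<m}. emeasure om (S k) + (if k = l then 1 else 0)) = (\<lambda>i\<in>{..<n}. stat n F om i + fst (b l) i)"
 if "om \<in> space P \<and> (\<forall>l\<in>{..<m}. emeasure om (S l) < \<infinity>)" and l: "l < m" for om l
proof
 fix i
 show "Y (\<lambda>k\<in>{..<m}. emeasure om (S k) + (if k = l then 1 else 0)) i = (\<lambda>i\<in>{..<n}. stat n F om i + fst (b l) i) i"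
 proof (cases "i < n")
  case True
  have "enn2real (emeasure om (S k) + (if k = l then 1 else 0)) = enn2real (emeasure om (S k)) + (if k = l then 1 else 0)" if "k < m" for k using \<open>om \<in> space P \<and> _\<close> that by (auto simp: enn2real_plus)
  then have "(\<Sum>k<m. enn2real (emeasure om (S k) + (if k = l then 1 else 0)) * fst (b k) i)
   = (\<Sum>k<m. enn2real (emeasure om (S k)) * fst (b k) i) + (\<Sum>k<m. if k = l then fst (b l) i else 0)" by (subst sum.distrib[symmetric]) (intro sum.cong refl, auto simp: distrib_right)
  then show ?thesis using True l statF[of om i] \<open>om \<in> space P \<and> _\<close> by (simp add: Y_def stat_def)
 qed (simp add: Y_def)
qed
define K where "K v = (nn_integral P (%om. phi (\<lambda>i\<in>{..<n}. stat n F om i + v i)))" for v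
have Cm: "(%om. emeasure om (S l)) \<in> borel_measurable P" if "l < m" for l using Ss[OF that] by (rule count_measurable)
have "(nn_integral P (%om. phi (stat n F om) * emeasure om W)) = (nn_integral P (%om. (\<Sum>l<m. phi (Y (?X om)) * emeasure om (S l) * (if snd (b l) then 1 else 0))))" by (rule nn_integral_cong_AE, use good in eventually_elim)
  (simp add: YX countW sum_distrib_left mult.assoc)
also have "... = (\<Sum>l<m. \<integral>\<^sup>+om. phi (Y (?X om)) * emeasure om (S l) * (if snd (b l) then 1 else 0) \<partial>P)" by (intro nn_integral_sum borel_measurable_times_ennreal measurable_compose[OF Xm \<Psi>] Cm) auto
also have "... = (\<Sum>l<m. emeasure \<nu> (S l) * (K (fst (b l)) * (if snd (b l) then 1 else 0)))"
proof (rule sum.cong[OF refl])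
 fix l assume "l \<in> {..<m}"
 then have l: "l < m" by simp
 have "(nn_integral P (%om. phi (Y (?X om)) * emeasure om (S l))) = emeasure \<nu> (S l) * (nn_integral P (%om. phi (Y (\<lambda>k\<in>{..<m}. emeasure om (S k) + (if k = l then 1 else 0)))))" by (rule counts_size_bias[OF Ss Sf disj l \<Psi>])
 also have "(nn_integral P (%om. phi (Y (\<lambda>k\<in>{..<m}. emeasure om (S k) + (if k = l then 1 else 0))))) = K (fst (b l))" unfolding K_def by (rule nn_integral_cong_AE, use good in eventually_elim) (rule arg_cong[of _ _ phi], rule YX1[OF _ l])
 finally have *: "(nn_integral P (%om. phi (Y (?X om)) * emeasure om (S l))) = emeasure \<nu> (S l) * K (fst (b l))" .
 show "(nn_integral P (%om. phi (Y (?X om)) * emeasure om (S l) * (if snd (b l) then 1 else 0))) = emeasure \<nu> (S l) * (K (fst (b l)) * (if snd (b l) then 1 else 0))" using * by (cases "snd (b l)") auto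
qed
also have "... = (\<Sum>l<m. \<integral>\<^sup>+x. indicator (S l) x * (K (fst (b l)) * (if snd (b l) then 1 else 0)) \<partial>\<nu>)" using Ss by (intro sum.cong refl) (simp add: nn_integral_multc)
also have "... = (nn_integral \<nu> (%x. (\<Sum>l<m. indicator (S l) x * (K (fst (b l)) * (if snd (b l) then 1 else 0)))))" using Ss by (intro nn_integral_sum[symmetric]) auto
also have "... = (nn_integral \<nu> (%x. (nn_integral P (%om. phi (shift n (stat n F om) F x))) * indicator W x))"
proof (rule nn_integral_cong)
 fix x assume x: "x \<in> space \<nu>"
 have "K (fst (h x)) = (nn_integral P (%om. phi (shift n (stat n F om) F x)))" unfolding K_def h_def shift_def by (intro nn_integral_cong arg_cong[of _ _ phi]) auto
 then show "(\<Sum>l<m. indicator (S l) x * (K (fst (b l)) * (if snd (b l) then 1 else 0))) = (nn_integral P (%om. phi (shift n (stat n F om) F x))) * indicator W x" using sum_h[OF x, of "%p. K (fst p) * (if snd p then 1 else 0)"] by (simp add: h_def indicator_def)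
qed
finally show ?thesis .
qed

end

text \<open>Square integrability makes the supports finite: if c is the least nonzero value of (F
  k)^2, then |F k| \<le> 2 |f| puts the support into {4 f^2 \<ge> c}, to which Markov's inequality
  applies.\<close>

lemma simple_approximation:
fixes f :: "'a => real"
assumes f: "f \<in> borel_measurable M" "integrable M (%x. (f x)^2)"
obtains F where "!!k. simple_function M (F k)" "!!k. emeasure M {x\<in>space M. F k x ~= 0} < \<infinity>"
 "!!x. x \<in> space M ==> (%k. F k x) ---> f x" "!!k x. x \<in> space M ==> \<bar>F k x\<bar> <= 2 * \<bar>f x\<bar>"
proof -
obtain F where F: "!!k. simple_function M (F k)" "!!x. x \<in> space M ==> (%k. F k x) ---> f x"
 "!!k x. x \<in> space M ==> dist (F k x) 0 <= 2 * dist (f x) 0" using borel_measurable_implies_sequence_metric[OF f(1), of 0] by metis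
have le: "\<bar>F k x\<bar> <= 2 * \<bar>f x\<bar>" if "x \<in> space M" for k x using F(3)[OF that, of k] by simp
have "emeasure M {x\<in>space M. F k x ~= 0} < \<infinity>" for k
proof (cases "\<exists>x\<in>space M. F k x ~= 0")
 case False
 then have empty: "{x\<in>space M. F k x ~= 0} = {}" by auto
 show ?thesis unfolding empty by simp
next
 case True
 have [measurable]: "F k \<in> borel_measurable M" "f \<in> borel_measurable M" using borel_measurable_simple_function[OF F(1)] f(1) by auto
 define R where "R = (%v. v^2) ` (F k ` space M - {0})"
 have R: "finite R" "R ~= {}" using True simple_functionD(1)[OF F(1)] by (auto simp: R_def)
 define c where "c = Min R"
 have c0: "c > 0" unfolding c_def using R by (subst Min_gr_iff) (auto simp: R_def)
 have "c <= 4 * (f x)^2" if x: "x \<in> space M" "F k x ~= 0" for x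
 proof -
  have "c <= (F k x)^2" unfolding c_def using R x by (intro Min_le) (auto simp: R_def)
  also have "... <= (2 * \<bar>f x\<bar>)^2" using power_mono[OF le[OF x(1), of k] abs_ge_zero, of 2] by simp
  finally show ?thesis by (simp add: power_mult_distrib)
 qed
 then have sub: "{x\<in>space M. F k x ~= 0} \<subseteq> {x\<in>space M. 1 <= ennreal (4 / c) * ennreal ((f x)^2)}" using c0 by (auto simp: ennreal_mult[symmetric] le_divide_eq)
 have "emeasure M {x\<in>space M. F k x ~= 0} <= emeasure M {x\<in>space M. 1 <= ennreal (4 / c) * ennreal ((f x)^2)}" by (intro emeasure_mono sub) measurable
 also have "... <= ennreal (4 / c) * (nn_integral M (%x. ennreal ((f x)^2) * indicator (space M) x))" by (rule nn_integral_Markov_inequality) measurable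
 also have "(nn_integral M (%x. ennreal ((f x)^2) * indicator (space M) x)) = ennreal (LINT x|M. (f x)^2)" by (subst nn_integral_eq_integral[symmetric, OF f(2)]) (auto intro!: nn_integral_cong)
 also have "ennreal (4 / c) * ... < \<infinity>" by (simp add: ennreal_mult_less_top)
 finally show ?thesis .
qed
then show ?thesis using that F le by blast
qed

context poisson_measure
begin

lemma count_expectation: "A \<in> sets \<nu> ==> emeasure \<nu> A < \<infinity> ==> (nn_integral P (%om. emeasure om A)) = emeasure \<nu> A" using count_size_bias[of A "%_. 1"] by (simp add: emeasure_space_1)

lemma shift_measurable:
assumes H: "!!i. i < n ==> H i \<in> borel_measurable \<nu>"
shows "(%p. shift n (stat n H (snd p)) H (fst p)) \<in> measurable (\<nu> \<Otimes>\<^sub>M P) (Leb n)" unfolding shift_def stat_def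
proof (intro measurable_restrict)
fix i assume i: "i \<in> {..<n}"
have [measurable]: "(%om. \<integral>x. H i x \<partial>om) \<in> borel_measurable P" "H i \<in> borel_measurable \<nu>" using H i by (auto intro: integral_configuration_measurable)
show "(%p. (\<lambda>i\<in>{..<n}. \<integral>x. H i x \<partial>snd p) i + H i (fst p)) \<in> measurable (\<nu> \<Otimes>\<^sub>M P) lborel" using i by simp
qed

text \<open>Dominated convergence in \<open>mecke_simple\<close>: the majorant is N(W), with mean
  \<nu>(W), on the left and the indicator of W on the right. The statistics converge pointwise,
  whence the continuity of \<open>phi\<close>.\<close>

lemma mecke_continuous:
fixes f :: "nat => 'a => real" and phi :: "(nat => real) => real"
assumes f: "!!i. i < n ==> f i \<in> borel_measurable \<nu>" "!!i. i < n ==> integrable \<nu> (%x. (f i x)^2)"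
 and fN: "!!i. i < n ==> AE om in P. integrable om (f i)"
 and W: "W \<in> sets \<nu>" "emeasure \<nu> W < \<infinity>"
 and phi: "phi \<in> borel_measurable (Leb n)" "!!y. 0 <= phi y" "!!y. phi y <= 1"
 and cont: "!!y z. (!!i. i < n ==> (%k. y k i) ---> z i) ==> (%k. phi (y k)) ---> phi z"
shows "(nn_integral P (%om. ennreal (phi (stat n f om)) * emeasure om W))
 = (nn_integral \<nu> (%x. (nn_integral P (%om. ennreal (phi (shift n (stat n f om) f x)))) * indicator W x))"
proof -
define Q where "Q i F \<longleftrightarrow> (ALL k. simple_function \<nu> (F k)) \<and> (ALL k. emeasure \<nu> {x\<in>space \<nu>. F k x ~= 0} < \<infinity>)
  \<and> (\<forall>x\<in>space \<nu>. (%k. F k x) ---> f i x) \<and> (ALL k. \<forall>x\<in>space \<nu>. \<bar>F k x\<bar> <= 2 * \<bar>f i x\<bar>)" for i F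
have "EX F. i < n --> Q i F" for i
proof (cases "i < n")
 case True
 obtain F where "!!k. simple_function \<nu> (F k)" "!!k. emeasure \<nu> {x\<in>space \<nu>. F k x ~= 0} < \<infinity>"
  "!!x. x \<in> space \<nu> ==> (%k. F k x) ---> f i x" "!!k x. x \<in> space \<nu> ==> \<bar>F k x\<bar> <= 2 * \<bar>f i x\<bar>" by (rule simple_approximation[OF f(1)[OF True] f(2)[OF True]]) (rule that; assumption)
 then have "Q i F" unfolding Q_def by auto
 then show ?thesis by blast
qed simp
then obtain G where Q: "!!i. i < n ==> Q i (G i)" by metis
have G: "!!i k. i < n ==> simple_function \<nu> (G i k)" "!!i k. i < n ==> emeasure \<nu> {x\<in>space \<nu>. G i k x ~= 0} < \<infinity>"
 "!!i x. i < n ==> x \<in> space \<nu> ==> (%k. G i k x) ---> f i x" "!!i k x. i < n ==> x \<in> space \<nu> ==> \<bar>G i k x\<bar> <= 2 * \<bar>f i x\<bar>" using Q unfolding Q_def by auto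
define F where "F k i = G i k" for k i
have Fm: "F k i \<in> borel_measurable \<nu>" if "i < n" for k i unfolding F_def by (rule borel_measurable_simple_function[OF G(1)[OF that]])
have Ym: "stat n (F k) \<in> measurable P (Leb n)" "stat n f \<in> measurable P (Leb n)" for k using Fm f(1) by (auto intro!: stat_measurable)
have Ylim: "AE om in P. om \<in> space P \<and> (ALL i<n. (%k. stat n (F k) om i) ---> stat n f om i)"
proof -
 have "AE om in P. \<forall>i\<in>{..<n}. integrable om (f i)" using fN by (intro AE_ball_countable') auto
 then show ?thesis using AE_space
 proof eventually_elim
  case (elim om)
  have "(%k. \<integral>x. G i k x \<partial>om) ---> (LINT x|om. f i x)" if i: "i < n" for i
  proof (rule integral_dominated_convergence[where w = "%x. 2 * \<bar>f i x\<bar>"])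
   show "integrable om (%x. 2 * \<bar>f i x\<bar>)" using elim i by auto
   show "f i \<in> borel_measurable om" "G i k \<in> borel_measurable om" for k using f(1)[OF i] borel_measurable_simple_function[OF G(1)[OF i]] by (auto intro: measurable_configuration[OF elim(2)])
   show "AE x in om. (%k. G i k x) ---> f i x" "AE x in om. norm (G i k x) <= 2 * \<bar>f i x\<bar>" for k using G(3,4)[OF i] by (auto intro!: AE_I2 simp: space_configuration[OF elim(2)])
  qed
  then show ?case using elim(2) by (simp add: stat_def F_def)
 qed
qed
have L: "(%k. \<integral>\<^sup>+om. ennreal (phi (stat n (F k) om)) * emeasure om W \<partial>P) ---> (nn_integral P (%om. ennreal (phi (stat n f om)) * emeasure om W))"
proof (rule nn_integral_dominated_convergence[where w = "%om. emeasure om W"])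
 have Wm: "(%om. emeasure om W) \<in> borel_measurable P" by (rule count_measurable[OF W(1)])
 then show "(%om. emeasure om W) \<in> borel_measurable P" .
 show "(%om. ennreal (phi (stat n (F k) om)) * emeasure om W) \<in> borel_measurable P"
  "(%om. ennreal (phi (stat n f om)) * emeasure om W) \<in> borel_measurable P" for k using measurable_compose[OF Ym(1) phi(1)] measurable_compose[OF Ym(2) phi(1)] Wm by auto
 show "(nn_integral P (%om. emeasure om W)) < \<infinity>" using count_expectation[OF W] W(2) by simp
 show "AE om in P. ennreal (phi (stat n (F k) om)) * emeasure om W <= emeasure om W" for k
 proof (rule AE_I2)
  fix om
  have "ennreal (phi (stat n (F k) om)) <= 1" using phi(3) by simp
  from mult_right_mono[OF this] show "ennreal (phi (stat n (F k) om)) * emeasure om W <= emeasure om W" by simp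
 qed
 show "AE om in P. (%k. ennreal (phi (stat n (F k) om)) * emeasure om W) ---> ennreal (phi (stat n f om)) * emeasure om W" using Ylim count_AE_finite[OF W]
 proof eventually_elim
  case (elim om)
  then have "(%k. ennreal (phi (stat n (F k) om))) ---> ennreal (phi (stat n f om))" by (intro tendsto_ennrealI cont) auto
  from ennreal_tendsto_cmult[OF _ this, of "emeasure om W"] show ?case using elim(2) by (simp add: mult.commute)
 qed
qed
define K where "K k x = (nn_integral P (%om. ennreal (phi (shift n (stat n (F k) om) (F k) x))))" for k x
define K0 where "K0 x = (nn_integral P (%om. ennreal (phi (shift n (stat n f om) f x))))" for x
have Km: "(%x. \<integral>\<^sup>+om. ennreal (phi (shift n (stat n H om) H x)) \<partial>P) \<in> borel_measurable \<nu>" if H: "!!i. i < n ==> H i \<in> borel_measurable \<nu>" for H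
proof -
 have "(%p. ennreal (phi (shift n (stat n H (snd p)) H (fst p)))) \<in> borel_measurable (\<nu> \<Otimes>\<^sub>M P)" using measurable_compose[OF shift_measurable[OF H] phi(1)] by simp
 then have "(%(x, om). ennreal (phi (shift n (stat n H om) H x))) \<in> borel_measurable (\<nu> \<Otimes>\<^sub>M P)" by (simp add: split_beta)
 from borel_measurable_nn_integral_fst[OF this] show ?thesis by simp
qed
have pm: "(%om. ennreal (phi (shift n (stat n H om) H x))) \<in> borel_measurable P" if H: "!!i. i < n ==> H i \<in> borel_measurable \<nu>" and x: "x \<in> space \<nu>" for H x using measurable_compose[OF measurable_compose[OF measurable_Pair1'[OF x, of P] shift_measurable[OF H]] phi(1)] by simp
have K_le: "K k x <= 1" for k x
proof -
 have "K k x <= (nn_integral P (%om. 1))" unfolding K_def using phi(3) by (intro nn_integral_mono) simp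
 then show ?thesis by (simp add: emeasure_space_1)
qed
have Klim: "(%k. K k x) ---> K0 x" if x: "x \<in> space \<nu>" for x unfolding K_def K0_def
proof (rule nn_integral_dominated_convergence[where w = "%_. 1"])
 show "AE om in P. (%k. ennreal (phi (shift n (stat n (F k) om) (F k) x))) ---> ennreal (phi (shift n (stat n f om) f x))" using Ylim
 proof eventually_elim
  case (elim om)
  show ?case
  proof (intro tendsto_ennrealI cont)
   fix i assume i: "i < n"
   have "(%k. stat n (F k) om i + F k i x) ---> stat n f om i + f i x" using elim i G(3)[OF i x] by (intro tendsto_add) (auto simp: F_def)
   then show "(%k. shift n (stat n (F k) om) (F k) x i) ---> shift n (stat n f om) f x i" using i by (simp add: shift_def)
  qed
 qed
qed (use pm[OF Fm x] pm[OF f(1) x] phi(3) in \<open>auto simp: emeasure_space_1\<close>)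
have R: "(%k. \<integral>\<^sup>+x. K k x * indicator W x \<partial>\<nu>) ---> (nn_integral \<nu> (%x. K0 x * indicator W x))"
proof (rule nn_integral_dominated_convergence[where w = "indicator W"])
 have [measurable]: "K k \<in> borel_measurable \<nu>" "K0 \<in> borel_measurable \<nu>" "W \<in> sets \<nu>" for k using Km[OF Fm] Km[OF f(1)] W(1) by (auto simp: K_def[abs_def] K0_def[abs_def])
 show "(%x. K k x * indicator W x) \<in> borel_measurable \<nu>" "(%x. K0 x * indicator W x) \<in> borel_measurable \<nu>" "indicator W \<in> borel_measurable \<nu>" for k by measurable
 show "(nn_integral \<nu> (%x. indicator W x)) < \<infinity>" using W by simp
 show "AE x in \<nu>. K k x * indicator W x <= indicator W x" for k using K_le[of k] by (intro AE_I2) (auto simp: indicator_def)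
 show "AE x in \<nu>. (%k. K k x * indicator W x) ---> K0 x * indicator W x"
 proof (rule AE_I2)
  fix x assume "x \<in> space \<nu>"
  from Klim[OF this] show "(%k. K k x * indicator W x) ---> K0 x * indicator W x" by (cases "x \<in> W") auto
 qed
qed
have "(nn_integral P (%om. ennreal (phi (stat n (F k) om)) * emeasure om W)) = (nn_integral \<nu> (%x. K k x * indicator W x))" for k unfolding K_def by (rule mecke_simple[OF _ _ W]) (use G(1,2) phi(1) in \<open>auto simp: F_def\<close>)
with L have "(%k. \<integral>\<^sup>+x. K k x * indicator W x \<partial>\<nu>) ---> (nn_integral P (%om. ennreal (phi (stat n f om)) * emeasure om W))" by simp
from LIMSEQ_unique[OF this R] show ?thesis unfolding K0_def .
qed

end

definition lower_box :: "nat => (nat => real) => (nat => real) set" where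
"lower_box n a = PiE {..<n} (%i. {..a i})"

lemma lower_box_iff: "y \<in> lower_box n a \<longleftrightarrow> y \<in> extensional {..<n} \<and> (\<forall>i\<in>{..<n}. y i <= a i)" by (simp only: lower_box_def PiE_iff atMost_iff) blast

text \<open>Continuous functions decreasing with r to the indicator of \<open>lower_box n a\<close>;
  they carry Mecke's formula over from continuous to measurable functions.\<close>

definition ramp :: "nat => (nat => real) => nat => (nat => real) => real" where
"ramp n a r y = (\<Prod>i<n. max 0 (min 1 (1 - real r * (y i - a i))))"

lemma ramp_bounds: "0 <= ramp n a r y" "ramp n a r y <= 1" unfolding ramp_def by (intro prod_nonneg prod_le_1; simp)+

lemma ramp_measurable: "ramp n a r \<in> borel_measurable (Leb n)" unfolding ramp_def[abs_def] by (intro borel_measurable_prod) measurable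

lemma ramp_tendsto:
assumes y: "y \<in> extensional {..<n}"
shows "(%r. ramp n a r y) ---> indicator (lower_box n a) y"
proof -
have "(%r. max 0 (min 1 (1 - real r * (y i - a i)))) ---> (if y i <= a i then 1 else 0)" for i
proof (cases "y i <= a i")
 case True
 then have "real r * (y i - a i) <= 0" for r by (intro mult_nonneg_nonpos) auto
 then have "max 0 (min 1 (1 - real r * (y i - a i))) = 1" for r by (smt (verit))
 then show ?thesis using True by simp
next
 case False
 then have "y i - a i > 0" by simp
 then have "eventually (%r. max 0 (min 1 (1 - real r * (y i - a i))) = 0) sequentially"
 proof -
  obtain R where R: "1 / (y i - a i) < real R" using reals_Archimedean2 by blast
  have "max 0 (min 1 (1 - real r * (y i - a i))) = 0" if "r >= R" for r
  proof -
   have "1 / (y i - a i) <= real r" using R that by linarith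
   then have "1 <= real r * (y i - a i)" using \<open>y i - a i > 0\<close> by (simp add: divide_le_eq)
   then show ?thesis by simp
  qed
  then show ?thesis by (auto simp: eventually_sequentially)
 qed
 then show ?thesis using False by (simp add: tendsto_eventually)
qed
then have "(%r. ramp n a r y) ---> (\<Prod>i<n. if y i <= a i then 1 else 0)" unfolding ramp_def by (intro tendsto_prod)
moreover have "(\<Prod>i<n. if y i <= a i then 1 else 0) = (indicator (lower_box n a) y :: real)"
proof (cases "ALL i<n. y i <= a i")
 case True
 then show ?thesis using y by (simp add: lower_box_def PiE_iff indicator_def)
next
 case False
 then obtain i where "i < n" "\<not> y i <= a i" by blast
 then have "(\<Prod>i<n. if y i <= a i then 1 else 0) = (0::real)" by (intro prod_zero) auto
 moreover have "y \<notin> lower_box n a" using False by (auto simp: lower_box_def PiE_iff)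
 ultimately show ?thesis by simp
qed
ultimately show ?thesis by simp
qed

lemma lower_box_sets: "lower_box n a \<in> sets (Leb n)" unfolding lower_box_def by (intro sets_PiM_I_finite) auto

lemma Leb_generated: "sets (Leb n) = sigma_sets (space (Leb n)) (range (lower_box n))"
proof -
let ?P = "{{f\<in>PiE {..<n} (%_. UNIV). \<forall>i\<in>j. f i \<in> A i} | A j. j \<in> {{..<n}} \<and> A \<in> Pi j (%_. range (atMost :: real => _))}"
have "sets (Leb n) = sets (PiM {..<n} (%_. sigma UNIV (range (atMost :: real => _))))" by (rule sets_PiM_cong) (simp_all add: borel_eq_atMost[symmetric])
also have "... = sets (sigma (PiE {..<n} (%_. UNIV)) ?P)"
proof (rule sets_PiM_sigma)
 show "\<exists>S\<subseteq>range (atMost :: real => _). countable S \<and> UNIV = \<Union>S" for i :: nat using real_arch_simple by (intro exI[of _ "range (%k. {..real k})"]) auto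
qed auto
also have "... = sigma_sets (space (Leb n)) ?P" by (subst sets_measure_of) (auto simp: space_PiM)
also have "?P = range (lower_box n)"
proof (intro subset_antisym subsetI)
 fix X assume "X \<in> ?P"
 then obtain j A where j: "X = {f\<in>PiE {..<n} (%_. UNIV). \<forall>i\<in>j. f i \<in> A i}" "j \<in> {{..<n}}" "A \<in> Pi j (%_. range (atMost :: real => _))" by (elim CollectE exE conjE)
 have jn: "j = {..<n}" using j(2) by simp
 have "\<forall>i\<in>{..<n}. EX a. A i = {..a}" using j(3) unfolding jn Pi_iff by (meson rangeE)
 from bchoice[OF this] obtain a where a: "\<forall>i\<in>{..<n}. A i = {..a i}" by (elim exE)
 have "X = lower_box n a"
 proof (rule Set.set_eqI)
  fix y
  show "y \<in> X \<longleftrightarrow> y \<in> lower_box n a" unfolding j(1) jn lower_box_iff using a by (simp add: PiE_iff)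
 qed
 then show "X \<in> range (lower_box n)" by (simp only: rangeI)
next
 fix X assume "X \<in> range (lower_box n)"
 then obtain a where a: "X = lower_box n a" by (elim rangeE)
 have X: "X = {f\<in>PiE {..<n} (%_. UNIV). \<forall>i\<in>{..<n}. f i \<in> {..a i}}"
 proof (rule Set.set_eqI)
  fix y
  show "y \<in> X \<longleftrightarrow> y \<in> {f\<in>PiE {..<n} (%_. UNIV). \<forall>i\<in>{..<n}. f i \<in> {..a i}}" unfolding a lower_box_iff by (simp add: PiE_iff)
 qed
 have "(%i. {..a i}) \<in> Pi {..<n} (%_. range (atMost :: real => _))" by simp
 with X show "X \<in> ?P" by (intro CollectI exI[of _ "%i. {..a i}"] exI[of _ "{..<n}"] conjI) simp_all
qed
finally show ?thesis .
qed

text \<open>In the limit the ramps give the masses of the lower boxes, which form an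
  intersection-stable generator.\<close>

lemma measure_eqI_ramp:
assumes M: "sets M = sets (Leb n)" "finite_measure M" and N: "sets N = sets (Leb n)" "finite_measure N"
 and eq: "!!a r. (nn_integral M (%y. ennreal (ramp n a r y))) = (nn_integral N (%y. ennreal (ramp n a r y)))"
shows "M = N"
proof -
interpret M: finite_measure M by fact
interpret N: finite_measure N by fact
have lim: "(%r. \<integral>\<^sup>+y. ennreal (ramp n a r y) \<partial>K) ---> emeasure K (lower_box n a)" if K: "sets K = sets (Leb n)" "finite_measure K" for K a
proof -
 interpret K: finite_measure K by fact
 have sp: "space K = space (Leb n)" by (rule sets_eq_imp_space_eq[OF K(1)])
 have rm [measurable]: "ramp n a r \<in> borel_measurable K" for r using ramp_measurable by (simp add: measurable_cong_sets[OF K(1) refl])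
 have bm: "lower_box n a \<in> sets K" using lower_box_sets K(1) by simp
 have "(%r. \<integral>\<^sup>+y. ennreal (ramp n a r y) \<partial>K) ---> (nn_integral K (%y. ennreal (indicator (lower_box n a) y)))"
 proof (rule nn_integral_dominated_convergence[where w = "%_. 1"])
  show "AE y in K. (%r. ennreal (ramp n a r y)) ---> ennreal (indicator (lower_box n a) y)" by (intro AE_I2 tendsto_ennrealI ramp_tendsto) (simp add: sp space_PiM PiE_iff)
  show "AE y in K. ennreal (ramp n a r y) <= 1" for r using ramp_bounds by (intro AE_I2) simp
  show "(nn_integral K (%y. 1)) < \<infinity>" by (simp add: less_top[symmetric])
 qed (use bm in measurable)
 moreover have "(nn_integral K (%y. ennreal (indicator (lower_box n a) y))) = emeasure K (lower_box n a)" using bm by (simp add: ennreal_indicator)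
 ultimately show ?thesis by simp
qed
show ?thesis
proof (rule measure_eqI_generator_eq)
 show "Int_stable (range (lower_box n))"
 proof (rule Int_stableI)
  fix X Y assume "X \<in> range (lower_box n)" "Y \<in> range (lower_box n)"
  then obtain a b where ab: "X = lower_box n a" "Y = lower_box n b" by (elim rangeE)
  have "X \<inter> Y = lower_box n (%i. min (a i) (b i))"
  proof (rule Set.set_eqI)
   fix y show "y \<in> X \<inter> Y \<longleftrightarrow> y \<in> lower_box n (%i. min (a i) (b i))" unfolding ab Int_iff lower_box_iff min.bounded_iff by meson
  qed
  then show "X \<inter> Y \<in> range (lower_box n)" by (simp only: rangeI)
 qed
 show "range (lower_box n) \<subseteq> Pow (space (Leb n))" using lower_box_sets sets.sets_into_space by blast
 show "sets M = sigma_sets (space (Leb n)) (range (lower_box n))" "sets N = sigma_sets (space (Leb n)) (range (lower_box n))" using M N Leb_generated by simp_all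
 show "emeasure M X = emeasure N X" if X: "X \<in> range (lower_box n)" for X
 proof -
  from X obtain a where "X = lower_box n a" by (elim rangeE)
  then show ?thesis using LIMSEQ_unique[OF lim[OF M] lim[OF N, unfolded eq[symmetric]]] by simp
 qed
 show "range (%k. lower_box n (%_. real k)) \<subseteq> range (lower_box n)" by blast
 show "emeasure M (lower_box n (%_. real k)) ~= \<infinity>" for k by simp
 show "(\<Union>k. lower_box n (%_. real k)) = space (Leb n)"
 proof (intro subset_antisym subsetI)
  fix y assume y: "y \<in> space (Leb n)"
  obtain k where k: "(\<Sum>i<n. \<bar>y i\<bar>) <= real k" using real_arch_simple by blast
  have "y i <= real k" if "i < n" for i
  proof -
   have "\<bar>y i\<bar> <= (\<Sum>i<n. \<bar>y i\<bar>)" using that by (intro member_le_sum) auto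
   then show ?thesis using k by linarith
  qed
  then show "y \<in> (\<Union>k. lower_box n (%_. real k))" using y by (intro UN_I[of k]) (simp_all add: lower_box_iff space_PiM PiE_iff)
 qed (use lower_box_sets sets.sets_into_space in blast)
qed
qed

context poisson_measure
begin

text \<open>The Mecke formula for the counting weight \<open>N(W)\<close>.\<close>

lemma mecke:
fixes f :: "nat => 'a => real"
assumes f: "!!i. i < n ==> f i \<in> borel_measurable \<nu>" "!!i. i < n ==> integrable \<nu> (%x. (f i x)^2)"
 and fN: "!!i. i < n ==> AE om in P. integrable om (f i)"
 and W: "W \<in> sets \<nu>" "emeasure \<nu> W < \<infinity>" and g: "g \<in> borel_measurable (Leb n)"
shows "(nn_integral P (%om. g (stat n f om) * emeasure om W)) = (nn_integral \<nu> (%x. (nn_integral P (%om. g (shift n (stat n f om) f x))) * indicator W x))"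
proof -
have Ym: "stat n f \<in> measurable P (Leb n)" by (intro stat_measurable f(1))
have Wm: "(%om. emeasure om W) \<in> borel_measurable P" by (rule count_measurable[OF W(1)])
have [measurable]: "W \<in> sets \<nu>" by (rule W(1))
let ?s = "%p. shift n (stat n f (snd p)) f (fst p)"
have sm: "?s \<in> measurable (\<nu> \<Otimes>\<^sub>M P) (Leb n)" by (rule shift_measurable[OF f(1)])
\<comment> \<open>Both sides of the formula are integrals of g against measures of mass \<nu>(W). It
  suffices that the two measures coincide, and this can be tested with continuous functions.\<close>
define \<mu>1 where "\<mu>1 = distr (density P (%om. emeasure om W)) (Leb n) (stat n f)"
define \<mu>2 where "\<mu>2 = distr (density (\<nu> \<Otimes>\<^sub>M P) (%p. indicator W (fst p))) (Leb n) ?s"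
have i1: "(nn_integral \<mu>1 (%y. g y)) = (nn_integral P (%om. g (stat n f om) * emeasure om W))" if g: "g \<in> borel_measurable (Leb n)" for g
proof -
 have "(nn_integral \<mu>1 (%y. g y)) = (nn_integral (density P (%om. emeasure om W)) (%om. g (stat n f om)))" unfolding \<mu>1_def using Ym g by (intro nn_integral_distr) auto
 also have "... = (nn_integral P (%om. emeasure om W * g (stat n f om)))" by (rule nn_integral_density[OF Wm measurable_compose[OF Ym g]])
 finally show ?thesis by (simp add: mult.commute)
qed
have i2: "(nn_integral \<mu>2 (%y. g y)) = (nn_integral \<nu> (%x. (nn_integral P (%om. g (shift n (stat n f om) f x))) * indicator W x))" if g: "g \<in> borel_measurable (Leb n)" for g
proof -
 have gs: "(%p. g (?s p)) \<in> borel_measurable (\<nu> \<Otimes>\<^sub>M P)" by (rule measurable_compose[OF sm g])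
 have "(nn_integral \<mu>2 (%y. g y)) = (nn_integral (density (\<nu> \<Otimes>\<^sub>M P) (%p. indicator W (fst p))) (%p. g (?s p)))" unfolding \<mu>2_def using sm g by (intro nn_integral_distr) auto
 also have "... = (nn_integral (\<nu> \<Otimes>\<^sub>M P) (%p. indicator W (fst p) * g (?s p)))" by (rule nn_integral_density[OF _ gs]) measurable
 also have "... = (nn_integral \<nu> (%x. \<integral>\<^sup>+om. indicator W (fst (x, om)) * g (?s (x, om)) \<partial>P))" by (rule nn_integral_fst[symmetric]) (use gs in measurable)
 also have "... = (nn_integral \<nu> (%x. (nn_integral P (%om. g (shift n (stat n f om) f x))) * indicator W x))" by (intro nn_integral_cong) (auto simp: indicator_def)
 finally show ?thesis .
qed
have fin1: "finite_measure \<mu>1"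
proof (rule finite_measureI)
 have "emeasure \<mu>1 (space \<mu>1) = (nn_integral \<mu>1 (%y. 1))" by simp
 also have "... = emeasure \<nu> W" using i1[of "%_. 1"] count_expectation[OF W] by simp
 finally show "emeasure \<mu>1 (space \<mu>1) ~= \<infinity>" using W(2) by simp
qed
have fin2: "finite_measure \<mu>2"
proof (rule finite_measureI)
 have "emeasure \<mu>2 (space \<mu>2) = (nn_integral \<mu>2 (%y. 1))" by simp
 also have "... = emeasure \<nu> W" using i2[of "%_. 1"] W by (simp add: emeasure_space_1)
 finally show "emeasure \<mu>2 (space \<mu>2) ~= \<infinity>" using W(2) by simp
qed
have "\<mu>1 = \<mu>2"
proof (rule measure_eqI_ramp[OF _ fin1 _ fin2])
 fix a r
 have cont: "(%k. ramp n a r (y k)) ---> ramp n a r z" if "!!i. i < n ==> (%k. y k i) ---> z i" for y z unfolding ramp_def using that by (intro tendsto_prod tendsto_max tendsto_min tendsto_diff tendsto_mult tendsto_const) auto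
 have rm: "(%y. ennreal (ramp n a r y)) \<in> borel_measurable (Leb n)" using ramp_measurable by simp
 show "(nn_integral \<mu>1 (%y. ennreal (ramp n a r y))) = (nn_integral \<mu>2 (%y. ennreal (ramp n a r y)))" unfolding i1[OF rm] i2[OF rm] by (rule mecke_continuous[OF f fN W ramp_measurable ramp_bounds cont])
qed (simp_all add: \<mu>1_def \<mu>2_def)
then show ?thesis using i1[OF g] i2[OF g] by simp
qed

lemma count_zero_prob:
assumes "A \<in> sets \<nu>" "emeasure \<nu> A < \<infinity>"
shows "prob {om \<in> space P. emeasure om A = 0} = exp (- measure \<nu> A)" using count_prob[OF assms, of 0] by simp

end

section \<open>Power sums of the shifted values\<close>

definition power_sums :: "nat => (nat => real) => nat => real" where
"power_sums n y = (\<lambda>k\<in>{..<n}. \<Sum>j<n. y j ^ (k + 1))"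

lemma power_sums_measurable: "power_sums n \<in> measurable (Leb n) (Leb n)" unfolding power_sums_def[abs_def] by (intro measurable_restrict) simp

text \<open>A nonzero vector in the kernel would be the coefficient vector of a nonzero polynomial of
degree less than \<open>n\<close> with the \<open>n\<close> roots \<open>a i\<close>.\<close>

lemma power_sums_jacobian_nonzero:
fixes a :: "nat => real"
assumes inj: "inj_on a {..<n}"
shows "Determinant.det (Matrix.mat n n (%(k, i). real (k + 1) * a i ^ k)) ~= 0"
proof
let ?J = "Matrix.mat n n (%(k, i). real (k + 1) * a i ^ k)"
assume "Determinant.det ?J = 0"
then have "Determinant.det (transpose_mat ?J) = 0" by (subst det_transpose[of _ n]) auto
moreover have "transpose_mat ?J \<in> carrier_mat n n" by simp
ultimately obtain v where v: "v \<in> carrier_vec n" "v ~= 0\<^sub>v n" "transpose_mat ?J *\<^sub>v v = 0\<^sub>v n" using det_0_iff_vec_prod_zero[of "transpose_mat ?J" n] by blast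
define p where "p = (\<Sum>k<n. monom (real (k + 1) * v $ k) k)"
have coeff: "coeff p k = real (k + 1) * v $ k" if "k < n" for k using that by (simp add: p_def coeff_sum)
have deg: "degree p <= n - 1" if "n > 0" unfolding p_def by (intro degree_sum_le) (auto intro: order_trans[OF degree_monom_le])
obtain k where k: "k < n" "v $ k ~= 0" using v(1,2) by (metis carrier_vecD eq_vecI index_zero_vec(1) index_zero_vec(2))
have "p ~= 0" using coeff[OF k(1)] k(2) by (metis coeff_0 mult_eq_0_iff of_nat_eq_0_iff add_is_0 one_neq_zero)
have root: "poly p (a i) = 0" if i: "i < n" for i
proof -
 have "(transpose_mat ?J *\<^sub>v v) $ i = (\<Sum>k<n. real (k + 1) * a i ^ k * v $ k)" using i v(1) by (simp add: scalar_prod_def lessThan_atLeast0)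
 then have "(\<Sum>k<n. real (k + 1) * a i ^ k * v $ k) = 0\<^sub>v n $ i" unfolding v(3) by (rule sym)
 then have "(\<Sum>k<n. real (k + 1) * a i ^ k * v $ k) = 0" using i by (simp only: index_zero_vec)
 then show ?thesis by (simp add: p_def poly_sum poly_monom mult_ac)
qed
have "card (a ` {..<n}) <= card {x. poly p x = 0}" using poly_roots_finite[OF \<open>p ~= 0\<close>] root by (intro card_mono) auto
also have "... <= degree p" by (rule card_poly_roots_bound[OF \<open>p ~= 0\<close>])
also have "... <= n - 1" using k(1) by (intro deg) auto
finally show False using k(1) inj by (simp add: card_image)
qed

lemma det_congruence:
fixes G :: "nat => nat => real"
shows "Determinant.det (Matrix.mat n n (%(k, l). \<Sum>i<n. \<Sum>j<n. J k i * (J l j * G i j)))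
 = (Determinant.det (Matrix.mat n n (%(k, i). J k i)))^2 * Determinant.det (Matrix.mat n n (%(i, j). G i j))"
proof -
let ?J = "Matrix.mat n n (%(k, i). J k i)" and ?G = "Matrix.mat n n (%(i, j). G i j)"
have "Matrix.mat n n (%(k, l). \<Sum>i<n. \<Sum>j<n. J k i * (J l j * G i j)) = ?J * (?G * transpose_mat ?J)" by (intro eq_matI) (auto simp: scalar_prod_def lessThan_atLeast0 sum_distrib_left mult_ac)
also have "Determinant.det ... = Determinant.det ?J * Determinant.det (?G * transpose_mat ?J)" by (rule det_mult[of _ n]) auto
also have "Determinant.det (?G * transpose_mat ?J) = Determinant.det ?G * Determinant.det (transpose_mat ?J)" by (rule det_mult[of _ n]) auto
also have "Determinant.det (transpose_mat ?J) = Determinant.det ?J" by (rule det_transpose[of _ n]) auto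
finally show ?thesis by (simp add: power2_eq_square mult_ac)
qed

text \<open>As before, a translation is written as two reflections.\<close>

lemma translation_null_set:
assumes C: "C \<in> null_sets (Leb n)"
shows "{z\<in>space (Leb n). (\<lambda>i\<in>{..<n}. z i + c i) \<in> C} \<in> null_sets (Leb n)"
proof -
let ?L = "Leb n"
have refl_null: "{z\<in>space ?L. dif n x z \<in> C} \<in> null_sets ?L" if C: "C \<in> null_sets ?L" and x: "x \<in> space ?L" for C x
proof -
 have m: "dif n x \<in> measurable ?L ?L" by (intro dif_measurable measurable_const x measurable_ident_sets refl)
 have eq: "{z\<in>space ?L. dif n x z \<in> C} = dif n x -` C \<inter> space ?L" by auto
 have "emeasure ?L (dif n x -` C \<inter> space ?L) = emeasure (distr ?L ?L (dif n x)) C" using C by (intro emeasure_distr[symmetric] m) auto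
 also have "... = 0" unfolding distr_dif_left[OF x] by (rule null_setsD1[OF C])
 finally show ?thesis unfolding eq using measurable_sets[OF m] C by (intro null_setsI) auto
qed
let ?c = "\<lambda>i\<in>{..<n}. c i" and ?o = "\<lambda>i\<in>{..<n}. 0 :: real"
have sp: "?c \<in> space ?L" "?o \<in> space ?L" by (simp_all add: space_PiM)
from refl_null[OF refl_null[OF C sp(1)] sp(2)]
have "{z\<in>space ?L. dif n ?o z \<in> {z\<in>space ?L. dif n ?c z \<in> C}} \<in> null_sets ?L" .
moreover have "dif n ?o z \<in> space ?L" "dif n ?c (dif n ?o z) = (\<lambda>i\<in>{..<n}. z i + c i)" for z by (auto simp: dif_def space_PiM fun_eq_iff)
ultimately show ?thesis by simp
qed

context dirichlet_structure
begin

text \<open>Where two shifted values agree, the point lies on a level set of f i - f j. There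
  \<open>gam_level_set\<close> makes \<gamma>(f i - f j, f k) vanish for all k, so two rows of the
  Gram matrix coincide. Hence the degeneracy of the Jacobian of the power sums is harmless.\<close>

lemma gram_det_equal_values:
assumes f: "!!j. j < n ==> f j \<in> D"
shows "AE x in M. \<not> inj_on (%j. y j + f j x) {..<n} --> gram_det gam n f x = 0"
proof -
have "AE x in M. \<forall>i\<in>{..<n}. \<forall>j\<in>{..<n}. \<forall>k\<in>{..<n}. f i x - f j x = y j - y i --> gam (f i) (f k) x = gam (f j) (f k) x"
proof (intro AE_ball_countable' countable_finite finite_lessThan)
 fix i j k assume "i \<in> {..<n}" "j \<in> {..<n}" "k \<in> {..<n}"
 then have fD: "f i \<in> D" "f j \<in> D" "f k \<in> D" using f by auto
 show "AE x in M. f i x - f j x = y j - y i --> gam (f i) (f k) x = gam (f j) (f k) x" using gam_level_set[OF D_diff[OF fD(1,2)] fD(3), of "y j - y i"] gam_diff[OF fD] by eventually_elim auto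
qed
then show ?thesis
proof eventually_elim
 case (elim x)
 show ?case
 proof
  assume "\<not> inj_on (%j. y j + f j x) {..<n}"
  then obtain i j where ij: "i < n" "j < n" "i ~= j" "y i + f i x = y j + f j x" by (auto simp: inj_on_def)
  let ?G = "Matrix.mat n n (%(i, j). gam (f i) (f j) x)"
  have "f i x - f j x = y j - y i" using ij(4) by linarith
  then have "gam (f i) (f k) x = gam (f j) (f k) x" if "k < n" for k using elim ij(1,2) that by blast
  then have "Matrix.row ?G i = Matrix.row ?G j" using ij by (intro eq_vecI) auto
  then have "Determinant.det ?G = 0" using ij by (intro det_identical_rows[of _ n i j]) auto
  then show "gram_det gam n f x = 0" by (simp add: gram_det_def)
 qed
qed
qed

text \<open>The energy image density property is applied to the power sums as functions of the added
  particle. By the chain rule their Gram matrix is congruent to that of f through the Jacobian of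
  the power sums, which is invertible where the shifted values are distinct.\<close>

lemma power_sums_shift:
assumes n: "n >= 1" and f: "!!j. j < n ==> f j \<in> D" and C: "C \<in> null_sets (Leb n)"
shows "AE x in M. power_sums n (%j. y j + f j x) \<in> C --> gram_det gam n f x = 0"
proof -
define p where "p k j = [:y j, 1:] ^ (k + 1)" for k j
have poly_p: "poly (p k j) t = (y j + t) ^ (k + 1)" for k j t by (simp only: p_def poly_power poly_pCons poly_0 mult_1_right mult_zero_right add_0_right)
have poly_p': "poly (pderiv (p k j)) t = real (k + 1) * (y j + t) ^ k" for k j t by (simp add: p_def pderiv_power_Suc pderiv_pCons del: power_Suc of_nat_Suc)
\<comment> \<open>The functions F k below belong to the domain after removal of their constant
  terms; C is translated by these constants.\<close>
define C' where "C' = {z\<in>space (Leb n). (\<lambda>k\<in>{..<n}. z k + (\<Sum>j<n. y j ^ (k + 1))) \<in> C}"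
have C': "C' \<in> null_sets (Leb n)" unfolding C'_def by (rule translation_null_set[OF C])
have m: "AE x in M. (ALL j<n. \<bar>f j x\<bar> <= real m) --> power_sums n (%j. y j + f j x) \<in> C --> gram_det gam n f x = 0" for m
proof -
 \<comment> \<open>Truncation makes the functions bounded; where all |f j| \<le> m it changes
   neither the values nor \<gamma>. Letting m grow exhausts the space.\<close>
 define h where "h j = trunc (real m) (f j)" for j
 have hD: "h j \<in> D" and hb: "EX C. ALL x. \<bar>h j x\<bar> <= C" and heq: "\<bar>f j x\<bar> <= real m ==> h j x = f j x"
  and hgam: "!!g. g \<in> D ==> AE x in M. \<bar>f j x\<bar> <= real m --> gam (h j) g x = gam (f j) g x" if "j < n" for j x unfolding h_def using trunc[OF f[OF that], of "real m"] by auto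
 define F where "F k x = (\<Sum>j<n. poly (p k j) (h j x) - poly (p k j) 0)" for k x
 have PD: "(%x. poly (p k j) (h j x) - poly (p k j) 0) \<in> D" if "j < n" for k j by (rule poly_chain[OF hD[OF that] hb[OF that]])
 have FD: "F k \<in> D" for k unfolding F_def[abs_def] by (intro D_sum PD) auto
 have Fb: "EX C. ALL x. \<bar>F k x\<bar> <= C" for k unfolding F_def[abs_def]
 proof (intro bounded_sum finite_lessThan)
  fix j assume "j \<in> {..<n}"
  then obtain R where R: "R > 0" "!!x. \<bar>h j x\<bar> <= R" using bounded_pos[OF hb, of j] by auto
  have "continuous_on {- R..R} (poly (p k j))" by (intro continuous_intros)
  then have "compact (poly (p k j) ` {- R..R})" by (intro compact_continuous_image) auto
  then obtain S where S: "!!t. t \<in> {- R..R} ==> \<bar>poly (p k j) t\<bar> <= S" using compact_imp_bounded by (fastforce simp: bounded_iff)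
  have "\<bar>poly (p k j) (h j x) - poly (p k j) 0\<bar> <= S + S" for x
  proof -
   have "h j x \<in> {- R..R}" "0 \<in> {- R..R}" using R(2)[of x] R(1) by auto
   from S[OF this(1)] S[OF this(2)] show ?thesis by linarith
  qed
  then show "EX C. ALL x. \<bar>poly (p k j) (h j x) - poly (p k j) 0\<bar> <= C" by blast
 qed
 have Fgam: "AE x in M. gam (F k) g x = (\<Sum>i<n. poly (pderiv (p k i)) (h i x) * gam (h i) g x)" if g: "g \<in> D" for k g
 proof -
  have "AE x in M. \<forall>i\<in>{..<n}. gam (%x. poly (p k i) (h i x) - poly (p k i) 0) g x = poly (pderiv (p k i)) (h i x) * gam (h i) g x" by (intro AE_ball_countable' countable_finite finite_lessThan poly_chain(2)[OF hD hb] g) auto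
  moreover have "AE x in M. gam (F k) g x = (\<Sum>i<n. gam (%x. poly (p k i) (h i x) - poly (p k i) 0) g x)" unfolding F_def[abs_def] by (intro gam_sum PD g) auto
  ultimately show ?thesis by eventually_elim simp
 qed
 have "AE x in M. \<forall>k\<in>{..<n}. \<forall>l\<in>{..<n}. (ALL j<n. \<bar>f j x\<bar> <= real m) --> gam (F k) (F l) x
  = (\<Sum>i<n. \<Sum>j<n. (real (k + 1) * (y i + f i x) ^ k) * ((real (l + 1) * (y j + f j x) ^ l) * gam (f i) (f j) x))"
 proof (intro AE_ball_countable' countable_finite finite_lessThan)
  fix k l
  have "AE x in M. \<forall>i\<in>{..<n}. gam (h i) (F l) x = gam (F l) (h i) x" by (intro AE_ball_countable' countable_finite finite_lessThan gam_sym FD hD) auto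
  moreover have "AE x in M. \<forall>i\<in>{..<n}. gam (F l) (h i) x = (\<Sum>j<n. poly (pderiv (p l j)) (h j x) * gam (h j) (h i) x)" by (intro AE_ball_countable' countable_finite finite_lessThan Fgam hD) auto
  moreover have "AE x in M. \<forall>i\<in>{..<n}. \<forall>j\<in>{..<n}. \<bar>f j x\<bar> <= real m --> gam (h j) (h i) x = gam (f j) (h i) x" by (intro AE_ball_countable' countable_finite finite_lessThan hgam hD) auto
  moreover have "AE x in M. \<forall>i\<in>{..<n}. \<forall>j\<in>{..<n}. gam (f j) (h i) x = gam (h i) (f j) x" by (intro AE_ball_countable' countable_finite finite_lessThan gam_sym hD f) auto
  moreover have "AE x in M. \<forall>i\<in>{..<n}. \<forall>j\<in>{..<n}. \<bar>f i x\<bar> <= real m --> gam (h i) (f j) x = gam (f i) (f j) x" by (intro AE_ball_countable' countable_finite finite_lessThan hgam f) auto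
  moreover note Fgam[OF FD[of l], of k]
  ultimately show "AE x in M. (ALL j<n. \<bar>f j x\<bar> <= real m) --> gam (F k) (F l) x
   = (\<Sum>i<n. \<Sum>j<n. (real (k + 1) * (y i + f i x) ^ k) * ((real (l + 1) * (y j + f j x) ^ l) * gam (f i) (f j) x))"
  proof eventually_elim
   case (elim x)
   show ?case
   proof
    assume b: "ALL j<n. \<bar>f j x\<bar> <= real m"
    have "gam (h i) (F l) x = (\<Sum>j<n. (real (l + 1) * (y j + f j x) ^ l) * gam (f i) (f j) x)" if i: "i < n" for i
    proof -
     have "gam (h i) (F l) x = (\<Sum>j<n. poly (pderiv (p l j)) (h j x) * gam (h j) (h i) x)" using elim(1,2) i by simp
     also have "... = (\<Sum>j<n. (real (l + 1) * (y j + f j x) ^ l) * gam (f i) (f j) x)" using elim(3-5) i b heq by (intro sum.cong refl) (simp add: poly_p')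
     finally show ?thesis .
    qed
    then show "gam (F k) (F l) x
     = (\<Sum>i<n. \<Sum>j<n. (real (k + 1) * (y i + f i x) ^ k) * ((real (l + 1) * (y j + f j x) ^ l) * gam (f i) (f j) x))" unfolding elim(6) using b heq by (intro sum.cong refl) (simp add: poly_p' sum_distrib_left)
   qed
  qed
 qed
 moreover have "AE x in M. (\<lambda>k\<in>{..<n}. F k x) \<in> C' --> gram_det gam n F x = 0" by (rule energy_image_density_bounded[OF n FD Fb C'])
 moreover have "AE x in M. \<not> inj_on (%j. y j + f j x) {..<n} --> gram_det gam n f x = 0" by (rule gram_det_equal_values[OF f])
 ultimately show ?thesis
 proof eventually_elim
  case (elim x)
  show ?case
  proof (intro impI)
   assume b: "ALL j<n. \<bar>f j x\<bar> <= real m" and V: "power_sums n (%j. y j + f j x) \<in> C"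
   have "(\<lambda>k\<in>{..<n}. (\<lambda>k\<in>{..<n}. F k x) k + (\<Sum>j<n. y j ^ (k + 1))) = power_sums n (%j. y j + f j x)" using b heq by (auto simp: F_def power_sums_def poly_p fun_eq_iff sum_subtractf simp del: power_Suc)
   then have "(\<lambda>k\<in>{..<n}. F k x) \<in> C'" using V by (simp add: C'_def space_PiM)
   then have F0: "gram_det gam n F x = 0" using elim(2) by blast
   let ?J = "%k i. real (k + 1) * (y i + f i x) ^ k"
   have "Matrix.mat n n (%(k, l). gam (F k) (F l) x) = Matrix.mat n n (%(k, l). \<Sum>i<n. \<Sum>j<n. ?J k i * (?J l j * gam (f i) (f j) x))" using elim(1) b by (intro eq_matI) auto
   with F0 have "(Determinant.det (Matrix.mat n n (%(k, i). ?J k i)))^2 * gram_det gam n f x = 0" unfolding gram_det_def by (simp only: det_congruence)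
   then have "Determinant.det (Matrix.mat n n (%(k, i). ?J k i)) = 0 \<or> gram_det gam n f x = 0" by (simp only: mult_eq_0_iff power_eq_0_iff) blast
   then show "gram_det gam n f x = 0" using power_sums_jacobian_nonzero[of "%i. y i + f i x" n] elim(3) by blast
  qed
 qed
qed
have "AE x in M. ALL m. (ALL j<n. \<bar>f j x\<bar> <= real m) --> power_sums n (%j. y j + f j x) \<in> C --> gram_det gam n f x = 0" unfolding AE_all_countable using m by blast
then show ?thesis
proof eventually_elim
 case (elim x)
 obtain m where "(\<Sum>j<n. \<bar>f j x\<bar>) <= real m" using real_arch_simple by blast
 then have "ALL j<n. \<bar>f j x\<bar> <= real m" using member_le_sum[of _ "{..<n}" "%j. \<bar>f j x\<bar>"] by (meson abs_ge_zero finite_lessThan lessThan_iff order_trans)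
 then show ?case using elim by blast
qed
qed

end

section \<open>Absolute continuity of the law of the power sums\<close>

theorem proposition23:
  fixes \<nu> :: "'x measure"
    and d :: "('x \<Rightarrow> real) set"
    and e :: "('x \<Rightarrow> real) \<Rightarrow> ('x \<Rightarrow> real) \<Rightarrow> real"
    and \<gamma> :: "('x \<Rightarrow> real) \<Rightarrow> ('x \<Rightarrow> real) \<Rightarrow> 'x \<Rightarrow> real"
    and P :: "'x measure measure"
    and \<Gamma> :: "('x measure \<Rightarrow> real) \<Rightarrow> ('x measure \<Rightarrow> real) \<Rightarrow> 'x measure \<Rightarrow> real"
    and n :: nat
    and f :: "nat \<Rightarrow> 'x \<Rightarrow> real"
  assumes sigma_finite: "sigma_finite_measure \<nu>"
    and diffuse: "\<And>x. x \<in> space \<nu> \<Longrightarrow> {x} \<in> sets \<nu> \<and> emeasure \<nu> {x} = 0"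
    and bottom_form: "dirichlet_form \<nu> d e" "local_form d e" "form_separable \<nu> d e"
    and bottom_carre: "carre_du_champ \<nu> d e \<gamma>"
    and one_loc: "(\<lambda>x. 1) \<in> loc_domain \<nu> d"
    and poisson: "poisson_random_measure \<nu> P"
    and dense: "l2_dense P (Domain (upper_pregenerator \<nu> P d e \<gamma>))"
    and upper_carre: "carre_du_champ P
           (friedrichs_domain P (upper_pregenerator \<nu> P d e \<gamma>))
           (friedrichs_form P (upper_pregenerator \<nu> P d e \<gamma>)) \<Gamma>"
    and EID: "energy_image_density P (friedrichs_domain P (upper_pregenerator \<nu> P d e \<gamma>)) \<Gamma>"
    and n_pos: "n \<ge> 1"
    and f_dom: "\<And>i. i < n \<Longrightarrow> f i \<in> d"
    and f_N: "\<And>i. i < n \<Longrightarrow> AE \<omega> in P. integrable \<omega> (f i)"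
    and f_distinct: "\<And>i j. i < n \<Longrightarrow> j < n \<Longrightarrow> i \<noteq> j \<Longrightarrow>
           emeasure \<nu> {x \<in> space \<nu>. f i x \<noteq> f j x} = \<infinity>"
    and f_det: "emeasure \<nu> {x \<in> space \<nu>. gram_det \<gamma> n f x > 0} = \<infinity>"
  shows "absolutely_continuous (lebesgue_pow n)
           (distr P (lebesgue_pow n)
             (\<lambda>\<omega>. \<lambda>k\<in>{..<n}. \<Sum>j<n. (\<integral>x. f j x \<partial>\<omega>) ^ (k + 1)))"
proof -
interpret S: dirichlet_structure \<nu> d e \<gamma> using sigma_finite bottom_form(1,2) bottom_carre by (rule dirichlet_structure.intro)
interpret N: poisson_measure \<nu> P using poisson by unfold_locales
interpret \<nu>: sigma_finite_measure \<nu> by fact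
interpret pair_sigma_finite \<nu> P ..
let ?L = "Leb n"
let ?V = "%\<omega>. \<lambda>k\<in>{..<n}. \<Sum>j<n. (LINT x|\<omega>. f j x) ^ (k + 1)"
have fm: "f i \<in> borel_measurable \<nu>" and f2: "integrable \<nu> (%x. (f i x)^2)" if "i < n" for i using S.D_measurable[OF f_dom[OF that]] S.D_sq_integrable[OF f_dom[OF that]] by auto
have V_eq: "?V = (%\<omega>. power_sums n (N.stat n f \<omega>))" by (auto simp: power_sums_def N.stat_def fun_eq_iff)
have Ym: "N.stat n f \<in> measurable P ?L" by (intro N.stat_measurable fm)
have Vm: "?V \<in> measurable P ?L" unfolding V_eq by (rule measurable_compose[OF Ym power_sums_measurable])
have shm: "(%p. N.shift n (N.stat n f (snd p)) f (fst p)) \<in> measurable (\<nu> \<Otimes>\<^sub>M P) ?L" by (rule N.shift_measurable[OF fm])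
have gm: "gram_det \<gamma> n f \<in> borel_measurable \<nu>" by (rule S.gram_det_measurable[OF f_dom])
define G where "G = {x \<in> space \<nu>. gram_det \<gamma> n f x > 0}"
have G: "G \<in> sets \<nu>" "emeasure \<nu> G = \<infinity>" unfolding G_def using gm f_det by auto
have "emeasure P (?V -` C \<inter> space P) = 0" if C: "C \<in> null_sets ?L" for C
proof -
 define U where "U = {y\<in>space ?L. power_sums n y \<in> C}"
 have Us [measurable]: "U \<in> sets ?L"
 proof -
  have "U = power_sums n -` C \<inter> space ?L" by (auto simp: U_def)
  then show ?thesis using measurable_sets[OF power_sums_measurable, of C] C by auto
 qed
 \<comment> \<open>The configuration enters only through its frozen statistics v; for almost every x
   in G, adding a particle at x leads out of the exceptional set.\<close>
 have key: "AE x in \<nu>. x \<in> G --> N.shift n v f x \<notin> U" for v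
 proof -
  have "power_sums n (N.shift n v f x) = power_sums n (%j. v j + f j x)" for x by (auto simp: power_sums_def N.shift_def fun_eq_iff)
  moreover have "AE x in \<nu>. power_sums n (%j. v j + f j x) \<in> C --> gram_det \<gamma> n f x = 0" by (rule S.power_sums_shift[OF n_pos f_dom C])
  ultimately show ?thesis by (auto simp: U_def G_def elim!: eventually_mono)
 qed
 have Vset: "?V -` C \<inter> space P = {\<omega>\<in>space P. N.stat n f \<omega> \<in> U}" unfolding V_eq U_def using measurable_space[OF Ym] by auto
 have Uset: "{\<omega>\<in>space P. N.stat n f \<omega> \<in> U} \<in> sets P" using measurable_sets[OF Ym Us] by (simp add: vimage_def Int_def conj_commute)
 \<comment> \<open>Almost surely no particle lies in W when the statistics lie in U, and an empty W
   has probability exp(-\<nu>(W)) with \<nu>(W) > k.\<close>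
 have le: "N.prob {\<omega>\<in>space P. N.stat n f \<omega> \<in> U} <= exp (- real k)" for k
 proof -
  obtain W where W: "W \<in> sets \<nu>" "W \<subseteq> G" "emeasure \<nu> W < \<infinity>" "ennreal (real k) < emeasure \<nu> W" using \<nu>.approx_PInf_emeasure_with_finite[OF G, of "real k"] by blast
  let ?g = "indicator U :: (nat => real) => ennreal"
  have [measurable]: "W \<in> sets \<nu>" by (rule W(1))
  have sm: "(%p. ?g (N.shift n (N.stat n f (snd p)) f (fst p)) * indicator W (fst p)) \<in> borel_measurable (\<nu> \<Otimes>\<^sub>M P)" using measurable_compose[OF shm, of ?g borel] by measurable
  have gP: "(%\<omega>. ?g (N.shift n (N.stat n f \<omega>) f x)) \<in> borel_measurable P" if x: "x \<in> space \<nu>" for x using measurable_compose[OF measurable_compose[OF measurable_Pair1'[OF x, of P] shm], of ?g borel] by simp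
  have "(nn_integral P (%\<omega>. ?g (N.stat n f \<omega>) * emeasure \<omega> W)) = (nn_integral \<nu> (%x. (nn_integral P (%\<omega>. ?g (N.shift n (N.stat n f \<omega>) f x))) * indicator W x))" by (rule N.mecke[OF fm f2 f_N W(1,3)]) auto
  also have "... = (nn_integral \<nu> (%x. (nn_integral P (%\<omega>. ?g (N.shift n (N.stat n f \<omega>) f x) * indicator W x))))" by (intro nn_integral_cong nn_integral_multc[symmetric] gP)
  \<comment> \<open>Fubini allows the configuration to be fixed first; the inner integral over x
    then vanishes by \<open>key\<close>.\<close>
  also have "... = (nn_integral P (%\<omega>. (nn_integral \<nu> (%x. ?g (N.shift n (N.stat n f \<omega>) f x) * indicator W x))))" using Fubini[OF sm] by simp
  also have "... = (nn_integral P (%\<omega>. 0))"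
  proof (rule nn_integral_cong)
   fix \<omega>
   have "(nn_integral \<nu> (%x. ?g (N.shift n (N.stat n f \<omega>) f x) * indicator W x)) = (nn_integral \<nu> (%x. 0))" using key[of "N.stat n f \<omega>"] W(2) by (intro nn_integral_cong_AE) (auto simp: indicator_def elim!: eventually_mono)
   then show "(nn_integral \<nu> (%x. ?g (N.shift n (N.stat n f \<omega>) f x) * indicator W x)) = 0" by simp
  qed
  finally have "(nn_integral P (%\<omega>. ?g (N.stat n f \<omega>) * emeasure \<omega> W)) = 0" by simp
  moreover have "(%\<omega>. ?g (N.stat n f \<omega>) * emeasure \<omega> W) \<in> borel_measurable P" using measurable_compose[OF Ym, of ?g borel] N.count_measurable[OF W(1)] by simp
  ultimately have "AE \<omega> in P. ?g (N.stat n f \<omega>) * emeasure \<omega> W = 0" by (simp add: nn_integral_0_iff_AE)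
  then have "AE \<omega> in P. N.stat n f \<omega> \<in> U --> emeasure \<omega> W = 0" by eventually_elim auto
  then have "N.prob {\<omega>\<in>space P. N.stat n f \<omega> \<in> U} <= N.prob {\<omega>\<in>space P. emeasure \<omega> W = 0}" using N.count_measurable[OF W(1)] by (intro N.finite_measure_mono_AE) auto
  also have "... = exp (- measure \<nu> W)" by (rule N.count_zero_prob[OF W(1,3)])
  also have "... <= exp (- real k)"
  proof -
   have "emeasure \<nu> W = ennreal (measure \<nu> W)" using W(3) by (intro emeasure_eq_ennreal_measure) auto
   then have "real k < measure \<nu> W" using W(4) by (simp add: ennreal_less_iff)
   then show ?thesis by simp
  qed
  finally show ?thesis .
 qed
 have "(%k. exp (- real k)) ---> 0" by real_asymp
 then have "N.prob {\<omega>\<in>space P. N.stat n f \<omega> \<in> U} <= 0" by (rule LIMSEQ_le_const) (use le in blast)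
 then have "N.prob {\<omega>\<in>space P. N.stat n f \<omega> \<in> U} = 0" using measure_nonneg[of P] by (meson order_antisym)
 then show ?thesis unfolding Vset by (simp add: N.emeasure_eq_measure)
qed
then show ?thesis unfolding absolutely_continuous_def using Vm by (auto simp: null_sets_def emeasure_distr)
qed

end
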